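(* Assume the hard constraint, drift and source assumption, the initial data assumption, the hard constraint restriction, and the congestion condition described in the context. Suppose that $p_k(\cdot,0)\to p_\infty(\cdot,0)$ uniformly as $k\to\infty$ and that $\Sigma(0)=\{x:p_\infty(x,0)>0\}$ is open. Let $(\varrho_\infty,p_\infty)$ be the limit of $(\varrho_k,p_k)$ in $L^1(Q_T)$ and let $\Sigma(t)=\{x:p_\infty(x,t)>0\}$. Then $\Sigma(t)$ is non-decreasing with respect to streamlines in the almost everywhere sense: for a.e. $x_0\in\mathbb{R}^d$ and a.e. $s,t$ with $0<s\le t<T$, $X(s,x_0)\in\Sigma(s)$ implies $X(t,x_0)\in\Sigma(t)$; and, for the initial time, for a.e. $x_0\in\Sigma(0)$ and a.e. $t\in(0,T)$, $X(t,x_0)\in\Sigma(t)$.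
   Context: Fix $d\ge 1$, $T>0$, and let $Q_T=\mathbb{R}^d\times(0,T)$. The operators $\nabla$, $\nabla\cdot$ act in the space variables only. Hard constraint, drift and source assumption: $m,f:Q_T\to\mathbb{R}$ and $\vec b:Q_T\to\mathbb{R}^d$ are in $C^\infty(Q_T)$ with bounded derivatives of all orders (order zero included), so that they extend smoothly to $\mathbb{R}^d\times[0,T]$, and there is $\delta>0$ with $m(x,t)\ge\delta$. Initial data assumption: for each $k>1$, $\varrho_k^{(0)}\in W^{1,1}(\mathbb{R}^d)$, $\varrho_k^{(0)}\ge 0$ a.e.; put $p_k^{(0)}=p_k(\cdot,0)=\frac{k}{k-1}\left(\varrho_k^{(0)}/m(\cdot,0)\right)^{k-1}$. There are a compact $K\subset\mathbb{R}^d$ and a constant $C$ with $\operatorname{supp}\varrho_k^{(0)}\subset K$, $\|\varrho_k^{(0)}\|_{L^\infty}\le C$, $\|\varrho_k^{(0)}\|_{W^{1,1}}\le C$, $\|p_k^{(0)}\|_{L^\infty}\le C$ for all $k>1$. There is $\varrho_\infty^{(0)}$ with $\varrho_k^{(0)}\to\varrho_\infty^{(0)}$ in $L^1(\mathbb{R}^d)$ as $k\to\infty$. Hard constraint restriction: at least one of the following holds: $m$ is radial in space, $m(x,t)=m(|x|,t)$; or $d=1$; or there is $R>0$ such that $|\nabla m(x,t)|\le\varepsilon/|x|$ for $|x|\ge R$, where $\varepsilon=\varepsilon(\delta)>0$ is a sufficiently small constant depending on $\delta$ (the result asserts that such an $\varepsilon(\delta)$ exists). Congestion condition: $\partial_t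 m<mf+\nabla\cdot(m\vec b)$ in $Q_T$. For $k>1$, $\varrho_k$ is the (nonnegative) weak solution of $\partial_t\varrho_k=\nabla\cdot(\varrho_k(\nabla p_k+\vec b))+f\varrho_k$ in $Q_T$ with initial data $\varrho_k^{(0)}$, where $p_k=\frac{k}{k-1}(\varrho_k/m)^{k-1}$: with $v_k=\varrho_k/m$, one has $\varrho_k\in L^2(Q_T)$, $v_k^k\in H^1(Q_T)$ and for all $\varphi\in C_c^\infty(\mathbb{R}^d\times[0,T))$ $$\iint_{Q_T}-\varrho_k\partial_t\varphi=\int_{\mathbb{R}^d}\varphi(x,0)\varrho_k^{(0)}(x)\,dx+\iint_{Q_T}-m\nabla\varphi\cdot\nabla v_k^k-\varrho_k\nabla\varphi\cdot\vec b+f\varphi\varrho_k.$$ It is known that under the first three assumptions $(\varrho_k,p_k)$ converges in $L^1(Q_T)$ as $k\to\infty$ to a pair $(\varrho_\infty,p_\infty)$. The function $p_\infty(\cdot,0)$ denotes the (uniform) limit of the initial pressures. Streamlines: for $x_0\in\mathbb{R}^d$, $X(\cdot,x_0)$ is the unique solution of $\frac{d}{dt}X(t,x_0)=-\vec b(X(t,x_0),t)$, $X(0,x_0)=x_0$. *)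

theory Defs
  imports "HOL-Analysis.Analysis"
begin

text \<open>
  Space-time points are pairs \<open>(x, t) :: (real^'n) \<times> real\<close>; the space dimension
  \<open>d = CARD('n)\<close> is at least 1 automatically.
\<close>

definition QT :: "real \<Rightarrow> ((real^'n) \<times> real) set" where
  "QT T = UNIV \<times> {0<..<T}"

subsection \<open>Classical derivatives and test functions\<close>

primrec iter_deriv ::
  "'a::euclidean_space list \<Rightarrow> ('a \<Rightarrow> 'b::real_normed_vector) \<Rightarrow> 'a \<Rightarrow> 'b" where
  "iter_deriv [] g = g"
| "iter_deriv (e # es) g = (\<lambda>z. frechet_derivative (iter_deriv es g) (at z) e)"

text \<open>
  \<open>C\<^sup>\<infinity>(S)\<close> for open \<open>S\<close>: every iterated partial derivative exists and is again
  (Frechet) differentiable, hence continuous.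
\<close>
definition smooth_on :: "'a::euclidean_space set \<Rightarrow> ('a \<Rightarrow> 'b::real_normed_vector) \<Rightarrow> bool" where
  "smooth_on S g \<longleftrightarrow>
     (\<forall>es. set es \<subseteq> Basis \<longrightarrow> (\<forall>z\<in>S. iter_deriv es g differentiable (at z)))"

text \<open>
  \<open>C\<^sup>\<infinity>\<close> on \<open>QT T\<close> with all derivatives (order zero included) bounded. Such a function extends
  uniquely by continuity to \<open>t = 0\<close> and \<open>t = T\<close>; the last clause says that its values there are
  those of the extension, so that for instance \<open>m (x, 0)\<close> is meaningful.
\<close>
definition smooth_bounded :: "real \<Rightarrow> ((real^'n) \<times> real \<Rightarrow> 'b::real_normed_vector) \<Rightarrow> bool" where
  "smooth_bounded T g \<longleftrightarrow>
     smooth_on (QT T) g \<and>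
     (\<forall>es. set es \<subseteq> Basis \<longrightarrow> bounded (iter_deriv es g ` QT T)) \<and>
     continuous_on (UNIV \<times> {0..T}) g"

text \<open>
  \<open>C\<^sub>c\<^sup>\<infinity>(S)\<close> for open \<open>S\<close>. The test functions on \<open>\<real>\<^sup>d \<times> [0,T)\<close>, which need not vanish at
  \<open>t = 0\<close>, are the restrictions of those on \<open>UNIV \<times> {..<T}\<close>.
\<close>
definition test_function :: "'a::euclidean_space set \<Rightarrow> ('a \<Rightarrow> real) \<Rightarrow> bool" where
  "test_function S \<phi> \<longleftrightarrow>
     smooth_on UNIV \<phi> \<and> compact (closure {z. \<phi> z \<noteq> 0}) \<and> closure {z. \<phi> z \<noteq> 0} \<subseteq> S"

definition grad :: "('a::euclidean_space \<Rightarrow> real) \<Rightarrow> 'a \<Rightarrow> 'a" where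
  "grad g z = (\<Sum>e\<in>Basis. frechet_derivative g (at z) e *\<^sub>R e)"

definition grad_x :: "((real^'n) \<times> real \<Rightarrow> real) \<Rightarrow> (real^'n) \<times> real \<Rightarrow> real^'n" where
  "grad_x g z = fst (grad g z)"

definition deriv_t :: "((real^'n) \<times> real \<Rightarrow> real) \<Rightarrow> (real^'n) \<times> real \<Rightarrow> real" where
  "deriv_t g z = snd (grad g z)"

definition div_x :: "((real^'n) \<times> real \<Rightarrow> real^'n) \<Rightarrow> (real^'n) \<times> real \<Rightarrow> real" where
  "div_x F z = (\<Sum>i\<in>UNIV. frechet_derivative F (at z) (axis i 1, 0) $ i)"

subsection \<open>Lebesgue and Sobolev spaces\<close>

definition Lp_on :: "real \<Rightarrow> 'a::euclidean_space set \<Rightarrow> ('a \<Rightarrow> 'b::euclidean_space) \<Rightarrow> bool" where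
  "Lp_on p S u \<longleftrightarrow>
     u \<in> borel_measurable (lebesgue_on S) \<and>
     integrable (lebesgue_on S) (\<lambda>z. norm (u z) powr p)"

definition locally_integrable ::
  "'a::euclidean_space set \<Rightarrow> ('a \<Rightarrow> 'b::euclidean_space) \<Rightarrow> bool" where
  "locally_integrable S u \<longleftrightarrow> (\<forall>K. compact K \<and> K \<subseteq> S \<longrightarrow> integrable (lebesgue_on K) u)"

definition has_weak_grad ::
  "'a::euclidean_space set \<Rightarrow> ('a \<Rightarrow> real) \<Rightarrow> ('a \<Rightarrow> 'a) \<Rightarrow> bool" where
  "has_weak_grad S u G \<longleftrightarrow>
     locally_integrable S u \<and> locally_integrable S G \<and>
     (\<forall>\<phi>. test_function S \<phi> \<longrightarrow>
        (LINT z|lebesgue_on S. u z *\<^sub>R grad \<phi> z) = - (LINT z|lebesgue_on S. \<phi> z *\<^sub>R G z))"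

text \<open>Weak gradients are unique up to null sets, so the choice is immaterial under integrals.\<close>
definition weak_grad :: "'a::euclidean_space set \<Rightarrow> ('a \<Rightarrow> real) \<Rightarrow> 'a \<Rightarrow> 'a" where
  "weak_grad S u = (SOME G. has_weak_grad S u G)"

text \<open>The Sobolev space \<open>W\<^bsup>1,p\<^esup>(S)\<close>; in particular \<open>H\<^sup>1(S)\<close> is \<open>W1_on 2 S\<close>.\<close>
definition W1_on :: "real \<Rightarrow> 'a::euclidean_space set \<Rightarrow> ('a \<Rightarrow> real) \<Rightarrow> bool" where
  "W1_on p S u \<longleftrightarrow> Lp_on p S u \<and> (\<exists>G. has_weak_grad S u G \<and> Lp_on p S G)"

definition W11_norm :: "('a::euclidean_space \<Rightarrow> real) \<Rightarrow> real" where
  "W11_norm u = (LINT x|lebesgue. \<bar>u x\<bar>) + (LINT x|lebesgue. norm (weak_grad UNIV u x))"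

definition ess_supp :: "('a::euclidean_space \<Rightarrow> real) \<Rightarrow> 'a set" where
  "ess_supp u = - \<Union>{U. open U \<and> (AE x in lebesgue_on U. u x = 0)}"

text \<open>\<open>u k \<rightarrow> l\<close> in \<open>L\<^sup>1(S)\<close> as the real parameter \<open>k\<close> tends to infinity.\<close>
definition L1_limit ::
  "'a::euclidean_space set \<Rightarrow> (real \<Rightarrow> 'a \<Rightarrow> real) \<Rightarrow> ('a \<Rightarrow> real) \<Rightarrow> bool" where
  "L1_limit S u l \<longleftrightarrow>
     integrable (lebesgue_on S) l \<and>
     (\<forall>\<^sub>F k in at_top. integrable (lebesgue_on S) (u k)) \<and>
     ((\<lambda>k. LINT z|lebesgue_on S. \<bar>u k z - l z\<bar>) \<longlongrightarrow> 0) at_top"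

subsection \<open>The equation and the assumptions on its data\<close>

definition pressure :: "real \<Rightarrow> ('a \<Rightarrow> real) \<Rightarrow> ('a \<Rightarrow> real) \<Rightarrow> 'a \<Rightarrow> real" where
  "pressure k m \<rho> z = k / (k - 1) * (\<rho> z / m z) powr (k - 1)"

definition data_assumption ::
  "real \<Rightarrow> real \<Rightarrow> ((real^'n) \<times> real \<Rightarrow> real) \<Rightarrow> ((real^'n) \<times> real \<Rightarrow> real) \<Rightarrow>
   ((real^'n) \<times> real \<Rightarrow> real^'n) \<Rightarrow> bool" where
  "data_assumption T \<delta> m f b \<longleftrightarrow>
     smooth_bounded T m \<and> smooth_bounded T f \<and> smooth_bounded T b \<and>
     (\<forall>z\<in>QT T. m z \<ge> \<delta>)"

definition initial_pressure ::
  "real \<Rightarrow> ((real^'n) \<times> real \<Rightarrow> real) \<Rightarrow> (real^'n \<Rightarrow> real) \<Rightarrow> real^'n \<Rightarrow> real" where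
  "initial_pressure k m \<rho>0 = pressure k (\<lambda>x. m (x, 0)) \<rho>0"

definition initial_assumption ::
  "((real^'n) \<times> real \<Rightarrow> real) \<Rightarrow> (real \<Rightarrow> real^'n \<Rightarrow> real) \<Rightarrow> bool" where
  "initial_assumption m \<rho>0 \<longleftrightarrow>
     (\<forall>k>1. W1_on 1 UNIV (\<rho>0 k) \<and> (AE x in lebesgue. \<rho>0 k x \<ge> 0)) \<and>
     (\<exists>K C. compact K \<and>
        (\<forall>k>1. ess_supp (\<rho>0 k) \<subseteq> K \<and>
               (AE x in lebesgue. \<bar>\<rho>0 k x\<bar> \<le> C) \<and>
               W11_norm (\<rho>0 k) \<le> C \<and>
               (AE x in lebesgue. \<bar>initial_pressure k m (\<rho>0 k) x\<bar> \<le> C))) \<and>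
     (\<exists>\<rho>0_lim. L1_limit UNIV \<rho>0 \<rho>0_lim)"

definition constraint_restriction ::
  "real \<Rightarrow> real \<Rightarrow> ((real^'n) \<times> real \<Rightarrow> real) \<Rightarrow> bool" where
  "constraint_restriction T \<epsilon> m \<longleftrightarrow>
     (\<exists>\<mu>. \<forall>(x, t)\<in>QT T. m (x, t) = \<mu> (norm x) t) \<or>
     CARD('n) = 1 \<or>
     (\<exists>R>0. \<forall>(x, t)\<in>QT T. norm x \<ge> R \<longrightarrow> norm (grad_x m (x, t)) \<le> \<epsilon> / norm x)"

definition congestion_condition ::
  "real \<Rightarrow> ((real^'n) \<times> real \<Rightarrow> real) \<Rightarrow> ((real^'n) \<times> real \<Rightarrow> real) \<Rightarrow>
   ((real^'n) \<times> real \<Rightarrow> real^'n) \<Rightarrow> bool" where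
  "congestion_condition T m f b \<longleftrightarrow>
     (\<forall>z\<in>QT T. deriv_t m z < m z * f z + div_x (\<lambda>y. m y *\<^sub>R b y) z)"

definition weak_solution ::
  "real \<Rightarrow> ((real^'n) \<times> real \<Rightarrow> real) \<Rightarrow> ((real^'n) \<times> real \<Rightarrow> real) \<Rightarrow>
   ((real^'n) \<times> real \<Rightarrow> real^'n) \<Rightarrow> real \<Rightarrow> (real^'n \<Rightarrow> real) \<Rightarrow>
   ((real^'n) \<times> real \<Rightarrow> real) \<Rightarrow> bool" where
  "weak_solution T m f b k \<rho>0 \<rho> \<longleftrightarrow>
     (let vk = (\<lambda>z. (\<rho> z / m z) powr k);
          Dvk = (\<lambda>z. fst (weak_grad (QT T) vk z))
      in (AE z in lebesgue_on (QT T). \<rho> z \<ge> 0) \<and>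
         Lp_on 2 (QT T) \<rho> \<and> W1_on 2 (QT T) vk \<and>
         (\<forall>\<phi>. test_function (UNIV \<times> {..<T}) \<phi> \<longrightarrow>
            (LINT z|lebesgue_on (QT T). - \<rho> z * deriv_t \<phi> z) =
            (LINT x|lebesgue. \<phi> (x, 0) * \<rho>0 x) +
            (LINT z|lebesgue_on (QT T).
               - m z * (grad_x \<phi> z \<bullet> Dvk z) - \<rho> z * (grad_x \<phi> z \<bullet> b z) + f z * \<phi> z * \<rho> z)))"

definition streamlines ::
  "real \<Rightarrow> ((real^'n) \<times> real \<Rightarrow> real^'n) \<Rightarrow> (real \<Rightarrow> real^'n \<Rightarrow> real^'n) \<Rightarrow> bool" where
  "streamlines T b X \<longleftrightarrow>
     (\<forall>x0. X 0 x0 = x0 \<and>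
        (\<forall>t\<in>{0..<T}. ((\<lambda>s. X s x0) has_vector_derivative - b (X t x0, t)) (at t within {0..<T})))"

definition pos_set :: "((real^'n) \<times> real \<Rightarrow> real) \<Rightarrow> real \<Rightarrow> (real^'n) set" where
  "pos_set p t = {x. p (x, t) > 0}"

end

theory Submission
  imports Defs
begin

text \<open>
  Put \<open>v = \<rho> / m\<close> and \<open>E = m f + div (m b) - \<partial>\<^sub>t m > 0\<close>. Testing the equation with \<open>g (v\<^sup>k) \<phi>\<close>,
  \<open>g s = exp (- N s)\<close>, the diffusion has a sign; mollifying \<open>v\<^sup>k\<close> towards the future in time makes
  this test function admissible and yields the initial trace by convexity. The limits \<open>k \<rightarrow> \<infinity>\<close>
  and then \<open>N \<rightarrow> \<infinity>\<close> show that the deficit \<open>w = m - \<rho>_lim \<ge> 0\<close>, which vanishes where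
  \<open>p_lim > 0\<close>, is a subsolution of a transport equation along the streamlines with the
  absorption term \<open>E\<close> on \<open>{p_lim = 0}\<close>. Testing this on cones around a streamline that shrink fast
  enough to absorb the distortion of the flow, and letting their width tend to 0, gives a
  one-dimensional inequality along almost every streamline: once the deficit is 0, no absorption
  can take place later, that is, \<open>p_lim\<close> stays positive. Almost every streamline meets a given
  null set only in a null set of times because the inverse of the flow map is Lipschitz.
\<close>

text \<open>The density \<open>\<rho>\<close> has no time derivative, so the chain rule cannot be
  applied to it. The way out is the function \<open>H = entropy_flux k N\<close>, whose derivative
  at \<open>s\<close> is \<open>s powr (1 / k)\<close> times that of \<open>exp (- N s)\<close>: at
  \<open>s = v^k\<close>, the product of \<open>v\<close> with an increment of
  \<open>exp (- N s)\<close> is an increment of \<open>H\<close>. The derivative of the test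
  function thus becomes exact and is integrated by parts against the smooth \<open>m\<close> alone.
  This produces the term \<open>- \<phi> H E\<close>; as \<open>H\<close> tends to
  \<open>exp (- N p) - 1\<close> and then to minus the indicator of \<open>p > 0\<close>,
  subtracting the identity satisfied by \<open>m\<close> itself leaves \<open>- E\<close> on
  \<open>p = 0\<close>. The test functions that occur, \<open>g\<close> of a mollified function and
  cone profiles, are only C1 in general, so inequalities for smooth test functions are extended
  first. The cones have radius \<open>eps exp (- L t)\<close> with \<open>L\<close> a Lipschitz
  constant of \<open>b\<close>: streamlines may leave such a cone but cannot enter it. Averages over
  the cones converge almost everywhere along a subsequence of radii, because displacing the argument
  by a small measure-preserving map is continuous in L2.\<close>

abbreviation "ind \<equiv> indicator"

abbreviation (input) scale (infixr "*." 75) where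
 "c *. x \<equiv> c *\<^sub>R x"

abbreviation "borel_fun \<equiv> borel_measurable borel"

abbreviation (input) seq_tendsto (infixr "---->" 60) where
 "X ----> L \<equiv> X \<longlonglongrightarrow> L"

subsection \<open>Smooth kernels\<close>

text \<open>The gradient is an explicit argument, so that it can be followed through convolutions,
  products and compositions. Differentiability is required at every point, hence \<open>D\<close> is
  forced to be \<open>grad h\<close>.\<close>

definition C1_with :: "('a::euclidean_space => real) => ('a => 'a) => bool" where
 "C1_with h D \<longleftrightarrow> (\<forall>z. (h has_derivative (%v. D z \<bullet> v)) (at z)) & continuous_on UNIV D"

lemma frechet_eq_grad:
 assumes "(h has_derivative (%v. d \<bullet> v)) (at z)"
 shows "frechet_derivative h (at z) e = d \<bullet> e" "grad h z = d"
proof -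
 have *: "frechet_derivative h (at z) = (%v. d \<bullet> v)"
  using frechet_derivative_at[OF assms] by simp
 show "frechet_derivative h (at z) e = d \<bullet> e" by (simp add: *)
 show "grad h z = d" by (simp add: grad_def * euclidean_representation)
qed

lemma has_derivative_grad:
 assumes "h differentiable (at z)"
 shows "(h has_derivative (%v. grad h z \<bullet> v)) (at z)"
proof -
 let ?L = "frechet_derivative h (at z)"
 have d: "(h has_derivative ?L) (at z)" using assms by (simp add: frechet_derivative_works)
 then have l: "linear ?L" by (rule has_derivative_linear)
 have "?L v = grad h z \<bullet> v" for v
 proof -
  have "?L v = ?L (\<Sum>e\<in>Basis. (v \<bullet> e) *. e)" by (simp add: euclidean_representation)
  also have "\<dots> = (\<Sum>e\<in>Basis. (v \<bullet> e) * ?L e)"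
   using l by (simp add: linear_sum linear_scale)
  also have "\<dots> = grad h z \<bullet> v"
   unfolding grad_def inner_sum_left by (auto intro!: sum.cong simp: inner_commute mult.commute)
  finally show ?thesis .
 qed
 then have "?L = (%v. grad h z \<bullet> v)" by auto
 with d show ?thesis by simp
qed

lemma C1_with_grad: "C1_with h D ==> grad h z = D z"
 using frechet_eq_grad(2) unfolding C1_with_def by blast

lemma C1_with_continuous:
 assumes "C1_with h D" shows "continuous_on S h"
 by (rule continuous_on_subset[OF _ subset_UNIV], rule has_derivative_continuous_on)
  (use assms in \<open>auto simp: C1_with_def\<close>)

lemma iter_deriv_append: "iter_deriv es (iter_deriv es' g) = iter_deriv (es @ es') g"
 by (induction es) auto

lemma smooth_iter_deriv:
 assumes "smooth_on UNIV g" "set es \<subseteq> Basis"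
 shows "smooth_on UNIV (iter_deriv es g)"
 using assms unfolding smooth_on_def by (auto simp: iter_deriv_append)

lemma smooth_imp_C1:
 assumes "smooth_on UNIV (h :: 'a::euclidean_space => real)"
 shows "C1_with h (grad h)"
proof -
 have d: "h differentiable (at z)" for z
  using assms unfolding smooth_on_def by (metis UNIV_I empty_set empty_subsetI iter_deriv.simps(1))
 have c: "continuous_on UNIV (%z. frechet_derivative h (at z) e)" if "e \<in> Basis" for e
 proof -
  have "iter_deriv [e] h differentiable (at z)" for z
   using assms that unfolding smooth_on_def by (metis UNIV_I empty_set empty_subsetI insert_subset list.simps(15))
  then show ?thesis
   by (auto intro!: continuous_at_imp_continuous_on differentiable_imp_continuous_within)
 qed
 have "continuous_on UNIV (grad h)"
  unfolding grad_def[abs_def] by (intro continuous_intros c)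
 with has_derivative_grad[OF d] show ?thesis by (auto simp: C1_with_def)
qed

text \<open>A coinduction principle: every \<open>iter_deriv\<close> of a member of a family closed
  under partial derivatives is again a member, hence differentiable. It replaces one induction over
  derivative lists per concrete function.\<close>

lemma smooth_onI_closed:
 assumes "g \<in> \<F>"
  and "!!h. h \<in> \<F> ==> \<exists>D. (\<forall>z. (h has_derivative (%v. D z \<bullet> v)) (at z)) & (\<forall>e\<in>Basis. (%z. D z \<bullet> e) \<in> \<F>)"
 shows "smooth_on UNIV (g :: 'a::euclidean_space => real)"
proof -
 have "iter_deriv es g \<in> \<F>" if "set es \<subseteq> Basis" for es
  using that
 proof (induction es)
  case Nil then show ?case using assms(1) by simp
 next
  case (Cons e es)
  then have "iter_deriv es g \<in> \<F>" by simp
  then obtain D where D: "\<forall>z. (iter_deriv es g has_derivative (%v. D z \<bullet> v)) (at z)"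
   "\<forall>e\<in>Basis. (%z. D z \<bullet> e) \<in> \<F>" using assms(2) by blast
  have "iter_deriv (e # es) g = (%z. D z \<bullet> e)"
   using frechet_eq_grad(1) D(1) by fastforce
  then show ?case using D(2) Cons.prems by simp
 qed
 then show ?thesis
  unfolding smooth_on_def using assms(2) differentiableI by metis
qed

text \<open>The classical flat function \<open>exp (- 1 / s)\<close>, divided by powers of
  \<open>s\<close> so that the family is closed under differentiation up to linear
  combinations.\<close>

definition flat_exp :: "nat => real => real" where
 "flat_exp n s = (if s > 0 then exp (- (1/s)) / s ^ n else 0)"

lemma flat_exp_tendsto: "(flat_exp n \<longlongrightarrow> 0) (at_right 0)"
proof -
 have "((%x. x ^ n / exp x) \<longlongrightarrow> 0) (at_top :: real filter)" by (rule tendsto_power_div_exp_0)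
 then have "((%s::real. (inverse s) ^ n / exp (inverse s)) \<longlongrightarrow> 0) (at_right 0)"
  by (rule filterlim_compose) (rule filterlim_inverse_at_top_right)
 moreover have "\<forall>\<^sub>F s::real in at_right 0. (inverse s) ^ n / exp (inverse s) = flat_exp n s"
  by (auto simp: eventually_at_right_less flat_exp_def exp_minus field_simps power_inverse
    intro!: eventually_mono[OF eventually_at_right_less])
 ultimately show ?thesis by (rule Lim_transform_eventually)
qed

lemma flat_exp_deriv:
 "(flat_exp n has_real_derivative (flat_exp (n + 2) s - n * flat_exp (n + 1) s)) (at s)"
proof -
 consider "s > 0" | "s < 0" | "s = 0" by linarith
 then show ?thesis
 proof cases
  case 1
  have "((%s. exp (- (1/s)) / s ^ n) has_real_derivative (flat_exp (n + 2) s - n * flat_exp (n + 1) s)) (at s)"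
  proof -
   have p: "((%s::real. s ^ n) has_real_derivative n * s ^ (n - 1)) (at s)"
    by (auto intro!: derivative_eq_intros)
   have e: "((%s. exp (- (1/s))) has_real_derivative exp (- (1/s)) / s^2) (at s)"
    using 1 by (auto intro!: derivative_eq_intros simp: power2_eq_square)
   have n: "real n * s ^ (n - 1) * s = real n * s ^ n" by (cases n) auto
   have "(exp (- (1/s)) / s\<^sup>2 * s ^ n - exp (- (1/s)) * (real n * s ^ (n - 1))) / (s ^ n * s ^ n)
     = exp (- (1/s)) / s^(n+2) - exp (- (1/s)) * (real n * s ^ (n - 1) * s) / (s ^ n * s ^ n * s)"
    using 1 by (simp add: field_simps power2_eq_square)
   also have "\<dots> = flat_exp (n + 2) s - n * flat_exp (n + 1) s"
    unfolding n using 1 by (simp add: flat_exp_def field_simps)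
   finally show ?thesis using DERIV_divide[OF e p] 1 by simp
  qed
  then show ?thesis
   by (rule has_field_derivative_transform_within_open[where S="{0<..}"]) (use 1 in \<open>auto simp: flat_exp_def\<close>)
 next
  case 2
  have "((%s. 0) has_real_derivative (flat_exp (n + 2) s - n * flat_exp (n + 1) s)) (at s)"
   using 2 by (simp add: flat_exp_def)
  then show ?thesis
   by (rule has_field_derivative_transform_within_open[where S="{..<0}"]) (use 2 in \<open>auto simp: flat_exp_def\<close>)
 next
  case 3
  \<comment> \<open>To the right of 0 the difference quotient of \<open>flat_exp n\<close> is
    \<open>flat_exp (n + 1)\<close>, so the limit lemma for all exponents settles the derivative at
    0.\<close>
  have r: "((%y. (flat_exp n y - flat_exp n 0) / (y - 0)) \<longlongrightarrow> 0) (at_right 0)"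
  proof -
   have "\<forall>\<^sub>F y in at_right 0. flat_exp (n + 1) y = (flat_exp n y - flat_exp n 0) / (y - 0)"
    by (intro eventually_mono[OF eventually_at_right_less]) (auto simp: flat_exp_def)
   from Lim_transform_eventually[OF flat_exp_tendsto this] show ?thesis .
  qed
  have l: "((%y. (flat_exp n y - flat_exp n 0) / (y - 0)) \<longlongrightarrow> 0) (at_left 0)"
   by (rule Lim_transform_eventually[OF tendsto_const])
     (auto simp: flat_exp_def eventually_at_filter)
  have "((%y. (flat_exp n y - flat_exp n 0) / (y - 0)) \<longlongrightarrow> 0) (at 0)"
   using l r by (rule filterlim_split_at)
  then have "(flat_exp n has_real_derivative 0) (at 0)"
   by (simp add: has_field_derivative_iff)
  moreover have "flat_exp (n + 2) s - n * flat_exp (n + 1) s = 0" using 3 by (simp add: flat_exp_def)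
  ultimately show ?thesis using 3 by simp
 qed
qed

text \<open>Radial bumps alone are not closed under partial derivatives, since the inner derivative
  brings in coordinates and constants. This algebra is closed, as \<open>smooth_onI_closed\<close>
  requires.\<close>

inductive_set bump_algebra :: "('a::euclidean_space => real) set" where
 const: "(%z. c) \<in> bump_algebra"
| coord: "(%z. z \<bullet> e) \<in> bump_algebra"
| flat: "(%z. flat_exp n (c - (z - a) \<bullet> (z - a))) \<in> bump_algebra"
| add: "\<lbrakk>f \<in> bump_algebra; g \<in> bump_algebra\<rbrakk> \<Longrightarrow> (%z. f z + g z) \<in> bump_algebra"
| mult: "\<lbrakk>f \<in> bump_algebra; g \<in> bump_algebra\<rbrakk> \<Longrightarrow> (%z. f z * g z) \<in> bump_algebra"

lemma bump_algebra_deriv: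
 assumes "h \<in> bump_algebra"
 shows "\<exists>D. (\<forall>z. (h has_derivative (%v. D z \<bullet> v)) (at z)) & (\<forall>e\<in>Basis. (%z. D z \<bullet> e) \<in> bump_algebra)"
 using assms
proof induction
 case (const c)
 show ?case by (rule exI[of _ "%z. 0"]) (auto intro: bump_algebra.const)
next
 case (coord e)
 show ?case
  by (rule exI[of _ "%z. e"]) (auto intro!: bump_algebra.const derivative_eq_intros simp: inner_commute)
next
 case (flat n c a)
 let ?q = "%z::'a. c - (z - a) \<bullet> (z - a)"
 let ?d = "%z::'a. flat_exp (n + 2) (?q z) + (- real n) * flat_exp (n + 1) (?q z)"
 have "((%z. flat_exp n (?q z)) has_derivative (%v. ((?d z * (-2)) *. (z - a)) \<bullet> v)) (at z)" for z
 proof -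
  have q: "(?q has_derivative (%v. - 2 * ((z - a) \<bullet> v))) (at z)"
   by (auto intro!: derivative_eq_intros simp: inner_commute)
  show ?thesis
   by (rule has_derivative_eq_rhs[OF DERIV_compose_FDERIV[OF flat_exp_deriv q]])
     (auto simp: algebra_simps)
 qed
 moreover have "(%z. ((?d z * (-2)) *. (z - a)) \<bullet> e) \<in> bump_algebra" for e
 proof -
  have "((?d z * (-2)) *. (z - a)) \<bullet> e = ?d z * (-2) * (z \<bullet> e + - (a \<bullet> e))" for z
   by (simp only: inner_scaleR_left inner_diff_left[of z a e] diff_conv_add_uminus[of "z \<bullet> e"])
  then have "(%z. ((?d z * (-2)) *. (z - a)) \<bullet> e) = (%z. ?d z * (-2) * (z \<bullet> e + - (a \<bullet> e)))" by (rule ext)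
  then show ?thesis
   by (simp only:) (intro bump_algebra.mult bump_algebra.add bump_algebra.flat bump_algebra.const bump_algebra.coord)
 qed
 ultimately show ?case by (intro exI[of _ "%z. (?d z * (-2)) *. (z - a)"]) blast
next
 case (add f g)
 then obtain D E where "\<forall>z. (f has_derivative (%v. D z \<bullet> v)) (at z)" "\<forall>e\<in>Basis. (%z. D z \<bullet> e) \<in> bump_algebra"
  "\<forall>z. (g has_derivative (%v. E z \<bullet> v)) (at z)" "\<forall>e\<in>Basis. (%z. E z \<bullet> e) \<in> bump_algebra" by blast
 then show ?case
  by (intro exI[of _ "%z. D z + E z"])
    (auto intro!: derivative_eq_intros bump_algebra.intros simp: inner_add_left)
next
 case (mult f g)
 then obtain D E where "\<forall>z. (f has_derivative (%v. D z \<bullet> v)) (at z)" "\<forall>e\<in>Basis. (%z. D z \<bullet> e) \<in> bump_algebra"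
  "\<forall>z. (g has_derivative (%v. E z \<bullet> v)) (at z)" "\<forall>e\<in>Basis. (%z. E z \<bullet> e) \<in> bump_algebra" by blast
 with mult.hyps show ?case
  by (intro exI[of _ "%z. g z *. D z + f z *. E z"])
    (auto intro!: derivative_eq_intros bump_algebra.intros simp: inner_add_left)
qed

lemma smooth_bump_algebra: "h \<in> bump_algebra ==> smooth_on UNIV h"
 by (rule smooth_onI_closed[where \<F>=bump_algebra]) (auto intro: bump_algebra_deriv)

lemma lborel_bounded_finite:
 assumes "bounded (S :: 'a::euclidean_space set)" shows "emeasure lborel S < \<infinity>"
proof -
 obtain a where "S \<subseteq> cbox (-a) a" using bounded_subset_cbox_symmetric[OF assms] by blast
 then have "emeasure lborel S <= emeasure lborel (cbox (-a) a)" by (intro emeasure_mono) auto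
 then show ?thesis using emeasure_lborel_cbox_finite le_less_trans by blast
qed

lemma integrable_bounded_support:
 fixes h :: "'a::euclidean_space => 'b::euclidean_space"
 assumes "h \<in> borel_fun" "!!z. norm (h z) <= B" "!!z. norm z > R ==> h z = 0"
 shows "integrable lborel h"
proof (rule Bochner_Integration.integrable_bound)
 have "integrable lborel (ind (cball (0::'a) R) :: 'a => real)"
  using lborel_bounded_finite[OF bounded_cball[of "0::'a" R]] by (simp add: integrable_indicator_iff)
 then show "integrable lborel (%z. B * ind (cball (0::'a) R) z)" by simp
 show "h \<in> borel_measurable lborel" using assms(1) by simp
 show "AE z in lborel. norm (h z) <= norm (B * ind (cball (0::'a) R) z)"
 proof (rule AE_I2)
  fix z show "norm (h z) <= norm (B * ind (cball (0::'a) R) z)"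
   using assms(2)[of z] assms(3)[of z] norm_ge_zero[of "h z"]
   by (cases "norm z <= R") (auto simp: indicator_def)
 qed
qed

text \<open>The centre \<open>a\<close> is free because \<open>mollify_weak_grad\<close> takes a
  kernel supported at strictly negative times.\<close>

lemma exists_smooth_kernel:
 assumes "r > 0"
 obtains K :: "'a::euclidean_space => real"
 where "smooth_on UNIV K" "!!z. 0 <= K z" "!!z. norm (z - a) >= r ==> K z = 0" "integrable lborel K" "(LBINT z. K z) = 1"
proof -
 define k where "k = (%z::'a. flat_exp 0 (r\<^sup>2 - (z - a) \<bullet> (z - a)))"
 have ka: "k \<in> bump_algebra" unfolding k_def by (rule bump_algebra.flat)
 have cont: "continuous_on UNIV k"
  using C1_with_continuous smooth_imp_C1 smooth_bump_algebra[OF ka] by blast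
 have k0: "k z >= 0" "k z <= 1" for z by (auto simp: k_def flat_exp_def)
 have ks: "k z = 0" if "norm (z - a) >= r" for z
 proof -
  have "(norm (z - a))\<^sup>2 >= r\<^sup>2" using that assms by (intro power_mono) auto
  then show ?thesis by (simp add: k_def flat_exp_def dot_square_norm)
 qed
 have kpos: "k z > 0" if "norm (z - a) < r" for z
 proof -
  have "(norm (z - a))\<^sup>2 < r\<^sup>2" using that by (intro power_strict_mono) auto
  then show ?thesis by (simp add: k_def flat_exp_def dot_square_norm)
 qed
 have int: "integrable lborel k"
  by (rule integrable_bounded_support[where B=1 and R="norm a + r"])
    (use cont k0 in \<open>auto intro: borel_measurable_continuous_onI\<close>,
    metis ks norm_triangle_sub add_le_cancel_left less_imp_le order_trans)
 have "(LBINT z. k z) ~= 0"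
 proof
  assume "(LBINT z. k z) = 0"
  then have "AE z in lborel. k z = 0"
   using integral_nonneg_eq_0_iff_AE[OF int] k0 by auto
  then have "AE z in lborel. z \<notin> ball a r"
   by (rule eventually_mono) (use kpos in \<open>fastforce simp: dist_norm norm_minus_commute\<close>)
  then have "ball a r \<in> null_sets lborel"
   by (simp add: AE_iff_null_sets)
  then have "negligible (ball a r)"
   using negligible_iff_null_sets null_sets_completionI by blast
  then show False using open_not_negligible[of "ball a r"] assms by simp
 qed
 then have pos: "(LBINT z. k z) > 0"
  using k0 by (metis Bochner_Integration.integral_nonneg order_le_less)
 define c where "c = (LBINT z. k z)"
 have "(%z. (1 / c) * k z) \<in> bump_algebra" by (intro bump_algebra.intros ka)
 then show thesis using int pos k0 ks
  by (intro that[of "%z. (1 / c) * k z"]) (auto simp: smooth_bump_algebra c_def)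
qed

subsection \<open>Convolution\<close>

text \<open>Borel rather than Lebesgue measurability: translates, shears and slices of such
  functions stay measurable by composition.\<close>

definition loc_int :: "('a::euclidean_space => 'b::euclidean_space) => bool" where
 "loc_int g \<longleftrightarrow> g \<in> borel_fun & (\<forall>r. set_integrable lborel (cball 0 r) g)"

lemma loc_int_borel [measurable_dest]: "loc_int g ==> g \<in> borel_fun"
 by (simp add: loc_int_def)

lemma loc_intI_integrable: "g \<in> borel_fun ==> integrable lborel g ==> loc_int g"
 unfolding loc_int_def set_integrable_def by (auto intro: integrable_mult_indicator)

definition vanishes_beyond :: "real => ('a::real_normed_vector => 'b::zero) => bool" where
 "vanishes_beyond R k \<longleftrightarrow> (\<forall>z. norm z > R --> k z = 0)"

lemma vanishes_beyondD: "vanishes_beyond R k ==> norm z > R ==> k z = 0"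
 by (simp add: vanishes_beyond_def)

lemma norm_lebesgue_integral_le:
 fixes f :: "'a => 'b::{banach, second_countable_topology}"
 assumes "integrable M f" "integrable M g" "!!x. norm (f x) <= g x"
 shows "norm (integral\<^sup>L M f) <= integral\<^sup>L M g"
 by (rule order_trans[OF Bochner_Integration.integral_norm_bound integral_mono]) (use assms in auto)

lemma set_integrable_mult_bounded:
 fixes g :: "'a::euclidean_space => real" and k :: "'a => 'b::euclidean_space"
 assumes "set_integrable lborel S g" "k \<in> borel_fun" "!!y. norm (k y) <= B"
  "!!y. y \<notin> S ==> k y = 0"
 shows "integrable lborel (%y. g y *. k y)"
  and "norm (LBINT y. g y *. k y) <= B * (LBINT y:S. \<bar>g y\<bar>)"
proof -
 have eq: "g y *. k y = (ind S y *. g y) *. k y" for y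
  using assms(4) by (auto simp: indicator_def)
 have i: "integrable lborel (%y. ind S y *. g y)"
  using assms(1) by (simp add: set_integrable_def)
 then have m: "(%y. ind S y *. g y) \<in> borel_measurable lborel" by auto
 have i2: "integrable lborel (%y. B * \<bar>ind S y *. g y\<bar>)" using i by simp
 have le: "norm ((ind S y *. g y) *. k y) <= B * \<bar>ind S y *. g y\<bar>" for y
  using mult_right_mono[OF assms(3)[of y], of "\<bar>ind S y *. g y\<bar>"] by (simp add: mult.commute)
 show *: "integrable lborel (%y. g y *. k y)"
  unfolding eq
  by (rule Bochner_Integration.integrable_bound[OF i2])
    (use m assms(2) le in \<open>auto intro!: AE_I2 order_trans[OF le abs_ge_self] simp del: norm_scaleR abs_mult real_scaleR_def\<close>)
 have "norm (LBINT y. g y *. k y) <= (LBINT y. B * \<bar>ind S y *. g y\<bar>)"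
  by (rule norm_lebesgue_integral_le[OF * i2]) (use le in \<open>simp only: eq\<close>)
 also have "\<dots> = B * (LBINT y:S. \<bar>g y\<bar>)"
  by (simp add: set_lebesgue_integral_def abs_mult)
 finally show "norm (LBINT y. g y *. k y) <= B * (LBINT y:S. \<bar>g y\<bar>)" .
qed

lemma bounded_support_bound:
 fixes k :: "'a::euclidean_space => 'b::real_normed_vector"
 assumes "continuous_on UNIV k" "vanishes_beyond R k"
 obtains B where "B > 0" "!!z. norm (k z) <= B"
proof -
 have "bounded (k ` cball 0 R)"
  using assms(1) by (intro compact_imp_bounded compact_continuous_image) (auto intro: continuous_on_subset)
 then obtain B where B: "\<forall>z\<in>cball 0 R. norm (k z) <= B" unfolding bounded_iff by blast
 show thesis
 proof (rule that[of "max B 1"])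
  fix z show "norm (k z) <= max B 1" using B vanishes_beyondD[OF assms(2), of z] by (cases "norm z <= R") (fastforce simp: le_max_iff_disj)+
 qed auto
qed

text \<open>The ball is enlarged by 1 as a buffer: if one of two points at distance below 1 leaves
  it, both lie outside radius \<open>R\<close>, where \<open>k\<close> vanishes.\<close>

lemma bounded_support_uniformly_continuous:
 fixes k :: "'a::euclidean_space => 'b::real_normed_vector"
 assumes "continuous_on UNIV k" "vanishes_beyond R k" "e > 0"
 obtains d where "d > 0" "!!x y. norm (x - y) < d ==> norm (k x - k y) < e"
proof -
 have "uniformly_continuous_on (cball 0 (R + 1)) k"
  using assms(1) by (intro compact_uniformly_continuous) (auto intro: continuous_on_subset)
 then obtain d where d: "d > 0" "!!x y. x \<in> cball 0 (R+1) ==> y \<in> cball 0 (R+1) ==> dist y x < d ==> dist (k y) (k x) < e"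
  unfolding uniformly_continuous_on_def using assms(3) by meson
 show thesis
 proof (rule that[of "min d 1"])
  show "min d 1 > 0" using d by simp
  fix x y :: 'a assume xy: "norm (x - y) < min d 1"
  show "norm (k x - k y) < e"
  proof (cases "norm x <= R + 1 & norm y <= R + 1")
   case True then show ?thesis using d(2)[of y x] xy by (auto simp: dist_norm)
  next
   case False
   have "norm x <= norm y + norm (x - y)" "norm y <= norm x + norm (x - y)"
    using norm_triangle_sub[of x y] norm_triangle_sub[of y x] by (auto simp: norm_minus_commute)
   then have "norm x > R" "norm y > R" using False xy by auto
   then show ?thesis using assms by (simp add: vanishes_beyond_def)
  qed
 qed
qed

lemma C1_with_support:
 assumes "C1_with k D" "vanishes_beyond R k"
 shows "vanishes_beyond R D"
 unfolding vanishes_beyond_def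
proof (intro allI impI)
 fix z :: 'a assume "norm z > R"
 have "open {z::'a. norm z > R}" by (intro open_Collect_less continuous_intros)
 then have "(k has_derivative (%v. 0)) (at z)"
  using assms(2) \<open>norm z > R\<close>
  by (intro has_derivative_transform_within_open[OF has_derivative_const[of 0 "at z"], of "{z. norm z > R}"])
    (auto simp: vanishes_beyond_def)
 then have "grad k z = 0" using frechet_eq_grad(2)[of k 0 z] by simp
 then show "D z = 0" using C1_with_grad[OF assms(1)] by simp
qed

text \<open>The first-order Taylor error is uniform in the base point because \<open>D\<close> is
  uniformly continuous. This is what permits differentiation under the convolution integral.\<close>

lemma C1_with_uniform:
 assumes k: "C1_with k D" "vanishes_beyond R k" and "e > 0"
 obtains d where "d > 0" "!!z v. norm v < d ==> \<bar>k (z + v) - k z - D z \<bullet> v\<bar> <= e * norm v"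
proof -
 obtain d where d: "d > 0" "!!x y. norm (x - y) < d ==> norm (D x - D y) < e"
  by (rule bounded_support_uniformly_continuous[of D R e])
    (use C1_with_support[OF k] k(1) \<open>e > 0\<close> in \<open>auto simp: C1_with_def\<close>)
 show thesis
 proof (rule that[OF d(1)])
  fix z v :: 'a assume v: "norm v < d"
  have "norm (k (z + v) - k z - D z \<bullet> ((z + v) - z)) <= norm ((z + v) - z) * e"
  proof (rule differentiable_bound_linearization[where S="cball z (norm v)" and f'="%x v. D x \<bullet> v"])
   fix t :: real assume "t \<in> {0..1}"
   then show "z + t *. (z + v - z) \<in> cball z (norm v)" by (simp add: dist_norm mult_left_le_one_le)
  next
   fix x assume "x \<in> cball z (norm v)"
   show "(k has_derivative (\<bullet>) (D x)) (at x within cball z (norm v))"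
    using k(1) unfolding C1_with_def by (blast intro: has_derivative_at_withinI)
   have "norm (D x - D z) < e" using \<open>x \<in> _\<close> v by (intro d(2)) (auto simp: dist_norm norm_minus_commute)
   then show "onorm ((\<bullet>) (D x) - (\<bullet>) (D z)) <= e"
    using \<open>e > 0\<close>
    by (intro onorm_bound)
      (auto simp: inner_diff_left[symmetric] intro!: order_trans[OF Cauchy_Schwarz_ineq2] mult_right_mono)
  qed simp
  then show "\<bar>k (z + v) - k z - D z \<bullet> v\<bar> <= e * norm v" by (simp add: mult.commute)
 qed
qed

text \<open>The factor \<open>k\<close>, on which derivatives will fall, may be vector-valued; the
  convolution with a gradient is then covered by the same definition.\<close>

definition conv :: "('a::euclidean_space => 'b::euclidean_space) => ('a => real) => 'a => 'b" where
 "conv k g z = (LBINT y. g y *. k (z - y))"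

lemma shifted_support:
 fixes k :: "'a::euclidean_space => 'b::real_normed_vector"
 assumes "vanishes_beyond R k" "norm (x - z) <= 1" "y \<notin> cball 0 (norm z + R + 1)"
 shows "k (x - y) = 0"
proof -
 have "norm y <= norm (x - y) + norm x" using norm_triangle_sub[of y x] by (simp add: norm_minus_commute)
 moreover have "norm x <= norm z + 1" using norm_triangle_sub[of x z] assms(2) by simp
 ultimately have "norm (x - y) > R" using assms(3) by simp
 then show ?thesis using assms(1) by (simp add: vanishes_beyond_def)
qed

lemma conv_integrable:
 fixes k :: "'a::euclidean_space => 'b::euclidean_space"
 assumes k: "continuous_on UNIV k" "vanishes_beyond R k" and g: "loc_int g"
 shows "integrable lborel (%y. g y *. k (z - y))"
proof -
 obtain B where "!!z. norm (k z) <= B" using bounded_support_bound[OF k] by blast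
 then show ?thesis
  by (intro set_integrable_mult_bounded(1)[where S="cball 0 (norm z + R + 1)" and B=B])
    (use g k shifted_support[OF k(2), of z z] in \<open>auto simp: loc_int_def
     intro!: borel_measurable_continuous_onI continuous_on_compose2[OF k(1)] continuous_intros\<close>)
qed

lemma conv_continuous:
 fixes k :: "'a::euclidean_space => 'b::euclidean_space"
 assumes k: "continuous_on UNIV k" "vanishes_beyond R k" and g: "loc_int g"
 shows "continuous_on UNIV (conv k g)"
proof (intro continuous_at_imp_continuous_on ballI)
 fix z :: 'a
 define S where "S = cball (0::'a) (norm z + R + 1)"
 define A where "A = (LBINT y:S. \<bar>g y\<bar>)"
 have A: "A >= 0" unfolding A_def set_lebesgue_integral_def by (intro Bochner_Integration.integral_nonneg) auto
 show "isCont (conv k g) z"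
  unfolding continuous_at_eps_delta
 proof (intro allI impI)
  fix e :: real assume "e > 0"
  \<comment> \<open>Division by \<open>A + 1\<close> instead of \<open>A\<close> covers the case
    that \<open>g\<close> has no mass on \<open>S\<close>.\<close>
  then have eA: "e / (A + 1) > 0" using A by simp
  obtain d where d: "d > 0" "!!x y. norm (x - y) < d ==> norm (k x - k y) < e / (A + 1)"
   using bounded_support_uniformly_continuous[OF k eA] by blast
  show "\<exists>d>0. \<forall>x'. dist x' z < d --> dist (conv k g x') (conv k g z) < e"
  proof (intro exI[of _ "min d 1"] conjI allI impI)
   fix x assume x: "dist x z < min d 1"
   have "conv k g x - conv k g z = (LBINT y. g y *. (k (x - y) - k (z - y)))"
    unfolding conv_def scaleR_diff_right
    by (rule Bochner_Integration.integral_diff[symmetric]) (rule conv_integrable[OF k g])+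
   also have "norm \<dots> <= (e / (A + 1)) * (LBINT y:S. \<bar>g y\<bar>)"
   proof (rule set_integrable_mult_bounded(2))
    show "set_integrable lborel S g" using g by (simp add: loc_int_def S_def)
    show "(%y. k (x - y) - k (z - y)) \<in> borel_fun"
     by (auto intro!: borel_measurable_continuous_onI continuous_on_compose2[OF k(1)] continuous_intros)
    show "norm (k (x - y) - k (z - y)) <= e / (A + 1)" for y
     using d(2)[of "x - y" "z - y"] x by (simp add: dist_norm)
    show "k (x - y) - k (z - y) = 0" if "y \<notin> S" for y
     using shifted_support[OF k(2), where z=z and y=y] that x unfolding S_def by (auto simp: dist_norm)
   qed
   also have "\<dots> < e" using \<open>e > 0\<close> A unfolding A_def[symmetric] by (simp add: field_simps)
   finally show "dist (conv k g x) (conv k g z) < e" by (simp add: dist_norm)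
  qed (use d in auto)
 qed
qed

text \<open>The derivative falls on \<open>k\<close>: \<open>C1_with_uniform\<close> bounds the
  remainder under the integral by a small multiple of \<open>norm (x - z)\<close> times the mass of
  \<open>g\<close> on one ball, the same for all \<open>x\<close> within distance 1 of
  \<open>z\<close>.\<close>

lemma conv_C1:
 assumes k: "C1_with k D" "vanishes_beyond R k" and g: "loc_int g"
 shows "C1_with (conv k g) (conv D g)"
proof -
 have kc: "continuous_on UNIV k" using k C1_with_continuous by blast
 have Dc: "continuous_on UNIV D" using k C1_with_def by blast
 note Ds = C1_with_support[OF k]
 have "(conv k g has_derivative (%v. conv D g z \<bullet> v)) (at z)" for z
  unfolding has_derivative_at_alt
 proof (intro conjI allI impI)
  show "bounded_linear ((\<bullet>) (conv D g z))" by (rule bounded_linear_inner_right)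
  fix e :: real assume "e > 0"
  define S where "S = cball (0::'a) (norm z + R + 1)"
  define A where "A = (LBINT y:S. \<bar>g y\<bar>)"
  have A: "A >= 0" unfolding A_def set_lebesgue_integral_def by (intro Bochner_Integration.integral_nonneg) auto
  then have eA: "e / (A + 1) > 0" using \<open>e > 0\<close> by simp
  obtain d where d: "d > 0" "!!z v. norm v < d ==> \<bar>k (z + v) - k z - D z \<bullet> v\<bar> <= e / (A + 1) * norm v"
   using C1_with_uniform[OF k eA] by blast
  show "\<exists>d>0. \<forall>y. norm (y - z) < d --> norm (conv k g y - conv k g z - conv D g z \<bullet> (y - z)) <= e * norm (y - z)"
  proof (intro exI[of _ "min d 1"] conjI allI impI)
   fix x assume x: "norm (x - z) < min d 1"
   let ?r = "%y. k (x - y) - k (z - y) - D (z - y) \<bullet> (x - z)"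
   have "conv D g z \<bullet> (x - z) = (LBINT y. (g y *. D (z - y)) \<bullet> (x - z))"
    unfolding conv_def by (rule integral_inner_left[symmetric]) (rule conv_integrable[OF Dc Ds g])
   then have "conv k g x - conv k g z - conv D g z \<bullet> (x - z) = (LBINT y. g y *. ?r y)"
    unfolding conv_def
    by (simp add: right_diff_distrib Bochner_Integration.integral_diff conv_integrable[OF kc k(2) g, simplified]
      integrable_inner_left[OF conv_integrable[OF Dc Ds g], simplified])
   also have "norm \<dots> <= (e / (A + 1) * norm (x - z)) * (LBINT y:S. \<bar>g y\<bar>)"
   proof (rule set_integrable_mult_bounded(2))
    show "set_integrable lborel S g" using g by (simp add: loc_int_def S_def)
    show "?r \<in> borel_fun"
     by (intro borel_measurable_continuous_onI continuous_intros continuous_on_compose2[OF kc] continuous_on_compose2[OF Dc]) auto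
    show "norm (?r y) <= e / (A + 1) * norm (x - z)" for y
     using d(2)[of "x - z" "z - y"] x by simp
    show "?r y = 0" if "y \<notin> S" for y
     using shifted_support[OF k(2), where z=z and y=y] shifted_support[OF Ds, of z z y] that x unfolding S_def by (auto)
   qed
   also have "\<dots> = norm (x - z) * (e / (A + 1) * A)" by (simp add: A_def)
   also have "\<dots> <= norm (x - z) * e"
    using \<open>e > 0\<close> A by (intro mult_left_mono) (auto simp: field_simps)
   finally show "norm (conv k g x - conv k g z - conv D g z \<bullet> (x - z)) <= e * norm (x - z)" by (simp add: mult.commute)
  qed (use d in auto)
 qed
 then show ?thesis using conv_continuous[OF Dc Ds g] by (auto simp: C1_with_def)
qed

text \<open>The convolutions of \<open>g\<close> with smooth kernels supported in a fixed ball form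
  a family closed under partial derivatives.\<close>

lemma conv_smooth:
 fixes k :: "'a::euclidean_space => real"
 assumes k: "smooth_on UNIV k" "vanishes_beyond R k" and g: "loc_int g"
 shows "smooth_on UNIV (conv k g)"
proof (rule smooth_onI_closed[where \<F>="{conv k g |k :: 'a => real. smooth_on UNIV k & vanishes_beyond R k}"])
 show "conv k g \<in> {conv k g |k :: 'a => real. smooth_on UNIV k & vanishes_beyond R k}" using k by auto
next
 fix h :: "'a => real" assume "h \<in> {conv k g |k :: 'a => real. smooth_on UNIV k & vanishes_beyond R k}"
 then obtain k :: "'a => real" where h: "h = conv k g" and k: "smooth_on UNIV k" "vanishes_beyond R k" by auto
 note C = smooth_imp_C1[OF k(1)]
 have Dc: "continuous_on UNIV (grad k)" using C C1_with_def by blast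
 note Ds = C1_with_support[OF C k(2)]
 have "(%z. conv (grad k) g z \<bullet> e) \<in> {conv k g |k :: 'a => real. smooth_on UNIV k & vanishes_beyond R k}" if e: "e \<in> Basis" for e
 proof -
  have "(%z. grad k z \<bullet> e) = iter_deriv [e] k"
   using frechet_eq_grad(1)[of k "grad k z" z e for z] C unfolding C1_with_def by (simp add: fun_eq_iff)
  then have s: "smooth_on UNIV (%z. grad k z \<bullet> e)"
   using smooth_iter_deriv[OF k(1), of "[e]"] e by simp
  have "(%z. conv (grad k) g z \<bullet> e) = conv (%z. grad k z \<bullet> e) g"
   unfolding conv_def using integral_inner_left[OF conv_integrable[OF Dc Ds g]] by (auto simp: fun_eq_iff)
  moreover have "vanishes_beyond R (%z. grad k z \<bullet> e)" using Ds by (simp add: vanishes_beyond_def)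
  ultimately show ?thesis using s by blast
 qed
 moreover have "C1_with h (conv (grad k) g)" unfolding h using conv_C1[OF C k(2) g] .
 ultimately show "\<exists>D. (\<forall>z. (h has_derivative (\<bullet>) (D z)) (at z)) &
   (\<forall>e\<in>Basis. (%z. D z \<bullet> e) \<in> {conv k g |k :: 'a => real. smooth_on UNIV k & vanishes_beyond R k})"
  unfolding C1_with_def by blast
qed

lemma lborel_distr_reflect: "distr lborel borel (%y::'a::euclidean_space. t - y) = lborel"
proof -
 have T: "(%x::'a. t + (\<Sum>j\<in>Basis. (-1 * (x \<bullet> j)) *. j)) = (%y. t - y)"
  by (simp add: fun_eq_iff sum_negf euclidean_representation)
 have "lborel = density (distr lborel borel (%y::'a. t - y)) (%_. \<Prod>j\<in>Basis. ennreal \<bar>-1::real\<bar>)"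
  using lborel_affine_euclidean[of "%_. -1" t] unfolding T by (simp add: prod_ennreal)
 then show ?thesis by (simp add: density_1)
qed

lemma lborel_distr_translate: "distr lborel borel (%y::'a::euclidean_space. y + t) = lborel"
 using lborel_distr_plus[of t] by (simp add: add.commute[of _ t])

lemma conv_commute:
 fixes k :: "'a::euclidean_space => real"
 assumes [measurable]: "k \<in> borel_fun" "g \<in> borel_fun"
 shows "conv k g z = conv g k z"
proof -
 have "conv k g z = (LINT y|distr lborel borel (%y. z - y). g y *. k (z - y))"
  by (simp add: conv_def lborel_distr_reflect)
 also have "\<dots> = conv g k z"
  by (subst integral_distr) (auto simp: conv_def mult.commute)
 finally show ?thesis .
qed

text \<open>The roles are exchanged here: the unit mass is carried by \<open>K\<close>, within
  radius \<open>d\<close>, while \<open>\<phi>\<close> stands in the place on which derivatives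
  fall. The same estimate then serves for \<open>\<phi>\<close> and for its gradient.\<close>

lemma conv_kernel_close:
 fixes \<phi> :: "'a::euclidean_space => 'b::euclidean_space"
 assumes "integrable lborel K" "!!z. K z >= 0" "(LBINT z. K z) = 1" "!!z. norm z >= d ==> K z = 0"
  and i: "integrable lborel (%y. K y *. \<phi> (z - y))"
  and "!!y. norm y < d ==> norm (\<phi> (z - y) - \<phi> z) <= e"
 shows "norm (conv \<phi> K z - \<phi> z) <= e"
proof -
 have "\<phi> z = (LBINT y. K y *. \<phi> z)" using assms(1,3) by simp
 then have "conv \<phi> K z - \<phi> z = (LBINT y. K y *. \<phi> (z - y)) - (LBINT y. K y *. \<phi> z)"
  by (simp add: conv_def)
 also have "\<dots> = (LBINT y. K y *. (\<phi> (z - y) - \<phi> z))"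
  using i assms(1) by (simp add: scaleR_diff_right)
 also have "norm \<dots> <= (LBINT y. e * K y)"
 proof (rule norm_lebesgue_integral_le)
  show "integrable lborel (%y. K y *. (\<phi> (z - y) - \<phi> z))"
   using i assms(1) by (simp add: scaleR_diff_right)
  show "norm (K y *. (\<phi> (z - y) - \<phi> z)) <= e * K y" for y
   using assms(2)[of y] assms(4)[of y] assms(6)[of y]
   by (cases "norm y < d") (auto simp: mult.commute[of e] intro!: mult_left_mono)
 qed (use assms(1) in auto)
 also have "\<dots> = e" using assms(3) by simp
 finally show ?thesis .
qed

section \<open>From smooth to C1 test functions\<close>

lemma C1_with_borel:
 assumes "C1_with h D" shows "h \<in> borel_fun" "D \<in> borel_fun"
 using C1_with_continuous[OF assms, of UNIV] assms by (auto simp: C1_with_def intro: borel_measurable_continuous_onI)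

lemma compact_support_vanishes:
 fixes \<phi> :: "'a::euclidean_space => real"
 assumes "compact (closure {z. \<phi> z ~= 0})"
 obtains R where "R > 0" "vanishes_beyond R \<phi>"
proof -
 obtain R where "\<forall>z\<in>closure {z. \<phi> z ~= 0}. norm z <= R"
  using compact_imp_bounded[OF assms] unfolding bounded_iff by blast
 then have "\<forall>z. \<phi> z ~= 0 --> norm z <= R" using closure_subset[of "{z. \<phi> z ~= 0}"] by auto
 then show thesis by (intro that[of "max R 1"]) (auto simp: vanishes_beyond_def)
qed

text \<open>Mollification with a kernel of radius \<open>d\<close> keeps the sign, moves value and
  gradient by at most their oscillation over distance \<open>d\<close>, and enlarges the support by
  at most \<open>d\<close>.\<close>

lemma mollify_test_function:
 fixes \<phi> :: "'a::euclidean_space => real"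
 assumes \<phi>: "C1_with \<phi> D" and S: "compact (closure {z. \<phi> z ~= 0})" "closure {z. \<phi> z ~= 0} \<subseteq> S" "open S"
  and R: "vanishes_beyond R \<phi>" and e: "e > 0" and pos: "!!z. \<phi> z >= 0"
 obtains \<psi> where "test_function S \<psi>" "!!z. \<psi> z >= 0" "vanishes_beyond (R + 1) \<psi>"
  "!!z. \<bar>\<psi> z - \<phi> z\<bar> <= e" "!!z. norm (grad \<psi> z - D z) <= e"
proof -
 let ?C = "closure {z. \<phi> z ~= 0}"
 have \<phi>c: "continuous_on UNIV \<phi>" and Dc: "continuous_on UNIV D"
  using C1_with_continuous[OF \<phi>] \<phi> by (auto simp: C1_with_def)
 have DR: "vanishes_beyond R D" by (rule C1_with_support[OF \<phi> R])
 note [measurable] = C1_with_borel[OF \<phi>]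
 obtain r where r: "r > 0" "(\<Union>x\<in>?C. cball x r) \<subseteq> S"
  using compact_subset_open_imp_cball_epsilon_subset[OF S(1,3,2)] by blast
 obtain d1 where d1: "d1 > 0" "!!x y. norm (x - y) < d1 ==> norm (\<phi> x - \<phi> y) < e"
  using bounded_support_uniformly_continuous[OF \<phi>c R e] by blast
 obtain d2 where d2: "d2 > 0" "!!x y. norm (x - y) < d2 ==> norm (D x - D y) < e"
  using bounded_support_uniformly_continuous[OF Dc DR e] by blast
 \<comment> \<open>Four requirements: oscillation of \<open>\<phi>\<close>, oscillation of
   \<open>D\<close>, room inside \<open>S\<close>, and growth of the radius \<open>R\<close> by at
   most 1.\<close>
 define d where "d = min (min d1 d2) (min r 1)"
 have d: "d > 0" "d <= d1" "d <= d2" "d <= r" "d <= 1" using r d1 d2 by (auto simp: d_def)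
 obtain K :: "'a => real" where K: "smooth_on UNIV K" "!!z. 0 <= K z" "!!z. norm z >= d ==> K z = 0"
  "integrable lborel K" "(LBINT z. K z) = 1" using exists_smooth_kernel[OF d(1), of 0] by (metis diff_zero)
 have Kb: "K \<in> borel_fun"
  by (rule C1_with_borel(1)[OF smooth_imp_C1[OF K(1)]])
 have Kl: "loc_int K" by (rule loc_intI_integrable[OF Kb K(4)])
 obtain B where B: "!!z. norm (\<phi> z) <= B" using bounded_support_bound[OF \<phi>c R] by blast
 have \<phi>l: "loc_int \<phi>"
  by (intro loc_intI_integrable integrable_bounded_support[where R=R and B=B] B)
    (use R in \<open>auto simp: vanishes_beyond_def\<close>)
 define \<psi> where "\<psi> = conv K \<phi>"
 \<comment> \<open>Two readings of one convolution: with kernel \<open>K\<close> it is smooth, with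
   kernel \<open>\<phi>\<close> its gradient is the mollified \<open>D\<close>.\<close>
 have \<psi>': "\<psi> = conv \<phi> K" unfolding \<psi>_def by (rule ext, rule conv_commute) (auto simp: Kb)
 have C1: "C1_with \<psi> (conv D K)" unfolding \<psi>' by (rule conv_C1[OF \<phi> R Kl])
 have Kd: "vanishes_beyond d K" using K(3) by (simp add: vanishes_beyond_def)
 have supp: "{z. \<psi> z ~= 0} \<subseteq> {x + y |x y. x \<in> ?C & y \<in> cball 0 d}"
 proof
  fix z assume "z \<in> {z. \<psi> z ~= 0}"
  then have nz: "\<psi> z ~= 0" by simp
  have "\<exists>y. \<phi> y * K (z - y) ~= 0"
  proof (rule ccontr)
   assume "\<not> ?thesis"
   then have "\<psi> z = (LBINT y::'a. 0)" unfolding \<psi>_def conv_def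
    by (intro Bochner_Integration.integral_cong) auto
   with nz show False by simp
  qed
  then obtain y where "\<phi> y ~= 0" "K (z - y) ~= 0" by auto
  then have "y \<in> ?C" "\<not> norm (z - y) >= d" using K(3)[of "z - y"] closure_subset[of "{z. \<phi> z ~= 0}"] by blast+
  then have "y \<in> ?C" "z - y \<in> cball 0 d" by simp_all
  then show "z \<in> {x + y |x y. x \<in> ?C & y \<in> cball 0 d}"
   by (intro CollectI exI[of _ y] exI[of _ "z - y"]) auto
 qed
 have cpt: "compact {x + y |x y. x \<in> ?C & y \<in> cball 0 d}" by (rule compact_sums[OF S(1) compact_cball])
 have cl: "closure {z. \<psi> z ~= 0} \<subseteq> {x + y |x y. x \<in> ?C & y \<in> cball 0 d}"
  by (rule closure_minimal[OF supp compact_imp_closed[OF cpt]])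
 have sub: "{x + y |x y. x \<in> ?C & y \<in> cball 0 d} \<subseteq> S"
 proof -
  have "x + y \<in> cball x r" if "y \<in> cball 0 d" for x y :: 'a using that d(4) by (simp add: dist_norm)
  then show ?thesis using r(2) by blast
 qed
 show thesis
 proof (rule that[of \<psi>])
  show "test_function S \<psi>"
   unfolding test_function_def
  proof (intro conjI)
   show "smooth_on UNIV \<psi>" unfolding \<psi>_def by (rule conv_smooth[OF K(1) Kd \<phi>l])
   show "compact (closure {z. \<psi> z ~= 0})"
    using compact_Int_closed[OF cpt closed_closure, of "{z. \<psi> z ~= 0}"] cl by (simp add: inf.absorb2)
  qed (use cl sub in auto)
  show "\<psi> z >= 0" for z unfolding \<psi>_def conv_def using K(2) pos by (intro Bochner_Integration.integral_nonneg) auto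
  show "vanishes_beyond (R + 1) \<psi>"
   unfolding vanishes_beyond_def
  proof (intro allI impI)
   fix z :: 'a assume z: "norm z > R + 1"
   have "\<phi> y * K (z - y) = 0" for y
   proof (cases "norm y > R")
    case True then show ?thesis using R by (simp add: vanishes_beyond_def)
   next
    case False
    then have "norm (z - y) >= d" using z d(5) norm_triangle_sub[of z y] by simp
    then show ?thesis using K(3) by simp
   qed
   then have "\<psi> z = (LBINT y::'a. 0)" unfolding \<psi>_def conv_def
    by (intro Bochner_Integration.integral_cong) auto
   then show "\<psi> z = 0" by simp
  qed
  fix z
  have "norm (conv \<phi> K z - \<phi> z) <= e"
  proof (rule conv_kernel_close[where d=d])
   show "integrable lborel (%y. K y *. \<phi> (z - y))" by (rule conv_integrable[OF \<phi>c R Kl])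
   fix y :: 'a assume "norm y < d"
   then show "norm (\<phi> (z - y) - \<phi> z) <= e" using d(2) by (intro less_imp_le d1(2)) simp
  qed (use K in auto)
  then show "\<bar>\<psi> z - \<phi> z\<bar> <= e" unfolding \<psi>' by simp
  have "norm (conv D K z - D z) <= e"
  proof (rule conv_kernel_close[where d=d])
   show "integrable lborel (%y. K y *. D (z - y))" by (rule conv_integrable[OF Dc DR Kl])
   fix y :: 'a assume "norm y < d"
   then show "norm (D (z - y) - D z) <= e" using d(3) by (intro less_imp_le d2(2)) simp
  qed (use K in auto)
  then show "norm (grad \<psi> z - D z) <= e" using C1_with_grad[OF C1] by simp
 qed
qed

lemma set_integrable_mult_continuous:
 fixes g :: "'a::euclidean_space => real" and k :: "'a => 'b::euclidean_space"
 assumes "loc_int g" "continuous_on UNIV k" "vanishes_beyond R k"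
 shows "integrable lborel (%y. g y *. k y)"
proof -
 obtain B where "!!z. norm (k z) <= B" using bounded_support_bound[OF assms(2,3)] by blast
 then show ?thesis
  by (intro set_integrable_mult_bounded(1)[where S="cball 0 R" and B=B])
    (use assms in \<open>auto simp: loc_int_def vanishes_beyond_def intro: borel_measurable_continuous_onI\<close>)
qed

lemma loc_int_inner: assumes "loc_int B" shows "loc_int (%z. B z \<bullet> e)"
proof -
 have "integrable lborel (%x. (ind (cball 0 r) x *. B x) \<bullet> e)" for r :: real
  using assms by (intro integrable_inner_left) (simp add: loc_int_def set_integrable_def)
 then show ?thesis using assms by (auto simp: loc_int_def set_integrable_def)
qed

lemma loc_int_norm: assumes "loc_int g" shows "integrable lborel (%x. ind (cball 0 r) x * norm (g x))"
proof -
 have "integrable lborel (%x. norm (ind (cball 0 r) x *. g x))"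
  using assms by (intro integrable_norm) (simp add: loc_int_def set_integrable_def)
 then show ?thesis by simp
qed

lemma integrable_inner_continuous:
 fixes B k :: "'a::euclidean_space => 'b::euclidean_space"
 assumes "loc_int B" "continuous_on UNIV k" "vanishes_beyond R k"
 shows "integrable lborel (%y. B y \<bullet> k y)"
proof -
 have "integrable lborel (%y. (B y \<bullet> e) *. (k y \<bullet> e))" for e
  by (rule set_integrable_mult_continuous[OF loc_int_inner[OF assms(1)], where R=R])
    (use assms(2,3) in \<open>auto simp: vanishes_beyond_def intro!: continuous_intros\<close>)
 then have "integrable lborel (%y. \<Sum>e\<in>Basis. (B y \<bullet> e) *. (k y \<bullet> e))" by auto
 moreover have "(%y. B y \<bullet> k y) = (%y. \<Sum>e\<in>Basis. (B y \<bullet> e) *. (k y \<bullet> e))"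
  by (rule ext, subst euclidean_inner) simp
 ultimately show ?thesis by simp
qed

lemma vanishes_beyond_slice:
 fixes \<phi> :: "'a::euclidean_space \<times> real => 'b::euclidean_space"
 assumes "continuous_on UNIV \<phi>" "vanishes_beyond R \<phi>"
 shows "continuous_on UNIV (%x. \<phi> (x, t))" "vanishes_beyond R (%x. \<phi> (x, t))"
proof -
 show "continuous_on UNIV (%x. \<phi> (x, t))"
  by (rule continuous_on_compose2[OF assms(1)]) (auto intro!: continuous_intros)
 show "vanishes_beyond R (%x. \<phi> (x, t))"
  unfolding vanishes_beyond_def
 proof (intro allI impI)
  fix x :: 'a assume "norm x > R"
  then have "norm (x, t) > R" using norm_fst_le[of x t] by simp
  then show "\<phi> (x, t) = 0" using assms(2) by (simp add: vanishes_beyond_def)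
 qed
qed

text \<open>The functional is continuous in the C1 norm on test functions supported in a fixed ball,
  because the coefficients are integrable there; smooth nonnegative test functions are dense among
  the C1 ones by \<open>mollify_test_function\<close>.\<close>

lemma test_inequality_extends_C1:
 fixes A :: "'a::euclidean_space \<times> real => real" and B :: "'a \<times> real => 'a \<times> real"
 assumes A: "loc_int A" and B: "loc_int B" and c: "loc_int c" and S: "open S"
  and test: "!!\<phi>. test_function S \<phi> ==> (!!z. \<phi> z >= 0) ==>
    0 <= (LBINT z. A z * \<phi> z + B z \<bullet> grad \<phi> z) + (LBINT x. c x * \<phi> (x, 0))"
  and \<phi>: "C1_with \<phi> D" "!!z. \<phi> z >= 0" "compact (closure {z. \<phi> z ~= 0})" "closure {z. \<phi> z ~= 0} \<subseteq> S"
 shows "0 <= (LBINT z. A z * \<phi> z + B z \<bullet> D z) + (LBINT x. c x * \<phi> (x, 0))"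
proof -
 obtain R where R: "R > 0" "vanishes_beyond R \<phi>" using compact_support_vanishes[OF \<phi>(3)] by blast
 define J where "J \<phi> D = (LBINT z. A z * \<phi> z + B z \<bullet> D z) + (LBINT x. c x * \<phi> (x, 0))" for \<phi> D
 let ?S = "cball 0 (R + 1)"
 let ?g = "%z. ind ?S z * (\<bar>A z\<bar> + norm (B z))"
 let ?h = "%x. ind ?S x * \<bar>c x\<bar>"
 have gi: "integrable lborel ?g" "integrable lborel ?h"
  using loc_int_norm[OF A, of "R + 1"] loc_int_norm[OF B, of "R + 1"] loc_int_norm[OF c, of "R + 1"]
  by (simp_all add: distrib_left)
 have J: "J \<phi> D >= - e" if "e > 0" for e
 proof -
  \<comment> \<open>Total weight of the coefficients on the enlarged ball: an approximation within
    \<open>e'\<close> changes the functional by at most \<open>e'\<close> times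
    \<open>M\<close>.\<close>
  define M where "M = (LBINT z. ?g z) + (LBINT x. ?h x)"
  have M: "M >= 0" unfolding M_def by (intro add_nonneg_nonneg Bochner_Integration.integral_nonneg) auto
  define e' where "e' = e / (M + 1)"
  have e': "e' > 0" "e' * M <= e" using that M by (auto simp: e'_def field_simps)
  obtain \<psi> where \<psi>: "test_function S \<psi>" "!!z. \<psi> z >= 0" "vanishes_beyond (R + 1) \<psi>"
   "!!z. \<bar>\<psi> z - \<phi> z\<bar> <= e'" "!!z. norm (grad \<psi> z - D z) <= e'"
   using mollify_test_function[OF \<phi>(1,3,4) S R(2) e'(1) \<phi>(2)] by blast
  have R': "vanishes_beyond (R + 1) \<phi>" using R(2) by (simp add: vanishes_beyond_def)
  have C: "C1_with \<psi> (grad \<psi>)" by (rule smooth_imp_C1) (use \<psi>(1) in \<open>simp add: test_function_def\<close>)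
  note cs = C1_with_continuous[OF \<phi>(1)] C1_with_continuous[OF C]
  have Dc: "continuous_on UNIV D" "continuous_on UNIV (grad \<psi>)" using C \<phi>(1) by (auto simp: C1_with_def)
  have Dv: "vanishes_beyond (R + 1) D" "vanishes_beyond (R + 1) (grad \<psi>)"
   using C1_with_support[OF \<phi>(1) R'] C1_with_support[OF C \<psi>(3)] .
  note i1 = set_integrable_mult_continuous[OF A cs(1) R', simplified] integrable_inner_continuous[OF B Dc(1) Dv(1)]
   set_integrable_mult_continuous[OF c vanishes_beyond_slice[OF cs(1) R', of 0], simplified]
  note i2 = set_integrable_mult_continuous[OF A cs(2) \<psi>(3), simplified] integrable_inner_continuous[OF B Dc(2) Dv(2)]
   set_integrable_mult_continuous[OF c vanishes_beyond_slice[OF cs(2) \<psi>(3), of 0], simplified]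
  have "(LBINT z. A z * \<psi> z + B z \<bullet> grad \<psi> z) - (LBINT z. A z * \<phi> z + B z \<bullet> D z)
    = (LBINT z. (A z * \<psi> z + B z \<bullet> grad \<psi> z) - (A z * \<phi> z + B z \<bullet> D z))"
   using i1 i2 by (intro Bochner_Integration.integral_diff[symmetric] Bochner_Integration.integrable_add)
  also have "\<dots> <= (LBINT z. e' * ?g z)"
  proof (rule integral_mono)
   show "integrable lborel (%z. (A z * \<psi> z + B z \<bullet> grad \<psi> z) - (A z * \<phi> z + B z \<bullet> D z))"
    using i1 i2 by (intro Bochner_Integration.integrable_diff Bochner_Integration.integrable_add)
   fix z
   show "(A z * \<psi> z + B z \<bullet> grad \<psi> z) - (A z * \<phi> z + B z \<bullet> D z) <= e' * ?g z"
   proof (cases "z \<in> ?S")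
    case True
    have "A z * (\<psi> z - \<phi> z) <= \<bar>A z\<bar> * \<bar>\<psi> z - \<phi> z\<bar>"
     using abs_ge_self[of "A z * (\<psi> z - \<phi> z)"] by (simp add: abs_mult)
    also have "\<dots> <= \<bar>A z\<bar> * e'" by (rule mult_left_mono[OF \<psi>(4) abs_ge_zero])
    finally have "A z * (\<psi> z - \<phi> z) <= \<bar>A z\<bar> * e'" .
    moreover have "B z \<bullet> (grad \<psi> z - D z) <= norm (B z) * e'"
     by (rule order_trans[OF norm_cauchy_schwarz]) (auto intro!: mult_left_mono \<psi>(5))
    ultimately show ?thesis using True by (simp add: algebra_simps inner_diff_right)
   next
    case False
    then have "norm z > R + 1" by simp
    then show ?thesis using False
     by (simp only: R'[THEN vanishes_beyondD] \<psi>(3)[THEN vanishes_beyondD] Dv[THEN vanishes_beyondD]) simp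
   qed
  qed (use gi in auto)
  finally have le1: "(LBINT z. A z * \<psi> z + B z \<bullet> grad \<psi> z) - (LBINT z. A z * \<phi> z + B z \<bullet> D z)
   <= e' * (LBINT z. ?g z)" by simp
  have "(LBINT x. c x * \<psi> (x, 0)) - (LBINT x. c x * \<phi> (x, 0))
    = (LBINT x. c x * \<psi> (x, 0) - c x * \<phi> (x, 0))"
   using i1 i2 by (intro Bochner_Integration.integral_diff[symmetric])
  also have "\<dots> <= (LBINT x. e' * ?h x)"
  proof (rule integral_mono)
   show "integrable lborel (%x. c x * \<psi> (x, 0) - c x * \<phi> (x, 0))"
    using i1 i2 by (intro Bochner_Integration.integrable_diff)
   fix x
   show "c x * \<psi> (x, 0) - c x * \<phi> (x, 0) <= e' * ?h x"
   proof (cases "x \<in> ?S")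
    case True
    have "c x * (\<psi> (x, 0) - \<phi> (x, 0)) <= \<bar>c x\<bar> * \<bar>\<psi> (x, 0) - \<phi> (x, 0)\<bar>"
     using abs_ge_self[of "c x * (\<psi> (x, 0) - \<phi> (x, 0))"] by (simp add: abs_mult)
    also have "\<dots> <= \<bar>c x\<bar> * e'" by (rule mult_left_mono[OF \<psi>(4) abs_ge_zero])
    finally have "c x * (\<psi> (x, 0) - \<phi> (x, 0)) <= \<bar>c x\<bar> * e'" .
    then show ?thesis using True by (simp add: algebra_simps)
   next
    case False
    then show ?thesis using vanishes_beyond_slice(2)[OF cs(1) R', of 0] vanishes_beyond_slice(2)[OF cs(2) \<psi>(3), of 0]
     by (simp add: vanishes_beyond_def)
   qed
  qed (use gi in auto)
  finally have le2: "(LBINT x. c x * \<psi> (x, 0)) - (LBINT x. c x * \<phi> (x, 0)) <= e' * (LBINT x. ?h x)" by simp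
  have "0 <= J \<psi> (grad \<psi>)" unfolding J_def by (rule test[OF \<psi>(1,2)])
  then have "0 <= J \<phi> D + e' * M"
   using le1 le2 by (simp add: J_def M_def distrib_left)
  then show ?thesis using e'(2) by simp
 qed
 have "0 <= J \<phi> D + e" if "e > 0" for e using J[OF that] by simp
 then have "0 <= J \<phi> D" by (rule field_le_epsilon)
 then show ?thesis by (simp add: J_def)
qed

subsection \<open>Mollification in \<open>L\<^sup>2\<close>\<close>

text \<open>Measure-preserving maps of small displacement. Besides translations they include the
  time-dependent shears of \<open>near_id_shear\<close>, so one continuity statement serves
  mollifiers and shrinking cones.\<close>

definition near_id :: "real => ('a::euclidean_space => 'a) => bool" where
 "near_id d \<tau> \<longleftrightarrow> \<tau> \<in> borel_fun & distr lborel borel \<tau> = lborel & (\<forall>z. norm (\<tau> z - z) <= d)"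

lemma near_idD: "near_id d \<tau> ==> norm (\<tau> z - z) <= d"
 unfolding near_id_def by blast

lemma near_id_mono: "near_id d \<tau> ==> d <= d' ==> near_id d' \<tau>"
 by (auto simp: near_id_def intro: order_trans)

lemma near_id_integral:
 fixes f :: "'a::euclidean_space => 'b::euclidean_space"
 assumes "near_id d \<tau>" "f \<in> borel_fun"
 shows "(LBINT z. f (\<tau> z)) = (LBINT z. f z)"
  and "integrable lborel (%z. f (\<tau> z)) \<longleftrightarrow> integrable lborel f"
proof -
 have t: "\<tau> \<in> measurable lborel borel" "distr lborel borel \<tau> = lborel" using assms by (auto simp: near_id_def)
 show "(LBINT z. f (\<tau> z)) = (LBINT z. f z)"
  using integral_distr[OF t(1) assms(2)] t(2) by simp
 show "integrable lborel (%z. f (\<tau> z)) \<longleftrightarrow> integrable lborel f"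
  using integrable_distr_eq[OF t(1) assms(2)] t(2) by simp
qed

lemma near_id_measurable:
 assumes "near_id d \<tau>" "f \<in> borel_fun"
 shows "(%z. f (\<tau> z)) \<in> borel_fun"
 using assms unfolding near_id_def by (auto intro: measurable_compose)

lemma lmeasurable_outer_open:
 assumes "A \<in> lmeasurable" "e > 0"
 obtains U where "open U" "A \<subseteq> U" "U \<in> lmeasurable" "measure lebesgue U < measure lebesgue A + e"
proof -
 obtain U where U: "open U" "A \<subseteq> U" "U - A \<in> lmeasurable" "emeasure lebesgue (U - A) < ennreal e"
  using sets_lebesgue_outer_open[of A e] assms by blast
 have eq: "U = A \<union> (U - A)" using U(2) by blast
 have UL: "U \<in> lmeasurable" by (subst eq) (intro fmeasurable.Un assms U)
 have "measure lebesgue (U - A) < e"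
  using U(3,4) assms(2) by (simp add: emeasure_eq_measure2 ennreal_less_iff)
 moreover have "measure lebesgue (U - A) = measure lebesgue U - measure lebesgue A"
  by (rule measurable_measure_Diff[OF UL _ U(2)]) (use assms in auto)
 ultimately show thesis using that U UL by simp
qed

text \<open>Inner regularity provides a closed set; intersecting it with growing balls makes it
  compact at the cost of another \<open>e / 2\<close>.\<close>

lemma lmeasurable_inner_compact:
 assumes "A \<in> lmeasurable" "e > 0"
 obtains C where "compact C" "C \<subseteq> A" "C \<in> lmeasurable" "measure lebesgue A < measure lebesgue C + e"
proof -
 obtain C where C: "closed C" "C \<subseteq> A" "A - C \<in> lmeasurable" "emeasure lebesgue (A - C) < ennreal (e / 2)"
  using sets_lebesgue_inner_closed[of A "e / 2"] assms by auto
 have CL: "C \<in> lmeasurable"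
  by (rule fmeasurableI2[OF assms(1) C(2)]) (use C(1) in auto)
 have "measure lebesgue (A - C) < e / 2"
  using C(3,4) assms(2) by (simp add: emeasure_eq_measure2 ennreal_less_iff)
 moreover have "measure lebesgue (A - C) = measure lebesgue A - measure lebesgue C"
  by (rule measurable_measure_Diff[OF assms(1) _ C(2)]) (use C in auto)
 ultimately have 1: "measure lebesgue A < measure lebesgue C + e / 2" by simp
 define F where "F n = C \<inter> cball 0 (real n)" for n
 have FC: "(\<Union>n. F n) = C"
 proof -
  have "\<exists>n. norm x <= real n" for x :: 'a using real_arch_simple by blast
  then show ?thesis by (auto simp: F_def)
 qed
 have F: "compact (F n)" for n unfolding F_def using C(1) by (simp add: closed_Int_compact)
 have "(%n. measure lebesgue (F n)) ----> measure lebesgue (\<Union>n. F n)"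
 proof (rule Lim_measure_incseq)
  show "range F \<subseteq> sets lebesgue" using F by (auto intro!: fmeasurableD lmeasurable_compact)
  show "incseq F" by (auto simp: incseq_def F_def)
  show "emeasure lebesgue (\<Union>n. F n) ~= \<infinity>" unfolding FC using fmeasurableD2[OF CL] by simp
 qed
 then have "\<forall>\<^sub>F n in sequentially. measure lebesgue C - e / 2 < measure lebesgue (F n)"
  unfolding FC using assms(2) by (intro order_tendstoD(1)) auto
 then obtain n where n: "measure lebesgue C - e / 2 < measure lebesgue (F n)" by (auto simp: eventually_sequentially)
 show thesis
  by (rule that[of "F n"]) (use F[of n] n 1 C in \<open>auto simp: F_def lmeasurable_compact\<close>)
qed

text \<open>For compact \<open>C\<close> inside and open \<open>U\<close> outside \<open>A\<close>,
  a displacement that is small compared with the gap between \<open>C\<close> and the complement of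
  \<open>U\<close> maps \<open>C\<close> into \<open>U\<close>. Only the thin sets
  \<open>A - C\<close> and \<open>U - A\<close> contribute.\<close>

lemma L1_continuity_indicator:
 assumes A: "A \<in> sets lborel" "emeasure lborel A < \<infinity>" and e: "e > 0"
 shows "\<exists>d>0. \<forall>\<tau>. near_id d \<tau> -->
  (LBINT z. \<bar>ind A (\<tau> z) - ind A (z::'a::euclidean_space)\<bar>) <= (e::real)"
proof -
 have AL: "A \<in> lmeasurable" using A
  by (intro fmeasurableI) (auto simp: emeasure_completion intro: sets_completionI_sets)
 obtain U where U: "open U" "A \<subseteq> U" "U \<in> lmeasurable" "measure lebesgue U < measure lebesgue A + e / 4"
  using lmeasurable_outer_open[OF AL, of "e / 4"] e by auto
 obtain C where C: "compact C" "C \<subseteq> A" "C \<in> lmeasurable" "measure lebesgue A < measure lebesgue C + e / 4"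
  using lmeasurable_inner_compact[OF AL, of "e / 4"] e by auto
 obtain d where d: "d > 0" "(\<Union>x\<in>C. cball x d) \<subseteq> U"
  using compact_subset_open_imp_cball_epsilon_subset[OF C(1) U(1)] U(2) C(2) by blast
 have b: "U \<in> sets borel" "C \<in> sets borel" "A \<in> sets borel" using U(1) C(1) A by (auto simp: compact_imp_closed)
 have fin: "integrable lborel (ind X :: 'a => real)" "(LBINT z. ind X z) = measure lebesgue X"
  if "X \<in> sets borel" "X \<in> lmeasurable" for X :: "'a set"
  using that by (auto simp: integrable_indicator_iff fmeasurable_def emeasure_completion measure_completion)
 note i = fin[OF b(1) U(3)] fin[OF b(2) C(3)] fin[OF b(3) AL]
 show ?thesis
 proof (intro exI[of _ d] conjI allI impI)
  fix \<tau> :: "'a => 'a" assume \<tau>: "near_id d \<tau>"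
  have it: "integrable lborel (%z. ind X (\<tau> z) :: real)"
   "(LBINT z. ind X (\<tau> z) :: real) = measure lebesgue X"
   if "X \<in> sets borel" "X \<in> lmeasurable" for X :: "'a set"
  proof -
   have m: "(ind X :: 'a => real) \<in> borel_fun" using that(1) by simp
   show "integrable lborel (%z. ind X (\<tau> z) :: real)"
    unfolding near_id_integral(2)[OF \<tau> m] by (rule fin(1)[OF that])
   show "(LBINT z. ind X (\<tau> z) :: real) = measure lebesgue X"
    unfolding near_id_integral(1)[OF \<tau> m] by (rule fin(2)[OF that])
  qed
  note it = it[OF b(1) U(3)] it[OF b(3) AL]
  \<comment> \<open>The difference itself has integral 0 because \<open>\<tau>\<close> preserves
    measure. Its absolute value exceeds it by twice its negative part, which lives where
    \<open>z\<close> is in \<open>A - C\<close> or \<open>\<tau> z\<close> is in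
    \<open>U - A\<close>.\<close>
  have "(LBINT z. \<bar>ind A (\<tau> z) - ind A z\<bar>) <=
   (LBINT z. (ind A (\<tau> z) - ind A z) + 2 * ((ind A z - ind C z) + (ind U (\<tau> z) - ind A (\<tau> z))) :: real)"
  proof (rule integral_mono)
   fix z :: 'a
   have "norm (\<tau> z - z) <= d" by (rule near_idD[OF \<tau>])
   then have "\<tau> z \<in> cball z d" by (metis dist_norm dist_commute mem_cball)
   then have "z \<in> C ==> \<tau> z \<in> U" by (intro subsetD[OF d(2)] UN_I[of z])
   then show "\<bar>ind A (\<tau> z) - ind A z\<bar> <=
    (ind A (\<tau> z) - ind A z) + 2 * ((ind A z - ind C z) + (ind U (\<tau> z) - ind A (\<tau> z)) :: real)"
    using U(2) C(2) by (auto simp: indicator_def)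
  qed (use i it in auto)
  also have "\<dots> = 2 * ((measure lebesgue A - measure lebesgue C) + (measure lebesgue U - measure lebesgue A))"
   using i it by simp
  also have "\<dots> <= e" using U(4) C(4) by simp
  finally show "(LBINT z. \<bar>ind A (\<tau> z) - ind A z\<bar>) <= e" .
 qed (rule d(1))
qed

text \<open>Density, in the form of induction over integrable functions. In the limit step the
  approximation error at the displaced point has the same integral as the error at \<open>z\<close>,
  again because \<open>\<tau>\<close> preserves measure.\<close>

lemma L1_continuity:
 fixes f :: "'a::euclidean_space => 'b::euclidean_space"
 assumes "integrable lborel f" "e > 0"
 shows "\<exists>d>0. \<forall>\<tau>. near_id d \<tau> --> (LBINT z. norm (f (\<tau> z) - f z)) <= e"
proof -
 have "\<forall>e>0. \<exists>d>0. \<forall>\<tau>. near_id d \<tau> --> (LBINT z. norm (f (\<tau> z) - f z)) <= e"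
  using assms(1)
 proof (induction rule: integrable_induct)
  case (base A c)
  show ?case
  proof (intro allI impI)
   fix e :: real assume e: "e > 0"
   then have "e / (norm c + 1) > 0" by (simp add: add_nonneg_pos)
   from L1_continuity_indicator[OF base this] obtain d where d: "d > 0"
    "!!\<tau>. near_id d \<tau> ==> (LBINT z. \<bar>ind A (\<tau> z) - ind A z\<bar>) <= e / (norm c + 1)" by blast
   show "\<exists>d>0. \<forall>\<tau>. near_id d \<tau> --> (LBINT z. norm (ind A (\<tau> z) *. c - ind A z *. c)) <= e"
   proof (intro exI[of _ d] conjI allI impI d(1))
    fix \<tau> :: "'a => 'a" assume "near_id d \<tau>"
    note d(2)[OF this]
    have "(LBINT z. norm (ind A (\<tau> z) *. c - ind A z *. c)) =
     (LBINT z. \<bar>ind A (\<tau> z) - ind A z\<bar> * norm c)"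
     by (simp flip: scaleR_diff_left)
    also have "\<dots> = (LBINT z. \<bar>ind A (\<tau> z) - ind A z\<bar>) * norm c" by simp
    also have "\<dots> <= e / (norm c + 1) * norm c"
     by (intro mult_right_mono d(2) \<open>near_id d \<tau>\<close>) simp
    also have "\<dots> <= e" using e add_pos_nonneg[OF zero_less_one norm_ge_zero[of c]] by (simp add: field_simps)
    finally show "(LBINT z. norm (ind A (\<tau> z) *. c - ind A z *. c)) <= e" .
   qed
  qed
 next
  case (add f g)
  show ?case
  proof (intro allI impI)
   fix e :: real assume "e > 0"
   then have e: "e / 2 > 0" by simp
   obtain d1 where d1: "d1 > 0" "!!\<tau>. near_id d1 \<tau> ==> (LBINT z. norm (f (\<tau> z) - f z)) <= e / 2"
    using add.IH(1) e by blast
   obtain d2 where d2: "d2 > 0" "!!\<tau>. near_id d2 \<tau> ==> (LBINT z. norm (g (\<tau> z) - g z)) <= e / 2"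
    using add.IH(2) e by blast
   show "\<exists>d>0. \<forall>\<tau>. near_id d \<tau> --> (LBINT z. norm (f (\<tau> z) + g (\<tau> z) - (f z + g z))) <= e"
   proof (intro exI[of _ "min d1 d2"] conjI allI impI)
    fix \<tau> :: "'a => 'a" assume \<tau>: "near_id (min d1 d2) \<tau>"
    have m: "f \<in> borel_fun" "g \<in> borel_fun" using add.hyps by auto
    have [simp]: "integrable lborel (%z. f (\<tau> z))" "integrable lborel (%z. g (\<tau> z))"
     using near_id_integral(2)[OF \<tau> m(1)] near_id_integral(2)[OF \<tau> m(2)] add.hyps by simp_all
    have "(LBINT z. norm (f (\<tau> z) + g (\<tau> z) - (f z + g z))) <=
     (LBINT z. norm (f (\<tau> z) - f z) + norm (g (\<tau> z) - g z))"
     using add.hyps by (intro integral_mono) (auto simp: add_diff_add intro: norm_triangle_ineq)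
    also have "\<dots> = (LBINT z. norm (f (\<tau> z) - f z)) + (LBINT z. norm (g (\<tau> z) - g z))"
     using add.hyps by (intro Bochner_Integration.integral_add) auto
    also have "\<dots> <= e / 2 + e / 2"
     by (intro add_mono d1(2) d2(2) near_id_mono[OF \<tau>]) auto
    finally show "(LBINT z. norm (f (\<tau> z) + g (\<tau> z) - (f z + g z))) <= e" by simp
   qed (use d1 d2 in auto)
  qed
 next
  case (lim f s)
  have [measurable]: "f \<in> borel_fun" "!!i. s i \<in> borel_fun"
   using lim.hyps by auto
  show ?case
  proof (intro allI impI)
   fix e :: real assume e: "e > 0"
   have "(%i. LBINT z. norm (s i z - f z)) ----> (LBINT (z::'a). 0)"
   proof (rule integral_dominated_convergence[where w="%z. 3 * norm (f z)"])
    show "AE z in lborel. (%i. norm (s i z - f z)) ----> 0"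
    proof (rule AE_I2)
     fix z :: 'a
     have "(%i. s i z) ----> f z" using lim.hyps by simp
     then have "(%i. norm (s i z - f z)) ----> norm (f z - f z)" by (intro tendsto_intros)
     then show "(%i. norm (s i z - f z)) ----> 0" by simp
    qed
    fix i
    show "AE z in lborel. norm (norm (s i z - f z)) <= 3 * norm (f z)"
    proof (rule AE_I2)
     fix z :: 'a
     have "norm (s i z) <= 2 * norm (f z)" using lim.hyps by simp
     then show "norm (norm (s i z - f z)) <= 3 * norm (f z)" using norm_triangle_ineq4[of "s i z" "f z"] by simp
    qed
   qed (use lim.hyps in auto)
   then have "\<forall>\<^sub>F i in sequentially. (LBINT z. norm (s i z - f z)) < e / 4"
    using e by (intro order_tendstoD(2)[where a="e/4"]) auto
   then obtain i where i: "(LBINT z. norm (s i z - f z)) < e / 4"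
    by (auto simp: eventually_sequentially)
   obtain d where d: "d > 0" "!!\<tau>. near_id d \<tau> ==> (LBINT z. norm (s i (\<tau> z) - s i z)) <= e / 2"
    using lim.IH[of i] e by (meson half_gt_zero)
   show "\<exists>d>0. \<forall>\<tau>. near_id d \<tau> --> (LBINT z. norm (f (\<tau> z) - f z)) <= e"
   proof (intro exI[of _ d] conjI allI impI d(1))
    fix \<tau> :: "'a => 'a" assume \<tau>: "near_id d \<tau>"
    have [simp]: "integrable lborel f" "integrable lborel (s i)" using lim.hyps by auto
    have [simp]: "integrable lborel (%z. f (\<tau> z))" "integrable lborel (%z. s i (\<tau> z))"
     using near_id_integral(2)[OF \<tau>, of f] near_id_integral(2)[OF \<tau>, of "s i"] by simp_all
    have eq: "(LBINT z. norm (s i (\<tau> z) - f (\<tau> z))) = (LBINT z. norm (s i z - f z))"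
     using near_id_integral(1)[OF \<tau>, of "%z. norm (s i z - f z)"] by simp
    have "(LBINT z. norm (f (\<tau> z) - f z)) <=
     (LBINT z. norm (s i (\<tau> z) - f (\<tau> z)) + norm (s i (\<tau> z) - s i z) + norm (s i z - f z))"
    proof (rule integral_mono)
     fix z
     have "f (\<tau> z) - f z = - (s i (\<tau> z) - f (\<tau> z)) + (s i (\<tau> z) - s i z) + (s i z - f z)" by simp
     then show "norm (f (\<tau> z) - f z) <= norm (s i (\<tau> z) - f (\<tau> z)) + norm (s i (\<tau> z) - s i z) + norm (s i z - f z)"
      by (metis norm_minus_cancel norm_triangle_ineq norm_triangle_mono order_refl)
    qed auto
    also have "\<dots> = (LBINT z. norm (s i z - f z)) + (LBINT z. norm (s i (\<tau> z) - s i z)) + (LBINT z. norm (s i z - f z))"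
     by (simp add: eq)
    also have "\<dots> <= e" using i d(2)[OF \<tau>] by simp
    finally show "(LBINT z. norm (f (\<tau> z) - f z)) <= e" .
   qed
  qed
 qed
 with assms(2) show ?thesis by blast
qed

lemma norm_sum3_squared:
 fixes a b c :: "'b::real_inner"
 shows "(norm (a + b + c))\<^sup>2 <= 3 * ((norm a)\<^sup>2 + (norm b)\<^sup>2 + (norm c)\<^sup>2)"
proof -
 have "norm (a + b + c) <= norm a + norm b + norm c" by (meson norm_triangle_ineq norm_triangle_mono order_refl)
 then have "(norm (a + b + c))\<^sup>2 <= (norm a + norm b + norm c)\<^sup>2" by (intro power_mono) auto
 also have "\<dots> <= 3 * ((norm a)\<^sup>2 + (norm b)\<^sup>2 + (norm c)\<^sup>2)"
  using sum_squares_ge_zero[of "norm a - norm b" "norm b - norm c"] zero_le_power2[of "norm a - norm c"]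
  by (simp add: power2_eq_square algebra_simps)
 finally show ?thesis .
qed

definition square_int :: "('a::euclidean_space => 'b::euclidean_space) => bool" where
 "square_int u \<longleftrightarrow> u \<in> borel_fun & integrable lborel (%z. (norm (u z))\<^sup>2)"

lemma square_int_diff:
 assumes "square_int u" "square_int v"
 shows "square_int (%z. u z - v z)"
 unfolding square_int_def
proof
 show [measurable]: "(%z. u z - v z) \<in> borel_fun" using assms by (auto simp: square_int_def)
 show "integrable lborel (%z. (norm (u z - v z))\<^sup>2)"
 proof (rule Bochner_Integration.integrable_bound)
  show "integrable lborel (%z. 3 * ((norm (u z))\<^sup>2 + (norm (v z))\<^sup>2))" using assms by (auto simp: square_int_def)
  show "AE z in lborel. norm ((norm (u z - v z))\<^sup>2) <= norm (3 * ((norm (u z))\<^sup>2 + (norm (v z))\<^sup>2))"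
   using norm_sum3_squared[of "u z" "- v z" 0 for z] by (auto intro!: AE_I2)
 qed auto
qed

lemma square_int_near_id:
 assumes "square_int u" "near_id d \<tau>" shows "square_int (%z. u (\<tau> z))"
 using assms near_id_integral(2)[OF assms(2), of "%z. (norm (u z))\<^sup>2"] near_id_measurable[OF assms(2)]
 by (auto simp: square_int_def)

text \<open>Reduction to L1: a truncated function is both integrable and bounded, and for bounded
  functions squared increments are controlled by increments.\<close>

lemma L2_continuity:
 fixes u :: "'a::euclidean_space => 'b::euclidean_space"
 assumes u: "square_int u" and e: "e > 0"
 obtains d where "d > 0" "!!\<tau>. near_id d \<tau> ==> (LBINT z. (norm (u (\<tau> z) - u z))\<^sup>2) <= e"
proof -
 have [measurable]: "u \<in> borel_fun" and ui: "integrable lborel (%z. (norm (u z))\<^sup>2)"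
  using u by (auto simp: square_int_def)
 \<comment> \<open>The lower cut makes \<open>U M\<close> integrable, since
   \<open>norm (u z)\<close> is at most \<open>Suc M\<close> times its square there; the upper cut
   bounds a squared increment by \<open>2 * Suc M\<close> times the increment.\<close>
 define U where "U M z = (if 1 / real (Suc M) <= norm (u z) & norm (u z) <= real (Suc M) then u z else 0)" for M z
 have [measurable]: "U M \<in> borel_fun" for M unfolding U_def by measurable
 have Ule: "norm (U M z) <= norm (u z)" "norm (U M z) <= real (Suc M)" "norm (u z - U M z) <= norm (u z)" for M z
  by (auto simp: U_def)
 have Ui: "square_int (U M)" for M
  unfolding square_int_def
  by (intro conjI, measurable, rule Bochner_Integration.integrable_bound[OF ui])
    (auto intro!: AE_I2 power_mono Ule)
 have U1: "integrable lborel (U M)" for M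
 proof (rule Bochner_Integration.integrable_bound)
  show "integrable lborel (%z. real (Suc M) * (norm (u z))\<^sup>2)" using ui by simp
  show "AE z in lborel. norm (U M z) <= norm (real (Suc M) * (norm (u z))\<^sup>2)"
  proof (rule AE_I2)
   fix z
   show "norm (U M z) <= norm (real (Suc M) * (norm (u z))\<^sup>2)"
   proof (cases "1 / real (Suc M) <= norm (u z) & norm (u z) <= real (Suc M)")
    case True
    then have "1 <= real (Suc M) * norm (u z)" by (simp add: field_simps)
    from mult_right_mono[OF this norm_ge_zero[of "u z"]] show ?thesis using True
     by (simp add: U_def power2_eq_square mult.assoc del: of_nat_Suc)
   qed (auto simp: U_def)
  qed
 qed auto
 have "(%M. LBINT z. (norm (u z - U M z))\<^sup>2) ----> (LBINT (z::'a). 0)"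
 proof (rule integral_dominated_convergence[where w="%z. (norm (u z))\<^sup>2"])
  show "AE z in lborel. (%M. (norm (u z - U M z))\<^sup>2) ----> 0"
  proof (rule AE_I2)
   fix z
   have "\<forall>\<^sub>F M in sequentially. (norm (u z - U M z))\<^sup>2 = 0"
   proof (cases "u z = 0")
    case False
    obtain n where n: "norm (u z) + 1 / norm (u z) < real n" using reals_Archimedean2 by blast
    show ?thesis
    proof (rule eventually_sequentiallyI[of n])
     fix M assume "n <= M"
     then have "norm (u z) + 1 / norm (u z) <= real (Suc M)" using n by simp
     moreover have "1 / norm (u z) > 0" "norm (u z) > 0" using False by auto
     ultimately have "norm (u z) <= real (Suc M)" "1 / norm (u z) <= real (Suc M)"
      by (linarith, linarith)
     then have "1 / real (Suc M) <= norm (u z)" using False by (simp add: field_simps)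
     with \<open>norm (u z) <= real (Suc M)\<close> show "(norm (u z - U M z))\<^sup>2 = 0" by (simp add: U_def)
    qed
   qed (simp add: U_def)
   then show "(%M. (norm (u z - U M z))\<^sup>2) ----> 0" by (rule tendsto_eventually)
  qed
  show "AE z in lborel. norm ((norm (u z - U i z))\<^sup>2) <= (norm (u z))\<^sup>2" for i
   by (auto intro!: AE_I2 power_mono Ule)
 qed (use ui in auto)
 then have "\<forall>\<^sub>F M in sequentially. (LBINT z. (norm (u z - U M z))\<^sup>2) < e / 9"
  using e by (intro order_tendstoD(2)[where a="e/9"]) auto
 then obtain M where M: "(LBINT z. (norm (u z - U M z))\<^sup>2) < e / 9"
  by (auto simp: eventually_sequentially)
 \<comment> \<open>Chosen so that the middle one of the three contributions becomes
   \<open>e / 9\<close> after multiplication by \<open>2 * Suc M\<close>; the overall factor 3 comes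
   from \<open>norm_sum3_squared\<close>.\<close>
 have "e / (18 * real (Suc M)) > 0" using e by simp
 from L1_continuity[OF U1[of M] this] obtain d where d: "d > 0"
  "!!\<tau>. near_id d \<tau> ==> (LBINT z. norm (U M (\<tau> z) - U M z)) <= e / (18 * real (Suc M))" by blast
 show thesis
 proof (rule that[OF d(1)])
  fix \<tau> :: "'a => 'a" assume \<tau>: "near_id d \<tau>"
  have i1: "integrable lborel (%z. (norm (u z - U M z))\<^sup>2)"
   using square_int_diff[OF u Ui] by (simp add: square_int_def)
  have i2: "integrable lborel (%z. (norm (u (\<tau> z) - U M (\<tau> z)))\<^sup>2)"
   using near_id_integral(2)[OF \<tau>, of "%z. (norm (u z - U M z))\<^sup>2"] i1 by simp
  have i3: "integrable lborel (%z. norm (U M (\<tau> z) - U M z))"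
   using near_id_integral(2)[OF \<tau>, of "U M"] U1 by (intro integrable_norm Bochner_Integration.integrable_diff) auto
  have eq: "(LBINT z. (norm (u (\<tau> z) - U M (\<tau> z)))\<^sup>2) = (LBINT z. (norm (u z - U M z))\<^sup>2)"
   using near_id_integral(1)[OF \<tau>, of "%z. (norm (u z - U M z))\<^sup>2"] by simp
  have "(LBINT z. (norm (u (\<tau> z) - u z))\<^sup>2) <=
   (LBINT z. 3 * ((norm (u (\<tau> z) - U M (\<tau> z)))\<^sup>2 + 2 * real (Suc M) * norm (U M (\<tau> z) - U M z) + (norm (u z - U M z))\<^sup>2))"
  proof (rule integral_mono)
   show "integrable lborel (%z. (norm (u (\<tau> z) - u z))\<^sup>2)"
    using square_int_diff[OF square_int_near_id[OF u \<tau>] u] by (simp add: square_int_def)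
   fix z
   have "norm (U M (\<tau> z) - U M z) <= 2 * real (Suc M)"
    unfolding mult_2 by (rule order_trans[OF norm_triangle_ineq4 add_mono[OF Ule(2) Ule(2)]])
   then have "(norm (U M (\<tau> z) - U M z))\<^sup>2 <= 2 * real (Suc M) * norm (U M (\<tau> z) - U M z)"
    unfolding power2_eq_square by (intro mult_right_mono) auto
   moreover have "u (\<tau> z) - u z = (u (\<tau> z) - U M (\<tau> z)) + (U M (\<tau> z) - U M z) + (U M z - u z)" by simp
   ultimately show "(norm (u (\<tau> z) - u z))\<^sup>2 <= 3 * ((norm (u (\<tau> z) - U M (\<tau> z)))\<^sup>2 + 2 * real (Suc M) * norm (U M (\<tau> z) - U M z) + (norm (u z - U M z))\<^sup>2)"
    using norm_sum3_squared[of "u (\<tau> z) - U M (\<tau> z)" "U M (\<tau> z) - U M z" "U M z - u z"]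
    by (simp add: norm_minus_commute[of "U M z" "u z"])
  qed (use i1 i2 i3 in auto)
  also have "\<dots> = 3 * ((LBINT z. (norm (u z - U M z))\<^sup>2) + 2 * real (Suc M) * (LBINT z. norm (U M (\<tau> z) - U M z)) + (LBINT z. (norm (u z - U M z))\<^sup>2))"
   using i1 i2 i3 by (simp add: eq)
  also have "\<dots> <= 3 * (e / 9 + 2 * real (Suc M) * (e / (18 * real (Suc M))) + e / 9)"
   using M d(2)[OF \<tau>] by (intro mult_left_mono add_mono) auto
  also have "\<dots> = e" by (simp add: field_simps)
  finally show "(LBINT z. (norm (u (\<tau> z) - u z))\<^sup>2) <= e" .
 qed
qed

text \<open>Jensen's inequality for the square, read off from the nonnegative variance of
  \<open>h\<close> under the probability weight \<open>K\<close>.\<close>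

lemma square_le_weighted:
 fixes K h :: "'a::euclidean_space => real"
 assumes K: "integrable lborel K" "!!y. K y >= 0" "(LBINT y. K y) = 1"
  and h: "integrable lborel (%y. K y * (h y)\<^sup>2)" and h': "integrable lborel (%y. K y * h y)"
 shows "(LBINT y. K y * h y)\<^sup>2 <= (LBINT y. K y * (h y)\<^sup>2)"
proof -
 define a where "a = (LBINT y. K y * h y)"
 have "0 <= (LBINT y. K y * (h y - a)\<^sup>2)"
  using K(2) by (intro Bochner_Integration.integral_nonneg) auto
 also have "(%y. K y * (h y - a)\<^sup>2) = (%y. K y * (h y)\<^sup>2 - 2 * a * (K y * h y) + a\<^sup>2 * K y)"
  by (auto simp: power2_eq_square algebra_simps)
 also have "(LBINT y. K y * (h y)\<^sup>2 - 2 * a * (K y * h y) + a\<^sup>2 * K y) =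
  (LBINT y. K y * (h y)\<^sup>2) - 2 * a * a + a\<^sup>2"
  using K h h' by (simp add: a_def)
 finally show ?thesis by (simp add: a_def power2_eq_square)
qed

text \<open>By Jensen and Tonelli an average of displaced copies of \<open>u\<close> is, in L2, no
  farther from \<open>u\<close> than the bound valid for each copy. The averaging variable lives in
  a space of its own, since cones average over space while \<open>u\<close> depends on
  space-time.\<close>

lemma L2_mollification:
 fixes u :: "'a::euclidean_space => 'b::euclidean_space" and K :: "'c::euclidean_space => real"
 assumes K: "integrable lborel K" "!!y. K y >= 0" "(LBINT y. K y) = 1" "K \<in> borel_fun"
  and u: "square_int u" and e: "e >= 0"
  and \<tau>: "(%(y, z). \<tau> y z) \<in> borel_measurable (borel \<Otimes>\<^sub>M borel)"
  and near: "!!y. K y ~= 0 ==> near_id d (\<tau> y)"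
  and d: "!!\<sigma>. near_id d \<sigma> ==> (LBINT z. (norm (u (\<sigma> z) - u z))\<^sup>2) <= e"
 shows "square_int (%z. (LBINT y. K y *. u (\<tau> y z)) - u z)"
  and "(LBINT z. (norm ((LBINT y. K y *. u (\<tau> y z)) - u z))\<^sup>2) <= e"
proof -
 note [measurable] = K(4) \<tau>
 have [measurable]: "u \<in> borel_fun" using u by (simp add: square_int_def)
 define U where "U z = (LBINT y. K y *. u (\<tau> y z))" for z
 have m1 [measurable]: "(%(z, y). u (\<tau> y z)) \<in> borel_measurable (borel \<Otimes>\<^sub>M borel)"
  by measurable
 have "(%(z, y). K y *. u (\<tau> y z)) \<in> borel_measurable (borel \<Otimes>\<^sub>M lborel)" by measurable
 then have U [measurable]: "U \<in> borel_fun"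
  unfolding U_def by (intro sigma_finite_measure.borel_measurable_lebesgue_integral[OF sigma_finite_lborel])
 define h where "h z y = norm (u (\<tau> y z) - u z)" for z y
 have mh [measurable]: "(%(z, y). h z y) \<in> borel_measurable (borel \<Otimes>\<^sub>M borel)" unfolding h_def by measurable
 \<comment> \<open>Stated with extended nonnegative integrals: integrability of the slice in
   \<open>y\<close> is available exactly when the right-hand side is finite, and otherwise the claim
   is trivial.\<close>
 have pt: "ennreal ((norm (U z - u z))\<^sup>2) <= (\<integral>\<^sup>+y. ennreal (K y * (h z y)\<^sup>2) \<partial>lborel)" for z
 proof (cases "(\<integral>\<^sup>+y. ennreal (K y * (h z y)\<^sup>2) \<partial>lborel) = \<infinity>")
  case False
  have [measurable]: "h z \<in> borel_fun" unfolding h_def by measurable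
  have [measurable]: "(%y. u (\<tau> y z)) \<in> borel_fun" by measurable
  have i2: "integrable lborel (%y. K y * (h z y)\<^sup>2)"
   by (rule integrableI_nonneg) (use K(2) False in \<open>auto simp: less_top\<close>)
  have i1: "integrable lborel (%y. K y * h z y)"
  proof (rule Bochner_Integration.integrable_bound)
   show "integrable lborel (%y. K y + K y * (h z y)\<^sup>2)" using K i2 by auto
   show "AE y in lborel. norm (K y * h z y) <= norm (K y + K y * (h z y)\<^sup>2)"
   proof (rule AE_I2)
    fix y
    have h: "h z y >= 0" by (simp add: h_def)
    have "h z y <= 1 + (h z y)\<^sup>2" using sum_squares_ge_zero[of "h z y - 1" "h z y"] h
     by (simp add: power2_eq_square algebra_simps)
    from mult_left_mono[OF this K(2)[of y]]
    show "norm (K y * h z y) <= norm (K y + K y * (h z y)\<^sup>2)" using h K(2)[of y] by (simp add: algebra_simps)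
   qed
  qed measurable
  have i3: "integrable lborel (%y. K y *. (u (\<tau> y z) - u z))"
   by (rule Bochner_Integration.integrable_bound[OF i1]) (use K(2) in \<open>auto simp: h_def\<close>)
  have iz: "integrable lborel (%y. K y *. u z)" using K by auto
  have "U z - u z = (LBINT y. K y *. (u (\<tau> y z) - u z) + K y *. u z) - (LBINT y. K y *. u z)"
   unfolding U_def using K by (simp add: scaleR_diff_right)
  also have "\<dots> = (LBINT y. K y *. (u (\<tau> y z) - u z))"
   by (subst Bochner_Integration.integral_add[OF i3 iz]) simp
  finally have "norm (U z - u z) <= (LBINT y. K y * h z y)"
   using norm_lebesgue_integral_le[OF i3 i1] K(2) by (simp add: h_def)
  then have "(norm (U z - u z))\<^sup>2 <= (LBINT y. K y * h z y)\<^sup>2" by (intro power_mono) auto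
  also have "\<dots> <= (LBINT y. K y * (h z y)\<^sup>2)" by (rule square_le_weighted[OF K(1,2,3) i2 i1])
  finally have "ennreal ((norm (U z - u z))\<^sup>2) <= ennreal (LBINT y. K y * (h z y)\<^sup>2)" by (rule ennreal_leI)
  also have "\<dots> = (\<integral>\<^sup>+y. ennreal (K y * (h z y)\<^sup>2) \<partial>lborel)"
   by (rule nn_integral_eq_integral[symmetric, OF i2]) (use K(2) in auto)
  finally show ?thesis .
 qed simp
 have "(\<integral>\<^sup>+z. ennreal ((norm (U z - u z))\<^sup>2) \<partial>lborel) <= (\<integral>\<^sup>+z. \<integral>\<^sup>+y. ennreal (K y * (h z y)\<^sup>2) \<partial>lborel \<partial>lborel)"
  by (rule nn_integral_mono) (rule pt)
 also have "\<dots> = (\<integral>\<^sup>+y. \<integral>\<^sup>+z. ennreal (K y * (h z y)\<^sup>2) \<partial>lborel \<partial>lborel)"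
  by (rule lborel_pair.Fubini') measurable
 also have "\<dots> <= (\<integral>\<^sup>+y. ennreal (K y) * ennreal e \<partial>lborel)"
 proof (rule nn_integral_mono)
  fix y :: 'c
  show "(\<integral>\<^sup>+z. ennreal (K y * (h z y)\<^sup>2) \<partial>lborel) <= ennreal (K y) * ennreal e"
  proof (cases "K y = 0")
   case False
   note n = near[OF False]
   have i: "integrable lborel (%z. (h z y)\<^sup>2)"
    using square_int_diff[OF square_int_near_id[OF u n] u] by (simp add: square_int_def h_def)
   have "(\<integral>\<^sup>+z. ennreal (K y * (h z y)\<^sup>2) \<partial>lborel) = ennreal (K y) * (\<integral>\<^sup>+z. ennreal ((h z y)\<^sup>2) \<partial>lborel)"
    using i by (subst nn_integral_cmult[symmetric]) (auto simp: ennreal_mult K(2))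
   also have "(\<integral>\<^sup>+z. ennreal ((h z y)\<^sup>2) \<partial>lborel) = ennreal (LBINT z. (h z y)\<^sup>2)"
    by (rule nn_integral_eq_integral[OF i]) auto
   also have "\<dots> <= ennreal e" using d[OF n] by (intro ennreal_leI) (simp add: h_def)
   finally show ?thesis by (simp add: mult_left_mono)
  qed simp
 qed
 also have "\<dots> = (\<integral>\<^sup>+y. ennreal (K y) \<partial>lborel) * ennreal e" by (rule nn_integral_multc) measurable
 also have "(\<integral>\<^sup>+y. ennreal (K y) \<partial>lborel) = 1" using nn_integral_eq_integral[OF K(1)] K(2,3) by auto
 finally have fin: "(\<integral>\<^sup>+z. ennreal ((norm (U z - u z))\<^sup>2) \<partial>lborel) <= ennreal e" by simp
 have i: "integrable lborel (%z. (norm (U z - u z))\<^sup>2)"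
  by (rule integrableI_nonneg) (use fin in \<open>auto intro: le_less_trans\<close>)
 then show "square_int (%z. (LBINT y. K y *. u (\<tau> y z)) - u z)"
  unfolding U_def[symmetric] square_int_def by auto
 have "ennreal (LBINT z. (norm (U z - u z))\<^sup>2) <= ennreal e"
  using fin nn_integral_eq_integral[OF i] by simp
 then show "(LBINT z. (norm ((LBINT y. K y *. u (\<tau> y z)) - u z))\<^sup>2) <= e"
  unfolding U_def[symmetric] using e by (simp add: ennreal_le_iff)
qed

subsection \<open>Smooth bounded functions and integration by parts\<close>

lemma QT_iff: "(x, t) \<in> QT T \<longleftrightarrow> 0 < t & t < T" "z \<in> QT T \<longleftrightarrow> 0 < snd z & snd z < T"
 by (auto simp: QT_def) (cases z; simp)

lemma open_QT: "open (QT T)"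
 unfolding QT_def by (intro open_Times) auto

lemma QT_borel [measurable]: "QT T \<in> sets borel"
 using open_QT by (rule borel_open)

lemma convex_QT: "convex (QT T)"
 unfolding QT_def by (intro convex_Times) auto

lemma smooth_boundedD:
 fixes g :: "(real^'n) \<times> real => 'b::euclidean_space"
 assumes g: "smooth_bounded T g"
 obtains B where "B > 0" "!!z. z \<in> QT T ==> norm (g z) <= B"
  "!!z v. z \<in> QT T ==> norm (frechet_derivative g (at z) v) <= B * norm v"
  "!!z. z \<in> QT T ==> (g has_derivative frechet_derivative g (at z)) (at z)"
  "continuous_on (QT T) g"
  "!!v. continuous_on (QT T) (%z. frechet_derivative g (at z) v)"
proof -
 have b: "bounded (iter_deriv es g ` QT T)" if "set es \<subseteq> Basis" for es
  using g that unfolding smooth_bounded_def by blast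
 have d: "iter_deriv es g differentiable (at z)" if "set es \<subseteq> Basis" "z \<in> QT T" for es z
  using g that unfolding smooth_bounded_def smooth_on_def by blast
 obtain B0 where B0: "!!z. z \<in> QT T ==> norm (g z) <= B0"
  using b[of "[]"] unfolding bounded_iff by auto
 have "\<forall>e\<in>Basis. \<exists>C. \<forall>z\<in>QT T. norm (frechet_derivative g (at z) e) <= C"
 proof
  fix e :: "(real^'n) \<times> real" assume "e \<in> Basis"
  then show "\<exists>C. \<forall>z\<in>QT T. norm (frechet_derivative g (at z) e) <= C"
   using b[of "[e]"] unfolding bounded_iff by auto
 qed
 then obtain C where C: "!!e z. e \<in> Basis ==> z \<in> QT T ==> norm (frechet_derivative g (at z) e) <= C e"
  by metis
 have der: "(g has_derivative frechet_derivative g (at z)) (at z)" if "z \<in> QT T" for z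
  using d[of "[]" z] that frechet_derivative_works by auto
 have lin: "frechet_derivative g (at z) v = (\<Sum>e\<in>Basis. (v \<bullet> e) *. frechet_derivative g (at z) e)" if "z \<in> QT T" for z v
 proof -
  have l: "linear (frechet_derivative g (at z))" using der[OF that] by (rule has_derivative_linear)
  have "frechet_derivative g (at z) v = frechet_derivative g (at z) (\<Sum>e\<in>Basis. (v \<bullet> e) *. e)"
   by (simp add: euclidean_representation)
  then show ?thesis using l by (simp add: linear_sum linear_scale)
 qed
 define S where "S = (\<Sum>e\<in>(Basis :: ((real^'n) \<times> real) set). \<bar>C e\<bar>)"
 have bd: "norm (frechet_derivative g (at z) v) <= S * norm v" if z: "z \<in> QT T" for z v
 proof -
  have "norm (frechet_derivative g (at z) v) <= (\<Sum>e\<in>Basis. norm ((v \<bullet> e) *. frechet_derivative g (at z) e))"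
   unfolding lin[OF z, of v] by (rule norm_sum)
  also have "\<dots> <= (\<Sum>e\<in>Basis. \<bar>C e\<bar> * norm v)"
  proof (rule sum_mono)
   fix e :: "(real^'n) \<times> real" assume e: "e \<in> Basis"
   have "\<bar>v \<bullet> e\<bar> * norm (frechet_derivative g (at z) e) <= norm v * \<bar>C e\<bar>"
    using C[OF e z] e by (intro mult_mono Basis_le_norm) auto
   then show "norm ((v \<bullet> e) *. frechet_derivative g (at z) e) <= \<bar>C e\<bar> * norm v" by (simp add: mult.commute)
  qed
  also have "\<dots> = S * norm v" by (simp add: S_def sum_distrib_right)
  finally show ?thesis .
 qed
 have cont: "continuous_on (QT T) (%z. frechet_derivative g (at z) v)" for v
 proof -
  have "continuous_on (QT T) (%z. frechet_derivative g (at z) e)" if "e \<in> Basis" for e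
  proof -
   have "iter_deriv [e] g differentiable (at z)" if "z \<in> QT T" for z
    using d[of "[e]" z] that \<open>e \<in> Basis\<close> by auto
   then show ?thesis
    by (auto intro!: continuous_at_imp_continuous_on differentiable_imp_continuous_within)
  qed
  then have "continuous_on (QT T) (%z. \<Sum>e\<in>Basis. (v \<bullet> e) *. frechet_derivative g (at z) e)"
   by (intro continuous_intros)
  then show ?thesis by (rule continuous_on_eq) (simp add: lin)
 qed
 have gc: "continuous_on (QT T) g"
  by (intro continuous_at_imp_continuous_on ballI has_derivative_continuous[OF der])
 have Snn: "S >= 0" unfolding S_def by (intro sum_nonneg) auto
 show thesis
 proof (rule that[of "max 1 B0 + S"])
  show "max 1 B0 + S > 0" using Snn by linarith
  show "norm (g z) <= max 1 B0 + S" if "z \<in> QT T" for z using B0[OF that] Snn by linarith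
  show "norm (frechet_derivative g (at z) v) <= (max 1 B0 + S) * norm v" if "z \<in> QT T" for z v
   by (rule order_trans[OF bd[OF that] mult_right_mono]) auto
 qed (use der gc cont in auto)
qed

lemma borel_indicator_continuous:
 fixes g :: "'a::euclidean_space => 'b::euclidean_space"
 assumes "continuous_on S g" "S \<in> sets borel"
 shows "(%z. ind S z *. g z) \<in> borel_fun"
 by (rule borel_measurable_continuous_on_indicator[OF assms(2,1)])

text \<open>The slab is invariant under spatial translations, so each horizontal difference quotient
  of \<open>F\<close>, extended by 0, has integral 0. The Lipschitz bound dominates the quotients,
  and the derivative is their limit.\<close>

lemma integral_directional_derivative_QT:
 fixes F :: "(real^'n) \<times> real => real"
 assumes F: "continuous_on (QT T) F"
  and F': "!!z. z \<in> QT T ==> (F has_derivative F' z) (at z)"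
  and B0: "B >= 0" and B: "!!z. z \<in> QT T ==> \<bar>F z\<bar> <= B" "!!z v. z \<in> QT T ==> \<bar>F' z v\<bar> <= B * norm v"
  and R: "!!z. z \<in> QT T ==> norm z > R ==> F z = 0"
 shows "(LBINT z. ind (QT T) z * F' z (v, 0)) = 0"
  and "(%z. ind (QT T) z * F' z (v, 0)) \<in> borel_fun"
  and "integrable lborel (%z. ind (QT T) z * F' z (v, 0))"
proof -
 define f where "f z = ind (QT T) z * F z" for z
 have fm [measurable]: "f \<in> borel_fun"
  unfolding f_def using borel_indicator_continuous[OF F] by auto
 define q where "q j z = real (Suc j) * (f (z + (1 / real (Suc j)) *. (v, 0)) - f z)" for j z
 have qm [measurable]: "q j \<in> borel_fun" for j unfolding q_def by measurable
 have Q: "z + h *. (v, 0) \<in> QT T \<longleftrightarrow> z \<in> QT T" for z :: "(real^'n) \<times> real" and h by (simp add: QT_iff)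
 have lim: "(%j. q j z) ----> ind (QT T) z * F' z (v, 0)" for z
 proof (cases "z \<in> QT T")
  case True
  have "((%h. F (z + h *. (v, 0))) has_derivative (%h. F' z (h *. (v, 0)))) (at 0)"
   by (rule has_derivative_compose[of "%h. z + h *. (v, 0)"]) (auto intro!: derivative_eq_intros F'[OF True, simplified] simp: True F' zero_prod_def[symmetric])
  moreover have "F' z (h *. (v, 0)) = h * F' z (v, 0)" for h
   using linear_scale[OF has_derivative_linear[OF F'[OF True]]] by (metis real_scaleR_def)
  ultimately have "((%h. F (z + h *. (v, 0))) has_real_derivative F' z (v, 0)) (at 0)"
   by (simp add: has_field_derivative_def mult.commute[of _ "F' z (v, 0)"])
  then have "((%h. (F (z + h *. (v, 0)) - F z) / h) \<longlongrightarrow> F' z (v, 0)) (at 0)"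
   by (simp add: has_field_derivative_iff zero_prod_def[symmetric])
  then have "(%j. (F (z + (1 / real (Suc j)) *. (v, 0)) - F z) / (1 / real (Suc j))) ----> F' z (v, 0)"
   by (rule filterlim_compose) (auto simp: filterlim_at simp del: of_nat_Suc intro: LIMSEQ_Suc[OF lim_1_over_n])
  then show ?thesis using True Q[of z] by (simp add: q_def f_def mult.commute)
 next
  case False then show ?thesis using Q[of z] by (simp add: q_def f_def)
 qed
 show m: "(%z. ind (QT T) z * F' z (v, 0)) \<in> borel_fun"
  by (rule borel_measurable_LIMSEQ_real[OF lim qm])
 have fi: "integrable lborel f"
 proof (rule integrable_bounded_support[where B=B and R=R])
  show "norm (f z) <= B" for z using B(1)[of z] B0 by (simp add: f_def indicator_def)
  show "f z = 0" if "norm z > R" for z using R[OF _ that] by (simp add: f_def indicator_def)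
 qed measurable
 have wi: "integrable lborel (%z::(real^'n) \<times> real. ind (cball 0 (R + norm v)) z * (B * norm v) :: real)"
  using lborel_bounded_finite[OF bounded_cball] by (intro integrable_mult_left) (auto simp: integrable_indicator_iff)
 \<comment> \<open>The ball grows by \<open>norm v\<close> because the quotient looks at
   \<open>F\<close> up to that distance, the step length being at most 1.\<close>
 have dom: "norm (q j z) <= ind (cball 0 (R + norm v)) z * (B * norm v)" for j z
  proof -
   let ?h = "1 / real (Suc j)"
   let ?w = "?h *. (v, 0::real)"
   have nw: "norm ?w = ?h * norm v" by (simp add: norm_Pair del: of_nat_Suc)
   have nw': "norm ?w <= norm v" unfolding nw by (simp add: field_simps)
   show "norm (q j z) <= ind (cball 0 (R + norm v)) z * (B * norm v)"
   proof (cases "z \<in> QT T")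
    case True
    show ?thesis
    proof (cases "norm z <= R + norm v")
     case False
     have "norm z <= norm (z + ?w) + norm ?w" using norm_triangle_ineq4[of "z + ?w" ?w] by simp
     then have "norm (z + ?w) > R" "norm z > R" using False nw' norm_ge_zero[of v] by linarith+
     then have "F (z + ?w) = 0" "F z = 0" using R True Q[of z ?h] by blast+
     then show ?thesis using False by (simp add: q_def f_def)
    next
     case in_ball: True
     have "norm (F (z + ?w) - F z) <= B * norm (z + ?w - z)"
     proof (rule differentiable_bound[where S="QT T" and f'=F'])
      show "(F has_derivative F' x) (at x within QT T)" if "x \<in> QT T" for x
       using F'[OF that] by (rule has_derivative_at_withinI)
      show "onorm (F' x) <= B" if "x \<in> QT T" for x
      proof (rule onorm_bound)
       show "B >= 0" by (rule B0)
       show "norm (F' x y) <= B * norm y" for y using B(2)[OF that] by simp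
      qed
     qed (use True Q[of z ?h] convex_QT in auto)
     then have "\<bar>F (z + ?w) - F z\<bar> <= B * (?h * norm v)" using nw by simp
     then have "real (Suc j) * \<bar>F (z + ?w) - F z\<bar> <= real (Suc j) * (B * (?h * norm v))" by (intro mult_left_mono) auto
     also have "\<dots> = B * norm v" by (simp del: of_nat_Suc)
     finally show ?thesis using True Q[of z ?h] in_ball by (simp add: q_def f_def abs_mult del: of_nat_Suc scaleR_Pair)
    qed
   next
    case False
    then have "q j z = 0" using Q[of z ?h] by (simp add: q_def f_def)
    then show ?thesis using B0 by simp
   qed
  qed
 have mm: "(%z. ind (QT T) z * F' z (v, 0)) \<in> borel_measurable lborel" "!!j. q j \<in> borel_measurable lborel"
  using m by auto
 show "integrable lborel (%z. ind (QT T) z * F' z (v, 0))"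
  by (rule integrable_dominated_convergence[OF mm wi AE_I2[OF lim] AE_I2[OF dom]])
 have "(%j. LBINT z. q j z) ----> (LBINT z. ind (QT T) z * F' z (v, 0))"
  by (rule integral_dominated_convergence[OF mm wi AE_I2[OF lim] AE_I2[OF dom]])
 moreover have "(LBINT z. q j z) = 0" for j
 proof -
  let ?w = "(1 / real (Suc j)) *. (v, 0::real)"
  have "(LBINT z. f (z + ?w)) = (LINT z|distr lborel borel (%z. z + ?w). f z)"
   by (subst integral_distr) auto
  then have e: "(LBINT z. f (z + ?w)) = (LBINT z. f z)" by (simp add: lborel_distr_translate)
  have i: "integrable lborel (%z. f (z + ?w))"
   using fi integrable_distr_eq[of "%z. z + ?w" lborel borel f] by (simp add: lborel_distr_translate)
  show ?thesis unfolding q_def using fi i e by simp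
 qed
 ultimately have "(%j. 0) ----> (LBINT z. ind (QT T) z * F' z (v, 0))" by simp
 then show "(LBINT z. ind (QT T) z * F' z (v, 0)) = 0"
  by (simp add: LIMSEQ_const_iff)
qed

lemma integral_div_x_QT:
 fixes F :: "(real^'n) \<times> real => real^'n"
 assumes F: "continuous_on (QT T) F"
  and F': "!!z. z \<in> QT T ==> (F has_derivative F' z) (at z)"
  and B0: "B >= 0" and B: "!!z. z \<in> QT T ==> norm (F z) <= B"
   "!!z v. z \<in> QT T ==> norm (F' z v) <= B * norm v"
  and R: "!!z. z \<in> QT T ==> norm z > R ==> F z = 0"
 shows "(LBINT z. ind (QT T) z * div_x F z) = 0"
  and "(%z. ind (QT T) z * div_x F z) \<in> borel_fun"
  and "integrable lborel (%z. ind (QT T) z * div_x F z)"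
proof -
 have *: "ind (QT T) z * div_x F z = (\<Sum>i\<in>UNIV. ind (QT T) z * F' z (axis i 1, 0) $ i)" for z
  using frechet_derivative_at[OF F'[of z]] by (auto simp: div_x_def indicator_def)
 have c: "(LBINT z. ind (QT T) z * F' z (axis i 1, 0) $ i) = 0"
  "(%z. ind (QT T) z * F' z (axis i 1, 0) $ i) \<in> borel_fun"
  "integrable lborel (%z. ind (QT T) z * F' z (axis i 1, 0) $ i)" for i
 proof -
  have 1: "continuous_on (QT T) (%z. F z $ i)" using F by (intro continuous_intros)
  have 2: "((%z. F z $ i) has_derivative (%v. F' z v $ i)) (at z)" if "z \<in> QT T" for z
   using bounded_linear.has_derivative[OF bounded_linear_vec_nth F'[OF that]] .
  have 3: "\<bar>F z $ i\<bar> <= B" if "z \<in> QT T" for z using order_trans[OF component_le_norm_cart B(1)[OF that]] .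
  have 4: "\<bar>F' z v $ i\<bar> <= B * norm v" if "z \<in> QT T" for z v using order_trans[OF component_le_norm_cart B(2)[OF that]] .
  have 5: "F z $ i = 0" if "z \<in> QT T" "norm z > R" for z using R[OF that] by simp
  show "(LBINT z. ind (QT T) z * F' z (axis i 1, 0) $ i) = 0"
   by (rule integral_directional_derivative_QT(1)[where F="%z. F z $ i" and F'="%z v. F' z v $ i" and B=B and R=R]) (use 1 2 B0 3 4 5 in auto)
  show "(%z. ind (QT T) z * F' z (axis i 1, 0) $ i) \<in> borel_fun"
   by (rule integral_directional_derivative_QT(2)[where F="%z. F z $ i" and F'="%z v. F' z v $ i" and B=B and R=R]) (use 1 2 B0 3 4 5 in auto)
  show "integrable lborel (%z. ind (QT T) z * F' z (axis i 1, 0) $ i)"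
   by (rule integral_directional_derivative_QT(3)[where F="%z. F z $ i" and F'="%z v. F' z v $ i" and B=B and R=R]) (use 1 2 B0 3 4 5 in auto)
 qed
 show "(LBINT z. ind (QT T) z * div_x F z) = 0"
  unfolding * by (subst Bochner_Integration.integral_sum) (use c in \<open>auto simp del: mult_eq_0_iff\<close>)
 show "(%z. ind (QT T) z * div_x F z) \<in> borel_fun"
  unfolding * using c by (intro borel_measurable_sum)
 show "integrable lborel (%z. ind (QT T) z * div_x F z)"
  unfolding * using c by (intro Bochner_Integration.integrable_sum)
qed

text \<open>The fundamental theorem on each vertical segment, in the interior form: \<open>F\<close>
  is differentiable in the open slab and continuous up to its two faces. The face
  \<open>t = T\<close> contributes 0 and the face \<open>t = 0\<close> the right-hand side.\<close>

lemma integral_time_derivative_QT: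
 fixes F :: "(real^'n) \<times> real => real"
 assumes T: "T > 0" and F: "continuous_on (UNIV \<times> {0..T}) F"
  and F': "!!z. z \<in> QT T ==> (F has_derivative F' z) (at z)"
  and m: "(%z. ind (QT T) z * F' z (0, 1)) \<in> borel_fun"
  and B: "!!z. z \<in> QT T ==> \<bar>F' z (0, 1)\<bar> <= B"
  and R: "!!z. z \<in> QT T ==> norm z > R ==> F z = 0"
  and FT: "!!x. F (x, T) = 0"
 shows "(LBINT z. ind (QT T) z * F' z (0, 1)) = - (LBINT x. F (x, 0))"
  and "integrable lborel (%z. ind (QT T) z * F' z (0, 1))"
proof -
 define g where "g z = ind (QT T) z * F' z (0, 1)" for z
 have gm [measurable]: "g \<in> borel_fun" unfolding g_def by (rule m)
 have supp: "F' z (0, 1) = 0" if z: "z \<in> QT T" "norm z > R" for z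
 proof -
  have o: "open (QT T \<inter> {z::(real^'n) \<times> real. norm z > R})"
   by (intro open_Int open_QT open_Collect_less continuous_intros)
  have "(F has_derivative (%v. 0)) (at z)"
   by (rule has_derivative_transform_within_open[OF has_derivative_const[of 0 "at z"] o]) (use z R in auto)
  from has_derivative_unique[OF this F'[OF z(1)]] show ?thesis by metis
 qed
 have gb: "norm (g z) <= \<bar>B\<bar>" "norm z > \<bar>R\<bar> ==> g z = 0" for z
  using B[of z] supp[of z] by (auto simp: g_def indicator_def)
 have gi: "integrable lborel g" by (rule integrable_bounded_support[OF gm gb])
 then show "integrable lborel (%z. ind (QT T) z * F' z (0, 1))" by (simp add: g_def[abs_def])
 have inner: "(LBINT t. g (x, t)) = - F (x, 0)" for x
 proof -
  have "((%t. F' (x, t) (0, 1)) has_integral (F (x, T) - F (x, 0))) {0..T}"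
  proof (rule fundamental_theorem_of_calculus_interior)
   show "continuous_on {0..T} (%t. F (x, t))"
    by (rule continuous_on_compose2[OF F]) (auto intro!: continuous_intros)
   fix t assume "t \<in> {0<..<T}"
   then have z: "(x, t) \<in> QT T" by (simp add: QT_iff)
   have d: "((%s. F (x, s)) has_derivative (%h. F' (x, t) (0, h))) (at t)"
    by (rule has_derivative_compose[of "%s. (x, s)"]) (auto intro!: derivative_eq_intros F' z)
   have "F' (x, t) (0, h) = h *. F' (x, t) (0, 1)" for h
    using linear_scale[OF has_derivative_linear[OF F'[OF z]], of h "(0, 1)"]
    by (simp only: scaleR_Pair scaleR_zero_right real_scaleR_def mult_1_right)
   then have eq: "(%h. F' (x, t) (0, h)) = (%h. h *. F' (x, t) (0, 1))" by (rule ext)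
   show "((%s. F (x, s)) has_vector_derivative F' (x, t) (0, 1)) (at t)"
    using d unfolding has_vector_derivative_def eq .
  qed (use T in auto)
  then have "((%t. F' (x, t) (0, 1)) has_integral (F (x, T) - F (x, 0))) {0<..<T}"
   by (simp add: has_integral_Icc_iff_Ioo)
  then have "((%t. if t \<in> {0<..<T} then F' (x, t) (0, 1) else 0) has_integral (F (x, T) - F (x, 0))) UNIV"
   by (simp only: has_integral_restrict_UNIV)
  moreover have "(%t. if t \<in> {0<..<T} then F' (x, t) (0, 1) else 0) = (%t. g (x, t))"
   by (auto simp: g_def indicator_def QT_iff)
  ultimately have 1: "((%t. g (x, t)) has_integral (F (x, T) - F (x, 0))) UNIV" by simp
  have "integrable lborel (%t. g (x, t))"
  proof (rule integrable_bounded_support[where R="\<bar>R\<bar>" and B="\<bar>B\<bar>"])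
   fix t :: real assume "norm t > \<bar>R\<bar>"
   then have "norm (x, t) > \<bar>R\<bar>" using norm_snd_le[of t x] by simp
   then show "g (x, t) = 0" by (rule gb)
  qed (use gb in auto)
  then have "((%t. g (x, t)) has_integral (LBINT t. g (x, t))) UNIV"
   by (rule has_integral_integral_lborel)
  then have "(LBINT t. g (x, t)) = F (x, T) - F (x, 0)" using 1 by (rule has_integral_unique)
  then show ?thesis using FT by simp
 qed
 have gi': "integrable (lborel \<Otimes>\<^sub>M lborel) g" using gi by (simp add: lborel_prod)
 have "(LBINT z. g z) = (LBINT x. LBINT t. g (x, t))"
  using lborel_pair.integral_fst'[OF gi'] by (simp add: lborel_prod)
 then show "(LBINT z. ind (QT T) z * F' z (0, 1)) = - (LBINT x. F (x, 0))"
  unfolding g_def[symmetric] by (simp only: inner Bochner_Integration.integral_minus)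
qed

section \<open>Integration by parts for transport and diffusion\<close>

lemma deriv_t_eq:
 assumes "(g has_derivative g') (at z)" shows "deriv_t g z = g' (0, 1)"
proof -
 have "g differentiable (at z)" using assms by (rule differentiableI)
 from has_derivative_unique[OF assms has_derivative_grad[OF this]]
 have "g' (0, 1) = grad g z \<bullet> (0, 1)" by (rule fun_cong)
 then show ?thesis by (simp add: deriv_t_def inner_prod_def)
qed

lemma div_x_eq:
 assumes "(F has_derivative F') (at z)" shows "div_x F z = (\<Sum>i\<in>UNIV. F' (axis i 1, 0) $ i)"
 using frechet_derivative_at[OF assms] by (simp add: div_x_def)

lemma C1_bounded_support_bounds:
 fixes h :: "'a::euclidean_space => real"
 assumes "C1_with h D" "vanishes_beyond R h"
 obtains B where "B > 0" "!!z. \<bar>h z\<bar> <= B" "!!z. norm (D z) <= B"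
proof -
 have "continuous_on UNIV D" using assms(1) by (simp add: C1_with_def)
 then obtain B1 where B1: "B1 > 0" "!!z. norm (D z) <= B1"
  using bounded_support_bound[OF _ C1_with_support[OF assms]] by blast
 obtain B2 where B2: "B2 > 0" "!!z. norm (h z) <= B2"
  using bounded_support_bound[OF C1_with_continuous[OF assms(1)] assms(2)] by blast
 show thesis
 proof (rule that[of "B1 + B2"])
  show "\<bar>h z\<bar> <= B1 + B2" for z using B1(1) B2(2)[of z] by simp
  show "norm (D z) <= B1 + B2" for z using B2(1) B1(2)[of z] by linarith
 qed (use B1 B2 in simp)
qed

text \<open>The integrand is the space divergence of \<open>h m b\<close> minus the time derivative
  of \<open>h m\<close>. The first has integral 0 and the second leaves the trace at time 0; read
  with \<open>h\<close> as test function, this is the transport equation satisfied by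
  \<open>m\<close>.\<close>

lemma transport_integration_by_parts:
 fixes m :: "(real^'n) \<times> real => real" and b :: "(real^'n) \<times> real => real^'n"
 assumes T: "T > 0" and m: "smooth_bounded T m" and b: "smooth_bounded T b"
  and h: "C1_with h D" "vanishes_beyond R h" and hT: "!!x. h (x, T) = 0"
 shows "(LBINT z. ind (QT T) z *
   (m z * (D z \<bullet> (b z, -1)) + h z * (div_x (%y. m y *. b y) z - deriv_t m z))) = (LBINT x. h (x, 0) * m (x, 0))"
proof -
 obtain Bm where Bm: "Bm > 0" "!!z. z \<in> QT T ==> norm (m z) <= Bm"
  "!!z v. z \<in> QT T ==> norm (frechet_derivative m (at z) v) <= Bm * norm v"
  "!!z. z \<in> QT T ==> (m has_derivative frechet_derivative m (at z)) (at z)"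
  "continuous_on (QT T) m" "!!v. continuous_on (QT T) (%z. frechet_derivative m (at z) v)"
  using smooth_boundedD[OF m] by blast
 obtain Bb where Bb: "Bb > 0" "!!z. z \<in> QT T ==> norm (b z) <= Bb"
  "!!z v. z \<in> QT T ==> norm (frechet_derivative b (at z) v) <= Bb * norm v"
  "!!z. z \<in> QT T ==> (b has_derivative frechet_derivative b (at z)) (at z)"
  "continuous_on (QT T) b" "!!v. continuous_on (QT T) (%z. frechet_derivative b (at z) v)"
  using smooth_boundedD[OF b] by blast
 obtain Bh where Bh: "Bh > 0" "!!z. \<bar>h z\<bar> <= Bh" "!!z. norm (D z) <= Bh"
  using C1_bounded_support_bounds[OF h] by blast
 let ?m' = "%z. frechet_derivative m (at z)" and ?b' = "%z. frechet_derivative b (at z)"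
 have hd: "(h has_derivative (%v. D z \<bullet> v)) (at z)" for z using h unfolding C1_with_def by blast
 have Dc: "continuous_on S D" for S using h(1) by (auto simp: C1_with_def intro: continuous_on_subset)
 note hc = C1_with_continuous[OF h(1)]
 define F2 where "F2 z = h z * m z" for z
 define F2' where "F2' z v = h z * ?m' z v + (D z \<bullet> v) * m z" for z v
 have F2d: "(F2 has_derivative F2' z) (at z)" if "z \<in> QT T" for z
  unfolding F2_def[abs_def] F2'_def[abs_def] by (rule has_derivative_mult[OF hd Bm(4)[OF that]])
 have F2b: "\<bar>F2 z\<bar> <= Bh * Bm" if "z \<in> QT T" for z
  unfolding F2_def abs_mult using Bh Bm(2)[OF that] Bm(1) by (intro mult_mono) auto
 have F2'b: "\<bar>F2' z v\<bar> <= 2 * Bh * Bm * norm v" if "z \<in> QT T" for z v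
 proof -
  have "\<bar>h z * ?m' z v\<bar> <= Bh * (Bm * norm v)"
   unfolding abs_mult using Bh Bm(3)[OF that, of v] by (intro mult_mono) auto
  moreover have "\<bar>(D z \<bullet> v) * m z\<bar> <= (Bh * norm v) * Bm"
   unfolding abs_mult using Bh(1,3) Bm(1) Bm(2)[OF that]
   by (intro mult_mono order_trans[OF Cauchy_Schwarz_ineq2] mult_right_mono) auto
  ultimately show ?thesis unfolding F2'_def by (auto simp: abs_le_iff algebra_simps)
 qed
 define F1 where "F1 z = F2 z *. b z" for z
 define F1' where "F1' z v = F2 z *. ?b' z v + F2' z v *. b z" for z v
 have F1d: "(F1 has_derivative F1' z) (at z)" if "z \<in> QT T" for z
  unfolding F1_def[abs_def] F1'_def[abs_def] by (rule has_derivative_scaleR[OF F2d[OF that] Bb(4)[OF that]])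
 have F1b: "norm (F1 z) <= 3 * Bh * Bm * Bb" if "z \<in> QT T" for z
 proof -
  have "norm (F1 z) <= (Bh * Bm) * Bb"
   unfolding F1_def norm_scaleR using F2b[OF that] Bb(2)[OF that] Bh(1) Bm(1) by (intro mult_mono) auto
  also have "\<dots> <= 3 * Bh * Bm * Bb" using Bh(1) Bm(1) Bb(1) by simp
  finally show ?thesis .
 qed
 have F1'b: "norm (F1' z v) <= 3 * Bh * Bm * Bb * norm v" if "z \<in> QT T" for z v
 proof -
  have "norm (F2 z *. ?b' z v) <= (Bh * Bm) * (Bb * norm v)"
   unfolding norm_scaleR using F2b[OF that] Bb(3)[OF that, of v] Bh(1) Bm(1) by (intro mult_mono) auto
  moreover have "norm (F2' z v *. b z) <= (2 * Bh * Bm * norm v) * Bb"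
   unfolding norm_scaleR using F2'b[OF that, of v] Bb(2)[OF that] Bh(1) Bm(1) by (intro mult_mono) auto
  ultimately have "norm (F1' z v) <= (Bh * Bm) * (Bb * norm v) + (2 * Bh * Bm * norm v) * Bb"
   unfolding F1'_def by (intro order_trans[OF norm_triangle_ineq] add_mono)
  then show ?thesis by (simp add: algebra_simps)
 qed
 have supp: "F2 z = 0" "F1 z = 0" if "norm z > R" for z
  using vanishes_beyondD[OF h(2) that] by (auto simp: F2_def F1_def)
 have F2c: "continuous_on (QT T) F2" unfolding F2_def[abs_def] by (intro continuous_intros hc Bm(5))
 have F1c: "continuous_on (QT T) F1" unfolding F1_def[abs_def] by (intro continuous_intros F2c Bb(5))
 have B0: "3 * Bh * Bm * Bb >= 0" using Bh(1) Bm(1) Bb(1) by simp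
 have F1i: "(LBINT z. ind (QT T) z * div_x F1 z) = 0" "integrable lborel (%z. ind (QT T) z * div_x F1 z)"
  using integral_div_x_QT[OF F1c F1d B0 F1b F1'b supp(2)] by auto
 have cm: "continuous_on (UNIV \<times> {0..T}) m" using m by (simp add: smooth_bounded_def)
 have F2i: "(LBINT z. ind (QT T) z * F2' z (0, 1)) = - (LBINT x. F2 (x, 0))"
  "integrable lborel (%z. ind (QT T) z * F2' z (0, 1))"
 proof -
  have 1: "continuous_on (UNIV \<times> {0..T}) F2" unfolding F2_def[abs_def] by (intro continuous_intros hc cm)
  have "continuous_on (QT T) (%z. F2' z (0, 1))"
   unfolding F2'_def by (intro continuous_intros hc Bm Dc)
  then have 2: "(%z. ind (QT T) z * F2' z (0, 1)) \<in> borel_fun"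
   using borel_indicator_continuous[of "QT T" "%z. F2' z (0, 1)"] by simp
  have 3: "\<bar>F2' z (0, 1)\<bar> <= 2 * Bh * Bm" if "z \<in> QT T" for z
   using F2'b[OF that, of "(0, 1)"] by (simp add: norm_Pair)
  have 4: "F2 (x, T) = 0" for x by (simp add: F2_def hT)
  show "(LBINT z. ind (QT T) z * F2' z (0, 1)) = - (LBINT x. F2 (x, 0))"
   by (rule integral_time_derivative_QT(1)[OF T 1 F2d 2 3 supp(1) 4])
  show "integrable lborel (%z. ind (QT T) z * F2' z (0, 1))"
   by (rule integral_time_derivative_QT(2)[OF T 1 F2d 2 3 supp(1) 4])
 qed
 have "ind (QT T) z * (m z * (D z \<bullet> (b z, -1)) + h z * (div_x (%y. m y *. b y) z - deriv_t m z))
  = ind (QT T) z * div_x F1 z - ind (QT T) z * F2' z (0, 1)" for z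
 proof (cases "z \<in> QT T")
  case z: True
  have mb: "((%y. m y *. b y) has_derivative (%v. m z *. ?b' z v + ?m' z v *. b z)) (at z)"
   by (rule has_derivative_scaleR[OF Bm(4)[OF z] Bb(4)[OF z]])
  have "div_x F1 z = (\<Sum>i\<in>UNIV. h z * (m z * ?b' z (axis i 1, 0) $ i + ?m' z (axis i 1, 0) * b z $ i)
    + m z * (fst (D z) $ i * b z $ i))"
   unfolding div_x_eq[OF F1d[OF z]] F1'_def F2'_def F2_def
   by (intro sum.cong) (auto simp: algebra_simps inner_prod_def inner_axis)
  also have "\<dots> = h z * div_x (%y. m y *. b y) z + m z * (fst (D z) \<bullet> b z)"
   unfolding div_x_eq[OF mb] by (simp add: sum.distrib sum_distrib_left inner_vec_def distrib_left)
  finally show ?thesis using z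
   by (simp add: F2'_def deriv_t_eq[OF Bm(4)[OF z]] inner_prod_def algebra_simps)
 qed simp
 then have "(LBINT z. ind (QT T) z *
   (m z * (D z \<bullet> (b z, -1)) + h z * (div_x (%y. m y *. b y) z - deriv_t m z)))
  = (LBINT z. ind (QT T) z * div_x F1 z) - (LBINT z. ind (QT T) z * F2' z (0, 1))"
  using F1i(2) F2i(2) by simp
 then show ?thesis using F1i(1) F2i(1) by (simp add: F2_def)
qed

lemma smooth_grad_C1:
 fixes \<phi> :: "'a::euclidean_space => real"
 assumes "smooth_on UNIV \<phi>" "vanishes_beyond R \<phi>"
 obtains G' B where "!!z. (grad \<phi> has_derivative G' z) (at z)" "B > 0" "!!z. norm (grad \<phi> z) <= B" "!!z v. norm (G' z v) <= B * norm v"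
  "!!z. norm z > R ==> grad \<phi> z = 0" "!!z v. norm z > R ==> G' z v = 0"
proof -
 define \<psi> where "\<psi> e z = frechet_derivative \<phi> (at z) e" for e z
 have \<psi>s: "smooth_on UNIV (\<psi> e)" if "e \<in> Basis" for e
  using smooth_iter_deriv[OF assms(1), of "[e]"] that by (simp add: \<psi>_def[abs_def])
 have C: "C1_with \<phi> (grad \<phi>)" by (rule smooth_imp_C1[OF assms(1)])
 have \<psi>g: "\<psi> e z = grad \<phi> z \<bullet> e" for e z
  using C frechet_eq_grad(1) unfolding C1_with_def \<psi>_def by blast
 have v: "vanishes_beyond R (grad \<phi>)" by (rule C1_with_support[OF C assms(2)])
 have \<psi>v: "vanishes_beyond R (\<psi> e)" for e using v unfolding vanishes_beyond_def \<psi>g by simp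
 have \<psi>C: "C1_with (\<psi> e) (grad (\<psi> e))" if "e \<in> Basis" for e by (rule smooth_imp_C1[OF \<psi>s[OF that]])
 have "\<exists>B>0. \<forall>z. norm (grad (\<psi> e) z) <= B" if e: "e \<in> Basis" for e
 proof -
  obtain B where "B > 0" "!!z. \<bar>\<psi> e z\<bar> <= B" "!!z. norm (grad (\<psi> e) z) <= B"
   using C1_bounded_support_bounds[OF \<psi>C[OF e] \<psi>v] by blast
  then show ?thesis by blast
 qed
 then obtain Be where Be: "!!e. e \<in> Basis ==> Be e > 0" "!!e z. e \<in> Basis ==> norm (grad (\<psi> e) z) <= Be e" by metis
 obtain B1 where B1: "B1 > 0" "!!z. \<bar>\<phi> z\<bar> <= B1" "!!z. norm (grad \<phi> z) <= B1"
  using C1_bounded_support_bounds[OF C assms(2)] by blast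
 define G' where "G' z v = (\<Sum>e\<in>Basis. (grad (\<psi> e) z \<bullet> v) *. e)" for z v
 have ge: "grad \<phi> z = (\<Sum>e\<in>Basis. \<psi> e z *. e)" for z unfolding \<psi>g by (simp add: euclidean_representation)
 have d: "(grad \<phi> has_derivative G' z) (at z)" for z
 proof -
  have "((%z. \<Sum>e\<in>Basis. \<psi> e z *. e) has_derivative G' z) (at z)"
   unfolding G'_def[abs_def]
   by (intro has_derivative_sum has_derivative_scaleR_left) (use \<psi>C in \<open>auto simp: C1_with_def\<close>)
  then show ?thesis unfolding ge[abs_def] .
 qed
 define B2 where "B2 = (\<Sum>e\<in>(Basis :: 'a set). Be e)"
 have B2: "B2 >= 0" unfolding B2_def by (intro sum_nonneg) (use Be less_imp_le in blast)
 have b: "norm (G' z v) <= B2 * norm v" for z v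
 proof -
  have "norm (G' z v) <= (\<Sum>e\<in>Basis. norm ((grad (\<psi> e) z \<bullet> v) *. e))" unfolding G'_def by (rule norm_sum)
  also have "\<dots> <= (\<Sum>e\<in>(Basis :: 'a set). Be e * norm v)"
   by (intro sum_mono) (auto intro!: order_trans[OF Cauchy_Schwarz_ineq2] mult_right_mono Be)
  finally show ?thesis by (simp add: B2_def sum_distrib_right)
 qed
 have \<psi>0: "grad (\<psi> e) z = 0" if "e \<in> Basis" "norm z > R" for e z
  using C1_with_support[OF \<psi>C[OF that(1)] \<psi>v] that(2) by (simp add: vanishes_beyond_def)
 show thesis
 proof (rule that[of G' "B1 + B2"])
  show "B1 + B2 > 0" using B1 B2 by simp
  show "norm (grad \<phi> z) <= B1 + B2" for z using B1(3)[of z] B2 by simp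
  show "norm (G' z v) <= (B1 + B2) * norm v" for z v
   by (rule order_trans[OF b mult_right_mono]) (use B1 in auto)
  show "grad \<phi> z = 0" if "norm z > R" for z using v that by (simp add: vanishes_beyond_def)
  show "G' z v = 0" if "norm z > R" for z v unfolding G'_def using \<psi>0[OF _ that] by simp
 qed (rule d)
qed

text \<open>The integrand is the divergence of \<open>h m grad_x \<phi>\<close>. The bounded support
  comes from \<open>\<phi>\<close>, so \<open>h\<close> may be any C1 function, such as a function
  of a mollified density; the constant \<open>C\<close> and the measurability are recorded for
  dominated convergence.\<close>

lemma diffusion_integration_by_parts:
 fixes m :: "(real^'n) \<times> real => real"
 assumes m: "smooth_bounded T m" and \<phi>: "smooth_on UNIV \<phi>" "vanishes_beyond R \<phi>"
 obtains C where "(%z. ind (QT T) z * div_x (%y. m y *. grad_x \<phi> y) z) \<in> borel_fun"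
  "!!z. z \<in> QT T ==> \<bar>div_x (%y. m y *. grad_x \<phi> y) z\<bar> <= C"
  "!!z. z \<in> QT T ==> norm z > R ==> div_x (%y. m y *. grad_x \<phi> y) z = 0"
  "!!h D. C1_with h D ==> (LBINT z. ind (QT T) z *
   (m z * (fst (grad \<phi> z) \<bullet> fst (D z)) + h z * div_x (%y. m y *. grad_x \<phi> y) z)) = 0"
proof -
 obtain Bm where Bm: "Bm > 0" "!!z. z \<in> QT T ==> norm (m z) <= Bm"
  "!!z v. z \<in> QT T ==> norm (frechet_derivative m (at z) v) <= Bm * norm v"
  "!!z. z \<in> QT T ==> (m has_derivative frechet_derivative m (at z)) (at z)"
  "continuous_on (QT T) m" "!!v. continuous_on (QT T) (%z. frechet_derivative m (at z) v)"
  using smooth_boundedD[OF m] by blast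
 let ?m' = "%z. frechet_derivative m (at z)"
 obtain G' B where G: "!!z. (grad \<phi> has_derivative G' z) (at z)" "B > 0" "!!z. norm (grad \<phi> z) <= B" "!!z v. norm (G' z v) <= B * norm v"
  "!!z. norm z > R ==> grad \<phi> z = 0" "!!z v. norm z > R ==> G' z v = 0" using smooth_grad_C1[OF \<phi>] by blast
 define P where "P y = m y *. grad_x \<phi> y" for y
 define P' where "P' z v = m z *. fst (G' z v) + ?m' z v *. grad_x \<phi> z" for z v
 have gx: "(grad_x \<phi> has_derivative (%v. fst (G' z v))) (at z)" for z
  unfolding grad_x_def[abs_def] by (rule has_derivative_fst[OF G(1)])
 have gxb: "norm (grad_x \<phi> z) <= B" "norm (fst (G' z v)) <= B * norm v" for z v
  unfolding grad_x_def
  using order_trans[OF norm_fst_le[of "fst (grad \<phi> z)" "snd (grad \<phi> z)"], of B] G(3)[of z]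
   order_trans[OF norm_fst_le[of "fst (G' z v)" "snd (G' z v)"], of "B * norm v"] G(4)[of z v] by simp_all
 have Pd: "(P has_derivative P' z) (at z)" if "z \<in> QT T" for z
  unfolding P_def[abs_def] P'_def[abs_def] by (rule has_derivative_scaleR[OF Bm(4)[OF that] gx])
 have Pb: "norm (P z) <= Bm * B" if "z \<in> QT T" for z
  unfolding P_def norm_scaleR using Bm(1) Bm(2)[OF that] gxb(1) G(2) by (intro mult_mono) auto
 have P'b: "norm (P' z v) <= 2 * Bm * B * norm v" if "z \<in> QT T" for z v
 proof -
  have "norm (m z *. fst (G' z v)) <= Bm * (B * norm v)"
   unfolding norm_scaleR using Bm(1) Bm(2)[OF that] gxb(2) by (intro mult_mono) auto
  moreover have "norm (?m' z v *. grad_x \<phi> z) <= (Bm * norm v) * B"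
   unfolding norm_scaleR using Bm(1) Bm(3)[OF that, of v] gxb(1) by (intro mult_mono) auto
  ultimately have "norm (P' z v) <= Bm * (B * norm v) + (Bm * norm v) * B"
   unfolding P'_def by (intro order_trans[OF norm_triangle_ineq] add_mono)
  then show ?thesis by (simp add: algebra_simps)
 qed
 have P0: "P z = 0" "P' z v = 0" if "norm z > R" for z v
  using G(5,6)[OF that] by (auto simp: P_def P'_def grad_x_def)
 have Pc: "continuous_on (QT T) P"
  by (intro continuous_at_imp_continuous_on ballI has_derivative_continuous[OF Pd])
 have gen: "(LBINT z. ind (QT T) z * div_x (%y. h y *. P y) z) = 0
   & (%z. ind (QT T) z * div_x (%y. h y *. P y) z) \<in> borel_fun
   & (\<forall>z\<in>QT T. div_x (%y. h y *. P y) z = m z * (fst (grad \<phi> z) \<bullet> fst (D z)) + h z * div_x P z)"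
  if h: "C1_with h D" for h D
 proof -
  have hd: "(h has_derivative (%v. D z \<bullet> v)) (at z)" for z using h unfolding C1_with_def by blast
  have Dc: "continuous_on (cball 0 R) D" using h by (auto simp: C1_with_def intro: continuous_on_subset)
  have "bounded (D ` cball 0 R)" "bounded (h ` cball 0 R)"
   by (intro compact_imp_bounded compact_continuous_image Dc C1_with_continuous[OF h] compact_cball)+
  then obtain C1 C2 where CC: "\<forall>z\<in>cball 0 R. norm (D z) <= C1" "\<forall>z\<in>cball 0 R. \<bar>h z\<bar> <= C2"
   unfolding bounded_iff by (auto simp del: mem_cball)
  define C where "C = max 1 (max C1 C2)"
  have C: "C > 0" "!!z. norm z <= R ==> norm (D z) <= C" "!!z. norm z <= R ==> \<bar>h z\<bar> <= C"
   using CC by (auto simp: C_def le_max_iff_disj)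
  define F where "F y = h y *. P y" for y
  define F' where "F' z v = h z *. P' z v + (D z \<bullet> v) *. P z" for z v
  have Fd: "(F has_derivative F' z) (at z)" if "z \<in> QT T" for z
   unfolding F_def[abs_def] F'_def[abs_def] by (rule has_derivative_scaleR[OF hd Pd[OF that]])
  have Fc: "continuous_on (QT T) F"
   by (intro continuous_at_imp_continuous_on ballI has_derivative_continuous[OF Fd])
  have pos: "0 <= 3 * C * Bm * B" using C(1) Bm(1) G(2) by simp
  have Fb: "norm (F z) <= 3 * C * Bm * B" if "z \<in> QT T" for z
  proof (cases "norm z <= R")
   case True
   have "norm (F z) <= C * (Bm * B)" unfolding F_def norm_scaleR using C(1,3) True Pb[OF that] by (intro mult_mono) auto
   then show ?thesis using pos by (simp add: algebra_simps)
  next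
   case False then show ?thesis using P0(1)[of z] pos by (simp add: F_def)
  qed
  have F'b: "norm (F' z v) <= 3 * C * Bm * B * norm v" if "z \<in> QT T" for z v
  proof (cases "norm z <= R")
   case True
   have "norm (h z *. P' z v) <= C * (2 * Bm * B * norm v)"
    unfolding norm_scaleR using C(1,3) True P'b[OF that] by (intro mult_mono) auto
   moreover have "norm ((D z \<bullet> v) *. P z) <= (C * norm v) * (Bm * B)"
    unfolding norm_scaleR real_norm_def using C(1,2) True Pb[OF that]
    by (intro mult_mono order_trans[OF Cauchy_Schwarz_ineq2] mult_right_mono) auto
   ultimately have "norm (F' z v) <= C * (2 * Bm * B * norm v) + (C * norm v) * (Bm * B)"
    unfolding F'_def by (intro order_trans[OF norm_triangle_ineq] add_mono)
   then show ?thesis by (simp add: algebra_simps)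
  next
   case False then show ?thesis using P0[of z] pos by (simp add: F'_def)
  qed
  have F0: "F z = 0" if "norm z > R" for z using P0[OF that] by (simp add: F_def)
  have "div_x F z = m z * (fst (grad \<phi> z) \<bullet> fst (D z)) + h z * div_x P z" if z: "z \<in> QT T" for z
  proof -
   have "div_x F z = (\<Sum>i\<in>UNIV. h z * P' z (axis i 1, 0) $ i + m z * (fst (grad \<phi> z) $ i * fst (D z) $ i))"
    unfolding div_x_eq[OF Fd[OF z]] F'_def P_def grad_x_def
    by (intro sum.cong) (auto simp: algebra_simps inner_prod_def inner_axis)
   then show ?thesis unfolding div_x_eq[OF Pd[OF z]] by (simp add: sum.distrib sum_distrib_left inner_vec_def)
  qed
  then show ?thesis
   using integral_div_x_QT[OF Fc Fd pos Fb F'b F0] unfolding F_def by blast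
 qed
 have one: "C1_with (%_. 1::real) (%_. 0 :: (real^'n) \<times> real)" by (simp add: C1_with_def)
 have dP: "div_x P z = (\<Sum>i\<in>UNIV. P' z (axis i 1, 0) $ i)" if "z \<in> QT T" for z by (rule div_x_eq[OF Pd[OF that]])
 show thesis
 proof (rule that[of "real CARD('n) * (2 * Bm * B)"])
  show "(%z. ind (QT T) z * div_x (%y. m y *. grad_x \<phi> y) z) \<in> borel_fun"
   using gen[OF one] by (simp add: P_def)
  fix z :: "(real^'n) \<times> real" assume z: "z \<in> QT T"
  have "\<bar>\<Sum>i\<in>UNIV. P' z (axis i 1, 0) $ i\<bar> <= (\<Sum>i\<in>(UNIV::'n set). 2 * Bm * B)"
  proof (rule order_trans[OF sum_abs sum_mono])
   fix i :: 'n
   have "\<bar>P' z (axis i 1, 0) $ i\<bar> <= norm (P' z (axis i 1, 0))" by (rule component_le_norm_cart)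
   also have "\<dots> <= 2 * Bm * B * norm (axis i 1 :: real^'n, 0::real)" by (rule P'b[OF z])
   also have "\<dots> = 2 * Bm * B" by (simp add: norm_Pair)
   finally show "\<bar>P' z (axis i 1, 0) $ i\<bar> <= 2 * Bm * B" .
  qed
  then show "\<bar>div_x (%y. m y *. grad_x \<phi> y) z\<bar> <= real CARD('n) * (2 * Bm * B)"
   using dP[OF z] by (simp add: P_def[abs_def])
  show "div_x (%y. m y *. grad_x \<phi> y) z = 0" if "norm z > R"
   using dP[OF z] P0(2)[OF that] by (simp add: P_def[abs_def])
 next
  fix h D assume h: "C1_with h (D :: (real^'n) \<times> real => (real^'n) \<times> real)"
  have "ind (QT T) z * (m z * (fst (grad \<phi> z) \<bullet> fst (D z)) + h z * div_x (%y. m y *. grad_x \<phi> y) z)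
   = ind (QT T) z * div_x (%y. h y *. P y) z" for z
   using gen[OF h] by (cases "z \<in> QT T") (auto simp: P_def[abs_def])
  then have eq: "(%z. ind (QT T) z * (m z * (fst (grad \<phi> z) \<bullet> fst (D z)) + h z * div_x (%y. m y *. grad_x \<phi> y) z))
   = (%z. ind (QT T) z * div_x (%y. h y *. P y) z)" by (rule ext)
  show "(LBINT z. ind (QT T) z *
   (m z * (fst (grad \<phi> z) \<bullet> fst (D z)) + h z * div_x (%y. m y *. grad_x \<phi> y) z)) = 0"
   unfolding eq using gen[OF h] by blast
 qed
qed

subsection \<open>Mollification of a function with weak gradient\<close>

text \<open>The scalars \<open>c\<close> in the closed family absorb the sign that every derivative
  brings out.\<close>

lemma smooth_on_reflect:
 fixes h :: "'a::euclidean_space => real"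
 assumes "smooth_on UNIV h"
 shows "smooth_on UNIV (%y. h (z - y))"
proof (rule smooth_onI_closed[where \<F>="{%y. c * h (z - y) |c h. smooth_on UNIV h}"])
 have "(%y. h (z - y)) = (%y. 1 * h (z - y))" by simp
 then show "(%y. h (z - y)) \<in> {%y. c * h (z - y) |c h. smooth_on UNIV h}" using assms by blast
next
 fix g :: "'a => real" assume "g \<in> {%y. c * h (z - y) |c h. smooth_on UNIV h}"
 then obtain c h where g: "g = (%y. c * h (z - y))" and h: "smooth_on UNIV (h :: 'a => real)" by blast
 have C: "C1_with h (grad h)" by (rule smooth_imp_C1[OF h])
 have "(g has_derivative (%v. ((- c) *. grad h (z - y)) \<bullet> v)) (at y)" for y
 proof -
  have "(h has_derivative (%v. grad h (z - y) \<bullet> v)) (at (z - y))" using C unfolding C1_with_def by blast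
  moreover have "((%y. z - y) has_derivative (%v. - v)) (at y)" by (auto intro!: derivative_eq_intros)
  ultimately have "((%y. h (z - y)) has_derivative (%v. grad h (z - y) \<bullet> (- v))) (at y)"
   using has_derivative_compose[where f="%y. z - y" and g=h] by blast
  from has_derivative_mult_right[OF this, of c] show ?thesis unfolding g by (simp add: fun_eq_iff)
 qed
 moreover have "(%y. ((- c) *. grad h (z - y)) \<bullet> e) \<in> {%y. c * h (z - y) |c h. smooth_on UNIV h}" if "e \<in> Basis" for e
 proof -
  have eq: "iter_deriv [e] h = (%w. grad h w \<bullet> e)"
   using frechet_eq_grad(1)[of h "grad h w" w e for w] C unfolding C1_with_def by (simp add: fun_eq_iff)
  have "smooth_on UNIV (%w. grad h w \<bullet> e)"
   using smooth_iter_deriv[OF h, of "[e]"] that unfolding eq by simp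
  then show ?thesis by (intro CollectI exI[of _ "- c"] exI[of _ "%w. grad h w \<bullet> e"]) simp
 qed
 ultimately show "\<exists>D. (\<forall>y. (g has_derivative (%v. D y \<bullet> v)) (at y)) &
  (\<forall>e\<in>Basis. (%y. D y \<bullet> e) \<in> {%y. c * h (z - y) |c h. smooth_on UNIV h})"
  by (intro exI[of _ "%y. (- c) *. grad h (z - y)"]) blast
qed

lemma square_int_loc_int:
 assumes "square_int u" shows "loc_int u"
 unfolding loc_int_def set_integrable_def
proof (intro conjI allI)
 show m [measurable]: "u \<in> borel_fun" using assms by (simp add: square_int_def)
 fix r :: real
 show "integrable lborel (%x. ind (cball 0 r) x *. u x)"
 proof (rule Bochner_Integration.integrable_bound)
  show "integrable lborel (%x. ind (cball 0 r) x + (norm (u x))\<^sup>2)"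
   using assms lborel_bounded_finite[OF bounded_cball, of "0::'a" r]
   by (intro Bochner_Integration.integrable_add) (auto simp: square_int_def integrable_indicator_iff)
  show "AE x in lborel. norm (ind (cball 0 r) x *. u x) <= norm (ind (cball 0 r) x + (norm (u x))\<^sup>2)"
  proof (rule AE_I2)
   fix x
   have "norm (u x) <= 1 + (norm (u x))\<^sup>2" using sum_squares_ge_zero[of "norm (u x) - 1" "norm (u x)"]
    norm_ge_zero[of "u x"] unfolding power2_eq_square by (simp add: algebra_simps del: norm_ge_zero)
   then show "norm (ind (cball 0 r) x *. u x) <= norm (ind (cball 0 r) x + (norm (u x))\<^sup>2)"
    by (simp add: indicator_def)
  qed
  have [measurable]: "cball (0::'a) r \<in> sets borel" by simp
  show "(%x. ind (cball 0 r) x *. u x) \<in> borel_measurable lborel" by measurable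
 qed
qed

lemma near_id_translate: "norm y <= d ==> near_id d (%z. z - y :: 'a::euclidean_space)"
 using lborel_distr_translate[of "- y"] by (simp add: near_id_def)

text \<open>The kernel sits around time \<open>- 2 r\<close>, so \<open>U\<close> at time
  \<open>t\<close> averages \<open>u\<close> over times between \<open>t + r\<close> and
  \<open>t + 3 r\<close>. Reflected kernels based at points with \<open>t \<ge> 0\<close> are
  therefore test functions of the open slab, and the classical gradient of \<open>U\<close> is the
  mollified weak gradient up to and including \<open>t = 0\<close>; the price is a margin before
  \<open>T\<close>.\<close>

lemma mollify_weak_grad:
 fixes u :: "(real^'n) \<times> real => real"
 assumes u: "square_int u" "!!z. u z >= 0" and G: "square_int G"
  and wg: "!!\<phi>. test_function (QT T) \<phi> ==> (LBINT z. u z *. grad \<phi> z) = - (LBINT z. \<phi> z *. G z)"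
  and e: "e > 0"
 obtains U D P where "C1_with U D" "!!z. U z >= 0" "U \<in> borel_fun"
  "square_int (%z. U z - u z)" "(LBINT z. (norm (U z - u z))\<^sup>2) <= e"
  "square_int (%z. P z - G z)" "(LBINT z. (norm (P z - G z))\<^sup>2) <= e"
  "!!z. 0 <= snd z ==> snd z < T - e ==> D z = P z"
proof -
 obtain d1 where d1: "d1 > 0" "!!\<tau>. near_id d1 \<tau> ==> (LBINT z. (norm (u (\<tau> z) - u z))\<^sup>2) <= e"
  using L2_continuity[OF u(1) e] by blast
 obtain d2 where d2: "d2 > 0" "!!\<tau>. near_id d2 \<tau> ==> (LBINT z. (norm (G (\<tau> z) - G z))\<^sup>2) <= e"
  using L2_continuity[OF G e] by blast
 \<comment> \<open>Kernel points have norm at most \<open>3 r\<close>: \<open>2 r\<close> for the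
   centre plus \<open>r\<close> for the radius.\<close>
 define r where "r = min (min d1 d2) e / 3"
 have r: "r > 0" "3 * r <= d1" "3 * r <= d2" "3 * r <= e" using d1 d2 e by (auto simp: r_def)
 define a where "a = (0 :: real^'n, - 2 * r)"
 obtain k :: "(real^'n) \<times> real => real" where k: "smooth_on UNIV k" "!!z. 0 <= k z" "!!z. norm (z - a) >= r ==> k z = 0"
  "integrable lborel k" "(LBINT z. k z) = 1" using exists_smooth_kernel[OF r(1), of a] by blast
 have "norm (0 :: real^'n, t) = \<bar>t\<bar>" for t :: real by (simp add: norm_Pair)
 then have na: "norm a = 2 * r" using r(1) unfolding a_def by simp
 have kC: "C1_with k (grad k)" by (rule smooth_imp_C1[OF k(1)])
 have kb [measurable]: "k \<in> borel_fun" by (rule C1_with_borel(1)[OF kC])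
 have ksupp: "norm y <= 3 * r" if "k y ~= 0" for y
  using k(3)[of y] that norm_triangle_sub[of y a] na by fastforce
 have kv: "vanishes_beyond (3 * r) k" unfolding vanishes_beyond_def using ksupp by force
 have [measurable]: "u \<in> borel_fun" "G \<in> borel_fun" using u G by (auto simp: square_int_def)
 have ul: "loc_int u" by (rule square_int_loc_int[OF u(1)])
 have \<tau>: "(%(y, z). z - y) \<in> borel_measurable (borel \<Otimes>\<^sub>M (borel :: ((real^'n) \<times> real) measure))" by measurable
 define U where "U = conv k u"
 define P where "P = conv G k"
 have U: "U z = (LBINT y. k y *. u (z - y))" for z
  unfolding U_def by (subst conv_commute) (auto simp: conv_def)
 have P: "P z = (LBINT y. k y *. G (z - y))" for z by (simp add: P_def conv_def)
 have C1: "C1_with U (conv (grad k) u)" unfolding U_def by (rule conv_C1[OF kC kv ul])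
 have near: "near_id d (%z. z - y)" if "k y ~= 0" "3 * r <= d" for y d
  by (rule near_id_translate) (use ksupp[OF that(1)] that(2) in simp)
 have e0: "e >= 0" using e by simp
 show thesis
 proof (rule that[of U "conv (grad k) u" P])
  show "U z >= 0" for z unfolding U using k(2) u(2) by (intro Bochner_Integration.integral_nonneg) auto
  show "U \<in> borel_fun" by (rule C1_with_borel(1)[OF C1])
  show "square_int (%z. U z - u z)" "(LBINT z. (norm (U z - u z))\<^sup>2) <= e"
   unfolding U by (rule L2_mollification[OF k(4,2,5) kb u(1) e0 \<tau> near[OF _ r(2)] d1(2)], assumption+)+
  show "square_int (%z. P z - G z)" "(LBINT z. (norm (P z - G z))\<^sup>2) <= e"
   unfolding P by (rule L2_mollification[OF k(4,2,5) kb G e0 \<tau> near[OF _ r(3)] d2(2)], assumption+)+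
  fix z :: "(real^'n) \<times> real" assume z: "0 <= snd z" "snd z < T - e"
  define \<phi> where "\<phi> y = k (z - y)" for y
  have \<phi>s: "smooth_on UNIV \<phi>" unfolding \<phi>_def[abs_def] by (rule smooth_on_reflect[OF k(1)])
  have "{y. \<phi> y ~= 0} \<subseteq> cball (z - a) r"
  proof
   fix y assume "y \<in> {y. \<phi> y ~= 0}"
   then have "norm (z - y - a) < r" using k(3)[of "z - y"] unfolding \<phi>_def by fastforce
   then show "y \<in> cball (z - a) r" by (simp add: dist_norm algebra_simps)
  qed
  then have cl: "closure {y. \<phi> y ~= 0} \<subseteq> cball (z - a) r" by (rule closure_minimal) simp
  \<comment> \<open>Times in this ball lie between \<open>snd z + r\<close> and
    \<open>snd z + 3 r\<close>, and \<open>3 r\<close> is at most \<open>e\<close>.\<close>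
  moreover have "cball (z - a) r \<subseteq> QT T"
  proof
   fix y assume "y \<in> cball (z - a) r"
   then have "norm (z - a - y) <= r" by (simp add: dist_norm)
   moreover have "\<bar>snd (z - a - y)\<bar> <= norm (z - a - y)" by (metis norm_snd_le prod.collapse real_norm_def)
   ultimately have "\<bar>snd z + 2 * r - snd y\<bar> <= r" by (simp add: a_def)
   then show "y \<in> QT T" using z r by (simp add: QT_iff abs_le_iff)
  qed
  moreover have "compact (closure {y. \<phi> y ~= 0})"
   using compact_Int_closed[OF compact_cball closed_closure, of "z - a" r "{y. \<phi> y ~= 0}"] cl by (simp add: inf.absorb2)
  ultimately have test: "test_function (QT T) \<phi>" unfolding test_function_def using \<phi>s by auto
  have "grad \<phi> y = - grad k (z - y)" for y
  proof -
   have "(k has_derivative (%v. grad k (z - y) \<bullet> v)) (at (z - y))" using kC unfolding C1_with_def by blast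
   moreover have "((%y. z - y) has_derivative (%v. - v)) (at y)" by (auto intro!: derivative_eq_intros)
   ultimately have "(\<phi> has_derivative (%v. grad k (z - y) \<bullet> (- v))) (at y)"
    unfolding \<phi>_def[abs_def] using has_derivative_compose[where f="%y. z - y" and g=k] by blast
   then have "(\<phi> has_derivative (%v. (- grad k (z - y)) \<bullet> v)) (at y)" by simp
   then show ?thesis by (rule frechet_eq_grad(2))
  qed
  then have "conv (grad k) u z = (LBINT y. k (z - y) *. G y)"
   using wg[OF test] by (simp add: conv_def \<phi>_def)
  also have "\<dots> = (LINT y|distr lborel borel (%y. z - y). k (z - y) *. G y)" by (simp add: lborel_distr_reflect)
  also have "\<dots> = P z" unfolding P by (subst integral_distr) auto
  finally show "conv (grad k) u z = P z" .
 qed (rule C1)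
qed

text \<open>Almost everywhere convergence of the functions costs a subsequence. The gradients are
  kept as the L2-convergent sequence \<open>P\<close>, which agrees with the classical gradients
  except near the final time.\<close>

lemma mollified_sequence:
 fixes u :: "(real^'n) \<times> real => real"
 assumes u: "square_int u" "!!z. u z >= 0" and G: "square_int G"
  and wg: "!!\<phi>. test_function (QT T) \<phi> ==> (LBINT z. u z *. grad \<phi> z) = - (LBINT z. \<phi> z *. G z)"
 obtains U D P where "!!j. C1_with (U j) (D j)" "!!j z. U j z >= 0"
  "AE z in lborel. (%j. U j z) ----> u z"
  "!!j::nat. square_int (%z. P j z - G z)" "(%j. LBINT z. (norm (P j z - G z))\<^sup>2) ----> 0"
  "!!z j. 0 <= snd z ==> snd z < T - 1 / real (Suc j) ==> D j z = P j z"
proof -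
 define Q where "Q j U D P \<longleftrightarrow> C1_with U D & (\<forall>z. U z >= 0) &
  square_int (%z. U z - u z) & (LBINT z. (norm (U z - u z))\<^sup>2) <= 1 / real (Suc j) &
  square_int (%z. P z - G z) & (LBINT z. (norm (P z - G z))\<^sup>2) <= 1 / real (Suc j) &
  (\<forall>z. 0 <= snd z --> snd z < T - 1 / real (Suc j) --> D z = P z)" for j U D P
 have "\<exists>U D P. Q j U D P" for j
 proof -
  have j: "1 / real (Suc j) > 0" by simp
  show ?thesis unfolding Q_def by (rule mollify_weak_grad[OF u G wg j], assumption) blast
 qed
 then obtain U D P where Q: "!!j. Q j (U j) (D j) (P j)" by metis
 have *: "!!j. C1_with (U j) (D j)" "!!j z. U j z >= 0"
  "!!j. square_int (%z. U j z - u z)" "!!j. (LBINT z. (norm (U j z - u z))\<^sup>2) <= 1 / real (Suc j)"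
  "!!j. square_int (%z. P j z - G z)" "!!j. (LBINT z. (norm (P j z - G z))\<^sup>2) <= 1 / real (Suc j)"
  "!!j z. 0 <= snd z ==> snd z < T - 1 / real (Suc j) ==> D j z = P j z"
  using Q unfolding Q_def by blast+
 have lim0: "(%j. 1 / real (Suc j)) ----> 0" by (rule LIMSEQ_Suc[OF lim_1_over_n])
 have sq: "(%j. LBINT z. (norm (V j z))\<^sup>2) ----> 0"
  if "!!j. (LBINT z. (norm (V j z))\<^sup>2) <= 1 / real (Suc j)" for V :: "nat => (real^'n) \<times> real => 'b::real_normed_vector"
  by (rule tendsto_sandwich[OF _ _ tendsto_const lim0]) (use that in auto)
 have "(%j. LBINT z. norm ((norm (U j z - u z))\<^sup>2)) ----> 0" using sq[OF *(4)] by simp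
 moreover have "!!j. integrable lborel (%z. (norm (U j z - u z))\<^sup>2)" using *(3) by (simp add: square_int_def)
 ultimately obtain s where s: "strict_mono s" "AE z in lborel. (%j. (norm (U (s j) z - u z))\<^sup>2) ----> 0"
  using tendsto_L1_AE_subseq[of lborel "%j z. (norm (U j z - u z))\<^sup>2"] by auto
 show thesis
 proof (rule that[of "%j. U (s j)" "%j. D (s j)" "%j. P (s j)"])
  show "AE z in lborel. (%j. U (s j) z) ----> u z"
   using s(2)
  proof eventually_elim
   fix z assume "(%j. (norm (U (s j) z - u z))\<^sup>2) ----> 0"
   from tendsto_real_sqrt[OF this] have "(%j. norm (U (s j) z - u z)) ----> 0" by simp
   then show "(%j. U (s j) z) ----> u z" by (simp add: tendsto_rabs_zero_iff LIM_zero_iff)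
  qed
  show "(%j. LBINT z. (norm (P (s j) z - G z))\<^sup>2) ----> 0"
   using LIMSEQ_subseq_LIMSEQ[OF sq[OF *(6)] s(1)] by (simp add: comp_def)
  fix z :: "(real^'n) \<times> real" and j assume z: "0 <= snd z" "snd z < T - 1 / real (Suc j)"
  \<comment> \<open>Since \<open>s j\<close> is at least \<open>j\<close>, passing to the
    subsequence only shrinks the final-time margin.\<close>
  have "1 / real (Suc (s j)) <= 1 / real (Suc j)"
   using strict_mono_imp_increasing[OF s(1), of j] by (intro divide_left_mono) auto
  then show "D (s j) z = P (s j) z" using z by (intro *(7)) auto
 qed (use * in auto)
qed

text \<open>The pairing with \<open>G\<close> converges by domination, because the product of two
  square-integrable functions is integrable; the pairing with \<open>P j - G\<close> is small by
  Young's inequality.\<close>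

lemma L2_pairing_limit:
 fixes F :: "nat => 'a::euclidean_space => 'b::euclidean_space"
 assumes F: "!!j. F j \<in> borel_fun" "AE z in lborel. (%j. F j z) ----> F0 z"
  "!!j z. norm (F j z) <= Fs z" and Fs: "square_int Fs" and F0: "F0 \<in> borel_fun"
  and G: "square_int G" and P: "!!j. square_int (%z. P j z - G z)" "(%j. LBINT z. (norm (P j z - G z))\<^sup>2) ----> 0"
 shows "(%j. LBINT z. F j z \<bullet> P j z) ----> (LBINT z. F0 z \<bullet> G z)"
  and "integrable lborel (%z. F j z \<bullet> P j z)" and "integrable lborel (%z. F0 z \<bullet> G z)"
proof -
 note [measurable] = F(1) F0
 have [measurable]: "G \<in> borel_fun" "Fs \<in> borel_fun" "!!j. (%z. P j z - G z) \<in> borel_fun"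
  using G Fs P by (auto simp: square_int_def)
 have Fs0: "Fs z >= 0" for z by (rule order_trans[OF norm_ge_zero F(3)])
 have Fsi: "integrable lborel (%z. (Fs z)\<^sup>2)" using Fs by (simp add: square_int_def)
 have Gi: "integrable lborel (%z. (norm (G z))\<^sup>2)" using G by (simp add: square_int_def)
 have Pi: "integrable lborel (%z. (norm (P j z - G z))\<^sup>2)" for j using P(1) by (simp add: square_int_def)
 have w: "integrable lborel (%z. (Fs z)\<^sup>2 + (norm (G z))\<^sup>2)" using Fsi Gi by simp
 have ab: "a * b <= a\<^sup>2 + b\<^sup>2" if "a >= 0" "b >= 0" for a b :: real
  using sum_squares_ge_zero[of "a - b" 0] mult_nonneg_nonneg[OF that] by (simp add: power2_eq_square algebra_simps)
 have dom: "norm (F j z \<bullet> G z) <= (Fs z)\<^sup>2 + (norm (G z))\<^sup>2" for j z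
 proof -
  have "norm (F j z \<bullet> G z) <= norm (F j z) * norm (G z)" by (simp add: Cauchy_Schwarz_ineq2)
  also have "\<dots> <= Fs z * norm (G z)" by (intro mult_right_mono F(3)) simp
  also have "\<dots> <= (Fs z)\<^sup>2 + (norm (G z))\<^sup>2" by (rule ab) (use Fs0 in auto)
  finally show ?thesis .
 qed
 have limz: "AE z in lborel. (%j. F j z \<bullet> G z) ----> F0 z \<bullet> G z"
  using F(2) by eventually_elim (intro tendsto_intros)
 have m1: "(%z. F0 z \<bullet> G z) \<in> borel_measurable lborel" "!!j. (%z. F j z \<bullet> G z) \<in> borel_measurable lborel" by measurable
 have l1: "(%j. LBINT z. F j z \<bullet> G z) ----> (LBINT z. F0 z \<bullet> G z)"
  by (rule integral_dominated_convergence[OF m1 w limz AE_I2[OF dom]])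
 show "integrable lborel (%z. F0 z \<bullet> G z)"
  by (rule integrable_dominated_convergence[OF m1 w limz AE_I2[OF dom]])
 have FG: "integrable lborel (%z. F j z \<bullet> G z)" for j
  by (rule Bochner_Integration.integrable_bound[OF w]) (measurable, rule AE_I2, rule order_trans[OF dom], simp)
 \<comment> \<open>The weight \<open>c\<close> is left free: it is 1 for integrability, and
   proportional to the target error for the limit.\<close>
 have dom2: "\<bar>F j z \<bullet> (P j z - G z)\<bar> <= c / 2 * (Fs z)\<^sup>2 + 1 / (2 * c) * (norm (P j z - G z))\<^sup>2" if "c > 0" for j z c
 proof -
  have "\<bar>F j z \<bullet> (P j z - G z)\<bar> <= norm (F j z) * norm (P j z - G z)" by (simp add: Cauchy_Schwarz_ineq2)
  also have "\<dots> <= Fs z * norm (P j z - G z)" by (intro mult_right_mono F(3)) simp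
  also have "\<dots> <= c / 2 * (Fs z)\<^sup>2 + 1 / (2 * c) * (norm (P j z - G z))\<^sup>2"
  proof -
   have "0 <= (c * Fs z - norm (P j z - G z))\<^sup>2" by simp
   then have "2 * c * (Fs z * norm (P j z - G z)) <= c\<^sup>2 * (Fs z)\<^sup>2 + (norm (P j z - G z))\<^sup>2"
    by (simp add: power2_eq_square algebra_simps)
   then show ?thesis using that by (simp add: field_simps power2_eq_square)
  qed
  finally show ?thesis .
 qed
 have FP: "integrable lborel (%z. F j z \<bullet> (P j z - G z))" for j
  by (rule Bochner_Integration.integrable_bound[where f="%z. 1 / 2 * (Fs z)\<^sup>2 + 1 / (2 * 1) * (norm (P j z - G z))\<^sup>2"])
    (use Fsi Pi dom2[of 1] in \<open>auto intro!: AE_I2 order_trans[OF dom2[of 1]] simp del: mult_1_right\<close>)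
 have l2: "(%j. LBINT z. F j z \<bullet> (P j z - G z)) ----> 0"
 proof (rule LIMSEQ_I)
  fix r :: real assume r: "r > 0"
  define A where "A = (LBINT z. (Fs z)\<^sup>2)"
  have A: "A >= 0" unfolding A_def by (intro Bochner_Integration.integral_nonneg) auto
  \<comment> \<open>With this weight each half of Young's bound is at most \<open>r / 2\<close> once
    the L2 distance of \<open>P j\<close> from \<open>G\<close> is below
    \<open>c * r\<close>.\<close>
  define c where "c = r / (A + 1)"
  have c: "c > 0" "c * A <= r" using r A by (auto simp: c_def field_simps)
  have "\<forall>\<^sub>F j in sequentially. (LBINT z. (norm (P j z - G z))\<^sup>2) < c * r"
   using P(2) by (rule order_tendstoD(2)) (use c r in simp)
  then obtain n where n: "!!j. j >= n ==> (LBINT z. (norm (P j z - G z))\<^sup>2) < c * r"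
   by (auto simp: eventually_sequentially)
  show "\<exists>n. \<forall>j\<ge>n. norm ((LBINT z. F j z \<bullet> (P j z - G z)) - 0) < r"
  proof (intro exI[of _ n] allI impI)
   fix j assume "j >= n"
   have "norm (LBINT z. F j z \<bullet> (P j z - G z)) <= (LBINT z. c / 2 * (Fs z)\<^sup>2 + 1 / (2 * c) * (norm (P j z - G z))\<^sup>2)"
    by (rule norm_lebesgue_integral_le[OF FP]) (use Fsi Pi dom2[OF c(1)] in auto)
   also have "\<dots> = c / 2 * A + 1 / (2 * c) * (LBINT z. (norm (P j z - G z))\<^sup>2)" using Fsi Pi by (simp add: A_def)
   also have "\<dots> < r / 2 + 1 / (2 * c) * (c * r)"
    using c n[OF \<open>j >= n\<close>] by (intro add_le_less_mono mult_strict_left_mono) auto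
   also have "\<dots> = r" using c by simp
   finally show "norm ((LBINT z. F j z \<bullet> (P j z - G z)) - 0) < r" by simp
  qed
 qed
 have sp: "F j z \<bullet> P j z = F j z \<bullet> G z + F j z \<bullet> (P j z - G z)" for j z by (simp add: inner_diff_right)
 show "integrable lborel (%z. F j z \<bullet> P j z)" unfolding sp using FG FP by simp
 have "(LBINT z. F j z \<bullet> P j z) = (LBINT z. F j z \<bullet> G z) + (LBINT z. F j z \<bullet> (P j z - G z))" for j
  unfolding sp by (rule Bochner_Integration.integral_add[OF FG FP])
 then show "(%j. LBINT z. F j z \<bullet> P j z) ----> (LBINT z. F0 z \<bullet> G z)"
  using tendsto_add[OF l1 l2] by simp
qed

subsection \<open>The entropy pair\<close>

text \<open>For \<open>r \<ge> 0\<close> this is \<open>r powr (1 / k)\<close> times the derivative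
  of \<open>exp (- N r)\<close>; at \<open>r = v powr k\<close> the first factor is
  \<open>v\<close>. The maximum extends it continuously by 0 to negative \<open>r\<close>.\<close>

definition entropy_density :: "real => real => real => real" where
 "entropy_density k N r = max r 0 powr (1 / k) * (- N * exp (- N * r))"

text \<open>The antiderivative vanishing at 0. It stands in for the chain rule: along
  \<open>s = v powr k\<close> its increments are \<open>v\<close> times the increments of
  \<open>exp (- N s)\<close>.\<close>

definition entropy_flux :: "real => real => real => real" where
 "entropy_flux k N s = (LBINT r=0..s. entropy_density k N r)"

lemma entropy_density_continuous:
 assumes "k > 0" shows "continuous_on S (entropy_density k N)"
 unfolding entropy_density_def[abs_def] using assms by (intro continuous_intros continuous_on_powr') auto

lemma entropy_flux_deriv:
 assumes "k > 0" shows "(entropy_flux k N has_real_derivative entropy_density k N s) (at s)"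
proof -
 \<comment> \<open>An interval with 0 and \<open>s\<close> in its range and \<open>s\<close> in its
   interior, whatever the sign of \<open>s\<close>.\<close>
 define a b where "a = min 0 s - 1" and "b = max 0 s + 1"
 have ab: "a <= 0" "0 <= b" "a < s" "s < b" by (auto simp: a_def b_def)
 have "((%u. LBINT r=0..u. entropy_density k N r) has_vector_derivative entropy_density k N s) (at s within {a..b})"
  using interval_integral_FTC2[of a 0 b "entropy_density k N" s] ab entropy_density_continuous[OF assms] by (simp add: zero_ereal_def)
 then have "((%u. LBINT r=0..u. entropy_density k N r) has_vector_derivative entropy_density k N s) (at s)"
  using ab at_within_Icc_at[of a s b] by simp
 then show ?thesis unfolding entropy_flux_def[abs_def] by (simp add: has_real_derivative_iff_has_vector_derivative)
qed

lemma entropy_flux_0: "entropy_flux k N 0 = 0"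
 by (simp add: entropy_flux_def zero_ereal_def)

lemma powr_inverse_le: "r >= 0 ==> k >= 1 ==> r powr (1 / k) <= 1 + (r::real)"
proof -
 assume r: "r >= 0" and k: "k >= 1"
 show ?thesis
 proof (cases "r <= 1")
  case True
  then have "r powr (1 / k) <= 1" using r k by (intro powr_le1) auto
  then show ?thesis using r by simp
 next
  case False
  then have "r powr (1 / k) <= r powr 1" using k by (intro powr_mono) auto
  then show ?thesis using r by simp
 qed
qed

text \<open>The bounds are uniform in \<open>k\<close>, so they can serve as dominating constants
  when \<open>k\<close> tends to infinity.\<close>

lemma entropy_flux_bounds:
 assumes k: "k >= 1" and N: "N > 0" and s: "s >= 0"
 shows "entropy_flux k N s <= 0" "entropy_flux k N s >= - (1 + 1 / N)"
proof -
 have k0: "k > 0" using k by simp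
 have d: "(entropy_flux k N has_real_derivative entropy_density k N x) (at x)" for x by (rule entropy_flux_deriv[OF k0])
 have "entropy_flux k N s <= entropy_flux k N 0"
  by (rule DERIV_nonpos_imp_nonincreasing[OF s])
    (use d N in \<open>auto simp: entropy_density_def intro!: exI[of _ "entropy_density k N _"]\<close>)
 then show "entropy_flux k N s <= 0" by (simp add: entropy_flux_0)
 \<comment> \<open>Comparison with \<open>(1 + s + 1 / N) exp (- N s)\<close>, whose derivative is
   \<open>- N (1 + s) exp (- N s)\<close>; this lies below the density because
   \<open>s powr (1 / k)\<close> is at most \<open>1 + s\<close>.\<close>
 define P where "P s = entropy_flux k N s - (1 + s + 1 / N) * exp (- N * s)" for s
 have "P 0 <= P s"
 proof (rule DERIV_nonneg_imp_nondecreasing[OF s])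
  fix x assume x: "0 <= x" "x <= s"
  have "(P has_real_derivative (entropy_density k N x + N * (1 + x) * exp (- N * x))) (at x)"
   unfolding P_def[abs_def] using N
   by (auto intro!: derivative_eq_intros d simp: field_simps)
  moreover have "x powr (1 / k) * (N * exp (- N * x)) <= (1 + x) * (N * exp (- N * x))"
   using powr_inverse_le[OF x(1) k] N by (intro mult_right_mono) auto
  then have "entropy_density k N x + N * (1 + x) * exp (- N * x) >= 0"
   using x(1) by (simp add: entropy_density_def algebra_simps)
  ultimately show "\<exists>y. (P has_real_derivative y) (at x) & 0 <= y" by blast
 qed
 moreover have "(1 + s + 1 / N) * exp (- N * s) >= 0" using N s by simp
 ultimately show "entropy_flux k N s >= - (1 + 1 / N)" by (simp add: P_def entropy_flux_0)
qed

text \<open>Uniform in \<open>k\<close>: the root is at most \<open>1 + r\<close>, and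
  \<open>x exp (- x) \<le> 1\<close> with \<open>x = N r\<close> absorbs the growing part.\<close>

lemma entropy_density_bound:
 assumes k: "k >= 1" and N: "N > 0"
 shows "\<bar>entropy_density k N r\<bar> <= N * exp (- N * r) + 1 \<or> r < 0" "r >= 0 ==> \<bar>entropy_density k N r\<bar> <= N + 1"
proof -
 have *: "\<bar>entropy_density k N r\<bar> <= N * exp (- N * r) + 1" if r: "r >= 0"
 proof -
  have "\<bar>entropy_density k N r\<bar> = r powr (1 / k) * (N * exp (- N * r))" using r N by (simp add: entropy_density_def abs_mult)
  also have "\<dots> <= (1 + r) * (N * exp (- N * r))"
   using powr_inverse_le[OF r k] N by (intro mult_right_mono) auto
  also have "\<dots> = N * exp (- N * r) + (N * r) * exp (- (N * r))" by (simp add: algebra_simps)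
  also have "(N * r) * exp (- (N * r)) <= exp (N * r) * exp (- (N * r))"
   using exp_ge_add_one_self[of "N * r"] by (intro mult_right_mono) (auto intro: order_trans[of _ "1 + N * r"])
  also have "\<dots> = 1" by (simp add: exp_minus)
  finally show ?thesis by simp
 qed
 then show "\<bar>entropy_density k N r\<bar> <= N * exp (- N * r) + 1 \<or> r < 0" by linarith
 assume r: "r >= 0"
 have "N * exp (- N * r) <= N * 1" using r N by (intro mult_left_mono) auto
 then show "\<bar>entropy_density k N r\<bar> <= N + 1" using *[OF r] by simp
qed

text \<open>As a function of \<open>s\<close>, \<open>v exp (- N s) - entropy_flux k N s\<close> has
  derivative \<open>(s powr (1 / k) - v) N exp (- N s)\<close>, hence its minimum at
  \<open>s = v powr k\<close>. Here \<open>v\<close> will be the initial datum and \<open>w\<close>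
  the value of a mollified \<open>v^k\<close> at time 0.\<close>

lemma entropy_minimal:
 assumes k: "k > 0" and N: "N > 0" and v: "v >= 0" and w: "w >= 0"
 shows "v * exp (- N * v powr k) - entropy_flux k N (v powr k) <= v * exp (- N * w) - entropy_flux k N w"
proof -
 define q where "q s = v * exp (- N * s) - entropy_flux k N s" for s
 have d: "(q has_real_derivative ((s powr (1 / k) - v) * (N * exp (- N * s)))) (at s)" if "s >= 0" for s
  unfolding q_def[abs_def] using that
  by (auto intro!: derivative_eq_intros entropy_flux_deriv[OF k] simp: entropy_density_def algebra_simps)
 define s0 where "s0 = v powr k"
 have s0: "s0 >= 0" "s0 powr (1 / k) = v" using k v by (auto simp: s0_def powr_powr)
 have "q s0 <= q w"
 proof (cases "w >= s0")
  case True
  show ?thesis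
  proof (rule DERIV_nonneg_imp_nondecreasing[OF True])
   fix x assume x: "s0 <= x" "x <= w"
   have "v <= x powr (1 / k)" unfolding s0(2)[symmetric] using x s0 k by (intro powr_mono2) auto
   then have "(x powr (1 / k) - v) * (N * exp (- N * x)) >= 0" using N by simp
   then show "\<exists>y. (q has_real_derivative y) (at x) & 0 <= y" using d[of x] x s0 by force
  qed
 next
  case False
  then have "w <= s0" by simp
  then show ?thesis
  proof (rule DERIV_nonpos_imp_nonincreasing)
   fix x assume x: "w <= x" "x <= s0"
   have "x powr (1 / k) <= v" unfolding s0(2)[symmetric] using x w k by (intro powr_mono2) auto
   then have "(x powr (1 / k) - v) * (N * exp (- N * x)) <= 0" using N by (simp add: mult_nonpos_nonneg)
   then show "\<exists>y. (q has_real_derivative y) (at x) & y <= 0" using d[of x] x w by force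
  qed
 qed
 then show ?thesis by (simp add: q_def s0_def)
qed

text \<open>For \<open>v > 1\<close> the power \<open>v powr k\<close> is at least \<open>v\<close>,
  so \<open>x exp (- x) \<le> 1\<close> with \<open>x = N v\<close> again gives a bound uniform in
  \<open>k\<close>.\<close>

lemma entropy_linear_bound:
 fixes k N v :: real
 assumes k: "k >= 1" and N: "N > 0" and v: "v >= 0"
 shows "v * exp (- N * v powr k) <= 1 + 1 / N"
proof (cases "v <= 1")
 case True
 have "v * exp (- N * v powr k) <= 1 * 1" using v True N by (intro mult_mono) auto
 then show ?thesis using N by (simp add: add_increasing2)
next
 case False
 have "v powr 1 <= v powr k" using False k by (intro powr_mono) auto
 then have "exp (- N * v powr k) <= exp (- N * v)" using N v by simp
 then have "v * exp (- N * v powr k) <= v * exp (- N * v)" using v by (intro mult_left_mono) auto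
 also have "\<dots> = 1 / N * ((N * v) * exp (- (N * v)))" using N by simp
 also have "\<dots> <= 1 / N * (exp (N * v) * exp (- (N * v)))"
  using exp_ge_add_one_self[of "N * v"] N by (intro mult_left_mono mult_right_mono) (auto intro: order_trans[of _ "1 + N * v"])
 also have "\<dots> = 1 / N" by (simp add: exp_minus)
 finally show ?thesis by simp
qed

section \<open>Closure properties of square-integrable and of C1 functions\<close>

lemma square_int_add:
 assumes "square_int u" "square_int v" shows "square_int (%z. u z + v z)"
proof -
 have "square_int (%z. - v z)" using assms(2) by (auto simp: square_int_def)
 from square_int_diff[OF assms(1) this] show ?thesis by simp
qed

lemma square_int_scale: "square_int u ==> square_int (%z. (c::real) *. u z)"
 by (auto simp: square_int_def power_mult_distrib)

lemma square_int_norm: "square_int u ==> square_int (%z. norm (u z))"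
 by (auto simp: square_int_def)

lemma square_int_cball: "square_int (ind (cball 0 r) :: 'a::euclidean_space => real)"
 unfolding square_int_def using lborel_bounded_finite[OF bounded_cball, of "0::'a" r]
 by (auto simp: integrable_indicator_iff power2_eq_square indicator_inter_arith[symmetric] intro!: borel_measurable_indicator)

lemma square_int_bound:
 assumes "square_int u" "v \<in> borel_fun" "!!z. norm (v z) <= norm (u z)"
 shows "square_int v"
 using assms unfolding square_int_def
 by (auto intro!: Bochner_Integration.integrable_bound[of lborel "%z. (norm (u z))\<^sup>2"] power_mono)

lemma C1_compose:
 assumes "C1_with U D" and g: "!!s. (g has_real_derivative g' s) (at s)" and "continuous_on UNIV g'"
 shows "C1_with (%z. g (U z)) (%z. g' (U z) *. D z)"
 unfolding C1_with_def
proof (intro conjI allI)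
 fix z
 have "(U has_derivative (%v. D z \<bullet> v)) (at z)" using assms(1) unfolding C1_with_def by blast
 from DERIV_compose_FDERIV[OF g this]
 show "((%z. g (U z)) has_derivative (%v. (g' (U z) *. D z) \<bullet> v)) (at z)" by (simp add: mult.commute)
 show "continuous_on UNIV (%z. g' (U z) *. D z)"
  using assms(1) C1_with_continuous[OF assms(1)]
  by (intro continuous_intros continuous_on_compose2[OF assms(3)]) (auto simp: C1_with_def)
qed

lemma C1_mult:
 assumes "C1_with f D" "C1_with g E"
 shows "C1_with (%z. f z * g z) (%z. f z *. E z + g z *. D z)"
 unfolding C1_with_def
proof (intro conjI allI)
 fix z
 have "(f has_derivative (%v. D z \<bullet> v)) (at z)" "(g has_derivative (%v. E z \<bullet> v)) (at z)"
  using assms unfolding C1_with_def by blast+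
 from has_derivative_mult[OF this]
 show "((%z. f z * g z) has_derivative (%v. (f z *. E z + g z *. D z) \<bullet> v)) (at z)"
  by (rule has_derivative_eq_rhs) (simp add: fun_eq_iff inner_add_left algebra_simps)
 show "continuous_on UNIV (%z. f z *. E z + g z *. D z)"
  using assms C1_with_continuous[OF assms(1)] C1_with_continuous[OF assms(2)]
  by (intro continuous_intros) (auto simp: C1_with_def)
qed

text \<open>Compactness leaves a gap before \<open>T\<close>. It covers the margin in which the
  mollified gradient may differ from the gradient of the mollified function.\<close>

lemma test_function_time_support:
 fixes \<phi> :: "(real^'n) \<times> real => real"
 assumes "compact (closure {z. \<phi> z ~= 0})" "closure {z. \<phi> z ~= 0} \<subseteq> UNIV \<times> {..<T}"
 obtains \<eta> where "\<eta> > 0" "!!z. snd z > T - \<eta> ==> \<phi> z = 0"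
proof (cases "{z. \<phi> z ~= 0} = {}")
 case True then show thesis by (intro that[of 1]) auto
next
 case False
 then have ne: "closure {z. \<phi> z ~= 0} ~= {}" by simp
 have "continuous_on (closure {z. \<phi> z ~= 0}) snd" by (intro continuous_intros)
 from continuous_attains_sup[OF assms(1) ne this]
 obtain z0 where z0: "z0 \<in> closure {z. \<phi> z ~= 0}" "!!z. z \<in> closure {z. \<phi> z ~= 0} ==> snd z <= snd z0" by blast
 show thesis
 proof (rule that[of "T - snd z0"])
  show "T - snd z0 > 0" using z0(1) assms(2) by (auto simp: mem_Times_iff dest!: subsetD)
  fix z :: "(real^'n) \<times> real" assume z: "snd z > T - (T - snd z0)"
  show "\<phi> z = 0"
  proof (rule ccontr)
   assume "\<phi> z ~= 0"
   then have "z \<in> closure {z. \<phi> z ~= 0}" using closure_subset[of "{z. \<phi> z ~= 0}"] by auto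
   from z0(2)[OF this] z show False by simp
  qed
 qed
qed

section \<open>Coefficients extended by zero and their bounds\<close>

locale congested_data =
 fixes T \<delta> :: real and m f :: "(real^'n) \<times> real => real" and b :: "(real^'n) \<times> real => real^'n"
 assumes T: "T > 0" and \<delta>: "\<delta> > 0" and data: "data_assumption T \<delta> m f b"
  and congestion: "congestion_condition T m f b"
begin

text \<open>The coefficients are set to 0 outside the slab, so that integrals over it become
  integrals over all of space-time.\<close>

definition mQ :: "(real^'n) \<times> real => real" where "mQ z = ind (QT T) z * m z"
definition fQ :: "(real^'n) \<times> real => real" where "fQ z = ind (QT T) z * f z"
text \<open>The space-time direction with \<open>grad \<phi> \<bullet> \<beta>\<close> equal to
  \<open>b\<close> paired with the space gradient minus the time derivative; it is opposite to the
  space-time velocity of the streamlines.\<close>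

definition \<beta> :: "(real^'n) \<times> real => (real^'n) \<times> real" where "\<beta> z = ind (QT T) z *. (b z, -1)"
text \<open>The slack in the congestion condition.\<close>

definition EQ :: "(real^'n) \<times> real => real" where
 "EQ z = ind (QT T) z * (m z * f z + div_x (%y. m y *. b y) z - deriv_t m z)"

lemma smooth: "smooth_bounded T m" "smooth_bounded T f" "smooth_bounded T b"
 using data by (auto simp: data_assumption_def)

lemma off_QT: "z \<notin> QT T ==> mQ z = 0" "z \<notin> QT T ==> fQ z = 0" "z \<notin> QT T ==> \<beta> z = 0" "z \<notin> QT T ==> EQ z = 0"
 by (auto simp: mQ_def fQ_def \<beta>_def EQ_def zero_prod_def)

lemma EQ_pos: "z \<in> QT T ==> EQ z > 0"
 using congestion by (auto simp: EQ_def congestion_condition_def)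

lemma EQ_nonneg: "EQ z >= 0"
 using EQ_pos[of z] off_QT(4)[of z] by (cases "z \<in> QT T") auto

lemma mQ_pos: "z \<in> QT T ==> mQ z >= \<delta>"
 using data by (auto simp: mQ_def data_assumption_def)

lemma mQ_nonneg: "mQ z >= 0"
 using mQ_pos[of z] \<delta> off_QT(1)[of z] by (cases "z \<in> QT T") auto

text \<open>The lower bound is assumed in the open slab; it reaches \<open>t = 0\<close> through the
  continuity that \<open>smooth_bounded\<close> includes.\<close>

lemma m_initial: "m (x, 0) >= \<delta>" "continuous_on UNIV (%x. m (x, 0))"
proof -
 have c: "continuous_on (UNIV \<times> {0..T}) m" using smooth by (simp add: smooth_bounded_def)
 show "continuous_on UNIV (%x. m (x, 0))"
  by (rule continuous_on_compose2[OF c]) (use T in \<open>auto intro!: continuous_intros\<close>)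
 have l: "((%t. m (x, t)) \<longlongrightarrow> m (x, 0)) (at 0 within {0..T})"
 proof -
  have "continuous_on {0..T} (%t. m (x, t))"
   by (rule continuous_on_compose2[OF c]) (auto intro!: continuous_intros)
  then show ?thesis using T by (simp add: continuous_on)
 qed
 have "\<forall>\<^sub>F t in at 0 within {0..T}. t \<in> {0<..<T}"
  unfolding eventually_at by (rule exI[of _ T]) (use T in \<open>auto simp: dist_real_def\<close>)
 then have "\<forall>\<^sub>F t in at 0 within {0..T}. \<delta> <= m (x, t)"
  by eventually_elim (use data in \<open>auto simp: data_assumption_def QT_iff\<close>)
 moreover have "at 0 within {0..T} ~= bot"
  using T by (simp add: at_within_Icc_at_right trivial_limit_at_right_real)
 ultimately show "m (x, 0) >= \<delta>" by (intro tendsto_lowerbound[OF l])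
qed

lemma coeffs:
 obtains B where "B > 0" "!!z. mQ z <= B" "!!z. \<bar>fQ z\<bar> <= B" "!!z. norm (\<beta> z) <= B" "!!z. EQ z <= B"
  and "mQ \<in> borel_fun" "fQ \<in> borel_fun" "\<beta> \<in> borel_fun" "EQ \<in> borel_fun"
  and "!!x. m (x, 0) <= B"
proof -
 obtain Bm where Bm: "Bm > 0" "!!z. z \<in> QT T ==> norm (m z) <= Bm"
  "!!z v. z \<in> QT T ==> norm (frechet_derivative m (at z) v) <= Bm * norm v"
  "!!z. z \<in> QT T ==> (m has_derivative frechet_derivative m (at z)) (at z)"
  "continuous_on (QT T) m" "!!v. continuous_on (QT T) (%z. frechet_derivative m (at z) v)"
  using smooth_boundedD[OF smooth(1)] by blast
 obtain Bf where Bf: "Bf > 0" "!!z. z \<in> QT T ==> norm (f z) <= Bf"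
  "!!z v. z \<in> QT T ==> norm (frechet_derivative f (at z) v) <= Bf * norm v"
  "!!z. z \<in> QT T ==> (f has_derivative frechet_derivative f (at z)) (at z)"
  "continuous_on (QT T) f" "!!v. continuous_on (QT T) (%z. frechet_derivative f (at z) v)"
  using smooth_boundedD[OF smooth(2)] by blast
 obtain Bb where Bb: "Bb > 0" "!!z. z \<in> QT T ==> norm (b z) <= Bb"
  "!!z v. z \<in> QT T ==> norm (frechet_derivative b (at z) v) <= Bb * norm v"
  "!!z. z \<in> QT T ==> (b has_derivative frechet_derivative b (at z)) (at z)"
  "continuous_on (QT T) b" "!!v. continuous_on (QT T) (%z. frechet_derivative b (at z) v)"
  using smooth_boundedD[OF smooth(3)] by blast
 define c where "c = real CARD('n)"
 \<comment> \<open>One constant for all coefficients. The first two products plus one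
   \<open>Bm\<close> bound \<open>EQ\<close>: the source, the product rule for the divergence summed
   over \<open>c\<close> coordinates, and the time derivative. \<open>Bb + 1\<close> bounds
   \<open>\<beta>\<close>.\<close>
 define B where "B = Bm * Bf + c * (2 * Bm * Bb) + 2 * Bm + Bf + Bb + 1"
 have nn: "Bm * Bf >= 0" "c * (2 * Bm * Bb) >= 0" using Bm(1) Bf(1) Bb(1) by (auto simp: c_def)
 have big: "Bm <= B" "Bf <= B" "Bb + 1 <= B" "Bm * Bf + c * (2 * Bm * Bb) + Bm <= B" "B > 0"
  unfolding B_def using nn Bm(1) Bf(1) Bb(1) by linarith+
 have mb: "((%y. m y *. b y) has_derivative
   (%v. m z *. frechet_derivative b (at z) v + frechet_derivative m (at z) v *. b z)) (at z)" if "z \<in> QT T" for z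
  by (rule has_derivative_scaleR[OF Bm(4)[OF that] Bb(4)[OF that]])
 define E where "E z = m z * f z + (\<Sum>i\<in>UNIV. (m z *. frechet_derivative b (at z) (axis i 1, 0) + frechet_derivative m (at z) (axis i 1, 0) *. b z) $ i)
   - frechet_derivative m (at z) (0, 1)" for z
 have EE: "EQ z = ind (QT T) z * E z" for z
  using div_x_eq[OF mb[of z]] deriv_t_eq[OF Bm(4)[of z]] by (cases "z \<in> QT T") (auto simp: EQ_def E_def)
 have Eb: "\<bar>E z\<bar> <= B" if z: "z \<in> QT T" for z
 proof -
  have 1: "\<bar>m z * f z\<bar> <= Bm * Bf" unfolding abs_mult using Bm(1) Bm(2)[OF z] Bf(2)[OF z] by (intro mult_mono) auto
  have 3: "\<bar>frechet_derivative m (at z) (0, 1)\<bar> <= Bm" using Bm(3)[OF z, of "(0, 1)"] by (simp add: norm_Pair)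
  have 2: "\<bar>\<Sum>i\<in>UNIV. (m z *. frechet_derivative b (at z) (axis i 1, 0) + frechet_derivative m (at z) (axis i 1, 0) *. b z) $ i\<bar>
    <= (\<Sum>i\<in>(UNIV::'n set). 2 * Bm * Bb)"
  proof (rule order_trans[OF sum_abs sum_mono])
   fix i :: 'n
   have n1: "norm (axis i 1 :: real^'n, 0::real) = 1" by (simp add: norm_Pair)
   have a: "norm (m z *. frechet_derivative b (at z) (axis i 1, 0)) <= Bm * Bb"
    unfolding norm_scaleR using Bm(1) Bm(2)[OF z] Bb(3)[OF z, of "(axis i 1, 0)"] unfolding n1 by (intro mult_mono) auto
   have b: "norm (frechet_derivative m (at z) (axis i 1, 0) *. b z) <= Bm * Bb"
    unfolding norm_scaleR using Bm(1) Bm(3)[OF z, of "(axis i 1, 0)"] Bb(2)[OF z] unfolding n1 by (intro mult_mono) auto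
   show "\<bar>(m z *. frechet_derivative b (at z) (axis i 1, 0) + frechet_derivative m (at z) (axis i 1, 0) *. b z) $ i\<bar> <= 2 * Bm * Bb"
    by (rule order_trans[OF component_le_norm_cart order_trans[OF norm_triangle_ineq]]) (use a b in simp)
  qed
  have "\<bar>E z\<bar> <= Bm * Bf + c * (2 * Bm * Bb) + Bm"
   unfolding E_def using 1 2 3 by (simp add: c_def)
  then show ?thesis using big(4) by linarith
 qed
 have Ec: "continuous_on (QT T) E" unfolding E_def[abs_def]
  by (intro continuous_intros Bm(5,6) Bf(5) Bb(5,6))
 have mc: "continuous_on UNIV (%x. m (x, 0))" by (rule m_initial)
 have Bmb: "m (x, t) <= Bm" if "0 < t" "t < T" for x t using Bm(2)[of "(x, t)"] that by (auto simp: QT_iff)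
 have m0: "m (x, 0) <= Bm" for x
 proof -
  have c: "continuous_on (UNIV \<times> {0..T}) m" using smooth by (simp add: smooth_bounded_def)
  have "continuous_on {0..T} (%t. m (x, t))"
   by (rule continuous_on_compose2[OF c]) (auto intro!: continuous_intros)
  then have l: "((%t. m (x, t)) \<longlongrightarrow> m (x, 0)) (at 0 within {0..T})" using T by (simp add: continuous_on)
  have "\<forall>\<^sub>F t in at 0 within {0..T}. t \<in> {0<..<T}"
   unfolding eventually_at by (rule exI[of _ T]) (use T in \<open>auto simp: dist_real_def\<close>)
  then have "\<forall>\<^sub>F t in at 0 within {0..T}. m (x, t) <= Bm" by eventually_elim (use Bmb in auto)
  moreover have "at 0 within {0..T} ~= bot"
   using T by (simp add: at_within_Icc_at_right trivial_limit_at_right_real)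
  ultimately show ?thesis by (intro tendsto_upperbound[OF l])
 qed
 show thesis
 proof (rule that[of B])
  show "B > 0" by (rule big)
  show "mQ z <= B" for z using Bm(2)[of z] big by (auto simp: mQ_def indicator_def)
  show "\<bar>fQ z\<bar> <= B" for z using Bf(2)[of z] big by (auto simp: fQ_def indicator_def)
  show "norm (\<beta> z) <= B" for z
  proof (cases "z \<in> QT T")
   case True
   have "norm (b z, -1::real) <= norm (b z) + norm (-1::real)" by (rule norm_Pair_le)
   then show ?thesis using True Bb(2)[OF True] big by (simp add: \<beta>_def)
  qed (use big in \<open>auto simp: \<beta>_def\<close>)
  show "EQ z <= B" for z using Eb[of z] big by (auto simp: EE indicator_def abs_le_iff)
  show "m (x, 0) <= B" for x using m0[of x] big by simp
  show "mQ \<in> borel_fun" using borel_indicator_continuous[OF Bm(5)] by (simp add: mQ_def[abs_def])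
  show "fQ \<in> borel_fun" using borel_indicator_continuous[OF Bf(5)] by (simp add: fQ_def[abs_def])
  show "EQ \<in> borel_fun" using borel_indicator_continuous[OF Ec] by (simp add: EE[abs_def])
  have "continuous_on (QT T) (%z. (b z, -1::real))" by (intro continuous_intros Bb(5))
  from borel_indicator_continuous[OF this] show "\<beta> \<in> borel_fun" by (simp add: \<beta>_def[abs_def])
 qed
qed

lemma transport:
 assumes "C1_with h D" "vanishes_beyond R h" "!!x. h (x, T) = 0"
 shows "(LBINT z. mQ z * (D z \<bullet> \<beta> z) + h z * (EQ z - fQ z * mQ z)) = (LBINT x. h (x, 0) * m (x, 0))"
proof -
 have "mQ z * (D z \<bullet> \<beta> z) + h z * (EQ z - fQ z * mQ z) =
  ind (QT T) z * (m z * (D z \<bullet> (b z, -1)) + h z * (div_x (%y. m y *. b y) z - deriv_t m z))" for z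
  by (cases "z \<in> QT T") (auto simp: mQ_def fQ_def \<beta>_def EQ_def algebra_simps)
 then show ?thesis using transport_integration_by_parts[OF T smooth(1,3) assms] by simp
qed

end

lemma loc_int_bounded:
 fixes g :: "'a::euclidean_space => 'b::euclidean_space"
 assumes "g \<in> borel_fun" "!!z. norm (g z) <= B"
 shows "loc_int g"
 unfolding loc_int_def set_integrable_def
proof (intro conjI allI assms(1))
 fix r :: real
 have [measurable]: "cball (0::'a) r \<in> sets borel" by simp
 have B: "B >= 0" by (rule order_trans[OF norm_ge_zero assms(2)])
 show "integrable lborel (%x. ind (cball 0 r) x *. g x)"
  by (rule integrable_bounded_support[where B=B and R=r])
    (use assms B in \<open>auto simp: indicator_def\<close>)
qed

lemma loc_int_scale_bounded:
 fixes a :: "'a::euclidean_space => real" and g :: "'a => 'b::euclidean_space"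
 assumes a: "a \<in> borel_fun" "!!z. \<bar>a z\<bar> <= B" and g: "loc_int g"
 shows "loc_int (%z. a z *. g z)"
 unfolding loc_int_def set_integrable_def
proof (intro conjI allI)
 note [measurable] = a(1) loc_int_borel[OF g]
 show "(%z. a z *. g z) \<in> borel_fun" by measurable
 fix r :: real
 have [measurable]: "cball (0::'a) r \<in> sets borel" by simp
 have i: "integrable lborel (%x. B * (ind (cball 0 r) x * norm (g x)))"
  using loc_int_norm[OF g] by simp
 show "integrable lborel (%x. ind (cball 0 r) x *. a x *. g x)"
  by (rule Bochner_Integration.integrable_bound[OF i])
    (use a(2) in \<open>auto simp: indicator_def intro!: AE_I2 order_trans[OF mult_right_mono[OF a(2)] abs_ge_self]\<close>)
qed

lemma loc_int_add:
 assumes "loc_int g" "loc_int h" shows "loc_int (%z. g z + h z)"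
 using assms unfolding loc_int_def set_integrable_def by (auto simp: scaleR_add_right)

lemma Pair0_borel [measurable]:
 "(%x::'a::euclidean_space. (x, 0::'b::euclidean_space)) \<in> borel_fun"
 by (intro borel_measurable_continuous_onI continuous_intros)

section \<open>The entropy inequality for one exponent\<close>

text \<open>The weak formulation is tested with \<open>\<phi> g (U j)\<close> and the transport
  identity of \<open>m\<close> with \<open>\<phi> H (U j)\<close>, where \<open>U j\<close>
  mollifies \<open>u = v^k\<close>; the two are subtracted. The terms with a gradient of
  \<open>U j\<close> are collected in \<open>I2\<close>, whose limit is nonpositive. The one
  remaining gradient of \<open>u\<close>, paired with that of \<open>\<phi>\<close>, is moved onto
  \<open>\<phi>\<close> by means of the antiderivative \<open>\<Gamma>\<close> of
  \<open>g\<close>.\<close>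

lemma (in congested_data) entropy_inequality:
 fixes v :: "(real^'n) \<times> real => real"
 assumes k: "k >= 1" and N: "N > 0"
  and v: "square_int v" "!!z. v z >= 0" and u: "square_int (%z. v z powr k)"
  and G: "square_int G"
  and wg: "!!\<phi>. test_function (QT T) \<phi> ==> (LBINT z. v z powr k *. grad \<phi> z) = - (LBINT z. \<phi> z *. G z)"
  and v0: "loc_int v0" "!!x. v0 x >= 0"
  and weak: "!!\<phi>. test_function (UNIV \<times> {..<T}) \<phi> ==>
    (LBINT z. mQ z * v z * (grad \<phi> z \<bullet> \<beta> z) - fQ z * mQ z * v z * \<phi> z + mQ z * (fst (grad \<phi> z) \<bullet> fst (G z)))
    = (LBINT x. \<phi> (x, 0) * (m (x, 0) * v0 x))"
  and \<phi>: "test_function (UNIV \<times> {..<T}) \<phi>" "!!z. \<phi> z >= 0"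
 shows "(LBINT x. \<phi> (x, 0) * m (x, 0) * (v0 x * exp (- N * v0 x powr k) - entropy_flux k N (v0 x powr k)))
  <= (LBINT z. mQ z * (v z * exp (- N * v z powr k) - entropy_flux k N (v z powr k)) * (grad \<phi> z \<bullet> \<beta> z - fQ z * \<phi> z)
    - \<phi> z * entropy_flux k N (v z powr k) * EQ z
    - (1 - exp (- N * v z powr k)) / N * (ind (QT T) z * div_x (%y. m y *. grad_x \<phi> y) z))"
proof -
 define u where "u z = v z powr k" for z
 define g where "g s = exp (- N * s)" for s
 define H where "H = entropy_flux k N"
 define h where "h = entropy_density k N"
 \<comment> \<open>The antiderivative of \<open>g\<close> vanishing at 0. Its size
   \<open>1 / N\<close> makes the diffusion term disappear as \<open>N\<close> grows.\<close>
 define \<Gamma> where "\<Gamma> s = (1 - exp (- N * s)) / N" for s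
 define W where "W z = ind (QT T) z * div_x (%y. m y *. grad_x \<phi> y) z" for z
 have k0: "k > 0" using k by simp
 have vm [measurable]: "v \<in> borel_fun" using v by (simp add: square_int_def)
 have um [measurable]: "u \<in> borel_fun" unfolding u_def by measurable
 have Gm [measurable]: "G \<in> borel_fun" using G by (simp add: square_int_def)
 have [measurable]: "G \<in> borel \<rightarrow>\<^sub>M borel \<Otimes>\<^sub>M borel" using Gm by (simp add: borel_prod)
 have v0m [measurable]: "v0 \<in> borel_fun" using v0 by (simp add: loc_int_def)
 have u0: "u z >= 0" for z by (simp add: u_def)
 obtain B where B: "B > 0" "!!z. mQ z <= B" "!!z. \<bar>fQ z\<bar> <= B" "!!z. norm (\<beta> z) <= B" "!!z. EQ z <= B"
  and cm [measurable]: "mQ \<in> borel_fun" "fQ \<in> borel_fun" "\<beta> \<in> borel_fun" "EQ \<in> borel_fun"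
  and B0: "!!x. m (x, 0) <= B" by (rule coeffs) blast
 have m0: "continuous_on UNIV (%x. m (x, 0))" "!!x. m (x, 0) >= 0"
  using m_initial \<delta> by (auto intro: order_trans less_imp_le)
 have m0m [measurable]: "(%x. m (x, 0)) \<in> borel_fun" using m0(1) by (rule borel_measurable_continuous_onI)
 have abm: "\<bar>mQ z\<bar> <= B" for z using mQ_nonneg B(2) by simp
 have gd: "(g has_real_derivative - N * g s) (at s)" for s unfolding g_def[abs_def] by (auto intro!: derivative_eq_intros)
 have Hd: "(H has_real_derivative h s) (at s)" for s unfolding H_def h_def by (rule entropy_flux_deriv[OF k0])
 have \<Gamma>d: "(\<Gamma> has_real_derivative g s) (at s)" for s unfolding \<Gamma>_def[abs_def] g_def using N by (auto intro!: derivative_eq_intros)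
 have gc: "continuous_on UNIV g" unfolding g_def[abs_def] by (intro continuous_intros)
 have hc: "continuous_on UNIV h" unfolding h_def by (rule entropy_density_continuous[OF k0])
 have Hc: "continuous_on UNIV H" by (intro continuous_at_imp_continuous_on ballI DERIV_isCont[OF Hd])
 have \<Gamma>c: "continuous_on UNIV \<Gamma>" by (intro continuous_at_imp_continuous_on ballI DERIV_isCont[OF \<Gamma>d])
 note [measurable] = borel_measurable_continuous_onI[OF gc] borel_measurable_continuous_onI[OF hc]
  borel_measurable_continuous_onI[OF Hc] borel_measurable_continuous_onI[OF \<Gamma>c]
 have gb: "0 <= g s" "s >= 0 ==> g s <= 1" for s using N by (auto simp: g_def)
 have Hb: "\<bar>H s\<bar> <= 1 + 1 / N" if "s >= 0" for s
  using entropy_flux_bounds[OF k N that] by (simp add: H_def)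
 have hb: "\<bar>h s\<bar> <= N + 1" if "s >= 0" for s using entropy_density_bound(2)[OF k N that] by (simp add: h_def)
 have \<Gamma>b: "\<bar>\<Gamma> s\<bar> <= 1 / N" if "s >= 0" for s using gb(2)[OF that] gb(1)[of s] N by (simp add: \<Gamma>_def g_def divide_right_mono)
 \<comment> \<open>The identity for which the density was designed; it will cancel the drift part of
   \<open>I2\<close> in the limit.\<close>
 have hu: "h (u z) = - N * g (u z) * v z" for z
  using v(2)[of z] k0 by (simp add: h_def entropy_density_def u_def powr_powr g_def)
 have \<phi>s: "smooth_on UNIV \<phi>" and \<phi>c: "compact (closure {z. \<phi> z ~= 0})" and \<phi>S: "closure {z. \<phi> z ~= 0} \<subseteq> UNIV \<times> {..<T}"
  using \<phi>(1) by (auto simp: test_function_def)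
 obtain R where R: "R > 0" "vanishes_beyond R \<phi>" using compact_support_vanishes[OF \<phi>c] by blast
 obtain \<eta> where \<eta>: "\<eta> > 0" "!!z. snd z > T - \<eta> ==> \<phi> z = 0" using test_function_time_support[OF \<phi>c \<phi>S] by blast
 have \<phi>C: "C1_with \<phi> (grad \<phi>)" by (rule smooth_imp_C1[OF \<phi>s])
 have gv: "vanishes_beyond R (grad \<phi>)" by (rule C1_with_support[OF \<phi>C R(2)])
 note [measurable] = C1_with_borel[OF \<phi>C]
 have [measurable]: "grad \<phi> \<in> borel \<rightarrow>\<^sub>M borel \<Otimes>\<^sub>M borel" using C1_with_borel(2)[OF \<phi>C] by (simp add: borel_prod)
 have g\<eta>: "grad \<phi> z = 0" if z: "snd z > T - \<eta>" for z
 proof -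
  have o: "open {z::(real^'n) \<times> real. snd z > T - \<eta>}" by (intro open_Collect_less continuous_intros)
  have "(\<phi> has_derivative (%v. 0)) (at z)"
   by (rule has_derivative_transform_within_open[OF has_derivative_const[of 0 "at z"] o]) (use z \<eta> in auto)
  then show ?thesis using frechet_eq_grad(2)[of \<phi> 0 z] by simp
 qed
 obtain B\<phi> where B\<phi>: "B\<phi> > 0" "!!z. \<bar>\<phi> z\<bar> <= B\<phi>" "!!z. norm (grad \<phi> z) <= B\<phi>"
  using C1_bounded_support_bounds[OF \<phi>C R(2)] by blast
 obtain C where W: "W \<in> borel_fun" "!!z. z \<in> QT T ==> \<bar>div_x (%y. m y *. grad_x \<phi> y) z\<bar> <= C"
  "!!z. z \<in> QT T ==> norm z > R ==> div_x (%y. m y *. grad_x \<phi> y) z = 0"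
  "!!h D. C1_with h D ==> (LBINT z. ind (QT T) z *
   (m z * (fst (grad \<phi> z) \<bullet> fst (D z)) + h z * div_x (%y. m y *. grad_x \<phi> y) z)) = 0"
  unfolding W_def[abs_def] using diffusion_integration_by_parts[OF smooth(1) \<phi>s R(2)] by blast
 note [measurable] = W(1)
 have Wi: "integrable lborel W"
  by (rule integrable_bounded_support[OF W(1), where B="\<bar>C\<bar>" and R=R])
    (use W(2,3) in \<open>force simp: W_def indicator_def\<close>)+
 obtain U D P where U: "!!j::nat. C1_with (U j) (D j)" "!!j z. U j z >= 0"
  "AE z in lborel. (%j. U j z) ----> u z"
  "!!j. square_int (%z. P j z - G z)" "(%j. LBINT z. (norm (P j z - G z))\<^sup>2) ----> 0"
  "!!z j. 0 <= snd z ==> snd z < T - 1 / real (Suc j) ==> D j z = P j z"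
  unfolding u_def by (rule mollified_sequence[OF assms(5) _ G wg]) (auto simp: v)
 note [measurable] = C1_with_borel[OF U(1)]
 obtain J where J: "1 / real (Suc J) < \<eta>" using \<eta>(1) by (metis nat_approx_posE)
 have DP: "D j z = P j z" if "j >= J" "z \<in> QT T" "snd z <= T - \<eta>" for j z
 proof -
  have "1 / real (Suc j) <= 1 / real (Suc J)" using that(1) by (intro divide_left_mono) auto
  then show ?thesis using J that by (intro U(6)) (auto simp: QT_iff)
 qed
 let ?D\<psi> = "%j z. \<phi> z *. ((- N * g (U j z)) *. D j z) + g (U j z) *. grad \<phi> z"
 let ?Dh = "%j z. \<phi> z *. (h (U j z) *. D j z) + H (U j z) *. grad \<phi> z"
 have \<psi>C: "C1_with (%z. \<phi> z * g (U j z)) (?D\<psi> j)" for j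
  by (rule C1_mult[OF \<phi>C C1_compose[OF U(1) gd]]) (intro continuous_intros gc)
 have hC: "C1_with (%z. \<phi> z * H (U j z)) (?Dh j)" for j
  by (rule C1_mult[OF \<phi>C C1_compose[OF U(1) Hd hc]])
 have v1: "vanishes_beyond R (%z. \<phi> z * g (U j z))" "vanishes_beyond R (%z. \<phi> z * H (U j z))" for j
  using R(2) by (auto simp: vanishes_beyond_def)
 \<comment> \<open>The weak formulation split into a zeroth-order coefficient \<open>A\<close> and a
   first-order coefficient \<open>Bv\<close>, the shape taken by
   \<open>test_inequality_extends_C1\<close>.\<close>
 define A where "A z = - fQ z * mQ z * v z" for z
 define Bv where "Bv z = (mQ z * v z) *. \<beta> z + mQ z *. (fst (G z), 0)" for z
 have vl: "loc_int v" by (rule square_int_loc_int[OF v(1)])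
 have fQmQ: "\<bar>- fQ z * mQ z\<bar> <= B * B" for z
  unfolding abs_mult abs_minus_cancel using B abm by (intro mult_mono) auto
 have Al: "loc_int A"
  using loc_int_scale_bounded[of "%z. - fQ z * mQ z" "B * B" v] fQmQ vl unfolding A_def[abs_def] by simp
 have fGl: "loc_int (%z. (fst (G z), 0::real))"
 proof (rule square_int_loc_int, rule square_int_bound[OF G])
  show "norm (fst (G z), 0::real) <= norm (G z)" for z
   using norm_fst_le[of "fst (G z)" "snd (G z)"] by (simp add: norm_Pair)
 qed measurable
 have Bvl: "loc_int Bv"
 proof -
  have 1: "loc_int (%z. v z *. (mQ z *. \<beta> z))"
   unfolding loc_int_def set_integrable_def
  proof (intro conjI allI)
   show "(%z. v z *. mQ z *. \<beta> z) \<in> borel_fun" by measurable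
   fix r :: real
   have [measurable]: "cball (0::(real^'n) \<times> real) r \<in> sets borel" by simp
   have i: "integrable lborel (%x. (B * B) * (ind (cball 0 r) x * norm (v x)))"
    using loc_int_norm[OF vl] by simp
   have le: "norm (ind (cball 0 r) z *. v z *. mQ z *. \<beta> z) <= (B * B) * (ind (cball 0 r) z * norm (v z))" for z
   proof -
    have "\<bar>mQ z\<bar> * norm (\<beta> z) <= B * B" using abm B by (intro mult_mono) auto
    from mult_left_mono[OF this, of "ind (cball 0 r) z * \<bar>v z\<bar>"]
    show ?thesis by (simp add: abs_mult mult_ac)
   qed
   show "integrable lborel (%x. ind (cball 0 r) x *. v x *. mQ x *. \<beta> x)"
    by (rule Bochner_Integration.integrable_bound[OF i], measurable, rule AE_I2, rule order_trans[OF le], simp)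
  qed
  have "loc_int (%z. v z *. (mQ z *. \<beta> z) + mQ z *. (fst (G z), 0))"
   by (rule loc_int_add[OF 1 loc_int_scale_bounded[OF cm(1) abm fGl]])
  then show ?thesis unfolding Bv_def[abs_def] by (simp add: mult.commute)
 qed
 define c where "c x = - (m (x, 0) * v0 x)" for x
 have cl: "loc_int c"
  using loc_int_scale_bounded[of "%x. - m (x, 0)" B v0] m0 B0 v0(1) unfolding c_def[abs_def] by simp
 have ABeq: "A z * \<psi> + Bv z \<bullet> E = mQ z * v z * (E \<bullet> \<beta> z) - fQ z * mQ z * v z * \<psi> + mQ z * (fst E \<bullet> fst (G z))" for z \<psi> E
  by (cases E) (simp add: A_def Bv_def inner_add_left inner_commute[of "\<beta> z"] inner_commute[of "fst (G z)"])
 have Aj: "(LBINT x. m (x, 0) * v0 x * (\<phi> (x, 0) * g (U j (x, 0)))) <= (LBINT z. A z * (\<phi> z * g (U j z)) + Bv z \<bullet> ?D\<psi> j z)" for j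
 proof -
  have sub: "{z. \<phi> z * g (U j z) ~= 0} \<subseteq> {z. \<phi> z ~= 0}" by auto
  have 1: "compact (closure {z. \<phi> z * g (U j z) ~= 0})"
   using compact_Int_closed[OF \<phi>c closed_closure, of "{z. \<phi> z * g (U j z) ~= 0}"] closure_mono[OF sub]
   by (simp add: inf.absorb2)
  have 2: "closure {z. \<phi> z * g (U j z) ~= 0} \<subseteq> UNIV \<times> {..<T}" using closure_mono[OF sub] \<phi>S by (rule order_trans)
  have 3: "open (UNIV \<times> {..<T} :: ((real^'n) \<times> real) set)" by (intro open_Times) auto
  have "0 <= (LBINT z. A z * (\<phi> z * g (U j z)) + Bv z \<bullet> ?D\<psi> j z) + (LBINT x. c x * (\<phi> (x, 0) * g (U j (x, 0))))"
  proof (rule test_inequality_extends_C1[OF Al Bvl cl 3 _ \<psi>C _ 1 2])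
   fix th :: "(real^'n) \<times> real => real" assume t: "test_function (UNIV \<times> {..<T}) th"
   have "(LBINT x. c x * th (x, 0)) = - (LBINT x. th (x, 0) * (m (x, 0) * v0 x))"
    by (simp add: c_def mult.commute)
   then show "0 <= (LBINT z. A z * th z + Bv z \<bullet> grad th z) + (LBINT x. c x * th (x, 0))"
    using weak[OF t] by (simp add: ABeq)
  next
   show "0 <= \<phi> z * g (U j z)" for z using \<phi>(2) gb(1) by simp
  qed
  then show ?thesis by (simp add: c_def)
 qed
 have Bj: "(LBINT z. mQ z * (?Dh j z \<bullet> \<beta> z) + (\<phi> z * H (U j z)) * (EQ z - fQ z * mQ z)) = (LBINT x. (\<phi> (x, 0) * H (U j (x, 0))) * m (x, 0))" for j
 proof (rule transport[OF hC v1(2)])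
  show "\<phi> (x, T) * H (U j (x, T)) = 0" for x using \<eta>(2)[of "(x, T)"] \<eta>(1) by simp
 qed
 \<comment> \<open>\<open>I1\<close> gathers the terms free of derivatives of \<open>U j\<close>;
   \<open>I2\<close> is the coefficient of its gradient.\<close>
 define I1 where "I1 s z = g s * (mQ z * v z * (grad \<phi> z \<bullet> \<beta> z - fQ z * \<phi> z) + mQ z * (fst (grad \<phi> z) \<bullet> fst (G z)))
   - H s * (mQ z * (grad \<phi> z \<bullet> \<beta> z) + \<phi> z * (EQ z - fQ z * mQ z))" for s z
 define I2 where "I2 s z = (\<phi> z * mQ z) *. ((- N * g s * v z - h s) *. \<beta> z + (- N * g s) *. (fst (G z), 0))" for s z
 define a where "a z = mQ z * v z * (grad \<phi> z \<bullet> \<beta> z - fQ z * \<phi> z) + mQ z * (fst (grad \<phi> z) \<bullet> fst (G z))" for z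
 define e where "e z = mQ z * (grad \<phi> z \<bullet> \<beta> z) + \<phi> z * (EQ z - fQ z * mQ z)" for z
 have I1: "I1 s z = g s * a z - H s * e z" for s z by (simp add: I1_def a_def e_def)
 have \<phi>0: "\<phi> z = 0" "grad \<phi> z = 0" if "z \<notin> cball 0 R" for z
  using that vanishes_beyondD[OF R(2), of z] vanishes_beyondD[OF gv, of z] by simp_all
 have g\<phi>\<beta>: "\<bar>grad \<phi> z \<bullet> \<beta> z\<bar> <= B\<phi> * B" for z
  by (rule order_trans[OF Cauchy_Schwarz_ineq2]) (use B\<phi>(1) B\<phi>(3)[of z] B(1) B(4)[of z] in \<open>auto intro!: mult_mono\<close>)
 have fst_pair: "mQ z * (fst (grad \<phi> z) \<bullet> fst w) = (mQ z *. (fst (grad \<phi> z), 0)) \<bullet> w" for z and w :: "(real^'n) \<times> real"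
  by (simp add: inner_prod_def)
 have fb: "norm (s *. (mQ z *. (fst (grad \<phi> z), 0::real))) <= B * B\<phi> * ind (cball 0 R) z" if "\<bar>s\<bar> <= 1" for s z
 proof (cases "z \<in> cball 0 R")
  case True
  have 1: "norm (fst (grad \<phi> z), 0::real) <= B\<phi>"
   using order_trans[OF norm_fst_le[of "fst (grad \<phi> z)" "snd (grad \<phi> z)"]] B\<phi>(3)[of z] by (simp add: norm_Pair)
  have "\<bar>s\<bar> * (\<bar>mQ z\<bar> * norm (fst (grad \<phi> z), 0::real)) <= 1 * (B * B\<phi>)"
   using that abm[of z] 1 B(1) by (intro mult_mono) auto
  then show ?thesis using True by (simp add: abs_mult mult.assoc)
 qed (use \<phi>0 in \<open>auto simp: zero_prod_def[symmetric]\<close>)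
 have sqR: "square_int (%z::(real^'n) \<times> real. K * ind (cball 0 R) z)" for K :: real
  using square_int_scale[OF square_int_cball[of R], of K] by simp
 have mfg [measurable]: "(%z. mQ z *. (fst (grad \<phi> z), 0::real)) \<in> borel_fun" by measurable
 have gU: "\<bar>g (U j z)\<bar> <= 1" "\<bar>g (u z)\<bar> <= 1" for j z using gb[of "U j z"] gb[of "u z"] U(2) u0 by auto
 have limU: "AE z in lborel. (%j. q (U j z)) ----> q (u z)" if "continuous_on UNIV q" for q :: "real => real"
  using U(3)
 proof eventually_elim
  fix z assume "(%j. U j z) ----> u z"
  then show "(%j. q (U j z)) ----> q (u z)"
   using that by (intro isCont_tendsto_compose[of _ q]) (auto simp: continuous_on_eq_continuous_at)
 qed
 have pair1: "(%j. LBINT z. (g (U j z) *. (mQ z *. (fst (grad \<phi> z), 0))) \<bullet> P j z) ---->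
   (LBINT z. (g (u z) *. (mQ z *. (fst (grad \<phi> z), 0))) \<bullet> G z)"
  "integrable lborel (%z. (g (U j z) *. (mQ z *. (fst (grad \<phi> z), 0))) \<bullet> P j z)"
  "integrable lborel (%z. (g (u z) *. (mQ z *. (fst (grad \<phi> z), 0))) \<bullet> G z)" for j
 proof -
  have l: "AE z in lborel. (%j. g (U j z) *. (mQ z *. (fst (grad \<phi> z), 0::real))) ----> g (u z) *. (mQ z *. (fst (grad \<phi> z), 0))"
   using limU[OF gc] by eventually_elim (intro tendsto_intros)
  have mj: "!!j. (%z. g (U j z) *. (mQ z *. (fst (grad \<phi> z), 0::real))) \<in> borel_fun" by measurable
  have m0: "(%z. g (u z) *. (mQ z *. (fst (grad \<phi> z), 0::real))) \<in> borel_fun" by measurable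
  note L = L2_pairing_limit[OF mj l fb[OF gU(1)] sqR m0 G U(4,5)]
  show "(%j. LBINT z. (g (U j z) *. (mQ z *. (fst (grad \<phi> z), 0))) \<bullet> P j z) ---->
   (LBINT z. (g (u z) *. (mQ z *. (fst (grad \<phi> z), 0))) \<bullet> G z)" by (rule L(1))
  show "integrable lborel (%z. (g (U j z) *. (mQ z *. (fst (grad \<phi> z), 0))) \<bullet> P j z)" by (rule L(2))
  show "integrable lborel (%z. (g (u z) *. (mQ z *. (fst (grad \<phi> z), 0))) \<bullet> G z)" by (rule L(3))
 qed
 have am [measurable]: "a \<in> borel_fun" unfolding a_def[abs_def] by measurable
 have em [measurable]: "e \<in> borel_fun" unfolding e_def[abs_def] by measurable
 have ai: "integrable lborel a"
 proof -
  have 1: "integrable lborel (%z. v z *. (mQ z * (grad \<phi> z \<bullet> \<beta> z - fQ z * \<phi> z)))"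
  proof (rule set_integrable_mult_bounded(1)[where S="cball 0 R" and B="B * (B\<phi> * B + B * B\<phi>)"])
   show "set_integrable lborel (cball 0 R) v" using vl by (simp add: loc_int_def)
   show "(%z. mQ z * (grad \<phi> z \<bullet> \<beta> z - fQ z * \<phi> z)) \<in> borel_fun" by measurable
   fix z
   have "\<bar>fQ z * \<phi> z\<bar> <= B * B\<phi>" unfolding abs_mult using B(1) B(3)[of z] B\<phi>(1) B\<phi>(2)[of z] by (intro mult_mono) auto
   then have "\<bar>grad \<phi> z \<bullet> \<beta> z - fQ z * \<phi> z\<bar> <= B\<phi> * B + B * B\<phi>" using g\<phi>\<beta>[of z] by linarith
   then show "norm (mQ z * (grad \<phi> z \<bullet> \<beta> z - fQ z * \<phi> z)) <= B * (B\<phi> * B + B * B\<phi>)"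
    unfolding real_norm_def abs_mult using abm[of z] B(1) by (intro mult_mono) auto
   show "z \<notin> cball 0 R ==> mQ z * (grad \<phi> z \<bullet> \<beta> z - fQ z * \<phi> z) = 0" using \<phi>0[of z] by simp
  qed
  \<comment> \<open>The pairing lemma is applied to a constant sequence here, for its integrability
    statement.\<close>
  have s0: "square_int (%z. G z - G z)" by (rule square_int_diff[OF G G])
  have mj: "!!j::nat. (%z. 1 *. (mQ z *. (fst (grad \<phi> z), 0::real))) \<in> borel_fun" by measurable
  have 2: "integrable lborel (%z. (1 *. (mQ z *. (fst (grad \<phi> z), 0))) \<bullet> G z)"
   by (rule L2_pairing_limit(3)[OF mj _ fb sqR mj G s0]) auto
  have "a = (%z. v z *. (mQ z * (grad \<phi> z \<bullet> \<beta> z - fQ z * \<phi> z)) + (1 *. (mQ z *. (fst (grad \<phi> z), 0))) \<bullet> G z)"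
   unfolding a_def[abs_def] fst_pair by (simp add: mult_ac)
  then show ?thesis using 1 2 by simp
 qed
 have ei: "integrable lborel e"
 proof (rule integrable_bounded_support[OF em, where B="B * (B\<phi> * B) + B\<phi> * (B + B * B)" and R=R])
  fix z
  have "\<bar>mQ z * (grad \<phi> z \<bullet> \<beta> z)\<bar> <= B * (B\<phi> * B)" unfolding abs_mult using abm[of z] g\<phi>\<beta>[of z] B(1) by (intro mult_mono) auto
  moreover have "\<bar>EQ z - fQ z * mQ z\<bar> <= B + B * B" using fQmQ[of z] EQ_nonneg[of z] B(5)[of z] by simp
  then have "\<bar>\<phi> z * (EQ z - fQ z * mQ z)\<bar> <= B\<phi> * (B + B * B)" unfolding abs_mult using B\<phi>(1) B\<phi>(2)[of z] by (intro mult_mono) auto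
  ultimately show "norm (e z) <= B * (B\<phi> * B) + B\<phi> * (B + B * B)" unfolding e_def by simp
  show "R < norm z ==> e z = 0" using \<phi>0[of z] by (simp add: e_def)
 qed
 have I1lim: "(%j. LBINT z. I1 (U j z) z) ----> (LBINT z. I1 (u z) z)"
  and I1i: "integrable lborel (%z. I1 (U j z) z)" "integrable lborel (%z. I1 (u z) z)" for j
 proof -
  have bd: "norm (I1 s z) <= \<bar>a z\<bar> + (1 + 1 / N) * \<bar>e z\<bar>" if "s >= 0" for s z
  proof -
   have "\<bar>g s * a z\<bar> <= 1 * \<bar>a z\<bar>" unfolding abs_mult using gb[of s] that by (intro mult_right_mono) auto
   moreover have "\<bar>H s * e z\<bar> <= (1 + 1 / N) * \<bar>e z\<bar>" unfolding abs_mult using Hb[OF that] by (intro mult_right_mono) auto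
   ultimately show ?thesis unfolding I1 by simp
  qed
  have w: "integrable lborel (%z. \<bar>a z\<bar> + (1 + 1 / N) * \<bar>e z\<bar>)" using ai ei by auto
  have mj: "!!j. (%z. I1 (U j z) z) \<in> borel_measurable lborel" and mu: "(%z. I1 (u z) z) \<in> borel_measurable lborel"
   unfolding I1 by measurable
  have l: "AE z in lborel. (%j. I1 (U j z) z) ----> I1 (u z) z"
   using limU[OF gc] limU[OF Hc] unfolding I1 by eventually_elim (intro tendsto_intros)
  show "(%j. LBINT z. I1 (U j z) z) ----> (LBINT z. I1 (u z) z)"
   by (rule integral_dominated_convergence[OF mu mj w l AE_I2[OF bd[OF U(2)]]])
  show "integrable lborel (%z. I1 (U j z) z)"
   by (rule Bochner_Integration.integrable_bound[OF w mj], rule AE_I2, rule order_trans[OF bd[OF U(2)]], simp)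
  show "integrable lborel (%z. I1 (u z) z)"
   by (rule Bochner_Integration.integrable_bound[OF w mu], rule AE_I2, rule order_trans[OF bd[OF u0]], simp)
 qed
 have I2lim: "(%j. LBINT z. I2 (U j z) z \<bullet> P j z) ----> (LBINT z. I2 (u z) z \<bullet> G z)"
  and I2i: "integrable lborel (%z. I2 (U j z) z \<bullet> P j z)" for j
 proof -
  define K where "K = (B\<phi> * B) * ((N + 1) * (B + 1))"
  \<comment> \<open>A square-integrable majorant of \<open>I2\<close>. The part coming from
    \<open>h\<close> is merely bounded, so it enters through the indicator of the ball that carries
    \<open>\<phi>\<close>.\<close>
  define Fs where "Fs z = K *. ((norm (v z) + ind (cball 0 R) z) + norm (G z))" for z
  have K0: "K >= 0" using B\<phi>(1) B(1) N by (simp add: K_def)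
  have sF: "square_int Fs" unfolding Fs_def[abs_def]
   by (intro square_int_scale square_int_add square_int_norm v G square_int_cball)
  have bd: "norm (I2 s z) <= Fs z" if s: "s >= 0" for s z
  proof (cases "z \<in> cball 0 R")
   case True
   have 1: "\<bar>- N * g s\<bar> <= N" using gb[of s] s N by (simp add: abs_mult mult_left_le)
   have "\<bar>- N * g s * v z - h s\<bar> <= \<bar>- N * g s\<bar> * \<bar>v z\<bar> + \<bar>h s\<bar>"
    using abs_triangle_ineq4[of "- N * g s * v z" "h s"] by (simp add: abs_mult)
   also have "\<dots> <= (N + 1) * \<bar>v z\<bar> + (N + 1)" using 1 hb[OF s] by (intro add_mono mult_right_mono) auto
   finally have 2: "\<bar>- N * g s * v z - h s\<bar> <= (N + 1) * (\<bar>v z\<bar> + 1)" by (simp add: algebra_simps)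
   have nb: "norm (\<beta> z) <= B + 1" using B(4)[of z] by simp
   have 3: "norm ((- N * g s * v z - h s) *. \<beta> z) <= ((N + 1) * (\<bar>v z\<bar> + 1)) * (B + 1)"
    unfolding norm_scaleR using 2 nb N by (intro mult_mono) auto
   have "norm (fst (G z), 0::real) <= norm (G z)" using norm_fst_le[of "fst (G z)" "snd (G z)"] by (simp add: norm_Pair)
   then have "norm ((- N * g s) *. (fst (G z), 0::real)) <= (N + 1) * norm (G z)"
    unfolding norm_scaleR using 1 N by (intro mult_mono) auto
   also have "\<dots> <= ((N + 1) * norm (G z)) * (B + 1)" using mult_left_mono[of 1 "B + 1" "(N + 1) * norm (G z)"] B(1) N by simp
   finally have "norm ((- N * g s * v z - h s) *. \<beta> z + (- N * g s) *. (fst (G z), 0)) <=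
     ((N + 1) * (\<bar>v z\<bar> + 1)) * (B + 1) + ((N + 1) * norm (G z)) * (B + 1)"
    using 3 by (intro order_trans[OF norm_triangle_ineq] add_mono)
   moreover have "\<bar>\<phi> z * mQ z\<bar> <= B\<phi> * B" unfolding abs_mult using B\<phi>(1) B\<phi>(2)[of z] abm[of z] by (intro mult_mono) auto
   ultimately have "norm (I2 s z) <= (B\<phi> * B) * (((N + 1) * (\<bar>v z\<bar> + 1)) * (B + 1) + ((N + 1) * norm (G z)) * (B + 1))"
    unfolding I2_def norm_scaleR[of "\<phi> z * mQ z"] using B\<phi>(1) B(1) by (intro mult_mono) auto
   also have "\<dots> = Fs z" using True by (simp add: Fs_def K_def algebra_simps)
   finally show ?thesis .
  next
   case False
   then have "norm (I2 s z) = 0" using \<phi>0(1)[OF False] by (simp add: I2_def)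
   then show ?thesis using K0 by (simp add: Fs_def)
  qed
  have mj: "!!j. (%z. I2 (U j z) z) \<in> borel_fun" and mu: "(%z. I2 (u z) z) \<in> borel_fun"
   unfolding I2_def by measurable
  have l: "AE z in lborel. (%j. I2 (U j z) z) ----> I2 (u z) z"
   using limU[OF gc] limU[OF hc] unfolding I2_def by eventually_elim (intro tendsto_intros)
  note L = L2_pairing_limit[OF mj l bd[OF U(2)] sF mu G U(4,5)]
  show "(%j. LBINT z. I2 (U j z) z \<bullet> P j z) ----> (LBINT z. I2 (u z) z \<bullet> G z)" by (rule L(1))
  show "integrable lborel (%z. I2 (U j z) z \<bullet> P j z)" by (rule L(2))
 qed
 \<comment> \<open>In the limit the factor \<open>- N g v - h\<close> vanishes by \<open>hu\<close>,
   and what remains is minus a nonnegative weight times the squared space gradient: this is the sign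
   of the diffusion.\<close>
 have I2neg: "(LBINT z. I2 (u z) z \<bullet> G z) <= 0"
 proof -
  have "I2 (u z) z \<bullet> G z = - (\<phi> z * mQ z * (N * g (u z)) * (norm (fst (G z)))\<^sup>2)" for z
   by (simp add: I2_def hu inner_prod_def power2_norm_eq_inner)
  moreover have "0 <= \<phi> z * mQ z * (N * g (u z)) * (norm (fst (G z)))\<^sup>2" for z
   using \<phi>(2)[of z] mQ_nonneg[of z] gb(1)[of "u z"] N by (intro mult_nonneg_nonneg) auto
  ultimately show ?thesis by (simp add: Bochner_Integration.integral_nonneg)
 qed
 define L where "L = (LBINT x. \<phi> (x, 0) * m (x, 0) * (v0 x * g (v0 x powr k) - H (v0 x powr k)))"
 \<comment> \<open>The value of \<open>U j\<close> at time 0 is not identified with the initial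
   datum. By \<open>entropy_minimal\<close> the integrand with \<open>v0 powr k\<close> in its place
   is a lower bound, and this gives the initial term.\<close>
 have step: "L <= (LBINT z. I1 (U j z) z) + (LBINT z. I2 (U j z) z \<bullet> P j z)" if j: "j >= J" for j
 proof -
  note sl = vanishes_beyond_slice[OF C1_with_continuous[OF \<psi>C] v1(1), of 0 j]
    vanishes_beyond_slice[OF C1_with_continuous[OF hC] v1(2), of 0 j]
  have ml: "loc_int (%x. m (x, 0))" by (rule loc_int_bounded[where B=B]) (use m0 B0 in auto)
  have i1: "integrable lborel (%x. m (x, 0) * v0 x * (\<phi> (x, 0) * g (U j (x, 0))))"
   using set_integrable_mult_continuous[OF cl sl(1,2)] by (simp add: c_def)
  have i2: "integrable lborel (%x. (\<phi> (x, 0) * H (U j (x, 0))) * m (x, 0))"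
   using set_integrable_mult_continuous[OF ml sl(3,4)] by (simp add: mult.commute)
  have le: "\<phi> (x, 0) * m (x, 0) * (v0 x * g (v0 x powr k) - H (v0 x powr k)) <=
   m (x, 0) * v0 x * (\<phi> (x, 0) * g (U j (x, 0))) - (\<phi> (x, 0) * H (U j (x, 0))) * m (x, 0)" for x
  proof -
   have "v0 x * g (v0 x powr k) - H (v0 x powr k) <= v0 x * g (U j (x, 0)) - H (U j (x, 0))"
    unfolding g_def H_def by (rule entropy_minimal[OF k0 N v0(2) U(2)])
   from mult_left_mono[OF this, of "\<phi> (x, 0) * m (x, 0)"] show ?thesis
    using \<phi>(2)[of "(x, 0)"] m0(2)[of x] by (simp add: algebra_simps)
  qed
  \<comment> \<open>Together with the bound \<open>le\<close> this places the integrand of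
    \<open>L\<close> between 0 and an integrable function.\<close>
  have nn: "0 <= \<phi> (x, 0) * m (x, 0) * (v0 x * g (v0 x powr k) - H (v0 x powr k))" for x
  proof -
   have "H (v0 x powr k) <= 0" unfolding H_def by (rule entropy_flux_bounds[OF k N]) simp
   then have "0 <= v0 x * g (v0 x powr k) - H (v0 x powr k)"
    using mult_nonneg_nonneg[OF v0(2)[of x] gb(1)[of "v0 x powr k"]] by linarith
   then show ?thesis by (intro mult_nonneg_nonneg \<phi>(2) m0(2))
  qed
  have [measurable]: "(%x. \<phi> (x, 0)) \<in> borel_fun" by measurable
  have "integrable lborel (%x. \<phi> (x, 0) * m (x, 0) * (v0 x * g (v0 x powr k) - H (v0 x powr k)))"
   by (rule Bochner_Integration.integrable_bound[OF Bochner_Integration.integrable_diff[OF i1 i2]])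
     (measurable, rule AE_I2, unfold real_norm_def abs_of_nonneg[OF nn], rule order_trans[OF le abs_ge_self])
  then have "L <= (LBINT x. m (x, 0) * v0 x * (\<phi> (x, 0) * g (U j (x, 0))) - (\<phi> (x, 0) * H (U j (x, 0))) * m (x, 0))"
   unfolding L_def by (rule integral_mono[OF _ Bochner_Integration.integrable_diff[OF i1 i2] le])
  also have "\<dots> = (LBINT x. m (x, 0) * v0 x * (\<phi> (x, 0) * g (U j (x, 0)))) - (LBINT x. (\<phi> (x, 0) * H (U j (x, 0))) * m (x, 0))"
   by (rule Bochner_Integration.integral_diff[OF i1 i2])
  \<comment> \<open>The weak formulation enters as the inequality \<open>Aj\<close>, the transport
    identity as the equality \<open>Bj\<close>.\<close>
  also have "\<dots> <= (LBINT z. A z * (\<phi> z * g (U j z)) + Bv z \<bullet> ?D\<psi> j z)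
   - (LBINT z. mQ z * (?Dh j z \<bullet> \<beta> z) + (\<phi> z * H (U j z)) * (EQ z - fQ z * mQ z))"
   using Aj[of j] Bj[of j] by simp
  also have "\<dots> = (LBINT z. (A z * (\<phi> z * g (U j z)) + Bv z \<bullet> ?D\<psi> j z)
   - (mQ z * (?Dh j z \<bullet> \<beta> z) + (\<phi> z * H (U j z)) * (EQ z - fQ z * mQ z)))"
  proof (rule Bochner_Integration.integral_diff[symmetric])
   have "continuous_on UNIV (?D\<psi> j)" using \<psi>C[of j] unfolding C1_with_def by blast
   from integrable_inner_continuous[OF Bvl this C1_with_support[OF \<psi>C v1(1)]]
    set_integrable_mult_continuous[OF Al C1_with_continuous[OF \<psi>C] v1(1)]
   show "integrable lborel (%z. A z * (\<phi> z * g (U j z)) + Bv z \<bullet> ?D\<psi> j z)" by simp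
   have l1: "loc_int (%z. mQ z *. \<beta> z)"
   proof (rule loc_int_bounded[where B="B * B"])
    show "norm (mQ z *. \<beta> z) <= B * B" for z unfolding norm_scaleR using abm[of z] B(4)[of z] B(1) by (intro mult_mono) auto
   qed measurable
   have l2: "loc_int (%z. EQ z - fQ z * mQ z)"
   proof (rule loc_int_bounded[where B="B + B * B"])
    show "norm (EQ z - fQ z * mQ z) <= B + B * B" for z using fQmQ[of z] EQ_nonneg[of z] B(5)[of z] by simp
   qed measurable
   have "continuous_on UNIV (?Dh j)" using hC[of j] unfolding C1_with_def by blast
   from integrable_inner_continuous[OF l1 this C1_with_support[OF hC v1(2)]]
    set_integrable_mult_continuous[OF l2 C1_with_continuous[OF hC] v1(2)]
   show "integrable lborel (%z. mQ z * (?Dh j z \<bullet> \<beta> z) + (\<phi> z * H (U j z)) * (EQ z - fQ z * mQ z))"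
    by (simp add: inner_commute[of "\<beta> _"] mult.commute[of "EQ _ - _"])
  qed
  also have "\<dots> = (LBINT z. I1 (U j z) z + I2 (U j z) z \<bullet> P j z)"
  proof (rule Bochner_Integration.integral_cong[OF refl])
   fix z
   have pj: "(X, 0::real) \<bullet> D j z = X \<bullet> fst (D j z)" for X by (simp add: inner_prod_def)
   have "(A z * (\<phi> z * g (U j z)) + Bv z \<bullet> ?D\<psi> j z)
    - (mQ z * (?Dh j z \<bullet> \<beta> z) + (\<phi> z * H (U j z)) * (EQ z - fQ z * mQ z)) = I1 (U j z) z + I2 (U j z) z \<bullet> D j z"
    unfolding ABeq I1_def I2_def
    by (simp add: inner_add_left inner_add_right inner_diff_left pj
      inner_commute[of "\<beta> z" "D j z"] inner_commute[of "fst (G z)" "fst (D j z)"] algebra_simps)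
   \<comment> \<open>Up to \<open>T - \<eta>\<close> the two gradients agree inside the slab;
     elsewhere \<open>\<phi>\<close> or \<open>mQ\<close> vanishes.\<close>
   moreover have "I2 (U j z) z \<bullet> D j z = I2 (U j z) z \<bullet> P j z"
   proof (cases "z \<in> QT T & snd z <= T - \<eta>")
    case True then show ?thesis using DP[OF j] by simp
   next
    case False
    then have "\<phi> z * mQ z = 0" using \<eta>(2)[of z] off_QT(1)[of z] by auto
    then show ?thesis by (simp add: I2_def)
   qed
   ultimately show "(A z * (\<phi> z * g (U j z)) + Bv z \<bullet> ?D\<psi> j z)
    - (mQ z * (?Dh j z \<bullet> \<beta> z) + (\<phi> z * H (U j z)) * (EQ z - fQ z * mQ z)) = I1 (U j z) z + I2 (U j z) z \<bullet> P j z"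
    by simp
  qed
  also have "\<dots> = (LBINT z. I1 (U j z) z) + (LBINT z. I2 (U j z) z \<bullet> P j z)"
   by (rule Bochner_Integration.integral_add[OF I1i(1) I2i])
  finally show ?thesis .
 qed
 have "L <= (LBINT z. I1 (u z) z) + (LBINT z. I2 (u z) z \<bullet> G z)"
  by (rule LIMSEQ_le_const[OF tendsto_add[OF I1lim I2lim]]) (use step in blast)
 then have L1: "L <= (LBINT z. I1 (u z) z)" using I2neg by simp
 have \<Gamma>W: "integrable lborel (%z. \<Gamma> (u z) * W z)" "(%j. LBINT z. \<Gamma> (U j z) * W z) ----> (LBINT z. \<Gamma> (u z) * W z)"
  "!!j. integrable lborel (%z. \<Gamma> (U j z) * W z)"
 proof -
  have bd: "norm (\<Gamma> s * W z) <= 1 / N * \<bar>W z\<bar>" if "s >= 0" for s z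
   unfolding real_norm_def abs_mult using \<Gamma>b[OF that] by (intro mult_right_mono) auto
  have w: "integrable lborel (%z. 1 / N * \<bar>W z\<bar>)" using Wi by auto
  have mj: "!!j. (%z. \<Gamma> (U j z) * W z) \<in> borel_measurable lborel" and mu: "(%z. \<Gamma> (u z) * W z) \<in> borel_measurable lborel"
   by measurable
  have l: "AE z in lborel. (%j. \<Gamma> (U j z) * W z) ----> \<Gamma> (u z) * W z"
   using limU[OF \<Gamma>c] by eventually_elim (intro tendsto_intros)
  show "(%j. LBINT z. \<Gamma> (U j z) * W z) ----> (LBINT z. \<Gamma> (u z) * W z)"
   by (rule integral_dominated_convergence[OF mu mj w l AE_I2[OF bd[OF U(2)]]])
  show "integrable lborel (%z. \<Gamma> (U j z) * W z)" for j
   by (rule Bochner_Integration.integrable_bound[OF w mj], rule AE_I2, rule order_trans[OF bd[OF U(2)]], use N in simp)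
  show "integrable lborel (%z. \<Gamma> (u z) * W z)"
   by (rule Bochner_Integration.integrable_bound[OF w mu], rule AE_I2, rule order_trans[OF bd[OF u0]], use N in simp)
 qed
 \<comment> \<open>The gradient of \<open>\<Gamma> (U j)\<close> is \<open>g (U j)\<close> times
   that of \<open>U j\<close>, so this is an instance of
   \<open>diffusion_integration_by_parts\<close>.\<close>
 have Cj: "(LBINT z. (g (U j z) *. (mQ z *. (fst (grad \<phi> z), 0))) \<bullet> P j z) + (LBINT z. \<Gamma> (U j z) * W z) = 0" if j: "j >= J" for j
 proof -
  have "(g (U j z) *. (mQ z *. (fst (grad \<phi> z), 0))) \<bullet> P j z + \<Gamma> (U j z) * W z = ind (QT T) z *
   (m z * (fst (grad \<phi> z) \<bullet> fst (g (U j z) *. D j z)) + \<Gamma> (U j z) * div_x (%y. m y *. grad_x \<phi> y) z)" for z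
  proof (cases "z \<in> QT T & snd z <= T - \<eta>")
   case True then show ?thesis using DP[OF j, of z] by (simp add: W_def mQ_def inner_prod_def)
  next
   case False
   then have "mQ z = 0 & z \<notin> QT T \<or> grad \<phi> z = 0" using g\<eta>[of z] off_QT(1)[of z] by auto
   then show ?thesis by (auto simp: W_def mQ_def zero_prod_def[symmetric])
  qed
  then have "(LBINT z. (g (U j z) *. (mQ z *. (fst (grad \<phi> z), 0))) \<bullet> P j z + \<Gamma> (U j z) * W z) = 0"
   using W(4)[OF C1_compose[OF U(1) \<Gamma>d gc], of j] by simp
  then show ?thesis using Bochner_Integration.integral_add[OF pair1(2) \<Gamma>W(3), of j j] by simp
 qed
 have "(%j. (LBINT z. (g (U j z) *. (mQ z *. (fst (grad \<phi> z), 0))) \<bullet> P j z) + (LBINT z. \<Gamma> (U j z) * W z)) ----> 0"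
  by (rule tendsto_eventually) (use Cj in \<open>auto simp: eventually_sequentially\<close>)
 with tendsto_add[OF pair1(1) \<Gamma>W(2)]
 have C0: "(LBINT z. (g (u z) *. (mQ z *. (fst (grad \<phi> z), 0))) \<bullet> G z) + (LBINT z. \<Gamma> (u z) * W z) = 0"
  by (rule LIMSEQ_unique)
 \<comment> \<open>Subtracting the vanishing quantity \<open>C0\<close> trades the last gradient of
   \<open>u\<close> for the diffusion term of the statement.\<close>
 have "(LBINT z. mQ z * (v z * g (u z) - H (u z)) * (grad \<phi> z \<bullet> \<beta> z - fQ z * \<phi> z)
    - \<phi> z * H (u z) * EQ z - \<Gamma> (u z) * W z)
  = (LBINT z. I1 (u z) z - ((g (u z) *. (mQ z *. (fst (grad \<phi> z), 0))) \<bullet> G z + \<Gamma> (u z) * W z))"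
  by (rule Bochner_Integration.integral_cong[OF refl]) (simp add: I1_def inner_prod_def algebra_simps)
 also have "\<dots> = (LBINT z. I1 (u z) z)"
  using I1i(2) pair1(3) \<Gamma>W(1) C0 by simp
 finally have "L <= (LBINT z. mQ z * (v z * g (u z) - H (u z)) * (grad \<phi> z \<bullet> \<beta> z - fQ z * \<phi> z)
    - \<phi> z * H (u z) * EQ z - \<Gamma> (u z) * W z)" using L1 by simp
 then show ?thesis unfolding L_def g_def H_def \<Gamma>_def W_def u_def by simp
qed

subsection \<open>The incompressible limit\<close>

text \<open>The powers \<open>a^(kap - 1)\<close> tend to \<open>P\<close>; their roots of order
  \<open>kap - 1\<close> are compared with \<open>(P + 1)^(1/(kap - 1))\<close> and, if
  \<open>P > 0\<close>, with \<open>(P / 2)^(1/(kap - 1))\<close>, both of which tend to 1. Hence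
  \<open>A \<le> 1\<close>, with equality where \<open>P > 0\<close>, so that \<open>A P = P\<close>
  in all cases and one more factor \<open>a\<close> does not change the limit of the powers.\<close>

lemma stiff_pressure_limit:
 fixes a kap :: "nat => real"
 assumes kap: "filterlim kap at_top sequentially" "!!j. kap j > 1" and a: "!!j. a j >= 0" "a ----> A"
  and p: "(%j. kap j / (kap j - 1) * a j powr (kap j - 1)) ----> P"
 shows "P >= 0" "A <= 1" "P > 0 ==> A = 1" "(%j. a j powr kap j) ----> P"
proof -
 have k1: "filterlim (%j. kap j - 1) at_top sequentially"
  using filterlim_tendsto_add_at_top[OF tendsto_const[of "-1"] kap(1)] by simp
 have inv: "(%j. 1 / (kap j - 1)) ----> 0"
  using tendsto_inverse_0_at_top[OF k1] by (simp add: divide_inverse)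
 have q: "(%j. a j powr (kap j - 1)) ----> P"
 proof -
  have "(%j. (1 - 1 / kap j) * (kap j / (kap j - 1) * a j powr (kap j - 1))) ----> (1 - 0) * P"
   using tendsto_inverse_0_at_top[OF kap(1)] by (intro tendsto_intros p) (simp add: divide_inverse)
  moreover have "(1 - 1 / kap j) * (kap j / (kap j - 1) * a j powr (kap j - 1)) = a j powr (kap j - 1)" for j
   using kap(2)[of j] by (simp add: field_simps)
  ultimately show ?thesis by simp
 qed
 show P: "P >= 0" by (rule LIMSEQ_le_const[OF q]) auto
 have root: "(%j. c powr (1 / (kap j - 1))) ----> 1" if "c > 0" for c
  using tendsto_powr[OF tendsto_const inv, of c] that by simp
 have aj: "(a j powr (kap j - 1)) powr (1 / (kap j - 1)) = a j" for j
  using kap(2)[of j] a(1)[of j] by (simp add: powr_powr)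
 show A: "A <= 1"
 proof -
  have "\<forall>\<^sub>F j in sequentially. a j powr (kap j - 1) < P + 1" using q by (rule order_tendstoD) simp
  then have "\<forall>\<^sub>F j in sequentially. a j <= (P + 1) powr (1 / (kap j - 1))"
  proof eventually_elim
   fix j assume "a j powr (kap j - 1) < P + 1"
   then have "(a j powr (kap j - 1)) powr (1 / (kap j - 1)) <= (P + 1) powr (1 / (kap j - 1))"
    using kap(2)[of j] by (intro powr_mono2) auto
   then show "a j <= (P + 1) powr (1 / (kap j - 1))" by (simp add: aj)
  qed
  then show ?thesis using P by (intro tendsto_le[OF _ root a(2)]) auto
 qed
 show "A = 1" if "P > 0"
 proof -
  have "\<forall>\<^sub>F j in sequentially. P / 2 < a j powr (kap j - 1)" using q by (rule order_tendstoD) (use that in simp)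
  then have "\<forall>\<^sub>F j in sequentially. (P / 2) powr (1 / (kap j - 1)) <= a j"
  proof eventually_elim
   fix j assume "P / 2 < a j powr (kap j - 1)"
   then have "(P / 2) powr (1 / (kap j - 1)) <= (a j powr (kap j - 1)) powr (1 / (kap j - 1))"
    using kap(2)[of j] that by (intro powr_mono2) auto
   then show "(P / 2) powr (1 / (kap j - 1)) <= a j" by (simp add: aj)
  qed
  then have "1 <= A" using that by (intro tendsto_le[OF _ a(2) root]) auto
  with A show ?thesis by simp
 qed
 then have AP: "A * P = P" using P by (cases "P = 0") auto
 have "a j powr kap j = a j * a j powr (kap j - 1)" for j
  using powr_mult_base[OF a(1), of j "kap j - 1"] by simp
 then show "(%j. a j powr kap j) ----> P" using tendsto_mult[OF a(2) q] AP by simp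
qed

lemma entropy_flux_eq:
 assumes "s >= 0" shows "entropy_flux k N s = (LBINT r. ind {0<..<s} r * entropy_density k N r)"
 using assms by (simp add: entropy_flux_def interval_lebesgue_integral_def set_lebesgue_integral_def zero_ereal_def)

text \<open>For fixed \<open>r > 0\<close> the factor \<open>r powr (1 / kap j)\<close> tends to 1,
  so the densities tend to \<open>- N exp (- N r)\<close>, the derivative of
  \<open>exp (- N r)\<close>. The indicators of the integration range converge except possibly at
  \<open>r = P\<close>.\<close>

lemma entropy_flux_limit:
 fixes u kap :: "nat => real"
 assumes kap: "filterlim kap at_top sequentially" "!!j. kap j > 1" and N: "N > 0"
  and u: "!!j. u j >= 0" "u ----> P"
 shows "(%j. entropy_flux (kap j) N (u j)) ----> exp (- N * P) - 1"
proof -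
 have P: "P >= 0" by (rule LIMSEQ_le_const[OF u(2)]) (use u in auto)
 have "Bseq u" using u(2) convergent_imp_Bseq convergentI by blast
 then obtain Q where Q: "!!j. norm (u j) <= Q" unfolding Bseq_def by blast
 have dc: "continuous_on UNIV (entropy_density (kap j) N)" for j
  by (rule entropy_density_continuous) (use kap(2)[of j] in simp)
 have dm: "entropy_density (kap j) N \<in> borel_fun" for j by (rule borel_measurable_continuous_onI[OF dc])
 have inv: "(%j. 1 / kap j) ----> 0" using tendsto_inverse_0_at_top[OF kap(1)] by (simp add: divide_inverse)
 have "(%j. LBINT r. ind {0<..<u j} r * entropy_density (kap j) N r) ---->
  (LBINT r. ind {0<..<P} r * (- N * exp (- N * r)))"
 proof (rule integral_dominated_convergence[where w="%r. ind {0..Q} r * (N + 1)"])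
  show "integrable lborel (%r. ind {0..Q} r * (N + 1))"
   by (intro integrable_mult_left) (simp add: integrable_indicator_iff emeasure_lborel_Icc_eq)
  show "AE r in lborel. (%j. ind {0<..<u j} r * entropy_density (kap j) N r) ----> ind {0<..<P} r * (- N * exp (- N * r))"
   using AE_lborel_singleton[of P]
  proof eventually_elim
   fix r assume "r ~= P"
   consider "r <= 0" | "0 < r" "r < P" | "r > 0" "r > P" using \<open>r ~= P\<close> by linarith
   then show "(%j. ind {0<..<u j} r * entropy_density (kap j) N r) ----> ind {0<..<P} r * (- N * exp (- N * r))"
   proof cases
    case 1 then show ?thesis by simp
   next
    case 2
    have "\<forall>\<^sub>F j in sequentially. r < u j" using u(2) 2(2) by (rule order_tendstoD)
    then have ev: "\<forall>\<^sub>F j in sequentially. r powr (1 / kap j) * (- N * exp (- N * r)) = ind {0<..<u j} r * entropy_density (kap j) N r"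
     by eventually_elim (use 2 in \<open>simp add: entropy_density_def\<close>)
    have "(%j. r powr (1 / kap j) * (- N * exp (- N * r))) ----> r powr 0 * (- N * exp (- N * r))"
     by (intro tendsto_intros inv) (use 2 in auto)
    from Lim_transform_eventually[OF this ev] show ?thesis using 2 by simp
   next
    case 3
    have "\<forall>\<^sub>F j in sequentially. u j < r" using u(2) 3(2) by (rule order_tendstoD)
    then have "\<forall>\<^sub>F j in sequentially. ind {0<..<u j} r * entropy_density (kap j) N r = 0"
     by eventually_elim simp
    then show ?thesis using 3 by (simp add: tendsto_eventually)
   qed
  qed
  fix j
  show "AE r in lborel. norm (ind {0<..<u j} r * entropy_density (kap j) N r) <= ind {0..Q} r * (N + 1)"
  proof (rule AE_I2)
   fix r
   show "norm (ind {0<..<u j} r * entropy_density (kap j) N r) <= ind {0..Q} r * (N + 1)"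
   proof (cases "r \<in> {0<..<u j}")
    case True
    have "\<bar>entropy_density (kap j) N r\<bar> <= N + 1"
     by (rule entropy_density_bound(2)) (use kap(2)[of j] N True in auto)
    moreover have "u j <= Q" using Q[of j] by simp
    ultimately show ?thesis using True by (simp add: indicator_def)
   qed (use N in simp)
  qed
  show "(%r. ind {0<..<u j} r * entropy_density (kap j) N r) \<in> borel_measurable lborel"
   using dm[of j] by simp
  show "(%r. ind {0<..<P} r * (- N * exp (- N * r))) \<in> borel_measurable lborel" by simp
 qed
 moreover have "(LBINT r. ind {0<..<P} r * (- N * exp (- N * r))) = exp (- N * P) - 1"
 proof -
  have "(LBINT r=ereal 0..ereal P. - N * exp (- N * r)) = exp (- N * P) - exp (- N * 0)"
  proof (rule interval_integral_FTC_finite[where F="%r. exp (- N * r)" and f="%r. - N * exp (- N * r)"])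
   show "continuous_on {min 0 P..max 0 P} (%r. - N * exp (- N * r))" by (intro continuous_intros)
   fix x
   have "((%r. exp (- N * r)) has_real_derivative (- N * exp (- N * x))) (at x)" by (auto intro!: derivative_eq_intros)
   then show "((%r. exp (- N * r)) has_vector_derivative - N * exp (- N * x)) (at x within {min 0 P..max 0 P})"
    by (simp add: has_real_derivative_iff_has_vector_derivative has_vector_derivative_at_within)
  qed
  then show ?thesis using P by (simp add: interval_lebesgue_integral_def set_lebesgue_integral_def zero_ereal_def)
 qed
 ultimately show ?thesis using entropy_flux_eq[OF u(1)] by simp
qed

text \<open>The equation for \<open>v = \<rho> / m\<close>, transcribed to total functions on all of
  space-time: \<open>v\<close> and \<open>v0\<close> are Borel and nonnegative everywhere, and
  \<open>G\<close> is one fixed square-integrable version of the gradient of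
  \<open>v^k\<close>.\<close>

definition (in congested_data) regular_solution :: "real => (real^'n => real) => ((real^'n) \<times> real => real) => bool" where
 "regular_solution k v0 v \<longleftrightarrow> square_int v & (\<forall>z. v z >= 0) & square_int (%z. v z powr k) & loc_int v0 & (\<forall>x. v0 x >= 0) &
  (\<exists>G. square_int G &
   (\<forall>\<phi>. test_function (QT T) \<phi> --> (LBINT z. v z powr k *. grad \<phi> z) = - (LBINT z. \<phi> z *. G z)) &
   (\<forall>\<phi>. test_function (UNIV \<times> {..<T}) \<phi> -->
    (LBINT z. mQ z * v z * (grad \<phi> z \<bullet> \<beta> z) - fQ z * mQ z * v z * \<phi> z + mQ z * (fst (grad \<phi> z) \<bullet> fst (G z)))
    = (LBINT x. \<phi> (x, 0) * (m (x, 0) * v0 x))))"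

text \<open>First the exponents tend to infinity with \<open>N\<close> fixed, then \<open>N\<close>
  does. The order matters for the diffusion term: its factor is at most \<open>1 / N\<close> for
  every exponent.\<close>

lemma (in congested_data) limit_inequality_test:
 fixes v :: "nat => (real^'n) \<times> real => real"
 assumes kap: "filterlim kap at_top sequentially" "!!j. kap j > 1"
  and sol: "!!j. regular_solution (kap j) (v0 j) (v j)"
  and V: "V \<in> borel_fun" and p: "p \<in> borel_fun"
  and V0: "V0 \<in> borel_fun" and p0: "p0 \<in> borel_fun"
  and lim: "AE z in lborel. z \<in> QT T --> (%j. v j z) ----> V z & (%j. kap j / (kap j - 1) * v j z powr (kap j - 1)) ----> p z"
  and lim0: "AE x in lborel. (%j. v0 j x) ----> V0 x & (%j. kap j / (kap j - 1) * v0 j x powr (kap j - 1)) ----> p0 x"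
  and \<phi>: "test_function (UNIV \<times> {..<T}) \<phi>" "!!z. \<phi> z >= 0"
 shows "(LBINT x. \<phi> (x, 0) * m (x, 0) * V0 x)
  <= (LBINT z. mQ z * V z * (grad \<phi> z \<bullet> \<beta> z - fQ z * \<phi> z) + \<phi> z * EQ z * ind {z. p z > 0} z)"
proof -
 obtain B where B: "B > 0" "!!z. mQ z <= B" "!!z. \<bar>fQ z\<bar> <= B" "!!z. norm (\<beta> z) <= B" "!!z. EQ z <= B"
  and cm [measurable]: "mQ \<in> borel_fun" "fQ \<in> borel_fun" "\<beta> \<in> borel_fun" "EQ \<in> borel_fun"
  and B0: "!!x. m (x, 0) <= B" by (rule coeffs) blast
 have m0: "continuous_on UNIV (%x. m (x, 0))" "!!x. m (x, 0) >= 0"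
  using m_initial \<delta> by (auto intro: order_trans less_imp_le)
 have m0m [measurable]: "(%x. m (x, 0)) \<in> borel_fun" using m0(1) by (rule borel_measurable_continuous_onI)
 have abm: "\<bar>mQ z\<bar> <= B" for z using mQ_nonneg B(2) by simp
 have \<phi>s: "smooth_on UNIV \<phi>" and \<phi>c: "compact (closure {z. \<phi> z ~= 0})"
  using \<phi>(1) by (auto simp: test_function_def)
 obtain R where R: "R > 0" "vanishes_beyond R \<phi>" using compact_support_vanishes[OF \<phi>c] by blast
 have \<phi>C: "C1_with \<phi> (grad \<phi>)" by (rule smooth_imp_C1[OF \<phi>s])
 have gv: "vanishes_beyond R (grad \<phi>)" by (rule C1_with_support[OF \<phi>C R(2)])
 note [measurable] = C1_with_borel[OF \<phi>C] V p V0 p0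
 obtain B\<phi> where B\<phi>: "B\<phi> > 0" "!!z. \<bar>\<phi> z\<bar> <= B\<phi>" "!!z. norm (grad \<phi> z) <= B\<phi>"
  using C1_bounded_support_bounds[OF \<phi>C R(2)] by blast
 have \<phi>0: "\<phi> z = 0" "grad \<phi> z = 0" if "z \<notin> cball 0 R" for z
  using that vanishes_beyondD[OF R(2), of z] vanishes_beyondD[OF gv, of z] by simp_all
 define W where "W z = ind (QT T) z * div_x (%y. m y *. grad_x \<phi> y) z" for z
 obtain C where W: "W \<in> borel_fun" "!!z. z \<in> QT T ==> \<bar>div_x (%y. m y *. grad_x \<phi> y) z\<bar> <= C"
  "!!z. z \<in> QT T ==> norm z > R ==> div_x (%y. m y *. grad_x \<phi> y) z = 0"
  "!!h D. C1_with h D ==> (LBINT z. ind (QT T) z *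
   (m z * (fst (grad \<phi> z) \<bullet> fst (D z)) + h z * div_x (%y. m y *. grad_x \<phi> y) z)) = 0"
  unfolding W_def[abs_def] using diffusion_integration_by_parts[OF smooth(1) \<phi>s R(2)] by blast
 note [measurable] = W(1)
 have Wb: "\<bar>W z\<bar> <= \<bar>C\<bar>" "z \<notin> cball 0 R ==> W z = 0" for z
  using W(2)[of z] W(3)[of z] by (auto simp: W_def indicator_def)
 have vj: "square_int (v j)" "v j z >= 0" "loc_int (v0 j)" "v0 j x >= 0" for j z x
  using sol unfolding regular_solution_def by blast+
 have [measurable]: "v j \<in> borel_fun" "v0 j \<in> borel_fun" for j
  using vj(1,3)[of j] by (auto simp: square_int_def loc_int_def)
 have Hc [measurable]: "entropy_flux (kap j) N \<in> borel_fun" for j N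
 proof -
  have "kap j > 0" using kap(2)[of j] by simp
  then show ?thesis
   by (intro borel_measurable_continuous_onI continuous_at_imp_continuous_on ballI DERIV_isCont[OF entropy_flux_deriv])
 qed
 define E where "E N j s = s * exp (- N * s powr kap j) - entropy_flux (kap j) N (s powr kap j)" for N j s
 have Em [measurable]: "E N j \<in> borel_fun" for N j unfolding E_def[abs_def] by measurable
 have k1: "kap j >= 1" for j using kap(2)[of j] by simp
 \<comment> \<open>These bounds are uniform in \<open>j\<close>, and so provide the majorants for
   dominated convergence.\<close>
 have Eb: "\<bar>E N j s\<bar> <= 2 * (1 + 1 / N)" "\<bar>entropy_flux (kap j) N (s powr kap j)\<bar> <= 1 + 1 / N" if "s >= 0" "N > 0" for N j s
 proof -
  have "0 <= s * exp (- N * s powr kap j)" using that by simp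
  moreover note entropy_linear_bound[OF k1 that(2,1), of j] entropy_flux_bounds[OF k1 that(2) powr_ge_zero, of j s "kap j"]
  ultimately show "\<bar>E N j s\<bar> <= 2 * (1 + 1 / N)" "\<bar>entropy_flux (kap j) N (s powr kap j)\<bar> <= 1 + 1 / N"
   unfolding E_def by (auto simp: abs_le_iff)
 qed
 have lims: "(%j. E N j (a j)) ----> A & (%j. entropy_flux (kap j) N (a j powr kap j)) ----> exp (- N * P) - 1 & (%j. a j powr kap j) ----> P & P >= 0"
  if "!!j. a j >= 0" "a ----> A" "(%j. kap j / (kap j - 1) * a j powr (kap j - 1)) ----> P" "N > 0" for a A P N
 proof -
  note s = stiff_pressure_limit[OF kap that(1,2,3)]
  have 1: "(%j. entropy_flux (kap j) N (a j powr kap j)) ----> exp (- N * P) - 1"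
   by (rule entropy_flux_limit[OF kap that(4) _ s(4)]) simp
  have "(%j. E N j (a j)) ----> A * exp (- N * P) - (exp (- N * P) - 1)"
   unfolding E_def by (intro tendsto_intros that(2) s(4) 1)
  \<comment> \<open>Either \<open>P = 0\<close> or \<open>A = 1\<close>: where the pressure is
    positive, the density is saturated. The limit of the entropies therefore no longer depends on
    \<open>N\<close>.\<close>
  moreover have "A * exp (- N * P) - (exp (- N * P) - 1) = A"
   using s(1,3) by (cases "P = 0") auto
  ultimately show ?thesis using 1 s by simp
 qed
 \<comment> \<open>The limit of the integrands on the right as the exponents tend to infinity, for
   fixed \<open>N\<close>.\<close>
 define Y where "Y N z = mQ z * V z * (grad \<phi> z \<bullet> \<beta> z - fQ z * \<phi> z) - \<phi> z * (exp (- N * p z) - 1) * EQ z - (1 - exp (- N * p z)) / N * W z" for N z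
 have cR: "integrable lborel (%z::(real^'n) \<times> real. K * ind (cball 0 R) z)" "integrable lborel (%x::real^'n. K * ind (cball 0 R) x)" for K :: real
  using lborel_bounded_finite[OF bounded_cball, of "0::(real^'n) \<times> real" R] lborel_bounded_finite[OF bounded_cball, of "0::real^'n" R]
  by (auto simp: integrable_indicator_iff)
 have q: "\<bar>mQ z * (grad \<phi> z \<bullet> \<beta> z - fQ z * \<phi> z)\<bar> <= B * (B\<phi> * B + B * B\<phi>) * ind (cball 0 R) z" for z
 proof (cases "z \<in> cball 0 R")
  case True
  have "\<bar>grad \<phi> z \<bullet> \<beta> z\<bar> <= B\<phi> * B"
   by (rule order_trans[OF Cauchy_Schwarz_ineq2]) (use B\<phi>(1) B\<phi>(3)[of z] B(1) B(4)[of z] in \<open>auto intro!: mult_mono\<close>)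
  moreover have "\<bar>fQ z * \<phi> z\<bar> <= B * B\<phi>" unfolding abs_mult using B(1) B(3)[of z] B\<phi>(1) B\<phi>(2)[of z] by (intro mult_mono) auto
  ultimately have "\<bar>grad \<phi> z \<bullet> \<beta> z - fQ z * \<phi> z\<bar> <= B\<phi> * B + B * B\<phi>" by linarith
  then have "\<bar>mQ z * (grad \<phi> z \<bullet> \<beta> z - fQ z * \<phi> z)\<bar> <= B * (B\<phi> * B + B * B\<phi>)"
   unfolding abs_mult using abm[of z] B(1) by (intro mult_mono) auto
  then show ?thesis using True by simp
 qed (use \<phi>0 in simp)
 have qE: "\<bar>\<phi> z * EQ z\<bar> <= B\<phi> * B * ind (cball 0 R) z" for z
 proof (cases "z \<in> cball 0 R")
  case True
  have "\<bar>\<phi> z * EQ z\<bar> <= B\<phi> * B" unfolding abs_mult using B(1) B(5)[of z] EQ_nonneg[of z] B\<phi>(1) B\<phi>(2)[of z] by (intro mult_mono) auto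
  then show ?thesis using True by simp
 qed (use \<phi>0 in simp)
 have WR: "\<bar>W z\<bar> <= \<bar>C\<bar> * ind (cball 0 R) z" for z
  using Wb[of z] by (cases "z \<in> cball 0 R") auto
 \<comment> \<open>Inherited from the stiff limit. With \<open>p \<ge> 0\<close> the exponentials
   \<open>exp (- N p)\<close> stay in the unit interval, so that \<open>Y N\<close> is dominated
   uniformly in \<open>N\<close>.\<close>
 have pr: "AE z in lborel. z \<in> QT T --> 0 <= p z & 0 <= V z & V z <= 1"
  using lim
 proof eventually_elim
  fix z assume l: "z \<in> QT T --> (%j. v j z) ----> V z & (%j. kap j / (kap j - 1) * v j z powr (kap j - 1)) ----> p z"
  show "z \<in> QT T --> 0 <= p z & 0 <= V z & V z <= 1"
  proof
   assume z: "z \<in> QT T"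
   then have c: "(%j. v j z) ----> V z" "(%j. kap j / (kap j - 1) * v j z powr (kap j - 1)) ----> p z" using l by auto
   have "0 <= V z" by (rule LIMSEQ_le_const[OF c(1)]) (use vj(2) in blast)
   then show "0 <= p z & 0 <= V z & V z <= 1" using stiff_pressure_limit(1,2)[OF kap vj(2) c] by simp
  qed
 qed
 have mainN: "(LBINT x. \<phi> (x, 0) * m (x, 0) * V0 x) <= (LBINT z. Y N z)" if N: "N > 0" for N
 proof -
  define X where "X j z = mQ z * E N j (v j z) * (grad \<phi> z \<bullet> \<beta> z - fQ z * \<phi> z) - \<phi> z * entropy_flux (kap j) N (v j z powr kap j) * EQ z
    - (1 - exp (- N * v j z powr kap j)) / N * W z" for j z
  have l1: "(%j. LBINT z. X j z) ----> (LBINT z. Y N z)"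
  proof (rule integral_dominated_convergence[where w="%z. (2 * (1 + 1 / N) * (B * (B\<phi> * B + B * B\<phi>)) + (1 + 1 / N) * (B\<phi> * B) + 1 / N * \<bar>C\<bar>) * ind (cball 0 R) z"])
   show "Y N \<in> borel_measurable lborel" unfolding Y_def[abs_def] by measurable
   show "X j \<in> borel_measurable lborel" for j unfolding X_def[abs_def] by measurable
   show "integrable lborel (%z::(real^'n) \<times> real. (2 * (1 + 1 / N) * (B * (B\<phi> * B + B * B\<phi>)) + (1 + 1 / N) * (B\<phi> * B) + 1 / N * \<bar>C\<bar>) * ind (cball 0 R) z)"
    by (rule cR)
   show "AE z in lborel. (%j. X j z) ----> Y N z"
    using lim
   proof eventually_elim
    fix z assume l: "z \<in> QT T --> (%j. v j z) ----> V z & (%j. kap j / (kap j - 1) * v j z powr (kap j - 1)) ----> p z"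
    show "(%j. X j z) ----> Y N z"
    proof (cases "z \<in> QT T")
     case True
     then have c: "(%j. v j z) ----> V z" "(%j. kap j / (kap j - 1) * v j z powr (kap j - 1)) ----> p z" using l by auto
     note L = lims[OF vj(2) c N]
     show ?thesis unfolding X_def Y_def using L N by (intro tendsto_intros) auto
    next
     case False then show ?thesis by (simp add: X_def Y_def off_QT W_def)
    qed
   qed
   fix j
   show "AE z in lborel. norm (X j z) <= (2 * (1 + 1 / N) * (B * (B\<phi> * B + B * B\<phi>)) + (1 + 1 / N) * (B\<phi> * B) + 1 / N * \<bar>C\<bar>) * ind (cball 0 R) z"
   proof (rule AE_I2)
    fix z
    have e1: "\<bar>E N j (v j z)\<bar> <= 2 * (1 + 1 / N)" by (rule Eb(1)[OF vj(2) N])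
    have e2: "\<bar>entropy_flux (kap j) N (v j z powr kap j)\<bar> <= 1 + 1 / N" by (rule Eb(2)[OF vj(2) N])
    have 1: "\<bar>E N j (v j z) * (mQ z * (grad \<phi> z \<bullet> \<beta> z - fQ z * \<phi> z))\<bar> <= 2 * (1 + 1 / N) * (B * (B\<phi> * B + B * B\<phi>) * ind (cball 0 R) z)"
     unfolding abs_mult[of "E N j (v j z)"] using e1 q[of z] N by (intro mult_mono) auto
    have 2: "\<bar>entropy_flux (kap j) N (v j z powr kap j) * (\<phi> z * EQ z)\<bar> <= (1 + 1 / N) * (B\<phi> * B * ind (cball 0 R) z)"
     unfolding abs_mult[of "entropy_flux (kap j) N (v j z powr kap j)"] using e2 qE[of z] N by (intro mult_mono) auto
    have "\<bar>(1 - exp (- N * v j z powr kap j)) / N\<bar> <= 1 / N" using N by (simp add: divide_right_mono)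
    then have 3: "\<bar>(1 - exp (- N * v j z powr kap j)) / N * W z\<bar> <= 1 / N * (\<bar>C\<bar> * ind (cball 0 R) z)"
     unfolding abs_mult using WR[of z] N by (intro mult_mono) auto
    have "\<bar>X j z\<bar> <= \<bar>E N j (v j z) * (mQ z * (grad \<phi> z \<bullet> \<beta> z - fQ z * \<phi> z))\<bar> + \<bar>entropy_flux (kap j) N (v j z powr kap j) * (\<phi> z * EQ z)\<bar>
     + \<bar>(1 - exp (- N * v j z powr kap j)) / N * W z\<bar>"
    proof -
     have "X j z = E N j (v j z) * (mQ z * (grad \<phi> z \<bullet> \<beta> z - fQ z * \<phi> z)) - entropy_flux (kap j) N (v j z powr kap j) * (\<phi> z * EQ z)
     - (1 - exp (- N * v j z powr kap j)) / N * W z" unfolding X_def by (simp add: mult_ac)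
     then show ?thesis by linarith
    qed
    also have "\<dots> <= 2 * (1 + 1 / N) * (B * (B\<phi> * B + B * B\<phi>) * ind (cball 0 R) z) + (1 + 1 / N) * (B\<phi> * B * ind (cball 0 R) z) + 1 / N * (\<bar>C\<bar> * ind (cball 0 R) z)"
     using 1 2 3 by (intro add_mono)
    finally show "norm (X j z) <= (2 * (1 + 1 / N) * (B * (B\<phi> * B + B * B\<phi>)) + (1 + 1 / N) * (B\<phi> * B) + 1 / N * \<bar>C\<bar>) * ind (cball 0 R) z"
     unfolding real_norm_def distrib_right mult.assoc .
   qed
  qed
  have l0: "(%j. LBINT x. \<phi> (x, 0) * m (x, 0) * E N j (v0 j x)) ----> (LBINT x. \<phi> (x, 0) * m (x, 0) * V0 x)"
  proof (rule integral_dominated_convergence[where w="%x. (B\<phi> * B * (2 * (1 + 1 / N))) * ind (cball 0 R) x"])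
   show "(%x. \<phi> (x, 0) * m (x, 0) * V0 x) \<in> borel_measurable lborel" by measurable
   show "(%x. \<phi> (x, 0) * m (x, 0) * E N j (v0 j x)) \<in> borel_measurable lborel" for j by measurable
   show "integrable lborel (%x::real^'n. (B\<phi> * B * (2 * (1 + 1 / N))) * ind (cball 0 R) x)" by (rule cR)
   show "AE x in lborel. (%j. \<phi> (x, 0) * m (x, 0) * E N j (v0 j x)) ----> \<phi> (x, 0) * m (x, 0) * V0 x"
    using lim0
   proof eventually_elim
    fix x assume l: "(%j. v0 j x) ----> V0 x & (%j. kap j / (kap j - 1) * v0 j x powr (kap j - 1)) ----> p0 x"
    show "(%j. \<phi> (x, 0) * m (x, 0) * E N j (v0 j x)) ----> \<phi> (x, 0) * m (x, 0) * V0 x"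
     using lims[OF vj(4) conjunct1[OF l] conjunct2[OF l] N] by (intro tendsto_intros) auto
   qed
   fix j
   show "AE x in lborel. norm (\<phi> (x, 0) * m (x, 0) * E N j (v0 j x)) <= (B\<phi> * B * (2 * (1 + 1 / N))) * ind (cball 0 R) x"
   proof (rule AE_I2)
    fix x
    show "norm (\<phi> (x, 0) * m (x, 0) * E N j (v0 j x)) <= (B\<phi> * B * (2 * (1 + 1 / N))) * ind (cball 0 R) x"
    proof (cases "x \<in> cball 0 R")
     case True
     have e1: "\<bar>E N j (v0 j x)\<bar> <= 2 * (1 + 1 / N)" by (rule Eb(1)[OF vj(4) N])
     have "norm (\<phi> (x, 0) * m (x, 0) * E N j (v0 j x)) <= B\<phi> * B * (2 * (1 + 1 / N))"
      unfolding real_norm_def abs_mult using B\<phi>(1) B\<phi>(2)[of "(x, 0)"] B(1) B0[of x] m0(2)[of x] e1 by (intro mult_mono) auto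
     then show ?thesis using True by simp
    next
     case False
     then have "norm (x, 0::real) > R" by (simp add: norm_Pair)
     then show ?thesis using vanishes_beyondD[OF R(2)] False by simp
    qed
   qed
  qed
  show ?thesis
  proof (rule LIMSEQ_le[OF l0 l1], intro exI[of _ 0] allI impI)
   fix j
   obtain G where G: "square_int G"
    "!!\<phi>. test_function (QT T) \<phi> ==> (LBINT z. v j z powr kap j *. grad \<phi> z) = - (LBINT z. \<phi> z *. G z)"
    "!!\<phi>. test_function (UNIV \<times> {..<T}) \<phi> ==>
     (LBINT z. mQ z * v j z * (grad \<phi> z \<bullet> \<beta> z) - fQ z * mQ z * v j z * \<phi> z + mQ z * (fst (grad \<phi> z) \<bullet> fst (G z)))
     = (LBINT x. \<phi> (x, 0) * (m (x, 0) * v0 j x))"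
    using sol[of j] unfolding regular_solution_def by blast
   have "square_int (%z. v j z powr kap j)" using sol[of j] unfolding regular_solution_def by blast
   from entropy_inequality[OF k1 N vj(1,2) this G(1,2) vj(3,4) G(3) \<phi>]
   show "(LBINT x. \<phi> (x, 0) * m (x, 0) * E N j (v0 j x)) <= (LBINT z. X j z)"
    by (simp add: E_def X_def W_def)
  qed
 qed
 \<comment> \<open>Now \<open>N\<close> runs through \<open>Suc n\<close>:
   \<open>exp (- N p)\<close> tends to the indicator of \<open>p = 0\<close>, and the diffusion term
   is of order \<open>1 / N\<close>.\<close>
 have "(%n. LBINT z. Y (real (Suc n)) z) ----> (LBINT z. mQ z * V z * (grad \<phi> z \<bullet> \<beta> z - fQ z * \<phi> z) + \<phi> z * EQ z * ind {z. p z > 0} z)"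
 proof (rule integral_dominated_convergence[where w="%z. (B * (B\<phi> * B + B * B\<phi>) + B\<phi> * B + \<bar>C\<bar>) * ind (cball 0 R) z"])
  show "(%z. mQ z * V z * (grad \<phi> z \<bullet> \<beta> z - fQ z * \<phi> z) + \<phi> z * EQ z * ind {z. p z > 0} z) \<in> borel_measurable lborel"
   by measurable
  show "Y (real (Suc n)) \<in> borel_measurable lborel" for n unfolding Y_def[abs_def] by measurable
  show "integrable lborel (%z::(real^'n) \<times> real. (B * (B\<phi> * B + B * B\<phi>) + B\<phi> * B + \<bar>C\<bar>) * ind (cball 0 R) z)" by (rule cR)
  show "AE z in lborel. (%n. Y (real (Suc n)) z) ----> mQ z * V z * (grad \<phi> z \<bullet> \<beta> z - fQ z * \<phi> z) + \<phi> z * EQ z * ind {z. p z > 0} z"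
   using pr
  proof eventually_elim
   fix z assume a: "z \<in> QT T --> 0 <= p z & 0 <= V z & V z <= 1"
   show "(%n. Y (real (Suc n)) z) ----> mQ z * V z * (grad \<phi> z \<bullet> \<beta> z - fQ z * \<phi> z) + \<phi> z * EQ z * ind {z. p z > 0} z"
   proof (cases "z \<in> QT T")
    case True
    have top: "filterlim (%n. real (Suc n)) at_top sequentially"
     using filterlim_sequentially_Suc[of real at_top] filterlim_real_sequentially by simp
    have e: "(%n. exp (- real (Suc n) * p z)) ----> (if p z > 0 then 0 else 1)"
    proof (cases "p z > 0")
     case True
     have "filterlim (%n. p z * real (Suc n)) at_top sequentially"
      by (rule filterlim_tendsto_pos_mult_at_top[OF tendsto_const True top])
     then have "filterlim (%n. - (p z * real (Suc n))) at_bot sequentially" by (simp only: filterlim_uminus_at_top[symmetric])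
     from filterlim_compose[OF exp_at_bot this] show ?thesis using True by (simp add: mult.commute del: of_nat_Suc)
    next
     case False then show ?thesis using a \<open>z \<in> QT T\<close> by simp
    qed
    have i: "(%n. 1 / real (Suc n)) ----> 0" by (rule LIMSEQ_Suc[OF lim_1_over_n])
    have "(%n. mQ z * V z * (grad \<phi> z \<bullet> \<beta> z - fQ z * \<phi> z) - \<phi> z * (exp (- real (Suc n) * p z) - 1) * EQ z
      - (1 - exp (- real (Suc n) * p z)) * (1 / real (Suc n)) * W z)
     ----> mQ z * V z * (grad \<phi> z \<bullet> \<beta> z - fQ z * \<phi> z) - \<phi> z * ((if p z > 0 then 0 else 1) - 1) * EQ z - (1 - (if p z > 0 then 0 else 1)) * 0 * W z"
     by (intro tendsto_intros e i)
    then show ?thesis unfolding Y_def by (cases "p z > 0") (simp_all del: of_nat_Suc)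
   next
    case False then show ?thesis by (simp add: Y_def off_QT W_def)
   qed
  qed
  fix n
  show "AE z in lborel. norm (Y (real (Suc n)) z) <= (B * (B\<phi> * B + B * B\<phi>) + B\<phi> * B + \<bar>C\<bar>) * ind (cball 0 R) z"
   using pr
  proof eventually_elim
   fix z assume a: "z \<in> QT T --> 0 <= p z & 0 <= V z & V z <= 1"
   show "norm (Y (real (Suc n)) z) <= (B * (B\<phi> * B + B * B\<phi>) + B\<phi> * B + \<bar>C\<bar>) * ind (cball 0 R) z"
   proof (cases "z \<in> QT T")
    case True
    define t where "t = exp (- real (Suc n) * p z)"
    have "0 <= real (Suc n) * p z" using a True by (intro mult_nonneg_nonneg) auto
    then have "- real (Suc n) * p z <= 0" unfolding mult_minus_left by (rule le_imp_neg_le[of 0, unfolded neg_0_equal_iff_equal minus_zero])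
    then have "t <= 1" unfolding t_def exp_le_one_iff .
    then have t: "0 <= t" "t <= 1" by (simp_all add: t_def)
    have tri: "\<bar>a - b - c\<bar> <= \<bar>a\<bar> + \<bar>b\<bar> + \<bar>c\<bar>" for a b c :: real by linarith
    have 1: "\<bar>V z * (mQ z * (grad \<phi> z \<bullet> \<beta> z - fQ z * \<phi> z))\<bar> <= 1 * (B * (B\<phi> * B + B * B\<phi>) * ind (cball 0 R) z)"
     unfolding abs_mult[of "V z"] using a True q[of z] by (intro mult_mono) auto
    have 2: "\<bar>(t - 1) * (\<phi> z * EQ z)\<bar> <= 1 * (B\<phi> * B * ind (cball 0 R) z)"
     unfolding abs_mult[of "t - 1"] using t qE[of z] by (intro mult_mono) auto
    have "(1 - t) / real (Suc n) <= 1 / 1" using t by (intro frac_le) auto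
    then have "\<bar>(1 - t) / real (Suc n)\<bar> <= 1" using t by simp
    then have 3: "\<bar>(1 - t) / real (Suc n) * W z\<bar> <= 1 * (\<bar>C\<bar> * ind (cball 0 R) z)"
     unfolding abs_mult[of "(1 - t) / real (Suc n)"] using WR[of z] by (intro mult_mono) auto
    have eqY: "Y (real (Suc n)) z = V z * (mQ z * (grad \<phi> z \<bullet> \<beta> z - fQ z * \<phi> z)) - (t - 1) * (\<phi> z * EQ z) - (1 - t) / real (Suc n) * W z"
     unfolding Y_def t_def by (simp add: mult_ac)
    have "\<bar>Y (real (Suc n)) z\<bar> <= 1 * (B * (B\<phi> * B + B * B\<phi>) * ind (cball 0 R) z) + 1 * (B\<phi> * B * ind (cball 0 R) z) + 1 * (\<bar>C\<bar> * ind (cball 0 R) z)"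
     unfolding eqY by (rule order_trans[OF tri add_mono[OF add_mono[OF 1 2] 3]])
    then show ?thesis by (simp add: distrib_right)
   next
    case False
    have "0 <= (B * (B\<phi> * B + B * B\<phi>) + B\<phi> * B + \<bar>C\<bar>)" using B(1) B\<phi>(1) by simp
    then show ?thesis using False by (simp add: Y_def off_QT W_def)
   qed
  qed
 qed
 then show ?thesis by (rule LIMSEQ_le_const) (use mainN in auto)
qed

section \<open>The inequality for the deficit\<close>

text \<open>The limit inequality for \<open>V\<close> is compared with the exact transport identity
  for \<open>m\<close>. There \<open>EQ\<close> carries full weight, in the limit only weight on
  \<open>p > 0\<close>; the difference is absorption on \<open>p \<le> 0\<close>. The passage to C1
  test functions prepares for the cones.\<close>

lemma (in congested_data) deficit_inequality:
 fixes v :: "nat => (real^'n) \<times> real => real"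
 assumes kap: "filterlim kap at_top sequentially" "!!j. kap j > 1"
  and sol: "!!j. regular_solution (kap j) (v0 j) (v j)"
  and V: "V \<in> borel_fun" "!!z. 0 <= V z" "!!z. V z <= 1" and p: "p \<in> borel_fun"
  and V0: "V0 \<in> borel_fun" "!!x. 0 <= V0 x" "!!x. V0 x <= 1" and p0: "p0 \<in> borel_fun"
  and lim: "AE z in lborel. z \<in> QT T --> (%j. v j z) ----> V z & (%j. kap j / (kap j - 1) * v j z powr (kap j - 1)) ----> p z"
  and lim0: "AE x in lborel. (%j. v0 j x) ----> V0 x & (%j. kap j / (kap j - 1) * v0 j x powr (kap j - 1)) ----> p0 x"
  and \<phi>: "C1_with \<phi> D" "!!z. \<phi> z >= 0" "compact (closure {z. \<phi> z ~= 0})" "closure {z. \<phi> z ~= 0} \<subseteq> UNIV \<times> {..<T}"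
 shows "0 <= (LBINT z. (- (EQ z * ind {z. p z <= 0} z) + fQ z * (mQ z * (1 - V z))) * \<phi> z + ((- (mQ z * (1 - V z))) *. \<beta> z) \<bullet> D z)
   + (LBINT x. (m (x, 0) * (1 - V0 x)) * \<phi> (x, 0))"
proof -
 define A where "A z = - (EQ z * ind {z. p z <= 0} z) + fQ z * (mQ z * (1 - V z))" for z
 define Bw where "Bw z = (- (mQ z * (1 - V z))) *. \<beta> z" for z
 define c where "c x = m (x, 0) * (1 - V0 x)" for x
 obtain B where B: "B > 0" "!!z. mQ z <= B" "!!z. \<bar>fQ z\<bar> <= B" "!!z. norm (\<beta> z) <= B" "!!z. EQ z <= B"
  and cm [measurable]: "mQ \<in> borel_fun" "fQ \<in> borel_fun" "\<beta> \<in> borel_fun" "EQ \<in> borel_fun"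
  and B0: "!!x. m (x, 0) <= B" by (rule coeffs) blast
 have m0: "continuous_on UNIV (%x. m (x, 0))" "!!x. m (x, 0) >= 0"
  using m_initial \<delta> by (auto intro: order_trans less_imp_le)
 have m0m [measurable]: "(%x. m (x, 0)) \<in> borel_fun" using m0(1) by (rule borel_measurable_continuous_onI)
 note [measurable] = V(1) V0(1) p p0
 have w: "\<bar>mQ z * (1 - V z)\<bar> <= B" for z
 proof -
  have "\<bar>mQ z\<bar> * \<bar>1 - V z\<bar> <= B * 1" using mQ_nonneg[of z] B(1) B(2)[of z] V(2)[of z] V(3)[of z] by (intro mult_mono) auto
  then show ?thesis by (simp add: abs_mult)
 qed
 have fw: "\<bar>fQ z * (mQ z * (1 - V z))\<bar> <= B * B" for z
  unfolding abs_mult[of "fQ z"] using B(1) B(3)[of z] w[of z] by (intro mult_mono) auto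
 have bw: "norm ((- (mQ z * (1 - V z))) *. \<beta> z) <= B * B" for z
  unfolding norm_scaleR abs_minus_cancel using B(1) B(4)[of z] w[of z] by (intro mult_mono) auto
 have Ab: "\<bar>A z\<bar> <= B + B * B" for z
  unfolding A_def using fw[of z] B(5)[of z] EQ_nonneg[of z] by (cases "p z <= 0") (auto simp: abs_le_iff)
 have Am: "A \<in> borel_fun" unfolding A_def[abs_def] by measurable
 have Bm: "Bw \<in> borel_fun" unfolding Bw_def[abs_def] by measurable
 have c_m: "c \<in> borel_fun" unfolding c_def[abs_def] by measurable
 have Al: "loc_int A" by (rule loc_int_bounded[where B="B + B * B", OF Am]) (use Ab in simp)
 have Bl: "loc_int Bw" by (rule loc_int_bounded[where B="B * B", OF Bm]) (unfold Bw_def, rule bw)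
 have cb: "norm (c x) <= B * 1" for x
  unfolding c_def real_norm_def abs_mult using B0[of x] m0(2)[of x] V0(2)[of x] V0(3)[of x] B(1) by (intro mult_mono) auto
 have cl: "loc_int c" by (rule loc_int_bounded[OF c_m cb])
 have oS: "open (UNIV \<times> {..<T} :: ((real^'n) \<times> real) set)" by (intro open_Times) auto
 have test: "0 <= (LBINT z. A z * th z + Bw z \<bullet> grad th z) + (LBINT x. c x * th (x, 0))"
  if t: "test_function (UNIV \<times> {..<T}) th" and t0: "!!z. th z >= 0" for th :: "(real^'n) \<times> real => real"
 proof -
 have ths: "smooth_on UNIV th" and thc: "compact (closure {z. th z ~= 0})" and thS: "closure {z. th z ~= 0} \<subseteq> UNIV \<times> {..<T}"
  using t by (auto simp: test_function_def)
 obtain R where R: "R > 0" "vanishes_beyond R th" using compact_support_vanishes[OF thc] by blast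
 have C: "C1_with th (grad th)" by (rule smooth_imp_C1[OF ths])
 have gv: "vanishes_beyond R (grad th)" by (rule C1_with_support[OF C R(2)])
 have gc: "continuous_on UNIV (grad th)" using C unfolding C1_with_def by blast
 obtain \<eta> where \<eta>: "\<eta> > 0" "!!z. snd z > T - \<eta> ==> th z = 0" using test_function_time_support[OF thc thS] by blast
 have tr: "(LBINT z. mQ z * (grad th z \<bullet> \<beta> z) + th z * (EQ z - fQ z * mQ z)) = (LBINT x. th (x, 0) * m (x, 0))"
  by (rule transport[OF C R(2)]) (use \<eta> in simp)
 have li: "(LBINT x. th (x, 0) * m (x, 0) * V0 x)
  <= (LBINT z. mQ z * V z * (grad th z \<bullet> \<beta> z - fQ z * th z) + th z * EQ z * ind {z. p z > 0} z)"
  by (rule limit_inequality_test[OF kap sol V(1) p V0(1) p0 lim lim0 t t0])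
 have lmb: "loc_int (%z. mQ z *. \<beta> z)"
 proof (rule loc_int_bounded[where B="B * B"], measurable)
  show "norm (mQ z *. \<beta> z) <= B * B" for z unfolding norm_scaleR using mQ_nonneg[of z] B(1) B(2)[of z] B(4)[of z] by (intro mult_mono) auto
 qed
 have lE: "loc_int (%z. EQ z - fQ z * mQ z)"
 proof (rule loc_int_bounded[where B="B + B * B"], measurable)
  fix z
  have "\<bar>fQ z * mQ z\<bar> <= B * B" unfolding abs_mult using B(1) B(3)[of z] mQ_nonneg[of z] B(2)[of z] by (intro mult_mono) auto
  then show "norm (EQ z - fQ z * mQ z) <= B + B * B" using B(5)[of z] EQ_nonneg[of z] by simp
 qed
 have i1: "integrable lborel (%z. mQ z * (grad th z \<bullet> \<beta> z) + th z * (EQ z - fQ z * mQ z))"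
  using integrable_inner_continuous[OF lmb gc gv] set_integrable_mult_continuous[OF lE C1_with_continuous[OF C] R(2)]
  by (simp add: inner_commute[of "\<beta> _"] mult.commute[of "EQ _ - _"])
 have i2: "integrable lborel (%z. A z * th z + Bw z \<bullet> grad th z)"
  using Bochner_Integration.integrable_add[OF set_integrable_mult_continuous[OF Al C1_with_continuous[OF C] R(2)]
   integrable_inner_continuous[OF Bl gc gv]] by simp
 have m0l: "loc_int (%x. m (x, 0))" by (rule loc_int_bounded[where B=B]) (use m0 B0 in auto)
 have m0V: "loc_int (%x. m (x, 0) * V0 x)"
 proof (rule loc_int_bounded[where B="B * 1"], measurable)
  show "norm (m (x, 0) * V0 x) <= B * 1" for x
   unfolding real_norm_def abs_mult using B0[of x] m0(2)[of x] V0(2)[of x] V0(3)[of x] B(1) by (intro mult_mono) auto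
 qed
 have i3: "integrable lborel (%x. th (x, 0) * m (x, 0))" "integrable lborel (%x. th (x, 0) * m (x, 0) * V0 x)"
  using set_integrable_mult_continuous[OF m0l vanishes_beyond_slice[OF C1_with_continuous[OF C] R(2)], of 0]
   set_integrable_mult_continuous[OF m0V vanishes_beyond_slice[OF C1_with_continuous[OF C] R(2)], of 0]
  by (simp_all add: mult_ac)
 have "(LBINT z. mQ z * V z * (grad th z \<bullet> \<beta> z - fQ z * th z) + th z * EQ z * ind {z. p z > 0} z)
  = (LBINT z. (mQ z * (grad th z \<bullet> \<beta> z) + th z * (EQ z - fQ z * mQ z)) + (A z * th z + Bw z \<bullet> grad th z))"
  by (rule Bochner_Integration.integral_cong[OF refl])
    (auto simp: A_def Bw_def indicator_def inner_commute[of "\<beta> _"] algebra_simps)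
 also have "\<dots> = (LBINT x. th (x, 0) * m (x, 0)) + (LBINT z. A z * th z + Bw z \<bullet> grad th z)"
  unfolding tr[symmetric] by (rule Bochner_Integration.integral_add[OF i1 i2])
 finally have e1: "(LBINT z. mQ z * V z * (grad th z \<bullet> \<beta> z - fQ z * th z) + th z * EQ z * ind {z. p z > 0} z)
  = (LBINT x. th (x, 0) * m (x, 0)) + (LBINT z. A z * th z + Bw z \<bullet> grad th z)" .
 have e2: "(LBINT x. c x * th (x, 0)) = (LBINT x. th (x, 0) * m (x, 0)) - (LBINT x. th (x, 0) * m (x, 0) * V0 x)"
  unfolding Bochner_Integration.integral_diff[OF i3, symmetric]
  by (rule Bochner_Integration.integral_cong[OF refl]) (simp add: c_def algebra_simps)
 show "0 <= (LBINT z. A z * th z + Bw z \<bullet> grad th z) + (LBINT x. c x * th (x, 0))"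
  using li unfolding e1 e2 by linarith
 qed
 have "0 <= (LBINT z. A z * \<phi> z + Bw z \<bullet> D z) + (LBINT x. c x * \<phi> (x, 0))"
  by (rule test_inequality_extends_C1[OF Al Bl cl oS test \<phi>])
 then show ?thesis unfolding A_def Bw_def c_def .
qed

subsection \<open>The flow\<close>

lemma limit_at_zero_le:
 fixes g :: "real => real"
 assumes "T > 0" "continuous_on {0..T} g" "!!t. 0 < t ==> t < T ==> g t <= c"
 shows "g 0 <= c"
proof -
 have l: "(g \<longlongrightarrow> g 0) (at 0 within {0..T})" using assms(1,2) by (simp add: continuous_on)
 have "\<forall>\<^sub>F t in at 0 within {0..T}. t \<in> {0<..<T}"
  unfolding eventually_at by (rule exI[of _ T]) (use assms(1) in \<open>auto simp: dist_real_def\<close>)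
 then have "\<forall>\<^sub>F t in at 0 within {0..T}. g t <= c" by eventually_elim (use assms(3) in auto)
 moreover have "at 0 within {0..T} ~= bot"
  using assms(1) by (simp add: at_within_Icc_at_right trivial_limit_at_right_real)
 ultimately show ?thesis by (intro tendsto_upperbound[OF l])
qed

locale congested_flow = congested_data T \<delta> m f b
 for T \<delta> and m f :: "(real^'n) \<times> real => real" and b :: "(real^'n) \<times> real => real^'n" +
 fixes X :: "real => real^'n => real^'n"
 assumes flow: "streamlines T b X"
begin

lemma X0: "X 0 y = y"
 using flow by (simp add: streamlines_def)

lemma X_deriv_within: "0 <= t ==> t < T ==> ((%s. X s y) has_vector_derivative - b (X t y, t)) (at t within {0..<T})"
 using flow by (simp add: streamlines_def)

lemma X_deriv: "0 < t ==> t < T ==> ((%s. X s y) has_vector_derivative - b (X t y, t)) (at t)"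
proof -
 assume t: "0 < t" "t < T"
 then have "((%s. X s y) has_vector_derivative - b (X t y, t)) (at t within {0<..<T})"
  by (intro has_vector_derivative_within_subset[OF X_deriv_within]) auto
 then show ?thesis using t at_within_open[of t "{0<..<T}"] by simp
qed

lemma X_continuous: "continuous_on {0..<T} (%t. X t y)"
 unfolding continuous_on_eq_continuous_within
 using has_vector_derivative_continuous[OF X_deriv_within] by auto

lemma drift_bounds:
 obtains L where "L > 0" "!!x y t. 0 <= t ==> t < T ==> norm (b (x, t) - b (y, t)) <= L * norm (x - y)"
  "!!x t. 0 <= t ==> t < T ==> norm (b (x, t)) <= L" "!!z. \<bar>fQ z\<bar> <= L"
proof -
 obtain Bb where Bb: "Bb > 0" "!!z. z \<in> QT T ==> norm (b z) <= Bb"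
  "!!z v. z \<in> QT T ==> norm (frechet_derivative b (at z) v) <= Bb * norm v"
  "!!z. z \<in> QT T ==> (b has_derivative frechet_derivative b (at z)) (at z)"
  "continuous_on (QT T) b" "!!v. continuous_on (QT T) (%z. frechet_derivative b (at z) v)"
  using smooth_boundedD[OF smooth(3)] by blast
 obtain B where B: "B > 0" "!!z. mQ z <= B" "!!z. \<bar>fQ z\<bar> <= B" "!!z. norm (\<beta> z) <= B" "!!z. EQ z <= B"
  and cm: "mQ \<in> borel_fun" "fQ \<in> borel_fun" "\<beta> \<in> borel_fun" "EQ \<in> borel_fun"
  and B0: "!!x. m (x, 0) <= B" by (rule coeffs) blast
 have bc: "continuous_on {0..T} (%t. b (x, t))" for x
 proof -
  have c: "continuous_on (UNIV \<times> {0..T}) b" using smooth by (simp add: smooth_bounded_def)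
  show ?thesis by (rule continuous_on_compose2[OF c]) (auto intro!: continuous_intros)
 qed
 have lip: "norm (b (x, t) - b (y, t)) <= Bb * norm (x - y)" if t: "0 < t" "t < T" for x y t
 proof -
  have "norm (b (x, t) - b (y, t)) <= Bb * norm ((x, t) - (y, t))"
  proof (rule differentiable_bound[OF convex_QT[of T]])
   fix z :: "(real^'n) \<times> real" assume z: "z \<in> QT T"
   show "(b has_derivative frechet_derivative b (at z)) (at z within QT T)"
    by (rule has_derivative_at_withinI[OF Bb(4)[OF z]])
   show "onorm (frechet_derivative b (at z)) <= Bb"
    by (rule onorm_bound) (use Bb(1) Bb(3)[OF z] in auto)
  qed (use t in \<open>auto simp: QT_iff\<close>)
  then show ?thesis by (simp add: norm_Pair)
 qed
 have lip0: "norm (b (x, 0) - b (y, 0)) <= Bb * norm (x - y)" for x y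
  by (rule limit_at_zero_le[OF T]) (use lip in \<open>auto intro!: continuous_intros bc\<close>)
 have bd: "norm (b (x, t)) <= Bb" if "0 < t" "t < T" for x t using Bb(2)[of "(x, t)"] that by (simp add: QT_iff)
 have bd0: "norm (b (x, 0)) <= Bb" for x
  by (rule limit_at_zero_le[OF T]) (use bd in \<open>auto intro!: continuous_intros bc\<close>)
 show thesis
 proof (rule that[of "Bb + B"])
  show "Bb + B > 0" using Bb(1) B(1) by simp
  fix x y :: "real^'n" and t :: real assume t: "0 <= t" "t < T"
  have "norm (b (x, t) - b (y, t)) <= Bb * norm (x - y)"
   using lip[of t x y] lip0[of x y] t by (cases "t = 0") auto
  also have "\<dots> <= (Bb + B) * norm (x - y)" using B(1) by (intro mult_right_mono) auto
  finally show "norm (b (x, t) - b (y, t)) <= (Bb + B) * norm (x - y)" .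
 next
  fix x :: "real^'n" and t :: real assume t: "0 <= t" "t < T"
  show "norm (b (x, t)) <= Bb + B" using bd[of t x] bd0[of x] t B(1) by (cases "t = 0") auto
 next
  show "\<bar>fQ z\<bar> <= Bb + B" for z using B(3)[of z] Bb(1) by simp
 qed
qed

text \<open>Streamlines cannot approach each other faster than exponentially:
  \<open>exp (2 L s)\<close> times the squared distance has nonnegative derivative. This gives
  injectivity of the flow map together with a Lipschitz bound for its inverse.\<close>

lemma flow_separation:
 assumes L: "!!x y t. 0 <= t ==> t < T ==> norm (b (x, t) - b (y, t)) <= L * norm (x - y)"
  and t: "0 <= t" "t < T"
 shows "norm (y - y') <= exp (L * t) * norm (X t y - X t y')"
proof -
 define r where "r s = exp (2 * L * s) * ((X s y - X s y') \<bullet> (X s y - X s y'))" for s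
 have "r 0 <= r t"
 proof (rule DERIV_nonneg_imp_increasing_open[OF t(1)])
  show "continuous_on {0..t} r"
   unfolding r_def[abs_def] using t by (intro continuous_intros continuous_on_subset[OF X_continuous]) auto
  fix s assume s: "0 < s" "s < t"
  let ?d = "X s y - X s y'" and ?b = "b (X s y, s) - b (X s y', s)"
  have st: "s < T" using s t by simp
  have "((%s. X s y - X s y') has_vector_derivative - ?b) (at s)"
   by (rule has_vector_derivative_eq_rhs[OF has_vector_derivative_diff[OF X_deriv[OF s(1) st] X_deriv[OF s(1) st]]]) simp
  then have "((%s. X s y - X s y') has_derivative (%h. h *. (- ?b))) (at s)" by (simp add: has_vector_derivative_def)
  from has_derivative_inner[OF this this]
  have "((%s. (X s y - X s y') \<bullet> (X s y - X s y')) has_derivative (%h. (- 2 * (?d \<bullet> ?b)) * h)) (at s)"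
   by (rule has_derivative_eq_rhs) (auto simp: fun_eq_iff inner_commute algebra_simps)
  then have d: "((%s. (X s y - X s y') \<bullet> (X s y - X s y')) has_real_derivative (- 2 * (?d \<bullet> ?b))) (at s)"
   unfolding has_field_derivative_def .
  have e: "((%s. exp (2 * L * s)) has_real_derivative 2 * L * exp (2 * L * s)) (at s)" by (auto intro!: derivative_eq_intros)
  have "(r has_real_derivative (2 * L * exp (2 * L * s) * (?d \<bullet> ?d) + (- 2 * (?d \<bullet> ?b)) * exp (2 * L * s))) (at s)"
   unfolding r_def[abs_def] by (rule DERIV_mult[OF e d])
  moreover have "?d \<bullet> ?b <= L * (?d \<bullet> ?d)"
  proof -
   have "?d \<bullet> ?b <= norm ?d * norm ?b" by (rule norm_cauchy_schwarz)
   also have "\<dots> <= norm ?d * (L * norm ?d)" using s st by (intro mult_left_mono L) auto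
   finally show ?thesis by (simp add: dot_square_norm power2_eq_square mult_ac)
  qed
  then have "0 <= 2 * exp (2 * L * s) * (L * (?d \<bullet> ?d) - ?d \<bullet> ?b)" by simp
  then have "0 <= 2 * L * exp (2 * L * s) * (?d \<bullet> ?d) + (- 2 * (?d \<bullet> ?b)) * exp (2 * L * s)" by (simp add: algebra_simps)
  ultimately show "\<exists>y. (r has_real_derivative y) (at s) & 0 <= y" by blast
 qed
 then have "(norm (y - y'))\<^sup>2 <= (exp (L * t) * norm (X t y - X t y'))\<^sup>2"
  by (simp add: r_def X0 dot_square_norm power_mult_distrib exp_double[symmetric] mult.assoc)
 then show ?thesis by (rule power2_le_imp_le) simp
qed

lemma flow_speed:
 assumes L: "!!x t. 0 <= t ==> t < T ==> norm (b (x, t)) <= L" and st: "0 <= s" "s < T" "0 <= t" "t < T"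
 shows "norm (X t y - X s y) <= L * \<bar>t - s\<bar>"
proof -
 have "norm (X t y - X s y) <= L * norm (t - s)"
 proof (rule differentiable_bound[where S="{0..<T}" and f'="%u h. h *. (- b (X u y, u))"])
  fix u assume u: "u \<in> {0..<T}"
  show "((%t. X t y) has_derivative (%h. h *. (- b (X u y, u)))) (at u within {0..<T})"
   using X_deriv_within[of u y] u by (simp add: has_vector_derivative_def)
  show "onorm (%h. h *. (- b (X u y, u))) <= L"
   using L[of u "X u y"] u T norm_ge_zero order_trans[OF norm_ge_zero L[of u "X u y"]]
   by (intro onorm_bound) (auto simp: mult.commute[of L] intro!: mult_left_mono)
 qed (use st in auto)
 then show ?thesis by simp
qed

text \<open>The bad pairs \<open>(y, t)\<close> are the image, under the inverse
  \<open>\<Psi>\<close> of the space-time flow map, of a subset of the null set. By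
  \<open>flow_separation\<close> and \<open>flow_speed\<close> the inverse is Lipschitz on that set,
  so the image is null as well, and Fubini slices it along streamlines.\<close>

lemma flow_AE:
 assumes "AE z in lborel. z \<in> QT T --> P z"
 shows "AE y in lborel. AE t in lborel. 0 < t & t < T --> P (X t y, t)"
proof -
 obtain L where L: "L > 0" "!!x y t. 0 <= t ==> t < T ==> norm (b (x, t) - b (y, t)) <= L * norm (x - y)"
  "!!x t. 0 <= t ==> t < T ==> norm (b (x, t)) <= L" "!!z. \<bar>fQ z\<bar> <= L" by (rule drift_bounds) blast
 define N where "N = {z \<in> QT T. \<not> P z}"
 obtain N0 where N0: "{z \<in> space lborel. \<not> (z \<in> QT T --> P z)} \<subseteq> N0" "emeasure lborel N0 = 0" "N0 \<in> sets lborel"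
  using assms by (rule AE_E)
 have "negligible N0" unfolding negligible_iff_null_sets
  by (rule null_sets_completionI, rule null_setsI) (use N0 in auto)
 then have "negligible N" by (rule negligible_subset) (use N0(1) in \<open>auto simp: N_def\<close>)
 define Z where "Z = {(y, t). 0 < t & t < T & (X t y, t) \<in> N}"
 \<comment> \<open>The description denotes the starting point when the flow reaches the given point;
   every point of \<open>N'\<close> is of this kind.\<close>
 define \<Psi> where "\<Psi> z = (THE y. X (snd z) y = fst z, snd z)" for z :: "(real^'n) \<times> real"
 have inj: "(THE y'. X t y' = X t y) = y" if "0 < t" "t < T" for t y
 proof (rule the_equality)
  fix y' assume "X t y' = X t y"
  then show "y' = y" using flow_separation[OF L(2), of t y' y] that by simp
 qed simp
 define N' where "N' = (%(y, t). (X t y, t)) ` Z"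
 have ZN: "Z = \<Psi> ` N'"
  unfolding N'_def image_image \<Psi>_def using inj by (force simp: Z_def image_iff)
 have "negligible N'" by (rule negligible_subset[OF \<open>negligible N\<close>]) (auto simp: N'_def Z_def)
 then have "negligible Z"
  unfolding ZN
 proof (rule negligible_locally_Lipschitz_image[OF order_refl])
  fix z assume "z \<in> N'"
  then obtain y t where z: "z = (X t y, t)" "0 < t" "t < T" by (auto simp: N'_def Z_def)
  have "norm (\<Psi> w - \<Psi> z) <= (exp (L * T) * (L + 1) + 1) * norm (w - z)" if wN: "w \<in> N'" for w
  proof -
   obtain y' s where w: "w = (X s y', s)" "0 < s" "s < T" using wN by (auto simp: N'_def Z_def)
   have p: "\<Psi> w = (y', s)" "\<Psi> z = (y, t)" using inj z w by (auto simp: \<Psi>_def)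
   have a: "\<bar>s - t\<bar> <= norm (w - z)" using norm_snd_le[of "s - t" "X s y' - X t y"] by (simp add: w z)
   have c: "norm (X s y' - X t y) <= norm (w - z)" using norm_fst_le[of "X s y' - X t y" "s - t"] by (simp add: w z)
   \<comment> \<open>Both streamlines are compared at the common time \<open>s\<close>; moving one
     of them from time \<open>t\<close> to time \<open>s\<close> costs at most \<open>L\<close>
     times the time difference.\<close>
   have "norm (y' - y) <= exp (L * s) * norm (X s y' - X s y)" by (rule flow_separation[OF L(2)]) (use w in auto)
   also have "norm (X s y' - X s y) <= norm (X s y' - X t y) + norm (X t y - X s y)"
    using norm_triangle_ineq[of "X s y' - X t y" "X t y - X s y"] by simp
   also have "norm (X t y - X s y) <= L * \<bar>t - s\<bar>" by (rule flow_speed[OF L(3)]) (use z w in auto)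
   finally have "norm (y' - y) <= exp (L * s) * (norm (X s y' - X t y) + L * \<bar>t - s\<bar>)" by simp
   also have "\<dots> <= exp (L * T) * (norm (w - z) + L * norm (w - z))"
    using a c L(1) w by (intro mult_mono add_mono mult_left_mono) (auto simp: abs_minus_commute)
   finally have 1: "norm (y' - y) <= exp (L * T) * (L + 1) * norm (w - z)" by (simp add: algebra_simps)
   have "norm (\<Psi> w - \<Psi> z) <= norm (y' - y) + norm (s - t)" unfolding p using norm_Pair_le[of "y' - y" "s - t"] by simp
   then show ?thesis using 1 a by (simp add: distrib_right)
  qed
  then show "\<exists>S B. open S & z \<in> S & (\<forall>w\<in>N' \<inter> S. norm (\<Psi> w - \<Psi> z) <= B * norm (w - z))"
   by (intro exI[of _ UNIV] exI[of _ "exp (L * T) * (L + 1) + 1"]) auto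
 qed
 then have "AE z in lebesgue. z \<notin> Z" by (simp add: negligible_iff_null_sets AE_not_in)
 then have "AE z in lborel. z \<notin> Z" by (simp add: AE_completion_iff)
 then have "AE z in lborel \<Otimes>\<^sub>M lborel. z \<notin> Z" by (simp only: lborel_prod)
 from lborel_pair.AE_pair[OF this] show ?thesis
  by eventually_elim (auto simp: Z_def N_def QT_iff elim!: eventually_mono)
qed

section \<open>Streamlines continued to negative times\<close>

text \<open>Test functions that see the initial datum live across \<open>t = 0\<close>, and cones
  with a C1 axis are needed there. The streamline is continued along its initial tangent.\<close>

definition path :: "real^'n => real => real^'n" where
 "path y t = (if t < 0 then y - t *. b (y, 0) else X t y)"
definition velocity :: "real^'n => real => real^'n" where
 "velocity y t = (if t < 0 then - b (y, 0) else - b (X t y, t))"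

lemma path_deriv:
 assumes "t < T" shows "(path y has_vector_derivative velocity y t) (at t)"
proof -
 have lin: "((%t. y - t *. b (y, 0)) has_vector_derivative - b (y, 0)) (at t within S)" for t S
  by (auto intro!: derivative_eq_intros)
 consider "t < 0" | "t > 0" | "t = 0" by linarith
 then show ?thesis
 proof cases
  case 1
  have "(path y has_vector_derivative - b (y, 0)) (at t)"
   by (rule has_vector_derivative_transform_within_open[OF lin, of "{..<0}"]) (use 1 in \<open>auto simp: path_def\<close>)
  then show ?thesis using 1 by (simp add: velocity_def)
 next
  case 2
  have "(path y has_vector_derivative - b (X t y, t)) (at t)"
   by (rule has_vector_derivative_transform_within_open[OF X_deriv[OF 2 assms], of "{0<..}"]) (use 2 in \<open>auto simp: path_def\<close>)
  then show ?thesis using 2 by (simp add: velocity_def)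
 next
  case 3
  \<comment> \<open>At 0 the two one-sided derivatives, from the tangent line and from the
    streamline, both equal \<open>?v\<close> and are glued.\<close>
  let ?v = "- b (y, 0)"
  have "(path y has_vector_derivative ?v) (at 0 within {..0})"
   by (rule has_vector_derivative_transform_within[OF lin zero_less_one]) (auto simp: path_def X0)
  then have "(path y has_vector_derivative ?v) (at 0 within {..<0})"
   by (rule has_vector_derivative_within_subset) auto
  then have l: "((%u. (1 / norm (u - 0)) *. (path y u - (path y 0 + (u - 0) *. ?v))) \<longlongrightarrow> 0) (at_left 0)"
   by (simp add: has_vector_derivative_def has_derivative_within)
  have "(path y has_vector_derivative ?v) (at 0 within {0..<T})"
  proof (rule has_vector_derivative_transform_within[OF _ zero_less_one])
   show "((%t. X t y) has_vector_derivative ?v) (at 0 within {0..<T})"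
    using X_deriv_within[of 0 y] T by (simp add: X0)
  qed (use T in \<open>auto simp: path_def\<close>)
  then have "(path y has_vector_derivative ?v) (at 0 within {0<..<T})"
   by (rule has_vector_derivative_within_subset) auto
  moreover have "at 0 within {0<..<T} = at_right (0::real)"
   by (rule at_within_nhd[of 0 "{..<T}"]) (use T in auto)
  ultimately have r: "((%u. (1 / norm (u - 0)) *. (path y u - (path y 0 + (u - 0) *. ?v))) \<longlongrightarrow> 0) (at_right 0)"
   by (simp add: has_vector_derivative_def has_derivative_within)
  have "((%u. (1 / norm (u - 0)) *. (path y u - (path y 0 + (u - 0) *. ?v))) \<longlongrightarrow> 0) (at 0)"
   by (rule filterlim_split_at[OF l r])
  then have "(path y has_vector_derivative ?v) (at 0)"
   unfolding has_vector_derivative_def has_derivative_within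
   by (auto intro!: bounded_linear_minus bounded_linear_scaleR_left)
  then show ?thesis using 3 by (simp add: velocity_def X0)
 qed
qed

lemma velocity_continuous: "continuous_on {..<T} (velocity y)"
proof -
 have b: "continuous_on (UNIV \<times> {0..T}) b" using smooth by (simp add: smooth_bounded_def)
 have x: "continuous_on {..<T} (%t. X (max t 0) y)"
  by (rule continuous_on_compose2[OF X_continuous]) (use T in \<open>auto intro!: continuous_intros\<close>)
 have "continuous_on {..<T} (%t. - b (X (max t 0) y, max t 0))"
  by (intro continuous_on_minus continuous_on_compose2[OF b] continuous_on_Pair x)
    (use T in \<open>auto intro!: continuous_intros\<close>)
 then show ?thesis by (rule continuous_on_eq) (auto simp: velocity_def X0 max_def)
qed

end

subsection \<open>Averages over shrinking balls\<close>

text \<open>A C1 profile with explicit derivative, in keeping with the extension of the inequalities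
  to C1 test functions.\<close>

definition pos_square :: "real => real" where
 "pos_square s = (max s 0)\<^sup>2"

lemma pos_square_deriv: "(pos_square has_real_derivative 2 * max s 0) (at s)"
proof -
 consider "s > 0" | "s < 0" | "s = 0" by linarith
 then show ?thesis
 proof cases
  case 1
  have "((%s. s\<^sup>2) has_real_derivative 2 * max s 0) (at s)" using 1 by (auto intro!: derivative_eq_intros)
  then show ?thesis
   by (rule has_field_derivative_transform_within_open[where S="{0<..}"]) (use 1 in \<open>auto simp: pos_square_def\<close>)
 next
  case 2
  have "((%s. 0) has_real_derivative 2 * max s 0) (at s)" using 2 by simp
  then show ?thesis
   by (rule has_field_derivative_transform_within_open[where S="{..<0}"]) (use 2 in \<open>auto simp: pos_square_def\<close>)
 next
  case 3
  have "((%y. (pos_square y - pos_square 0) / (y - 0)) \<longlongrightarrow> 0) (at 0)"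
  proof (rule tendsto_sandwich[where f="%y. -\<bar>y\<bar>" and h="%y. \<bar>y\<bar>"])
   show "\<forall>\<^sub>F y in at 0. - \<bar>y\<bar> <= (pos_square y - pos_square 0) / (y - 0)"
    by (auto simp: eventually_at_filter pos_square_def max_def power2_eq_square)
   show "\<forall>\<^sub>F y in at 0. (pos_square y - pos_square 0) / (y - 0) <= \<bar>y\<bar>"
    by (auto simp: eventually_at_filter pos_square_def max_def power2_eq_square)
   show "((%y. - \<bar>y\<bar>) \<longlongrightarrow> 0) (at (0::real))" "((%y. \<bar>y\<bar>) \<longlongrightarrow> 0) (at (0::real))"
    by (auto intro!: tendsto_eq_intros)
  qed
  then show ?thesis using 3 by (simp add: has_field_derivative_iff)
 qed
qed

lemma pos_square_simps: "pos_square s >= 0" "s <= 0 ==> pos_square s = 0" "s <= 1 ==> pos_square s <= 1"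
 by (auto simp: pos_square_def max_def power_le_one)

lemma pos_square_continuous: "continuous_on S pos_square"
 unfolding pos_square_def[abs_def] by (intro continuous_intros)

text \<open>The squared positive part of \<open>1 - \<zeta> \<bullet> \<zeta>\<close>, normalised to
  unit mass. A function of the squared distance is differentiable also at the centre, and its
  derivative along a moving centre is explicit.\<close>

definition ball_kernel :: "'a::euclidean_space => real" where
 "ball_kernel \<zeta> = pos_square (1 - \<zeta> \<bullet> \<zeta>) / (LBINT \<xi>::'a. pos_square (1 - \<xi> \<bullet> \<xi>))"

lemma ball_kernel:
 "integrable lborel (%\<zeta>::'a::euclidean_space. pos_square (1 - \<zeta> \<bullet> \<zeta>))"
 "(LBINT \<xi>::'a. pos_square (1 - \<xi> \<bullet> \<xi>)) > 0"
 "integrable lborel (ball_kernel :: 'a => real)" "(LBINT \<zeta>::'a. ball_kernel \<zeta>) = 1"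
 "ball_kernel (\<zeta> :: 'a) >= 0" "norm (\<zeta> :: 'a) >= 1 ==> ball_kernel \<zeta> = 0" "(ball_kernel :: 'a => real) \<in> borel_fun"
proof -
 define k where "k = (%z::'a. pos_square (1 - z \<bullet> z))"
 have cont: "continuous_on UNIV k" unfolding k_def
  by (rule continuous_on_compose2[OF pos_square_continuous[of UNIV]]) (auto intro!: continuous_intros)
 have kb: "k \<in> borel_fun" by (rule borel_measurable_continuous_onI[OF cont])
 have ks: "k z = 0" if "norm z >= 1" for z
 proof -
  have "(norm z)\<^sup>2 >= 1\<^sup>2" using that by (intro power_mono) auto
  then show ?thesis unfolding k_def by (intro pos_square_simps(2)) (simp add: dot_square_norm)
 qed
 have kpos: "k z > 0" if "norm z < 1" for z
 proof -
  have "(norm z)\<^sup>2 < 1\<^sup>2" using that by (intro power_strict_mono) auto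
  then show ?thesis by (simp add: k_def pos_square_def dot_square_norm)
 qed
 have k1: "norm (k z) <= 1" for z unfolding k_def real_norm_def using pos_square_simps(1,3)[of "1 - z \<bullet> z"] by simp
 have int: "integrable lborel k"
  by (rule integrable_bounded_support[OF kb k1, where R=1]) (use ks in auto)
 then show "integrable lborel (%\<zeta>::'a. pos_square (1 - \<zeta> \<bullet> \<zeta>))" unfolding k_def .
 have "(LBINT z. k z) ~= 0"
 proof
  assume "(LBINT z. k z) = 0"
  then have "AE z in lborel. k z = 0"
   using integral_nonneg_eq_0_iff_AE[OF int] by (auto simp: k_def pos_square_simps)
  then have "AE z in lborel. z \<notin> ball (0::'a) 1"
   by (rule eventually_mono) (use kpos in fastforce)
  then have "ball (0::'a) 1 \<in> null_sets lborel" by (simp add: AE_iff_null_sets)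
  then have "negligible (ball (0::'a) 1)"
   using negligible_iff_null_sets null_sets_completionI by blast
  then show False using open_not_negligible[of "ball (0::'a) 1"] by simp
 qed
 moreover have "(LBINT z. k z) >= 0" by (intro Bochner_Integration.integral_nonneg) (simp add: k_def pos_square_simps)
 ultimately have pos: "(LBINT z. k z) > 0" by linarith
 then show "(LBINT \<xi>::'a. pos_square (1 - \<xi> \<bullet> \<xi>)) > 0" by (simp add: k_def)
 have bk: "ball_kernel = (%z. k z / (LBINT z. k z))" by (simp add: ball_kernel_def[abs_def] k_def)
 show "integrable lborel (ball_kernel :: 'a => real)" "(LBINT \<zeta>::'a. ball_kernel \<zeta>) = 1"
  unfolding bk using int pos by auto
 show "ball_kernel (\<zeta> :: 'a) >= 0" "norm (\<zeta> :: 'a) >= 1 ==> ball_kernel \<zeta> = 0" "(ball_kernel :: 'a => real) \<in> borel_fun"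
  unfolding bk using pos ks[of \<zeta>] kb by (auto simp: k_def pos_square_simps)
qed

text \<open>On each time slice the map is a translation; Tonelli with time as the outer variable
  gives invariance of Lebesgue measure.\<close>

lemma near_id_shear:
 fixes \<zeta> :: "'a::euclidean_space" and c :: "real => real"
 assumes c: "c \<in> borel_fun" "!!t. \<bar>c t\<bar> * norm \<zeta> <= d"
 shows "near_id d (%z. (fst z + c (snd z) *. \<zeta>, snd z))"
proof -
 define \<tau> where "\<tau> z = (fst z + c (snd z) *. \<zeta>, snd z)" for z :: "'a \<times> real"
 have "(%z. (fst z + c (snd z) *. \<zeta>, snd z)) \<in> borel \<Otimes>\<^sub>M borel \<rightarrow>\<^sub>M borel \<Otimes>\<^sub>M borel"
  using c(1) by measurable
 then have m: "\<tau> \<in> borel_fun" unfolding \<tau>_def[abs_def] by (simp add: borel_prod)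
 have "distr lborel borel \<tau> = lborel"
 proof (rule measure_eqI)
  fix A assume "A \<in> sets (distr lborel borel \<tau>)"
  then have A: "A \<in> sets borel" by simp
  have A': "A \<in> sets (lborel \<Otimes>\<^sub>M lborel)" using A by (simp only: lborel_prod sets_lborel)
  have fm: "(%z. ind A (\<tau> z) :: ennreal) \<in> borel_measurable (lborel \<Otimes>\<^sub>M lborel)"
   using measurable_compose[OF m borel_measurable_indicator[OF A]] by (simp add: lborel_prod)
  have gm: "(ind A :: 'a \<times> real => ennreal) \<in> borel_measurable (lborel \<Otimes>\<^sub>M lborel)"
   using borel_measurable_indicator[OF A'] .
  have sl: "(%x. ind A (x, t) :: ennreal) \<in> borel_fun" for t
   using measurable_compose[OF _ gm, of "%x. (x, t)" borel] by simp
  have inner: "(\<integral>\<^sup>+x. ind A (\<tau> (x, t)) \<partial>lborel) = (\<integral>\<^sup>+x. ind A (x, t) \<partial>lborel)" for t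
  proof -
   have "(\<integral>\<^sup>+x. ind A (x, t) \<partial>lborel) = (\<integral>\<^sup>+x. ind A (x, t) \<partial>distr lborel borel (%x. x + c t *. \<zeta>))"
    by (simp only: lborel_distr_translate)
   also have "\<dots> = (\<integral>\<^sup>+x. ind A (x + c t *. \<zeta>, t) \<partial>lborel)"
    by (rule nn_integral_distr) (use sl in auto)
   finally show ?thesis by (simp add: \<tau>_def)
  qed
  have "emeasure (distr lborel borel \<tau>) A = (\<integral>\<^sup>+z. ind A z \<partial>distr lborel borel \<tau>)"
   using A by simp
  also have "\<dots> = (\<integral>\<^sup>+z. ind A (\<tau> z) \<partial>lborel)"
   by (rule nn_integral_distr) (use m A in auto)
  also have "\<dots> = (\<integral>\<^sup>+t. \<integral>\<^sup>+x. ind A (\<tau> (x, t)) \<partial>lborel \<partial>lborel)"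
   using lborel_pair.nn_integral_snd[OF fm] by (simp add: lborel_prod)
  also have "\<dots> = (\<integral>\<^sup>+t. \<integral>\<^sup>+x. ind A (x, t) \<partial>lborel \<partial>lborel)" by (simp only: inner)
  also have "\<dots> = (\<integral>\<^sup>+z. ind A z \<partial>lborel)"
   using lborel_pair.nn_integral_snd[OF gm] by (simp add: lborel_prod)
  also have "\<dots> = emeasure lborel A" using A by simp
  finally show "emeasure (distr lborel borel \<tau>) A = emeasure lborel A" .
 qed simp
 moreover have "norm (\<tau> z - z) <= d" for z
  using c(2)[of "snd z"] by (cases z) (simp add: \<tau>_def norm_Pair)
 ultimately show ?thesis using m unfolding near_id_def \<tau>_def[abs_def] by blast
qed

text \<open>The average over the section, at the time of \<open>z\<close>, of a cone shrinking like
  \<open>exp (- L t)\<close>. The absolute value keeps the radius at most \<open>eps\<close> for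
  negative times too, so that the displacement is a \<open>near_id\<close> map on all of
  space-time.\<close>

definition cone_avg :: "real => ('a::euclidean_space \<times> real => 'b::euclidean_space) => real => 'a \<times> real => 'b" where
 "cone_avg L F eps z = (LBINT \<zeta>. ball_kernel \<zeta> *. F (fst z + (eps * exp (- L * \<bar>snd z\<bar>)) *. \<zeta>, snd z))"

definition ball_avg :: "('a::euclidean_space => real) => real => 'a => real" where
 "ball_avg F eps x = (LBINT \<zeta>. ball_kernel \<zeta> *. F (x + eps *. \<zeta>))"

lemma cone_avg_L2:
 fixes F :: "'a::euclidean_space \<times> real => 'b::euclidean_space"
 assumes F: "square_int F" and e: "e > 0" and L: "L >= 0"
 obtains d where "d > 0" "!!eps. 0 < eps ==> eps <= d ==> square_int (%z. cone_avg L F eps z - F z)"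
  "!!eps. 0 < eps ==> eps <= d ==> (LBINT z. (norm (cone_avg L F eps z - F z))\<^sup>2) <= e"
proof -
 obtain d where d: "d > 0" "!!\<tau>. near_id d \<tau> ==> (LBINT z. (norm (F (\<tau> z) - F z))\<^sup>2) <= e"
  using L2_continuity[OF F e] by blast
 have *: "square_int (%z. cone_avg L F eps z - F z) & (LBINT z. (norm (cone_avg L F eps z - F z))\<^sup>2) <= e"
  if eps: "0 < eps" "eps <= d" for eps
 proof -
  define \<tau> where "\<tau> \<zeta> z = (fst z + (eps * exp (- L * \<bar>snd z\<bar>)) *. \<zeta>, snd z)" for \<zeta> and z :: "'a \<times> real"
  have "continuous_on UNIV (%p. (fst (snd p) + (eps * exp (- L * \<bar>snd (snd p)\<bar>)) *. fst p, snd (snd p)) :: 'a \<times> real)"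
   by (intro continuous_intros)
  then have "(%(\<zeta>, z). \<tau> \<zeta> z) \<in> borel_fun"
   unfolding \<tau>_def split_beta by (rule borel_measurable_continuous_onI)
  then have \<tau>m: "(%(\<zeta>, z). \<tau> \<zeta> z) \<in> borel_measurable (borel \<Otimes>\<^sub>M borel)" by (simp only: borel_prod)
  have near: "near_id d (\<tau> \<zeta>)" if "ball_kernel \<zeta> ~= 0" for \<zeta>
   unfolding \<tau>_def
  proof (rule near_id_shear)
   fix t :: real
   have "norm \<zeta> <= 1" using ball_kernel(6)[of \<zeta>] that by linarith
   moreover have "exp (- L * \<bar>t\<bar>) <= 1" using L by simp
   ultimately have "exp (- L * \<bar>t\<bar>) * norm \<zeta> <= 1 * 1" by (intro mult_mono) auto
   then have "eps * (exp (- L * \<bar>t\<bar>) * norm \<zeta>) <= eps * 1" using eps by (intro mult_left_mono) auto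
   then have "eps * (exp (- L * \<bar>t\<bar>) * norm \<zeta>) <= d" using eps by linarith
   then show "\<bar>eps * exp (- L * \<bar>t\<bar>)\<bar> * norm \<zeta> <= d" using eps by (simp add: abs_mult mult.assoc)
  qed measurable
  have e0: "e >= 0" using e by simp
  note M = L2_mollification[OF ball_kernel(3,5,4,7) F e0 \<tau>m near d(2)]
  show ?thesis using M unfolding \<tau>_def cone_avg_def by blast
 qed
 show thesis by (rule that[OF d(1)]) (use * in blast)+
qed

lemma ball_avg_L2:
 fixes F :: "'a::euclidean_space => real"
 assumes F: "square_int F" and e: "e > 0"
 obtains d where "d > 0" "!!eps. 0 < eps ==> eps <= d ==> square_int (%z. ball_avg F eps z - F z)"
  "!!eps. 0 < eps ==> eps <= d ==> (LBINT z. (norm (ball_avg F eps z - F z))\<^sup>2) <= e"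
proof -
 obtain d where d: "d > 0" "!!\<tau>. near_id d \<tau> ==> (LBINT z. (norm (F (\<tau> z) - F z))\<^sup>2) <= e"
  using L2_continuity[OF F e] by blast
 have *: "square_int (%z. ball_avg F eps z - F z) & (LBINT z. (norm (ball_avg F eps z - F z))\<^sup>2) <= e"
  if eps: "0 < eps" "eps <= d" for eps
 proof -
  have \<tau>m: "(%(\<zeta>, z). z + eps *. \<zeta>) \<in> borel_measurable (borel \<Otimes>\<^sub>M (borel :: 'a measure))" by measurable
  have near: "near_id d (%z. z + eps *. \<zeta>)" if "ball_kernel \<zeta> ~= 0" for \<zeta> :: 'a
  proof -
   have "norm \<zeta> <= 1" using ball_kernel(6)[of \<zeta>] that by linarith
   then have "eps * norm \<zeta> <= eps * 1" using eps by (intro mult_left_mono) auto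
   then have "eps * norm \<zeta> <= d" using eps by linarith
   then have "norm (- (eps *. \<zeta>)) <= d" using eps by simp
   from near_id_translate[OF this] show ?thesis by simp
  qed
  have e0: "e >= 0" using e by simp
  note M = L2_mollification[OF ball_kernel(3,5,4,7) F e0 \<tau>m near d(2)]
  show ?thesis using M unfolding ball_avg_def by blast
 qed
 show thesis by (rule that[OF d(1)]) (use * in blast)+
qed

lemma L2_subsequence_AE:
 fixes V :: "nat => 'a::euclidean_space => 'b::euclidean_space"
 assumes "!!j. square_int (V j)" "!!j. (LBINT z. (norm (V j z))\<^sup>2) <= 1 / real (Suc j)"
 obtains s where "strict_mono s" "AE z in lborel. (%j. V (s j) z) ----> 0"
proof -
 have lim0: "(%j. 1 / real (Suc j)) ----> 0" by (rule LIMSEQ_Suc[OF lim_1_over_n])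
 have "(%j. LBINT z. norm ((norm (V j z))\<^sup>2)) ----> 0"
  by (rule tendsto_sandwich[OF _ _ tendsto_const lim0]) (use assms(2) in auto)
 then obtain s where s: "strict_mono s" "AE z in lborel. (%j. (norm (V (s j) z))\<^sup>2) ----> 0"
  using tendsto_L1_AE_subseq[of lborel "%j z. (norm (V j z))\<^sup>2"] assms(1) by (auto simp: square_int_def)
 have "AE z in lborel. (%j. V (s j) z) ----> 0"
  using s(2)
 proof eventually_elim
  fix z assume "(%j. (norm (V (s j) z))\<^sup>2) ----> 0"
  from tendsto_real_sqrt[OF this] have "(%j. norm (V (s j) z)) ----> 0" by simp
  then show "(%j. V (s j) z) ----> 0" by (rule tendsto_norm_zero_cancel)
 qed
 with s(1) show thesis by (rule that)
qed

text \<open>L2 convergence of the averages as the radius tends to 0 gives convergence almost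
  everywhere along a subsequence of radii. One sequence has to serve both averages, so the second
  subsequence is extracted from the first.\<close>

lemma averages_converge_AE:
 fixes F :: "'a::euclidean_space \<times> real => 'b::euclidean_space" and F0 :: "'a => real"
 assumes F: "square_int F" and F0: "square_int F0" and L: "L >= 0"
 obtains eps where "!!j::nat. 0 < eps j" "!!j. eps j <= 1 / real (Suc j)"
  "AE z in lborel. (%j. cone_avg L F (eps j) z) ----> F z" "AE x in lborel. (%j. ball_avg F0 (eps j) x) ----> F0 x"
proof -
 define Q where "Q j eps \<longleftrightarrow> 0 < eps & eps <= 1 / real (Suc j) & square_int (%z. cone_avg L F eps z - F z) &
  (LBINT z. (norm (cone_avg L F eps z - F z))\<^sup>2) <= 1 / real (Suc j) & square_int (%z. ball_avg F0 eps z - F0 z) &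
  (LBINT z. (norm (ball_avg F0 eps z - F0 z))\<^sup>2) <= 1 / real (Suc j)" for j eps
 have "\<exists>eps. Q j eps" for j
 proof -
  have p: "1 / real (Suc j) > 0" by simp
  obtain d1 where d1: "d1 > 0" "!!eps. 0 < eps ==> eps <= d1 ==> square_int (%z. cone_avg L F eps z - F z)"
   "!!eps. 0 < eps ==> eps <= d1 ==> (LBINT z. (norm (cone_avg L F eps z - F z))\<^sup>2) <= 1 / real (Suc j)"
   using cone_avg_L2[OF F p L] by blast
  obtain d2 where d2: "d2 > 0" "!!eps. 0 < eps ==> eps <= d2 ==> square_int (%z. ball_avg F0 eps z - F0 z)"
   "!!eps. 0 < eps ==> eps <= d2 ==> (LBINT z. (norm (ball_avg F0 eps z - F0 z))\<^sup>2) <= 1 / real (Suc j)"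
   using ball_avg_L2[OF F0 p] by blast
  have "0 < min (min d1 d2) (1 / real (Suc j))" "min (min d1 d2) (1 / real (Suc j)) <= d1" "min (min d1 d2) (1 / real (Suc j)) <= d2" "min (min d1 d2) (1 / real (Suc j)) <= 1 / real (Suc j)" using d1(1) d2(1) by auto
  then show ?thesis unfolding Q_def using d1(2,3) d2(2,3) by blast
 qed
 then obtain eps where "!!j. Q j (eps j)" by metis
 then have Q: "!!j. 0 < eps j" "!!j. eps j <= 1 / real (Suc j)" "!!j. square_int (%z. cone_avg L F (eps j) z - F z)"
  "!!j. (LBINT z. (norm (cone_avg L F (eps j) z - F z))\<^sup>2) <= 1 / real (Suc j)"
  "!!j. square_int (%z. ball_avg F0 (eps j) z - F0 z)" "!!j. (LBINT z. (norm (ball_avg F0 (eps j) z - F0 z))\<^sup>2) <= 1 / real (Suc j)"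
  unfolding Q_def by blast+
 obtain s where s: "strict_mono s" "AE z in lborel. (%j. cone_avg L F (eps (s j)) z - F z) ----> 0"
  using L2_subsequence_AE[of "%j z. cone_avg L F (eps j) z - F z", OF Q(3,4)] by blast
 have "(LBINT z. (norm (ball_avg F0 (eps (s j)) z - F0 z))\<^sup>2) <= 1 / real (Suc j)" for j
 proof -
  have "1 / real (Suc (s j)) <= 1 / real (Suc j)"
   using strict_mono_imp_increasing[OF s(1), of j] by (intro divide_left_mono) auto
  then show ?thesis using Q(6)[of "s j"] by linarith
 qed
 then obtain r where r: "strict_mono r" "AE z in lborel. (%j. ball_avg F0 (eps (s (r j))) z - F0 z) ----> 0"
  using L2_subsequence_AE[of "%j z. ball_avg F0 (eps (s j)) z - F0 z", OF Q(5)] by blast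
 show thesis
 proof (rule that[of "%j. eps (s (r j))"])
  show "AE z in lborel. (%j. cone_avg L F (eps (s (r j))) z) ----> F z"
   using s(2)
  proof eventually_elim
   fix z assume "(%j. cone_avg L F (eps (s j)) z - F z) ----> 0"
   from LIMSEQ_subseq_LIMSEQ[OF this r(1)] show "(%j. cone_avg L F (eps (s (r j))) z) ----> F z"
    by (simp add: comp_def LIM_zero_iff)
  qed
  show "AE x in lborel. (%j. ball_avg F0 (eps (s (r j))) x) ----> F0 x"
   using r(2) by eventually_elim (simp add: LIM_zero_iff)
   show "0 < eps (s (r j))" for j by (rule Q(1))
  have "j <= s (r j)" for j
   using strict_mono_imp_increasing[OF r(1), of j] strict_mono_imp_increasing[OF s(1), of "r j"] by linarith
  then have "1 / real (Suc (s (r j))) <= 1 / real (Suc j)" for j by (intro divide_left_mono) auto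
  then show "eps (s (r j)) <= 1 / real (Suc j)" for j using Q(2)[of "s (r j)"] order_trans by blast
 qed
qed

lemma lborel_integral_scale:
 fixes f :: "'a::euclidean_space => real"
 assumes "c > 0" "f \<in> borel_fun"
 shows "(LBINT x. f x) = c ^ DIM('a) * (LBINT \<zeta>. f (a + c *. \<zeta>))"
proof -
 have "(LBINT x. f x) = (LINT x|density (distr lborel borel (%x. a + c *. x)) (%_. \<bar>c\<bar> ^ DIM('a)). f x)"
  using lborel_affine[of c a] assms(1) by simp
 also have "\<dots> = (LINT x|distr lborel borel (%x. a + c *. x). c ^ DIM('a) *. f x)"
  by (subst integral_density[symmetric]) (use assms in \<open>auto simp: ennreal_power\<close>)
 also have "\<dots> = (LBINT \<zeta>. c ^ DIM('a) *. f (a + c *. \<zeta>))"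
  by (subst integral_distr) (use assms in auto)
 finally show ?thesis by simp
qed

subsection \<open>The inequality on shrinking cones\<close>

context congested_flow
begin

text \<open>Streamlines are specified only before \<open>T\<close>; the value 0 from there on yields
  a Borel function on the whole line.\<close>

definition total_path :: "real^'n => real => real^'n" where
 "total_path y t = ind {..<T} t *. path y t"

lemma total_path_borel [measurable]: "total_path y \<in> borel_fun"
proof -
 have "continuous_on {..<T} (path y)"
  unfolding continuous_on_eq_continuous_within
  using has_vector_derivative_continuous[OF path_deriv] continuous_at_imp_continuous_at_within by blast
 then show ?thesis unfolding total_path_def[abs_def] by (rule borel_indicator_continuous) auto
qed

lemma total_path_deriv:
 assumes "t < T" shows "(total_path y has_vector_derivative velocity y t) (at t)"
 by (rule has_vector_derivative_transform_within_open[OF path_deriv[OF assms], of "{..<T}"])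
   (use assms in \<open>auto simp: total_path_def\<close>)

lemma total_path_eq: "0 <= t ==> t < T ==> total_path y t = X t y" "total_path y 0 = y"
 using T by (auto simp: total_path_def path_def X0)

lemma total_path_bound:
 assumes L: "!!x t. 0 <= t ==> t < T ==> norm (b (x, t)) <= L" and "t < T"
 shows "norm (total_path y t) <= norm y + L * \<bar>t\<bar>"
proof (cases "t < 0")
 case True
 have "norm (total_path y t) <= norm y + norm (t *. b (y, 0))"
  using True assms(2) norm_triangle_ineq4[of y "t *. b (y, 0)"] by (simp add: total_path_def path_def)
 also have "norm (t *. b (y, 0)) <= \<bar>t\<bar> * L" using L[of 0 y] T by (auto intro!: mult_left_mono)
 finally show ?thesis by (simp add: mult.commute)
next
 case False
 then have t: "0 <= t" "t < T" using assms(2) by auto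
 have "norm (X t y - X 0 y) <= L * \<bar>t - 0\<bar>" by (rule flow_speed[OF L]) (use t T in auto)
 then have "norm (X t y - y) <= L * \<bar>t\<bar>" by (simp add: X0)
 then have "norm (X t y) <= norm y + L * \<bar>t\<bar>" using norm_triangle_sub[of "X t y" y] by linarith
 then show ?thesis using total_path_eq(1)[OF t, of y] by simp
qed

text \<open>Here \<open>\<sigma>\<close> is the inverse square of the cone radius
  \<open>eps exp (- L t)\<close>. The axis is controlled before \<open>T\<close> only, but
  \<open>th\<close> and its derivative vanish already beyond \<open>T - \<eta>\<close>; continuity
  of the gradient is checked on two overlapping open half-spaces.\<close>

lemma cone_function_C1:
 fixes eps L :: real and y :: "real^'n"
 assumes th: "!!t. (th has_real_derivative th' t) (at t)" "continuous_on UNIV th'"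
  "!!t. t > T - \<eta> ==> th t = 0 & th' t = 0" and \<eta>: "\<eta> > 0"
 defines "\<sigma> \<equiv> %t. exp (2 * L * t) / eps\<^sup>2"
 defines "\<rho> \<equiv> %z :: (real^'n) \<times> real. fst z - total_path y (snd z)"
 defines "B \<equiv> %z. pos_square (1 - \<sigma> (snd z) * (\<rho> z \<bullet> \<rho> z))"
 defines "B1 \<equiv> %z. 2 * max (1 - \<sigma> (snd z) * (\<rho> z \<bullet> \<rho> z)) 0"
 shows "C1_with (%z. th (snd z) * exp (- L * snd z) * B z)
  (%z. ((- (2 * (th (snd z) * exp (- L * snd z)) * B1 z * \<sigma> (snd z))) *. \<rho> z,
   (th' (snd z) - L * th (snd z)) * exp (- L * snd z) * B z
    - th (snd z) * exp (- L * snd z) * B1 z * \<sigma> (snd z) * (2 * L * (\<rho> z \<bullet> \<rho> z) - 2 * (\<rho> z \<bullet> velocity y (snd z)))))"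
  (is "C1_with ?\<phi> ?D")
proof -
 have deriv: "(?\<phi> has_derivative (%v. ?D z \<bullet> v)) (at z)" for z
 proof (cases "snd z < T")
  case True
  have "((%z. total_path y (snd z)) has_derivative (%h. snd h *. velocity y (snd z))) (at z)"
   by (rule has_derivative_compose[OF has_derivative_snd[OF has_derivative_ident]])
     (use total_path_deriv[OF True, of y] in \<open>simp add: has_vector_derivative_def\<close>)
  then have r: "(\<rho> has_derivative (%h. fst h - snd h *. velocity y (snd z))) (at z)"
   unfolding \<rho>_def by (intro has_derivative_diff has_derivative_fst has_derivative_ident)
  have rr: "((%z. \<rho> z \<bullet> \<rho> z) has_derivative (%h. 2 * (\<rho> z \<bullet> fst h) - 2 * snd h * (\<rho> z \<bullet> velocity y (snd z)))) (at z)"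
   by (rule has_derivative_eq_rhs[OF has_derivative_inner[OF r r]])
     (auto simp: fun_eq_iff inner_commute inner_diff_right algebra_simps)
  have s: "((%z. \<sigma> (snd z)) has_derivative (%h. 2 * L * \<sigma> (snd z) * snd h)) (at z)"
  proof (rule has_derivative_compose[OF has_derivative_snd[OF has_derivative_ident]])
   have "(\<sigma> has_real_derivative (2 * L * \<sigma> (snd z))) (at (snd z))"
   proof -
    have "((%t. exp (2 * L * t)) has_real_derivative 2 * L * exp (2 * L * snd z)) (at (snd z))"
     by (auto intro!: derivative_eq_intros)
    from DERIV_cdivide[OF this, of "eps\<^sup>2"] show ?thesis unfolding \<sigma>_def by simp
   qed
   then show "(\<sigma> has_derivative (%h. 2 * L * \<sigma> (snd z) * h)) (at (snd z))" by (simp add: has_field_derivative_def)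
  qed
  have q: "((%z. 1 - \<sigma> (snd z) * (\<rho> z \<bullet> \<rho> z)) has_derivative (%h. - (\<sigma> (snd z) * (2 * (\<rho> z \<bullet> fst h)
    + snd h * (2 * L * (\<rho> z \<bullet> \<rho> z) - 2 * (\<rho> z \<bullet> velocity y (snd z))))))) (at z)"
   by (rule has_derivative_eq_rhs[OF has_derivative_diff[OF has_derivative_const has_derivative_mult[OF s rr]]])
     (auto simp: fun_eq_iff algebra_simps)
  have Bd: "(B has_derivative (%h. B1 z * (- (\<sigma> (snd z) * (2 * (\<rho> z \<bullet> fst h)
    + snd h * (2 * L * (\<rho> z \<bullet> \<rho> z) - 2 * (\<rho> z \<bullet> velocity y (snd z)))))))) (at z)"
   unfolding B_def B1_def
   by (rule has_derivative_compose[OF q])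
     (use pos_square_deriv[of "1 - \<sigma> (snd z) * (\<rho> z \<bullet> \<rho> z)"] in \<open>simp add: has_field_derivative_def\<close>)
  have a: "((%z. th (snd z) * exp (- L * snd z)) has_derivative (%h. (th' (snd z) - L * th (snd z)) * exp (- L * snd z) * snd h)) (at z)"
  proof (rule has_derivative_compose[OF has_derivative_snd[OF has_derivative_ident]])
   have e: "((%t. exp (- L * t)) has_real_derivative (- L * exp (- L * snd z))) (at (snd z))"
    by (auto intro!: derivative_eq_intros)
   have "((%t. th t * exp (- L * t)) has_real_derivative ((th' (snd z) - L * th (snd z)) * exp (- L * snd z))) (at (snd z))"
    by (rule DERIV_cong[OF DERIV_mult[OF th(1) e]]) (simp add: algebra_simps)
   then show "((%t. th t * exp (- L * t)) has_derivative (%h. (th' (snd z) - L * th (snd z)) * exp (- L * snd z) * h)) (at (snd z))"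
    by (simp add: has_field_derivative_def)
  qed
  show ?thesis
   by (rule has_derivative_eq_rhs[OF has_derivative_mult[OF a Bd]])
     (auto simp: fun_eq_iff inner_prod_def algebra_simps)
 next
  case False
  then have z: "snd z > T - \<eta>" using \<eta> by simp
  have o: "open {z :: (real^'n) \<times> real. snd z > T - \<eta>}"
   by (intro open_Collect_less continuous_intros)
  have "(?\<phi> has_derivative (%v. 0)) (at z)"
   by (rule has_derivative_transform_within_open[OF has_derivative_const o]) (use z th(3) in auto)
  moreover have "?D z = 0" using th(3)[OF z] by (simp add: zero_prod_def)
  ultimately show ?thesis by simp
 qed
 let ?U = "{z :: (real^'n) \<times> real. snd z < T}" and ?W = "{z :: (real^'n) \<times> real. snd z > T - \<eta>}"
 have oU: "open ?U" and oW: "open ?W" by (intro open_Collect_less continuous_intros)+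
 have sU: "continuous_on ?U (snd :: (real^'n) \<times> real => real)" by (intro continuous_intros)
 have "continuous_on {..<T} (total_path y)"
  unfolding continuous_on_eq_continuous_within
  using has_vector_derivative_continuous[OF total_path_deriv] continuous_at_imp_continuous_at_within by blast
 then have gU: "continuous_on ?U (%z. total_path y (snd z))" by (rule continuous_on_compose2[OF _ sU]) auto
 have vU: "continuous_on ?U (%z. velocity y (snd z))" by (rule continuous_on_compose2[OF velocity_continuous sU]) auto
 have thU: "continuous_on ?U (%z. th (snd z))"
  by (rule continuous_on_compose2[OF _ sU, of UNIV]) (use th(1) DERIV_isCont in \<open>auto simp: continuous_on_eq_continuous_at\<close>)
 have thU': "continuous_on ?U (%z. th' (snd z))" by (rule continuous_on_compose2[OF th(2) sU]) auto
 have rU: "continuous_on ?U \<rho>" unfolding \<rho>_def by (intro continuous_intros gU)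
 have \<sigma>U: "continuous_on ?U (%z. \<sigma> (snd z))" unfolding \<sigma>_def divide_inverse by (intro continuous_intros)
 have BU: "continuous_on ?U B" unfolding B_def
  by (rule continuous_on_compose2[OF pos_square_continuous[of UNIV]]) (intro continuous_intros rU \<sigma>U subset_UNIV)+
 have B1U: "continuous_on ?U B1" unfolding B1_def by (intro continuous_intros rU \<sigma>U)
 have 1: "continuous_on ?U ?D" by (intro continuous_intros thU thU' \<sigma>U BU B1U rU vU)
 have 2: "continuous_on ?W ?D"
  by (rule continuous_on_eq[OF continuous_on_const[of _ 0]]) (use th(3) in \<open>auto simp: zero_prod_def\<close>)
 have "?U \<union> ?W = UNIV" using \<eta> by auto
 then have "continuous_on UNIV ?D" using continuous_on_open_Un[OF oU oW 1 2] by simp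
 then show ?thesis unfolding C1_with_def using deriv by blast
qed

lemma cone_support:
 fixes eps L t :: real
 assumes "eps > 0" and "pos_square (1 - exp (2 * L * t) / eps\<^sup>2 * ((x - g) \<bullet> (x - g))) ~= 0"
 shows "norm ((x :: real^'n) - g) < eps * exp (- L * t)"
proof (rule ccontr)
 assume "\<not> ?thesis"
 then have "(eps * exp (- L * t))\<^sup>2 <= (norm (x - g))\<^sup>2" using assms(1) by (intro power_mono) auto
 then have "exp (2 * L * t) / eps\<^sup>2 * (eps * exp (- L * t))\<^sup>2 <= exp (2 * L * t) / eps\<^sup>2 * ((x - g) \<bullet> (x - g))"
  by (intro mult_left_mono) (auto simp: dot_square_norm)
 moreover have "exp (2 * L * t) / eps\<^sup>2 * (eps * exp (- L * t))\<^sup>2 = 1"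
  using assms(1) by (simp add: power_mult_distrib power2_eq_square exp_add[symmetric])
 ultimately show False using pos_square_simps(2) assms(2) by simp
qed

text \<open>The substitution that turns every section of the cone into the unit ball, with a profile
  independent of time.\<close>

lemma cone_rescale:
 fixes eps L t :: real and g :: "real^'n"
 assumes "eps > 0"
 shows "exp (2 * L * t) / eps\<^sup>2 * (((g + (eps * exp (- L * t)) *. \<zeta>) - g) \<bullet> ((g + (eps * exp (- L * t)) *. \<zeta>) - g)) = \<zeta> \<bullet> \<zeta>"
proof -
 have "exp (2 * L * t) / eps\<^sup>2 * ((eps * exp (- L * t)) * (eps * exp (- L * t))) = 1"
  using assms by (simp add: power2_eq_square exp_add[symmetric])
 then show ?thesis by (simp add: mult.assoc[symmetric])
qed

text \<open>One factor \<open>exp (- L t)\<close> compensates the source \<open>f\<close>; its power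
  with exponent the dimension is the Jacobian of rescaling a section.\<close>

definition decay :: "real => real => real" where
 "decay L t = exp (- L * t) * exp (- L * t) ^ CARD('n)"

text \<open>Absorption and deficit are paired so that one sequence of radii serves both, and are cut
  off in space so that, vanishing outside the slab, they are square-integrable.\<close>

definition cut :: "real => ((real^'n) \<times> real => real) => ((real^'n) \<times> real => real) => (real^'n) \<times> real => real \<times> real" where
 "cut R e w z = ind {x. norm x <= R} (fst z) *. (e z, w z)"

lemma cut_borel:
 assumes "e \<in> borel_fun" "w \<in> borel_fun"
 shows "cut R e w \<in> borel_fun"
proof -
 have "{x :: real^'n. norm x <= R} \<in> sets borel" by measurable
 then have "(%z. ind {x. norm x <= R} (fst z) :: real) \<in> borel_measurable (borel :: ((real^'n) \<times> real) measure)"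
  by (rule measurable_compose[OF borel_measurable_continuous_onI[OF continuous_on_fst[OF continuous_on_id]] borel_measurable_indicator])
 then show ?thesis unfolding cut_def[abs_def]
  by (intro borel_measurable_scaleR borel_measurable_Pair assms)
qed

lemma cut_bound:
 assumes "!!z. 0 <= e z" "!!z. e z <= B" "!!z. 0 <= w z" "!!z. w z <= B"
 shows "norm (cut R e w z) <= 2 * B"
proof -
 have "norm (cut R e w z) <= norm (e z, w z)" by (simp add: cut_def indicator_def)
 also have "\<dots> <= norm (e z) + norm (w z)" by (rule norm_Pair_le)
 finally show ?thesis using assms(1)[of z] assms(2)[of z] assms(3)[of z] assms(4)[of z] by simp
qed

text \<open>The test function is \<open>th exp (- L t)\<close> times the cone profile. Since the
  cone shrinks at rate \<open>L\<close>, neighbouring streamlines can leave but not enter it, and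
  the lateral term has a sign; since \<open>fQ\<close> is at most \<open>L\<close>, the derivative
  of \<open>exp (- L t)\<close> compensates the source. Rescaling the sections leaves averages along
  a single streamline.\<close>

lemma cone_inequality:
 fixes e w :: "(real^'n) \<times> real => real" and w0 :: "real^'n => real"
 assumes L: "L > 0" "!!x y t. 0 <= t ==> t < T ==> norm (b (x, t) - b (y, t)) <= L * norm (x - y)"
  "!!x t. 0 <= t ==> t < T ==> norm (b (x, t)) <= L" "!!z. \<bar>fQ z\<bar> <= L"
  and [measurable]: "e \<in> borel_fun" "w \<in> borel_fun" "w0 \<in> borel_fun"
  and e: "!!z. 0 <= e z" "!!z. e z <= B" "!!z. z \<notin> QT T ==> e z = 0"
  and w: "!!z. 0 <= w z" "!!z. w z <= B" "!!z. z \<notin> QT T ==> w z = 0"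
  and ineq: "!!\<phi> D. C1_with \<phi> D ==> (!!z. \<phi> z >= 0) ==> compact (closure {z. \<phi> z ~= 0})
   ==> closure {z. \<phi> z ~= 0} \<subseteq> UNIV \<times> {..<T}
   ==> 0 <= (LBINT z. (- e z + fQ z * w z) * \<phi> z + ((- w z) *. \<beta> z) \<bullet> D z) + (LBINT x. w0 x * \<phi> (x, 0))"
  and th: "!!t. (th has_real_derivative th' t) (at t)" "continuous_on UNIV th'"
  "!!t. t > T - \<eta> ==> th t = 0 & th' t = 0" "!!t. t < -1 ==> th t = 0" "!!t. th t >= 0" and \<eta>: "\<eta> > 0"
  and eps: "0 < eps" "eps <= 1" and R: "norm y + L * T + 1 <= R"
 shows "0 <= (LBINT t. ((- th t, th' t) \<bullet> cone_avg L (cut R e w) eps (total_path y t, t)) * decay L t)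
   + th 0 * ball_avg (%x. ind (cball 0 R) x * w0 x) eps y"
proof -
 define \<sigma> where "\<sigma> t = exp (2 * L * t) / eps\<^sup>2" for t
 define \<rho> where "\<rho> z = fst z - total_path y (snd z)" for z :: "(real^'n) \<times> real"
 define K where "K z = pos_square (1 - \<sigma> (snd z) * (\<rho> z \<bullet> \<rho> z))" for z
 define K1 where "K1 z = 2 * max (1 - \<sigma> (snd z) * (\<rho> z \<bullet> \<rho> z)) 0" for z
 define \<phi> where "\<phi> z = th (snd z) * exp (- L * snd z) * K z" for z
 define D where "D z = ((- (2 * (th (snd z) * exp (- L * snd z)) * K1 z * \<sigma> (snd z))) *. \<rho> z,
   (th' (snd z) - L * th (snd z)) * exp (- L * snd z) * K z
    - th (snd z) * exp (- L * snd z) * K1 z * \<sigma> (snd z) * (2 * L * (\<rho> z \<bullet> \<rho> z) - 2 * (\<rho> z \<bullet> velocity y (snd z))))" for z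
 define kap where "kap = (LBINT \<xi>::real^'n. pos_square (1 - \<xi> \<bullet> \<xi>))"
 have kap: "kap > 0" unfolding kap_def by (rule ball_kernel(2))
 have C1: "C1_with \<phi> D"
  unfolding \<phi>_def[abs_def] D_def[abs_def] K_def K1_def \<sigma>_def \<rho>_def by (rule cone_function_C1[OF th(1,2,3) \<eta>])
 have K0: "K z >= 0" "K z <= 1" "K1 z >= 0" for z
 proof -
  have "0 <= \<sigma> (snd z) * (\<rho> z \<bullet> \<rho> z)" unfolding \<sigma>_def by (intro mult_nonneg_nonneg) auto
  then show "K z >= 0" "K z <= 1" "K1 z >= 0" unfolding K_def K1_def by (auto intro: pos_square_simps)
 qed
 have near: "norm (fst z - total_path y (snd z)) < eps * exp (- L * snd z)" if "K z ~= 0" for z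
  using cone_support[OF eps(1), of L "snd z" "fst z" "total_path y (snd z)"] that
  unfolding K_def \<sigma>_def \<rho>_def by blast
 \<comment> \<open>Bounds the support on times between \<open>- 1\<close> and \<open>T\<close>; at
   time \<open>- 1\<close> the cone has widened to at most \<open>exp L\<close>, and
   \<open>T + 1\<close> accounts for the time coordinate.\<close>
 define r where "r = (norm y + L * (T + 1) + exp L) + (T + 1)"
 have far: "norm z <= r" if "K z ~= 0" "- 1 <= snd z" "snd z < T" for z
 proof -
  have "eps * exp (- L * snd z) <= 1 * exp L"
   using eps L(1) that(2) mult_left_mono[of "- snd z" 1 L] by (intro mult_mono) auto
  moreover have "norm (total_path y (snd z)) <= norm y + L * \<bar>snd z\<bar>" by (rule total_path_bound[OF L(3) that(3)])
  moreover have "L * \<bar>snd z\<bar> <= L * (T + 1)" using L(1) that T by (intro mult_left_mono) auto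
  moreover have "norm (fst z) <= norm (total_path y (snd z)) + norm (fst z - total_path y (snd z))"
   by (metis add.commute norm_triangle_sub)
  ultimately have "norm (fst z) <= norm y + L * (T + 1) + exp L" using near[OF that(1)] by linarith
  moreover have "norm (snd z) <= T + 1" using that T by (auto simp: abs_le_iff)
  moreover have "norm z <= norm (fst z) + norm (snd z)" using norm_Pair_le[of "fst z" "snd z"] by simp
  ultimately show ?thesis unfolding r_def by linarith
 qed
 have \<phi>0: "\<phi> z = 0" if "norm z > r" for z
 proof (rule ccontr)
  assume nz: "\<phi> z ~= 0"
  then have a: "th (snd z) ~= 0" "K z ~= 0" by (auto simp: \<phi>_def)
  have "\<not> snd z < -1" "\<not> snd z > T - \<eta>" using th(3,4) a(1) by blast+
  then have "- 1 <= snd z" "snd z < T" using \<eta> by auto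
  then show False using far[OF a(2)] that by simp
 qed
 then have vb: "vanishes_beyond r \<phi>" by (simp add: vanishes_beyond_def)
 have bdd: "bounded {z. \<phi> z ~= 0}" unfolding bounded_iff using \<phi>0 by (auto intro!: exI[of _ r] simp: not_less[symmetric])
 have cp: "compact (closure {z. \<phi> z ~= 0})" using bdd by simp
 have cl: "closure {z. \<phi> z ~= 0} \<subseteq> UNIV \<times> {..<T}"
 proof -
  have "closed {z :: (real^'n) \<times> real. snd z <= T - \<eta>}" by (intro closed_Collect_le continuous_intros)
  moreover have "{z. \<phi> z ~= 0} \<subseteq> {z. snd z <= T - \<eta>}" using th(3) by (auto simp: \<phi>_def not_less[symmetric])
  ultimately have "closure {z. \<phi> z ~= 0} \<subseteq> {z. snd z <= T - \<eta>}" by (rule closure_minimal[rotated])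
  then have "snd z < T" if "z \<in> closure {z. \<phi> z ~= 0}" for z using that \<eta> by fastforce
  then show ?thesis by (auto simp: mem_Times_iff)
 qed
 have \<phi>p: "\<phi> z >= 0" for z unfolding \<phi>_def using th(5) K0 by simp
 define I where "I z = (- e z + fQ z * w z) * \<phi> z + ((- w z) *. \<beta> z) \<bullet> D z" for z
 have main: "0 <= (LBINT z. I z) + (LBINT x. w0 x * \<phi> (x, 0))"
  unfolding I_def by (rule ineq[OF C1 \<phi>p cp cl])
 define J where "J z = ((- th (snd z), th' (snd z)) \<bullet> cut R e w z) * exp (- L * snd z) * K z" for z
 have IJ: "I z <= J z" for z
 proof (cases "z \<in> QT T & K z ~= 0")
  case False
  have "K z = 0 ==> K1 z = 0" by (auto simp: K_def K1_def pos_square_def max_def split: if_splits)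
  then show ?thesis using False e(3)[of z] w(3)[of z] by (auto simp: I_def J_def cut_def \<phi>_def D_def zero_prod_def inner_prod_def)
 next
  case True
  let ?t = "snd z" and ?x = "fst z" and ?g = "total_path y (snd z)"
  define a where "a = th ?t * exp (- L * ?t)"
  have t: "0 < ?t" "?t < T" using True by (auto simp: QT_iff)
  have g: "?g = X ?t y" by (rule total_path_eq) (use t in auto)
  have vel: "velocity y ?t = - b (?g, ?t)" using t by (simp add: velocity_def g)
  have \<beta>: "\<beta> z = (b (?x, ?t), -1)" using True by (simp add: \<beta>_def)
  have a0: "a >= 0" using th(5) by (simp add: a_def)
  have s0: "\<sigma> ?t >= 0" by (simp add: \<sigma>_def)
  \<comment> \<open>At positive times the cone has radius at most 1 and its axis stays within
    \<open>norm y + L * T\<close>, so the cutoff at \<open>R\<close> leaves it intact.\<close>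
  have R': "norm ?x <= R"
  proof -
   have "eps * exp (- L * ?t) <= 1 * 1" using eps L(1) t by (intro mult_mono) auto
   moreover have "norm ?g <= norm y + L * \<bar>?t\<bar>" by (rule total_path_bound[OF L(3) t(2)])
   moreover have "L * \<bar>?t\<bar> <= L * T" using L(1) t by (intro mult_left_mono) auto
   moreover have "norm ?x <= norm ?g + norm (?x - ?g)" by (metis add.commute norm_triangle_sub)
   ultimately show ?thesis using near[of z] True R by linarith
  qed
  then have c: "cut R e w z = (e z, w z)" by (simp add: cut_def)
  have "\<rho> z \<bullet> (b (?x, ?t) - b (?g, ?t)) <= norm (\<rho> z) * norm (b (?x, ?t) - b (?g, ?t))" by (rule norm_cauchy_schwarz)
  also have "\<dots> <= norm (\<rho> z) * (L * norm (?x - ?g))" by (intro mult_left_mono L(2)) (use t in auto)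
  finally have ld: "\<rho> z \<bullet> (b (?x, ?t) - b (?g, ?t)) <= L * (\<rho> z \<bullet> \<rho> z)"
   by (simp add: \<rho>_def dot_square_norm power2_eq_square mult_ac)
  \<comment> \<open>The space gradient of the profile meets \<open>b\<close> at \<open>x\<close> and
    the moving centre contributes \<open>b\<close> on the axis, so only the difference of the two
    enters; the shrinking of the cone adds \<open>L\<close> times the squared distance.\<close>
  have De: "\<beta> z \<bullet> D z = - ((th' ?t - L * th ?t) * exp (- L * ?t) * K z)
    + 2 * (a * K1 z * \<sigma> ?t) * (L * (\<rho> z \<bullet> \<rho> z) - \<rho> z \<bullet> (b (?x, ?t) - b (?g, ?t)))"
   unfolding \<beta> D_def vel a_def by (simp add: inner_prod_def inner_diff_right inner_commute algebra_simps)
  have "0 <= 2 * (a * K1 z * \<sigma> ?t) * (L * (\<rho> z \<bullet> \<rho> z) - \<rho> z \<bullet> (b (?x, ?t) - b (?g, ?t)))"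
   using a0 s0 K0(3)[of z] ld by (intro mult_nonneg_nonneg) auto
  then have "w z * (\<beta> z \<bullet> D z) >= w z * (- ((th' ?t - L * th ?t) * exp (- L * ?t) * K z))"
   unfolding De by (intro mult_left_mono w(1)) simp
  moreover have "fQ z * (w z * \<phi> z) <= L * (w z * \<phi> z)"
   using L(4)[of z] w(1)[of z] \<phi>p[of z] by (intro mult_right_mono) auto
  ultimately show ?thesis
   unfolding I_def J_def c \<phi>_def by (simp add: inner_prod_def algebra_simps)
 qed
 have cutm [measurable]: "cut R e w \<in> borel_fun" by (rule cut_borel) measurable
 have thc: "continuous_on UNIV th" using th(1) DERIV_isCont by (auto simp: continuous_on_eq_continuous_at)
 have [measurable]: "th \<in> borel_fun" "th' \<in> borel_fun"
  using borel_measurable_continuous_onI[OF thc] borel_measurable_continuous_onI[OF th(2)] by auto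
 have snd_m [measurable]: "snd \<in> borel_measurable (borel :: ((real^'n) \<times> real) measure)"
  and fst_m [measurable]: "fst \<in> borel_measurable (borel :: ((real^'n) \<times> real) measure)"
  by (intro borel_measurable_continuous_onI continuous_intros)+
 have rho_m: "\<rho> \<in> borel_fun" unfolding \<rho>_def[abs_def]
  by (intro borel_measurable_diff fst_m measurable_compose[OF snd_m total_path_borel])
 have exp_m: "(%z. exp (c * snd z)) \<in> borel_measurable (borel :: ((real^'n) \<times> real) measure)" for c :: real
  by (intro borel_measurable_continuous_onI continuous_intros)
 have ps [measurable]: "pos_square \<in> borel_fun" by (rule borel_measurable_continuous_onI[OF pos_square_continuous])
 have Km [measurable]: "K \<in> borel_fun" unfolding K_def[abs_def] \<sigma>_def
  by (intro measurable_compose[OF _ ps] borel_measurable_diff borel_measurable_const borel_measurable_times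
    borel_measurable_divide borel_measurable_inner rho_m exp_m)
 have Jm: "J \<in> borel_fun" unfolding J_def[abs_def]
  by (intro borel_measurable_times borel_measurable_inner borel_measurable_Pair borel_measurable_uminus cutm Km exp_m
    measurable_compose[OF snd_m]) measurable
 obtain Bt where Bt: "Bt > 0" "!!z. norm (th z) <= Bt" "!!z. norm (th' z) <= Bt"
 proof -
  have v1: "vanishes_beyond (T + 1) th" using th(3,4) \<eta> T by (auto simp: vanishes_beyond_def abs_real_def split: if_splits)
  have v2: "vanishes_beyond (T + 1) th'"
   unfolding vanishes_beyond_def
  proof (intro allI impI)
   fix t :: real assume "T + 1 < norm t"
   then consider "t > T - \<eta>" | "t < -1" using \<eta> T by (auto simp: abs_real_def split: if_splits)
   then show "th' t = 0"
   proof cases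
    case 2
    have "(th has_real_derivative 0) (at t)"
     by (rule has_field_derivative_transform_within_open[of "%_. 0" _ _ "{..<-1}"]) (use 2 th(4) in auto)
    then show ?thesis using th(1) DERIV_unique by blast
   qed (use th(3) in blast)
  qed
  obtain B1 where "B1 > 0" "!!z. norm (th z) <= B1" by (rule bounded_support_bound[OF thc v1]) blast
  moreover obtain B2 where "B2 > 0" "!!z. norm (th' z) <= B2" by (rule bounded_support_bound[OF th(2) v2]) blast
  ultimately show thesis by (intro that[of "max B1 B2"]) (auto simp: le_max_iff_disj)
 qed
 have B0: "B >= 0" using e(1,2) order_trans by blast
 have Jb: "norm (J z) <= (2 * Bt) * (2 * B)" for z
 proof (cases "z \<in> QT T")
  case False
  then show ?thesis using e(3) w(3) Bt(1) B0 by (simp add: J_def cut_def zero_prod_def)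
 next
  case True
  have "norm ((- th (snd z), th' (snd z)) \<bullet> cut R e w z) <= norm (- th (snd z), th' (snd z)) * norm (cut R e w z)"
   using Cauchy_Schwarz_ineq2 by auto
  also have "norm (- th (snd z), th' (snd z)) <= 2 * Bt"
   using norm_Pair_le[of "- th (snd z)" "th' (snd z)"] Bt(2,3)[of "snd z"] by simp
  also have "norm (cut R e w z) <= 2 * B" by (rule cut_bound[OF e(1,2) w(1,2)])
  finally have 1: "norm ((- th (snd z), th' (snd z)) \<bullet> cut R e w z) <= (2 * Bt) * (2 * B)"
   using Bt(1) by (simp add: mult_left_mono mult_right_mono)
  have 2: "exp (- L * snd z) * K z <= 1 * 1" using True L(1) K0 by (intro mult_mono) (auto simp: QT_iff)
  have "norm (J z) = norm ((- th (snd z), th' (snd z)) \<bullet> cut R e w z) * (exp (- L * snd z) * K z)"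
   unfolding J_def using K0(1)[of z] by (simp add: abs_mult)
  also have "\<dots> <= ((2 * Bt) * (2 * B)) * (1 * 1)" by (rule mult_mono[OF 1 2]) (use Bt(1) B0 K0(1)[of z] in auto)
  finally show ?thesis by simp
 qed
 have Jz: "J z = 0" if "norm z > r" for z
 proof (rule ccontr)
  assume "J z ~= 0"
  then have k: "K z ~= 0" "cut R e w z ~= 0" by (auto simp: J_def)
  have "z \<in> QT T" using k(2) e(3)[of z] w(3)[of z] by (cases "z \<in> QT T") (auto simp: cut_def zero_prod_def)
  then show False using far[OF k(1)] that by (simp add: QT_iff)
 qed
 have Ji: "integrable lborel J" by (rule integrable_bounded_support[OF Jm Jb Jz])
 have Ii: "integrable lborel I"
 proof -
  obtain Bc where Bc: "Bc > 0" "!!z. mQ z <= Bc" "!!z. \<bar>fQ z\<bar> <= Bc" "!!z. norm (\<beta> z) <= Bc" "!!z. EQ z <= Bc"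
   and cm [measurable]: "mQ \<in> borel_fun" "fQ \<in> borel_fun" "\<beta> \<in> borel_fun" "EQ \<in> borel_fun"
   and "!!x. m (x, 0) <= Bc" by (rule coeffs) blast
  have Dc: "continuous_on UNIV D" using C1 by (simp add: C1_with_def)
  have Dv: "vanishes_beyond r D" by (rule C1_with_support[OF C1 vb])
  obtain B1 where B1: "B1 > 0" "!!z. norm (\<phi> z) <= B1" by (rule bounded_support_bound[OF C1_with_continuous[OF C1] vb]) blast
  obtain B2 where B2: "B2 > 0" "!!z. norm (D z) <= B2" by (rule bounded_support_bound[OF Dc Dv]) blast
  have [measurable]: "\<phi> \<in> borel_fun" "D \<in> borel_fun"
   using borel_measurable_continuous_onI[OF C1_with_continuous[OF C1]] borel_measurable_continuous_onI[OF Dc] by auto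
  show ?thesis
  proof (rule integrable_bounded_support)
   show "I \<in> borel_fun" unfolding I_def[abs_def] by measurable
   show "I z = 0" if "norm z > r" for z
    using vanishes_beyondD[OF vb that] vanishes_beyondD[OF Dv that] by (simp add: I_def)
   fix z
   have "\<bar>- e z + fQ z * w z\<bar> <= B + Bc * B"
   proof -
    have "\<bar>fQ z * w z\<bar> <= Bc * B" unfolding abs_mult using Bc(1,3) w B0 by (intro mult_mono) auto
    then show ?thesis using e(1)[of z] e(2)[of z] abs_triangle_ineq[of "- e z" "fQ z * w z"] by simp
   qed
   then have "\<bar>(- e z + fQ z * w z) * \<phi> z\<bar> <= (B + Bc * B) * B1"
    unfolding abs_mult using B1 B0 Bc(1) by (intro mult_mono) auto
   moreover have "\<bar>((- w z) *. \<beta> z) \<bullet> D z\<bar> <= B * Bc * B2"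
   proof -
    have "\<bar>((- w z) *. \<beta> z) \<bullet> D z\<bar> <= norm ((- w z) *. \<beta> z) * norm (D z)" by (rule Cauchy_Schwarz_ineq2)
    also have "\<dots> <= (B * Bc) * B2" unfolding norm_scaleR using w Bc B2 B0 by (intro mult_mono) auto
    finally show ?thesis .
   qed
   ultimately show "norm (I z) <= (B + Bc * B) * B1 + B * Bc * B2" unfolding I_def real_norm_def by linarith
  qed
 qed
 have "(LBINT z. I z) <= (LBINT z. J z)" by (rule integral_mono[OF Ii Ji IJ])
 then have main2: "0 <= (LBINT z. J z) + (LBINT x. w0 x * \<phi> (x, 0))" using main by linarith
 \<comment> \<open>The volume element gives \<open>eps exp (- L t)\<close> to the power of the
   dimension, and normalising the kernel gives \<open>kap\<close>. For \<open>t \<le> 0\<close> both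
   sides vanish; for positive \<open>t\<close> the absolute value in \<open>cone_avg\<close> is
   \<open>t\<close> itself.\<close>
 have inner_eq: "(LBINT x. J (x, t)) = eps ^ CARD('n) * kap * (((- th t, th' t) \<bullet> cone_avg L (cut R e w) eps (total_path y t, t)) * decay L t)" for t
 proof (cases "0 < t")
  case False
  then have z: "cut R e w (x, t) = 0" for x using e(3)[of "(x, t)"] w(3)[of "(x, t)"] by (simp add: cut_def QT_iff zero_prod_def)
  then show ?thesis by (simp add: J_def cone_avg_def)
 next
  case True
  let ?c = "eps * exp (- L * t)" and ?g = "total_path y t"
  have Pm [measurable]: "(%x. (x, t)) \<in> borel_measurable (borel :: (real^'n) measure)"
   by (intro borel_measurable_continuous_onI continuous_intros)
  have "(LBINT x. J (x, t)) = ?c ^ DIM(real^'n) * (LBINT \<zeta>. J (?g + ?c *. \<zeta>, t))"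
   by (rule lborel_integral_scale) (use eps(1) measurable_compose[OF Pm Jm] in auto)
  also have "(LBINT \<zeta>. J (?g + ?c *. \<zeta>, t))
   = (LBINT \<zeta>. (exp (- L * t) * kap) * ((- th t, th' t) \<bullet> (ball_kernel \<zeta> *. cut R e w (?g + ?c *. \<zeta>, t))))"
  proof (rule Bochner_Integration.integral_cong[OF refl])
   fix \<zeta> :: "real^'n"
   have "K (?g + ?c *. \<zeta>, t) = pos_square (1 - \<zeta> \<bullet> \<zeta>)"
    unfolding K_def \<sigma>_def \<rho>_def fst_conv snd_conv cone_rescale[OF eps(1)] ..
   also have "\<dots> = kap * ball_kernel \<zeta>" unfolding ball_kernel_def kap_def[symmetric] using kap by simp
   finally show "J (?g + ?c *. \<zeta>, t) = (exp (- L * t) * kap) * ((- th t, th' t) \<bullet> (ball_kernel \<zeta> *. cut R e w (?g + ?c *. \<zeta>, t)))"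
    unfolding J_def fst_conv snd_conv by (simp only: inner_scaleR_right mult_ac)
  qed
  also have "\<dots> = (exp (- L * t) * kap) * (LBINT \<zeta>. (- th t, th' t) \<bullet> (ball_kernel \<zeta> *. cut R e w (?g + ?c *. \<zeta>, t)))"
   by (rule integral_mult_right_zero)
  also have "(LBINT \<zeta>. (- th t, th' t) \<bullet> (ball_kernel \<zeta> *. cut R e w (?g + ?c *. \<zeta>, t)))
   = (- th t, th' t) \<bullet> (LBINT \<zeta>. ball_kernel \<zeta> *. cut R e w (?g + ?c *. \<zeta>, t))"
  proof (rule integral_inner_right)
   have Sm: "(%\<zeta>. (?g + ?c *. \<zeta>, t)) \<in> borel_measurable (borel :: (real^'n) measure)"
    by (intro borel_measurable_continuous_onI continuous_intros)
   have km: "(ball_kernel :: real^'n => real) \<in> borel_fun" by (rule ball_kernel(7))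
   show "integrable lborel (%\<zeta>. ball_kernel \<zeta> *. cut R e w (?g + ?c *. \<zeta>, t))"
   proof (rule Bochner_Integration.integrable_bound)
    show "integrable lborel (%\<zeta>::real^'n. (2 * B) * ball_kernel \<zeta>)" by (intro integrable_mult_right ball_kernel(3))
    show "(%\<zeta>. ball_kernel \<zeta> *. cut R e w (?g + ?c *. \<zeta>, t)) \<in> borel_measurable lborel"
     using borel_measurable_scaleR[OF km measurable_compose[OF Sm cutm]] by simp
    have "norm (ball_kernel \<zeta> *. cut R e w (?g + ?c *. \<zeta>, t)) <= norm ((2 * B) * ball_kernel \<zeta>)" for \<zeta> :: "real^'n"
    proof -
     have "norm (ball_kernel \<zeta> *. cut R e w (?g + ?c *. \<zeta>, t)) = ball_kernel \<zeta> * norm (cut R e w (?g + ?c *. \<zeta>, t))"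
      using ball_kernel(5)[of \<zeta>] by simp
     also have "\<dots> <= ball_kernel \<zeta> * (2 * B)" by (intro mult_left_mono cut_bound[OF e(1,2) w(1,2)] ball_kernel(5))
     also have "\<dots> = norm ((2 * B) * ball_kernel \<zeta>)" using B0 ball_kernel(5)[of \<zeta>] by (simp add: abs_mult)
     finally show ?thesis .
    qed
    then show "AE \<zeta> in lborel. norm (ball_kernel \<zeta> *. cut R e w (?g + ?c *. \<zeta>, t)) <= norm ((2 * B) * ball_kernel \<zeta>)"
     by (intro AE_I2)
   qed
  qed
  also have "(LBINT \<zeta>. ball_kernel \<zeta> *. cut R e w (?g + ?c *. \<zeta>, t)) = cone_avg L (cut R e w) eps (?g, t)"
   using True by (simp add: cone_avg_def)
  finally show ?thesis by (simp add: decay_def power_mult_distrib mult_ac)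
 qed
 have "integrable (lborel \<Otimes>\<^sub>M lborel) (case_prod (%x t. J (x, t)))"
  using Ji by (simp add: lborel_prod)
 from lborel_pair.integral_snd[OF this]
 have "(LBINT t. LBINT x. J (x, t)) = (LBINT z. J z)" by (simp add: lborel_prod)
 then have J_eq: "(LBINT z. J z) = (eps ^ CARD('n) * kap) *
   (LBINT t. ((- th t, th' t) \<bullet> cone_avg L (cut R e w) eps (total_path y t, t)) * decay L t)"
  unfolding inner_eq by (simp only: integral_mult_right_zero)
 \<comment> \<open>At time 0 the axis is at \<open>y\<close> and the radius is \<open>eps\<close>,
   so the initial term becomes an ordinary ball average with the same factor as the space-time
   term.\<close>
 have ini: "(LBINT x. w0 x * \<phi> (x, 0)) = (eps ^ CARD('n) * kap) * (th 0 * ball_avg (%x. ind (cball 0 R) x * w0 x) eps y)"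
 proof -
  have K0': "K (y + eps *. \<zeta>, 0) = kap * ball_kernel \<zeta>" for \<zeta>
  proof -
   have "K (y + eps *. \<zeta>, 0) = pos_square (1 - \<zeta> \<bullet> \<zeta>)"
    using cone_rescale[OF eps(1), of L 0 y \<zeta>] by (simp add: K_def \<sigma>_def \<rho>_def total_path_eq)
   also have "\<dots> = kap * ball_kernel \<zeta>" unfolding ball_kernel_def kap_def[symmetric] using kap by simp
   finally show ?thesis .
  qed
  have "(%x. w0 x * \<phi> (x, 0)) \<in> borel_fun"
  proof -
   have "continuous_on UNIV (%x. \<phi> (x, 0))"
    by (rule continuous_on_compose2[OF C1_with_continuous[OF C1, of UNIV]]) (auto intro!: continuous_intros)
   from borel_measurable_continuous_onI[OF this] show ?thesis by measurable
  qed
  then have "(LBINT x. w0 x * \<phi> (x, 0)) = eps ^ DIM(real^'n) * (LBINT \<zeta>. w0 (y + eps *. \<zeta>) * \<phi> (y + eps *. \<zeta>, 0))"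
   by (rule lborel_integral_scale[OF eps(1)])
  also have "(LBINT \<zeta>. w0 (y + eps *. \<zeta>) * \<phi> (y + eps *. \<zeta>, 0))
   = (LBINT \<zeta>. (kap * th 0) * (ball_kernel \<zeta> *. (ind (cball 0 R) (y + eps *. \<zeta>) * w0 (y + eps *. \<zeta>))))"
  proof (rule Bochner_Integration.integral_cong[OF refl])
   fix \<zeta> :: "real^'n"
   have "ball_kernel \<zeta> = 0 \<or> norm (y + eps *. \<zeta>) <= R"
   proof (cases "norm \<zeta> >= 1")
    case False
    have "eps * norm \<zeta> <= 1 * 1" using False eps by (intro mult_mono) auto
    moreover have "norm (y + eps *. \<zeta>) <= norm y + eps * norm \<zeta>" using norm_triangle_ineq[of y "eps *. \<zeta>"] eps(1) by simp
    moreover have "0 <= L * T" using L(1) T by simp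
    ultimately show ?thesis using R by linarith
   qed (use ball_kernel(6) in blast)
   then show "w0 (y + eps *. \<zeta>) * \<phi> (y + eps *. \<zeta>, 0) = (kap * th 0) * (ball_kernel \<zeta> *. (ind (cball 0 R) (y + eps *. \<zeta>) * w0 (y + eps *. \<zeta>)))"
    unfolding \<phi>_def K0' by auto
  qed
  also have "\<dots> = (kap * th 0) * ball_avg (%x. ind (cball 0 R) x * w0 x) eps y"
   unfolding ball_avg_def by (rule integral_mult_right_zero)
  finally show ?thesis by (simp add: mult_ac)
 qed
 have "0 <= (eps ^ CARD('n) * kap) * ((LBINT t. ((- th t, th' t) \<bullet> cone_avg L (cut R e w) eps (total_path y t, t)) * decay L t)
   + th 0 * ball_avg (%x. ind (cball 0 R) x * w0 x) eps y)"
  using main2 unfolding J_eq ini by (simp only: distrib_left)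
 moreover have pos: "0 < eps ^ CARD('n) * kap" using eps(1) kap by simp
 ultimately show ?thesis by (simp only: mult_le_cancel_left_pos[OF pos, of 0, unfolded mult_zero_right])
qed

end

subsection \<open>Comparison along one streamline\<close>

text \<open>A second difference of \<open>pos_square\<close>: a quadratic spline rising from 0 to 1
  on the unit interval. Its derivative is the hat function with peak 2 at
  \<open>1 / 2\<close>.\<close>

definition smooth_step :: "real => real" where
 "smooth_step r = 2 * pos_square r - 4 * pos_square (r - 1 / 2) + 2 * pos_square (r - 1)"

definition smooth_step' :: "real => real" where
 "smooth_step' r = 4 * max r 0 - 8 * max (r - 1 / 2) 0 + 4 * max (r - 1) 0"

lemma smooth_step_deriv: "(smooth_step has_real_derivative smooth_step' r) (at r)"
proof -
 have s: "((%r. pos_square (r - c)) has_real_derivative 2 * max (r - c) 0) (at r)" for c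
 proof -
  have "((%r. r - c) has_real_derivative 1) (at r)" by (auto intro!: derivative_eq_intros)
  from DERIV_chain2[OF pos_square_deriv this] show ?thesis by simp
 qed
 show ?thesis unfolding smooth_step_def[abs_def] smooth_step'_def
  by (rule DERIV_cong[OF DERIV_add[OF DERIV_diff[OF DERIV_cmult[OF pos_square_deriv] DERIV_cmult[OF s]] DERIV_cmult[OF s]]]) simp
qed

lemma smooth_step:
 "continuous_on S smooth_step'" "0 <= smooth_step' r" "smooth_step' r <= 2"
 "r <= 0 ==> smooth_step' r = 0" "r >= 1 ==> smooth_step' r = 0"
 "r <= 0 ==> smooth_step r = 0" "r >= 1 ==> smooth_step r = 1" "0 <= smooth_step r" "smooth_step r <= 1"
proof -
 show "continuous_on S smooth_step'" unfolding smooth_step'_def[abs_def] by (intro continuous_intros)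
 show "0 <= smooth_step' r" "smooth_step' r <= 2" "r <= 0 ==> smooth_step' r = 0" "r >= 1 ==> smooth_step' r = 0"
  by (auto simp: smooth_step'_def max_def)
 show a: "r <= 0 ==> smooth_step r = 0" for r by (auto simp: smooth_step_def pos_square_def max_def)
 show b: "r >= 1 ==> smooth_step r = 1" for r
  by (auto simp: smooth_step_def pos_square_def max_def power2_eq_square algebra_simps)
 have m: "smooth_step x <= smooth_step y" if "x <= y" for x y
  by (rule DERIV_nonneg_imp_nondecreasing[OF that])
    (use smooth_step_deriv in \<open>auto intro!: exI simp: smooth_step'_def max_def\<close>)
 show "0 <= smooth_step r" using m[of "min r 0" r] a[of "min r 0"] by simp
 show "smooth_step r <= 1" using m[of r "max r 1"] b[of "max r 1"] by simp
qed

text \<open>The hypothesis \<open>H\<close> is applied to \<open>G \<psi>\<close>, where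
  \<open>\<psi>\<close> cuts off before \<open>T\<close>. The term with the derivative of
  \<open>\<psi>\<close> has a favourable sign because \<open>c\<close> and \<open>G\<close> are
  nonnegative.\<close>

lemma comparison_step:
 fixes a c :: "real => real"
 assumes [measurable]: "a \<in> borel_fun" "c \<in> borel_fun"
  and a: "!!t. 0 <= a t" "!!t. a t <= B" "!!t. \<not> (0 < t & t < T) ==> a t = 0"
  and c: "!!t. 0 <= c t" "!!t. c t <= B" "!!t. \<not> (0 < t & t < T) ==> c t = 0"
  and H: "!!th th' \<eta>. \<eta> > 0 ==> (!!t. (th has_real_derivative th' t) (at t)) ==> continuous_on UNIV th'
   ==> (!!t. t > T - \<eta> ==> th t = 0 & th' t = 0) ==> (!!t. t < -1 ==> th t = 0) ==> (!!t. th t >= 0)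
   ==> 0 <= (LBINT t. - th t * a t + th' t * c t) + th 0 * c0"
  and G: "!!t. (G has_real_derivative G' t) (at t)" "continuous_on UNIV G'" "!!t. 0 <= G t" "!!t. 0 <= G' t"
   "!!t. t < -1 ==> G t = 0" "G 0 * c0 = 0" and \<eta>: "\<eta> > 0"
 shows "(LBINT t. ind {..T - 2 * \<eta>} t * (G t * a t)) <= (LBINT t. G' t * c t)"
  and "integrable lborel (%t. ind {..T - 2 * \<eta>} t * (G t * a t))" "integrable lborel (%t. G' t * c t)"
proof -
 \<comment> \<open>Descends from 1 at \<open>T - 2 \<eta>\<close> to 0 at
   \<open>T - \<eta>\<close>.\<close>
 define \<psi> where "\<psi> t = 1 - smooth_step ((t - (T - 2 * \<eta>)) / \<eta>)" for t
 define \<psi>' where "\<psi>' t = - (smooth_step' ((t - (T - 2 * \<eta>)) / \<eta>) / \<eta>)" for t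
 have \<psi>d: "(\<psi> has_real_derivative \<psi>' t) (at t)" for t
 proof -
  have "((%t. (t - (T - 2 * \<eta>)) / \<eta>) has_real_derivative 1 / \<eta>) (at t)"
   using \<eta> by (auto intro!: derivative_eq_intros)
  from DERIV_chain2[OF smooth_step_deriv this]
  have "((%t. smooth_step ((t - (T - 2 * \<eta>)) / \<eta>)) has_real_derivative smooth_step' ((t - (T - 2 * \<eta>)) / \<eta>) * (1 / \<eta>)) (at t)" .
  from DERIV_diff[OF DERIV_const this] show ?thesis unfolding \<psi>_def[abs_def] \<psi>'_def by simp
 qed
 have \<psi>'c: "continuous_on UNIV \<psi>'" unfolding \<psi>'_def[abs_def] divide_inverse
  by (intro continuous_intros continuous_on_compose2[OF smooth_step(1)[of UNIV]]) auto
 have \<psi>: "0 <= \<psi> t" "\<psi> t <= 1" "\<psi>' t <= 0" for t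
  using smooth_step(2,8,9)[of "(t - (T - 2 * \<eta>)) / \<eta>"] \<eta> by (auto simp: \<psi>_def \<psi>'_def)
 have \<psi>1: "\<psi> t = 1" if "t <= T - 2 * \<eta>" for t
  unfolding \<psi>_def using smooth_step(6)[of "(t - (T - 2 * \<eta>)) / \<eta>"] that \<eta> by (simp add: divide_nonpos_pos)
 have \<psi>0: "\<psi> t = 0 & \<psi>' t = 0" if "t > T - \<eta>" for t
 proof -
  have "(t - (T - 2 * \<eta>)) / \<eta> >= 1" using that \<eta> by (simp add: field_simps)
  then show ?thesis unfolding \<psi>_def \<psi>'_def using smooth_step(5,7) by simp
 qed
 define th where "th t = G t * \<psi> t" for t
 define th' where "th' t = G' t * \<psi> t + \<psi>' t * G t" for t
 have Gc: "continuous_on UNIV G" using G(1) DERIV_isCont by (auto simp: continuous_on_eq_continuous_at)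
 have \<psi>c: "continuous_on UNIV \<psi>" using \<psi>d DERIV_isCont by (auto simp: continuous_on_eq_continuous_at)
 have [measurable]: "G \<in> borel_fun" "G' \<in> borel_fun" "\<psi> \<in> borel_fun" "\<psi>' \<in> borel_fun"
  using borel_measurable_continuous_onI Gc G(2) \<psi>c \<psi>'c by auto
 have d: "(th has_real_derivative th' t) (at t)" for t unfolding th_def[abs_def] th'_def by (rule DERIV_mult[OF G(1) \<psi>d])
 have "0 <= (LBINT t. - th t * a t + th' t * c t) + th 0 * c0"
 proof (rule H[OF \<eta> d])
  show "continuous_on UNIV th'" unfolding th'_def[abs_def] by (intro continuous_intros G(2) Gc \<psi>c \<psi>'c)
 qed (use \<psi>0 G \<psi> in \<open>auto simp: th_def th'_def\<close>)
 moreover have "th 0 * c0 = 0" using G(6) by (auto simp: th_def)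
 ultimately have le: "0 <= (LBINT t. - th t * a t + th' t * c t)" by simp
 have bd: "integrable lborel (%t. g t * h t)"
  if g: "continuous_on UNIV g" and h: "h \<in> borel_fun" "!!t. \<bar>h t\<bar> <= B" "!!t. \<not> (0 < t & t < T) ==> h t = 0"
  for g h :: "real => real"
 proof -
  have "compact (g ` {0..T})" by (intro compact_continuous_image continuous_on_subset[OF g]) auto
  then have "bounded (g ` {0..T})" by (rule compact_imp_bounded)
  then obtain N where "!!y. y \<in> g ` {0..T} ==> norm y <= N" unfolding bounded_iff by blast
  then have N: "\<bar>g t\<bar> <= N" if "t \<in> {0..T}" for t using imageI[OF that, of g] by fastforce
  have [measurable]: "g \<in> borel_fun" "h \<in> borel_fun" using borel_measurable_continuous_onI[OF g] h(1) by auto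
  show ?thesis
  proof (rule integrable_bounded_support)
   show "(%t. g t * h t) \<in> borel_fun" by measurable
   show "g t * h t = 0" if "norm t > T" for t using h(3)[of t] that by (auto simp: abs_real_def split: if_splits)
   show "norm (g t * h t) <= \<bar>N\<bar> * B" for t
   proof (cases "0 < t & t < T")
    case True
    have "\<bar>g t\<bar> <= \<bar>N\<bar>" using N[of t] True by auto
    then have "\<bar>g t\<bar> * \<bar>h t\<bar> <= \<bar>N\<bar> * B" using h(2)[of t] by (rule mult_mono) auto
    then show ?thesis by (simp add: abs_mult)
   next
    case False
    have "0 <= B" using h(2)[of t] by simp
    then show ?thesis using h(3)[OF False] by simp
   qed
  qed
 qed
 have ia: "integrable lborel (%t. G t * (ind {..T - 2 * \<eta>} t * a t))"
  using a by (intro bd Gc) (auto simp: indicator_def intro: order_trans[OF a(1) a(2)])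
 then show i1: "integrable lborel (%t. ind {..T - 2 * \<eta>} t * (G t * a t))" by (simp add: mult_ac)
 show i2: "integrable lborel (%t. G' t * c t)" using c by (intro bd G(2)) auto
 have i3: "integrable lborel (%t. th t * a t)" unfolding th_def using a by (intro bd continuous_intros Gc \<psi>c) auto
 have i4: "integrable lborel (%t. th' t * c t)" unfolding th'_def using c by (intro bd continuous_intros Gc \<psi>c \<psi>'c G(2)) auto
 have "(LBINT t. - th t * a t + th' t * c t) <= (LBINT t. - (ind {..T - 2 * \<eta>} t * (G t * a t)) + G' t * c t)"
 proof (rule integral_mono)
  show "integrable lborel (%t. - th t * a t + th' t * c t)" using i3 i4 by simp
  show "integrable lborel (%t. - (ind {..T - 2 * \<eta>} t * (G t * a t)) + G' t * c t)" using i1 i2 by simp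
  fix t
  have "ind {..T - 2 * \<eta>} t * (G t * a t) <= th t * a t"
   using \<psi>1[of t] \<psi>(1)[of t] G(3)[of t] a(1)[of t] by (auto simp: th_def indicator_def)
  moreover have "G' t * \<psi> t + \<psi>' t * G t <= G' t * 1 + 0"
   using \<psi>[of t] G(3,4)[of t] by (intro add_mono mult_left_mono mult_nonpos_nonneg) auto
  then have "th' t * c t <= G' t * c t" unfolding th'_def using c(1)[of t] by (intro mult_right_mono) auto
  ultimately show "- th t * a t + th' t * c t <= - (ind {..T - 2 * \<eta>} t * (G t * a t)) + G' t * c t" by simp
 qed
 also have "\<dots> = - (LBINT t. ind {..T - 2 * \<eta>} t * (G t * a t)) + (LBINT t. G' t * c t)"
  using i1 i2 by simp
 finally show "(LBINT t. ind {..T - 2 * \<eta>} t * (G t * a t)) <= (LBINT t. G' t * c t)" using le by linarith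
qed

text \<open>On \<open>[0, 1/2]\<close> the squared profile is at least
  \<open>(3/4)^2 = 9/16\<close>, while the left-hand side is at most 4; the quotient is
  \<open>64/9\<close>. Outside that interval the left-hand side is 0.\<close>

lemma ball_kernel_dominates_step:
 "2 * smooth_step' (2 * r) <= 64 / 9 * (LBINT \<xi>::real. pos_square (1 - \<xi> \<bullet> \<xi>)) * ball_kernel (r :: real)"
proof -
 define kap where "kap = (LBINT \<xi>::real. pos_square (1 - \<xi> \<bullet> \<xi>))"
 have kap: "kap > 0" unfolding kap_def by (rule ball_kernel(2))
 show ?thesis
 proof (cases "0 <= r & r <= 1 / 2")
  case True
  have "r * r <= 1 / 2 * (1 / 2)" using True by (intro mult_mono) auto
  then have "(3 / 4)\<^sup>2 <= (max (1 - r * r) 0)\<^sup>2" by (intro power_mono) auto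
  then have "9 / 16 <= pos_square (1 - r \<bullet> r)" by (simp add: pos_square_def power2_eq_square)
  then have "4 <= 64 / 9 * pos_square (1 - r \<bullet> r)" by simp
  moreover have "smooth_step' (2 * r) <= 2" by (rule smooth_step(3))
  ultimately show ?thesis unfolding ball_kernel_def kap_def[symmetric] using kap by simp
 next
  case False
  then have "smooth_step' (2 * r) = 0" using smooth_step(4,5)[of "2 * r"] by auto
  then show ?thesis unfolding kap_def[symmetric] using kap ball_kernel(5)[of r] by simp
 qed
qed

text \<open>The open interval is exhausted by countably many compact ones; the margin
  \<open>2 \<eta>\<close> is the one left by \<open>comparison_step\<close>.\<close>

lemma AE_zero_of_vanishing_integrals:
 fixes a :: "real => real"
 assumes "a \<in> borel_fun" "!!t. 0 <= a t"
  and "!!u \<eta>. s < u ==> 0 < \<eta> ==> integrable lborel (%t. ind {u..T - 2 * \<eta>} t * a t)"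
  and "!!u \<eta>. s < u ==> 0 < \<eta> ==> (LBINT t. ind {u..T - 2 * \<eta>} t * a t) <= 0"
 shows "AE t in lborel. s < t & t < T --> a t = 0"
proof -
 have "AE t in lborel. t \<in> {s + 1 / real (Suc n)..T - 2 * (1 / real (Suc n))} --> a t = 0" for n
 proof -
  let ?f = "%t. ind {s + 1 / real (Suc n)..T - 2 * (1 / real (Suc n))} t * a t"
  have u: "s < s + 1 / real (Suc n)" "0 < 1 / real (Suc n)" by auto
  have n: "AE t in lborel. 0 <= ?f t" using assms(2) by auto
  have "integral\<^sup>L lborel ?f = 0" using assms(4)[OF u] integral_nonneg_AE[OF n] by linarith
  then have "AE t in lborel. ?f t = 0" using integral_nonneg_eq_0_iff_AE[OF assms(3)[OF u] n] by blast
  then show ?thesis by eventually_elim (auto simp: indicator_def)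
 qed
 then have "AE t in lborel. \<forall>n. t \<in> {s + 1 / real (Suc n)..T - 2 * (1 / real (Suc n))} --> a t = 0"
  unfolding AE_all_countable by blast
 then show ?thesis
 proof eventually_elim
  case (elim t)
  show ?case
  proof
   assume t: "s < t & t < T"
   define d where "d = min (t - s) (T - t)"
   define r where "r = d / 2"
   have "d > 0" using t by (simp add: d_def)
   then have r: "r > 0" "r + r = d" by (simp_all add: r_def)
   then obtain n where n: "inverse (real (Suc n)) < r" using reals_Archimedean by blast
   define x where "x = 1 / real (Suc n)"
   have 1: "x < r" using n by (simp add: x_def inverse_eq_divide)
   have 2: "d <= t - s" unfolding d_def by (rule min.cobounded1)
   have 3: "d <= T - t" unfolding d_def by (rule min.cobounded2)
   have "s + x <= t" using 1 2 r by linarith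
   moreover have "t <= T - (x + x)" using 1 3 r(2) by linarith
   then have "t <= T - 2 * x" by (simp only: mult_2)
   ultimately have "t \<in> {s + 1 / real (Suc n)..T - 2 * (1 / real (Suc n))}" unfolding x_def by (simp only: atLeastAtMost_iff)
   then show "a t = 0" using elim by blast
  qed
 qed
qed

text \<open>Testing with a steep ramp at \<open>s\<close> bounds the later integral of
  \<open>a\<close> by an average of \<open>c\<close> near \<open>s\<close>. At almost every
  \<open>s\<close> this average tends to a multiple of \<open>c s\<close>, so once the deficit is 0
  the later absorption is 0.\<close>

lemma transport_comparison:
 fixes a c :: "real => real"
 assumes [measurable]: "a \<in> borel_fun" "c \<in> borel_fun"
  and a: "!!t. 0 <= a t" "!!t. a t <= B" "!!t. \<not> (0 < t & t < T) ==> a t = 0"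
  and c: "!!t. 0 <= c t" "!!t. c t <= B" "!!t. \<not> (0 < t & t < T) ==> c t = 0"
  and H: "!!th th' \<eta>. \<eta> > 0 ==> (!!t. (th has_real_derivative th' t) (at t)) ==> continuous_on UNIV th'
   ==> (!!t. t > T - \<eta> ==> th t = 0 & th' t = 0) ==> (!!t. t < -1 ==> th t = 0) ==> (!!t. th t >= 0)
   ==> 0 <= (LBINT t. - th t * a t + th' t * c t) + th 0 * c0"
 shows "AE s in lborel. 0 < s --> c s = 0 --> (AE t in lborel. s < t & t < T --> a t = 0)"
  and "c0 = 0 ==> AE t in lborel. 0 < t & t < T --> a t = 0"
proof -
 have lin: "((%t. smooth_step (p * t + q)) has_real_derivative smooth_step' (p * t + q) * p) (at t)" for p q t
  by (rule DERIV_chain2[OF smooth_step_deriv]) (auto intro!: derivative_eq_intros)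
 have linc: "continuous_on UNIV (%t. smooth_step' (p * t + q) * p)" for p q
  by (intro continuous_intros continuous_on_compose2[OF smooth_step(1)[of UNIV]]) auto
 define kap where "kap = 64 / 9 * (LBINT \<xi>::real. pos_square (1 - \<xi> \<bullet> \<xi>))"
 have kap0: "kap >= 0" unfolding kap_def using ball_kernel(2)[where 'a=real] by simp
 have iu: "integrable lborel (%t. ind {u..v} t * a t)" for u v
 proof (rule integrable_bounded_support[where R=T and B=B])
  show "(%t. ind {u..v} t * a t) \<in> borel_fun" by measurable
  show "norm (ind {u..v} t * a t) <= B" for t using a(1,2)[of t] by (auto simp: indicator_def)
  show "ind {u..v} t * a t = 0" if "norm t > T" for t using a(3)[of t] that by (auto simp: abs_real_def split: if_splits)
 qed
 \<comment> \<open>\<open>G\<close> climbs from 0 at \<open>s\<close> to 1 at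
   \<open>s + eps / 2\<close>. Rescaled by \<open>eps\<close>, its derivative lies below
   \<open>kap\<close> times the ball kernel, which turns the right-hand side into an average of
   \<open>c\<close> around \<open>s\<close>.\<close>
 have est: "(LBINT t. ind {u..T - 2 * \<eta>} t * a t) <= kap * ball_avg c eps s"
  if h: "0 < s" "0 < eps" "s + eps <= u" "\<eta> > 0" for s eps u \<eta>
 proof -
  define G where "G t = smooth_step (2 / eps * t + (- (2 * s / eps)))" for t
  define G' where "G' t = smooth_step' (2 / eps * t + (- (2 * s / eps))) * (2 / eps)" for t
  have arg: "2 / eps * t + (- (2 * s / eps)) = 2 * ((t - s) / eps)" for t using h(2) by (simp add: field_simps)
  have Gz: "G t = 0" if "t <= s" for t
   unfolding G_def arg using smooth_step(6)[of "2 * ((t - s) / eps)"] that h(2) by (simp add: divide_nonpos_pos)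
  have Go: "G t = 1" if "t >= u" for t
  proof -
   have "(t - s) / eps >= 1" using that h by (simp add: field_simps)
   then have "1 <= 2 * ((t - s) / eps)" by linarith
   then show ?thesis unfolding G_def arg by (rule smooth_step(7))
  qed
  have Gp: "0 <= G t" "0 <= G' t" for t unfolding G_def G'_def using smooth_step(2,8) h(2) by auto
  have Gd: "(G has_real_derivative G' t) (at t)" for t unfolding G_def[abs_def] G'_def by (rule lin)
  have Gc: "continuous_on UNIV G'" unfolding G'_def[abs_def] by (rule linc)
  have Gl: "G t = 0" if "t < -1" for t using Gz[of t] that h(1) by simp
  have G0: "G 0 * c0 = 0" using Gz[of 0] h(1) by simp
  note step = comparison_step[OF assms(1,2) a c H Gd Gc Gp Gl G0 h(4)]
  have "(LBINT t. ind {u..T - 2 * \<eta>} t * a t) <= (LBINT t. ind {..T - 2 * \<eta>} t * (G t * a t))"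
   by (rule integral_mono[OF iu step(2)]) (use Go Gp(1) a(1) in \<open>auto simp: indicator_def\<close>)
  also have "\<dots> <= (LBINT t. G' t * c t)" by (rule step(1))
  also have "\<dots> = eps ^ DIM(real) * (LBINT \<zeta>. G' (s + eps *. \<zeta>) * c (s + eps *. \<zeta>))"
  proof (rule lborel_integral_scale[OF h(2)])
   have "G' \<in> borel_fun" by (rule borel_measurable_continuous_onI[OF Gc])
   then show "(%t. G' t * c t) \<in> borel_fun" by measurable
  qed
  also have "(LBINT \<zeta>. G' (s + eps *. \<zeta>) * c (s + eps *. \<zeta>)) <= (LBINT \<zeta>. (kap / eps) * (ball_kernel \<zeta> *. c (s + eps *. \<zeta>)))"
  proof (rule integral_mono')
   have "integrable lborel (%\<zeta>. ball_kernel \<zeta> *. c (s + eps *. \<zeta>))"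
   proof (rule Bochner_Integration.integrable_bound)
    show "integrable lborel (%\<zeta>::real. B * ball_kernel \<zeta>)" by (intro integrable_mult_right ball_kernel(3))
    have [measurable]: "(ball_kernel :: real => real) \<in> borel_fun" by (rule ball_kernel(7))
    show "(%\<zeta>. ball_kernel \<zeta> *. c (s + eps *. \<zeta>)) \<in> borel_measurable lborel" by measurable
    have "norm (ball_kernel \<zeta> *. c (s + eps *. \<zeta>)) <= norm (B * ball_kernel \<zeta>)" for \<zeta> :: real
     using mult_left_mono[OF c(2)[of "s + eps *. \<zeta>"] ball_kernel(5)[of \<zeta>]] c(1)[of "s + eps *. \<zeta>"] c(2)[of "s + eps *. \<zeta>"] ball_kernel(5)[of \<zeta>]
     by (simp add: abs_mult mult.commute)
    then show "AE \<zeta> in lborel. norm (ball_kernel \<zeta> *. c (s + eps *. \<zeta>)) <= norm (B * ball_kernel \<zeta>)" by (intro AE_I2)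
   qed
   then show "integrable lborel (%\<zeta>. (kap / eps) * (ball_kernel \<zeta> *. c (s + eps *. \<zeta>)))" by (rule integrable_mult_right)
   fix \<zeta> :: real
   have "G' (s + eps *. \<zeta>) = (2 * smooth_step' (2 * \<zeta>)) / eps" unfolding G'_def arg using h(2) by simp
   also have "\<dots> <= (kap * ball_kernel \<zeta>) / eps"
    using ball_kernel_dominates_step[of \<zeta>] h(2) by (intro divide_right_mono) (auto simp: kap_def)
   finally have "G' (s + eps *. \<zeta>) * c (s + eps *. \<zeta>) <= (kap * ball_kernel \<zeta>) / eps * c (s + eps *. \<zeta>)"
    using c(1) by (intro mult_right_mono) auto
   then show "G' (s + eps *. \<zeta>) * c (s + eps *. \<zeta>) <= (kap / eps) * (ball_kernel \<zeta> *. c (s + eps *. \<zeta>))" by simp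
   show "0 <= (kap / eps) * (ball_kernel \<zeta> *. c (s + eps *. \<zeta>))"
    using kap0 h(2) ball_kernel(5)[of \<zeta>] c(1) by simp
  qed
  also have "(LBINT \<zeta>. (kap / eps) * (ball_kernel \<zeta> *. c (s + eps *. \<zeta>))) = kap / eps * ball_avg c eps s"
   unfolding ball_avg_def by (rule integral_mult_right_zero)
  finally show ?thesis using h(2) by simp
 qed
 have sqc: "square_int c"
  unfolding square_int_def
 proof (intro conjI assms(2) integrable_bounded_support[where R=T and B="B\<^sup>2"])
  show "(%z. (norm (c z))\<^sup>2) \<in> borel_fun" by measurable
  show "norm ((norm (c z))\<^sup>2) <= B\<^sup>2" for z using power_mono[OF c(2) c(1), of z 2] by simp
  show "(norm (c z))\<^sup>2 = 0" if "norm z > T" for z using c(3)[of z] that by (auto simp: abs_real_def split: if_splits)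
 qed
 \<comment> \<open>Averages in one variable are wanted here, so the space-time function in
   \<open>averages_converge_AE\<close> is taken to be 0.\<close>
 have sq0: "square_int (%_ :: real \<times> real. 0::real)" by (simp add: square_int_def)
 obtain eps where eps: "!!j::nat. 0 < eps j" "!!j. eps j <= 1 / real (Suc j)"
  and lim: "AE s in lborel. (%j. ball_avg c (eps j) s) ----> c s"
  by (rule averages_converge_AE[OF sq0 sqc order_refl]) blast
 show "AE s in lborel. 0 < s --> c s = 0 --> (AE t in lborel. s < t & t < T --> a t = 0)"
  using lim
 proof (eventually_elim, intro impI)
  fix s assume l: "(%j. ball_avg c (eps j) s) ----> c s" and s: "0 < s" "c s = 0"
  show "AE t in lborel. s < t & t < T --> a t = 0"
  proof (rule AE_zero_of_vanishing_integrals[OF assms(1) a(1) iu])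
   fix u \<eta> :: real assume u: "s < u" "0 < \<eta>"
   have k: "(%j. kap * ball_avg c (eps j) s) ----> kap * c s" by (intro tendsto_intros l)
   obtain N where N: "inverse (real (Suc N)) < u - s" using reals_Archimedean[of "u - s"] u by auto
   have "(LBINT t. ind {u..T - 2 * \<eta>} t * a t) <= kap * ball_avg c (eps j) s" if "j >= N" for j
   proof (rule est[OF s(1) eps(1) _ u(2)])
    have "1 / real (Suc j) <= 1 / real (Suc N)" using that by (intro divide_left_mono) auto
    then show "s + eps j <= u" using eps(2)[of j] N by (simp add: inverse_eq_divide)
   qed
   then have "(LBINT t. ind {u..T - 2 * \<eta>} t * a t) <= kap * c s"
    by (intro LIMSEQ_le_const[OF k]) auto
   then show "(LBINT t. ind {u..T - 2 * \<eta>} t * a t) <= 0" using s(2) by simp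
  qed
 qed
 show "AE t in lborel. 0 < t & t < T --> a t = 0" if "c0 = 0"
 proof (rule AE_zero_of_vanishing_integrals[OF assms(1) a(1) iu])
  fix u \<eta> :: real assume u: "0 < u" "0 < \<eta>"
  \<comment> \<open>The climb takes place in \<open>[-1, 0]\<close>, where \<open>c\<close>
    vanishes, and the value at time 0 is multiplied by \<open>c0 = 0\<close>.\<close>
  define G where "G t = smooth_step (1 * t + 1)" for t
  define G' where "G' t = smooth_step' (1 * t + 1) * 1" for t
  have Gd: "(G has_real_derivative G' t) (at t)" for t unfolding G_def[abs_def] G'_def by (rule lin)
  have Gc: "continuous_on UNIV G'" unfolding G'_def[abs_def] by (rule linc)
  have Gp: "0 <= G t" "0 <= G' t" for t unfolding G_def G'_def using smooth_step(2,8) by auto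
  have Gl: "G t = 0" if "t < -1" for t using that smooth_step(6) by (simp add: G_def)
  have G0: "G 0 * c0 = 0" using that by simp
  note step = comparison_step[OF assms(1,2) a c H Gd Gc Gp Gl G0 u(2)]
  have Go: "G t = 1" if "t >= 0" for t using that smooth_step(7) by (simp add: G_def)
  have "(LBINT t. ind {u..T - 2 * \<eta>} t * a t) <= (LBINT t. ind {..T - 2 * \<eta>} t * (G t * a t))"
   by (rule integral_mono[OF iu step(2)]) (use Go Gp(1) a(1) u in \<open>auto simp: indicator_def\<close>)
  also have "\<dots> <= (LBINT t. G' t * c t)" by (rule step(1))
  also have "(%t. G' t * c t) = (%t. 0)"
  proof
   fix t show "G' t * c t = 0" using c(3)[of t] smooth_step(5)[of "1 * t + 1"] by (cases "t > 0") (auto simp: G'_def)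
  qed
  finally show "(LBINT t. ind {u..T - 2 * \<eta>} t * a t) <= 0" by simp
 qed
qed

subsection \<open>Propagation of positivity\<close>

context congested_flow
begin

lemma decay_bounds: "decay L t > 0" "L > 0 ==> t >= 0 ==> decay L t <= 1"
proof -
 show "decay L t > 0" by (simp add: decay_def)
 assume "L > 0" "t >= 0"
 then have e: "exp (- L * t) <= 1" by simp
 then have "exp (- L * t) * exp (- L * t) ^ CARD('n) <= 1 * 1" by (intro mult_mono power_le_one) auto
 then show "decay L t <= 1" by (simp add: decay_def)
qed

lemma decay_borel [measurable]: "decay L \<in> borel_fun"
 unfolding decay_def[abs_def] by measurable

lemma path_point_borel: "(%t. (total_path y t, t)) \<in> borel_fun"
 by (intro borel_measurable_Pair total_path_borel) simp

lemma cone_avg_bound: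
 assumes "!!z. norm (F z) <= N"
 shows "norm (cone_avg L F eps (z :: (real^'n) \<times> real)) <= N"
proof -
 have "norm (cone_avg L F eps z) <= (LBINT \<zeta>. norm (ball_kernel \<zeta> *. F (fst z + (eps * exp (- L * \<bar>snd z\<bar>)) *. \<zeta>, snd z)))"
  unfolding cone_avg_def by (rule integral_norm_bound)
 also have "\<dots> <= (LBINT \<zeta>::real^'n. N * ball_kernel \<zeta>)"
 proof (rule integral_mono')
  show "integrable lborel (%\<zeta>::real^'n. N * ball_kernel \<zeta>)" by (intro integrable_mult_right ball_kernel(3))
  fix \<zeta> :: "real^'n"
  have "ball_kernel \<zeta> * norm (F (fst z + (eps * exp (- L * \<bar>snd z\<bar>)) *. \<zeta>, snd z)) <= ball_kernel \<zeta> * N"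
   by (intro mult_left_mono assms ball_kernel(5))
  then show "norm (ball_kernel \<zeta> *. F (fst z + (eps * exp (- L * \<bar>snd z\<bar>)) *. \<zeta>, snd z)) <= N * ball_kernel \<zeta>"
   using ball_kernel(5)[of \<zeta>] by (simp add: mult.commute)
  show "0 <= N * ball_kernel \<zeta>" using ball_kernel(5)[of \<zeta>] order_trans[OF norm_ge_zero assms] by simp
 qed
 also have "\<dots> = N" using ball_kernel(4)[where 'a="real^'n"] by simp
 finally show ?thesis .
qed

lemma cone_avg_along_path_borel:
 fixes F :: "(real^'n) \<times> real => real \<times> real"
 assumes F: "F \<in> borel_fun"
 shows "(%t. cone_avg L F eps (total_path y t, t)) \<in> borel_fun"
proof -
 have k: "(%p. ball_kernel (snd p)) \<in> borel_measurable (borel \<Otimes>\<^sub>M (lborel :: (real^'n) measure))"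
  by (rule measurable_compose[OF measurable_snd]) (simp add: ball_kernel(7))
 have "(%p. total_path y (fst p) + (eps * exp (- L * \<bar>fst p\<bar>)) *. snd p) \<in> borel_measurable (borel \<Otimes>\<^sub>M (lborel :: (real^'n) measure))"
  by measurable
 moreover have "fst \<in> borel_measurable (borel \<Otimes>\<^sub>M (lborel :: (real^'n) measure))" by measurable
 ultimately have "(%p. (total_path y (fst p) + (eps * exp (- L * \<bar>fst p\<bar>)) *. snd p, fst p :: real))
   \<in> borel_measurable (borel \<Otimes>\<^sub>M (lborel :: (real^'n) measure))" by (rule borel_measurable_Pair)
 from borel_measurable_scaleR[OF k measurable_compose[OF this F]]
 have "case_prod (%t \<zeta>. ball_kernel \<zeta> *. F (total_path y t + (eps * exp (- L * \<bar>t\<bar>)) *. \<zeta>, t))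
   \<in> borel_measurable (borel \<Otimes>\<^sub>M (lborel :: (real^'n) measure))" by (simp add: split_beta')
 from lborel.borel_measurable_lebesgue_integral[OF this] show ?thesis by (simp add: cone_avg_def)
qed

lemma cut_square_int:
 assumes [measurable]: "e \<in> borel_fun" "w \<in> borel_fun"
  and e: "!!z. 0 <= e z" "!!z. e z <= B" "!!z. z \<notin> QT T ==> e z = 0"
  and w: "!!z. 0 <= w z" "!!z. w z <= B" "!!z. z \<notin> QT T ==> w z = 0"
 shows "square_int (cut R e w)"
 unfolding square_int_def
proof (intro conjI)
 show m: "cut R e w \<in> borel_fun" by (rule cut_borel) measurable
 show "integrable lborel (%z. (norm (cut R e w z))\<^sup>2)"
 proof (rule integrable_bounded_support)
  show "(%z. (norm (cut R e w z))\<^sup>2) \<in> borel_fun" using m by measurable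
  show "norm ((norm (cut R e w z))\<^sup>2) <= (2 * B)\<^sup>2" for z
   using power_mono[OF cut_bound[OF e(1,2) w(1,2), where R=R and z=z] norm_ge_zero, where n=2] by simp
  fix z :: "(real^'n) \<times> real" assume z: "norm z > \<bar>R\<bar> + T"
  have n: "norm z <= norm (fst z) + norm (snd z)" using norm_Pair_le[of "fst z" "snd z"] by simp
  show "(norm (cut R e w z))\<^sup>2 = 0"
  proof (cases "z \<in> QT T")
   case True
   then have "norm (snd z) < T" by (simp add: QT_iff)
   then have "norm (fst z) > R" using n z by linarith
   then show ?thesis by (simp add: cut_def)
  qed (use e(3) w(3) in \<open>simp add: cut_def zero_prod_def\<close>)
 qed
qed

text \<open>The radii depend on the spatial cutoff, so they are chosen for all integer cutoffs
  \<open>n\<close> at once. Countably many null sets of starting points are discarded, and each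
  remaining streamline then uses an \<open>n\<close> beyond its reach.\<close>

lemma deficit_along_streamlines:
 fixes e w :: "(real^'n) \<times> real => real" and w0 :: "real^'n => real"
 assumes bor: "e \<in> borel_fun" "w \<in> borel_fun" "w0 \<in> borel_fun"
  and e: "!!z. 0 <= e z" "!!z. e z <= B" "!!z. z \<notin> QT T ==> e z = 0"
  and w: "!!z. 0 <= w z" "!!z. w z <= B" "!!z. z \<notin> QT T ==> w z = 0"
  and w0: "!!x. 0 <= w0 x" "!!x. w0 x <= B"
  and ineq: "!!\<phi> D. C1_with \<phi> D ==> (!!z. \<phi> z >= 0) ==> compact (closure {z. \<phi> z ~= 0})
   ==> closure {z. \<phi> z ~= 0} \<subseteq> UNIV \<times> {..<T}
   ==> 0 <= (LBINT z. (- e z + fQ z * w z) * \<phi> z + ((- w z) *. \<beta> z) \<bullet> D z) + (LBINT x. w0 x * \<phi> (x, 0))"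
 shows "AE y in lborel.
  (AE s in lborel. 0 < s --> w (total_path y s, s) = 0 --> (AE t in lborel. s < t & t < T --> e (total_path y t, t) = 0)) &
  (w0 y = 0 --> (AE t in lborel. 0 < t & t < T --> e (total_path y t, t) = 0))"
proof -
 obtain L where L: "L > 0" "!!x y t. 0 <= t ==> t < T ==> norm (b (x, t) - b (y, t)) <= L * norm (x - y)"
  "!!x t. 0 <= t ==> t < T ==> norm (b (x, t)) <= L" "!!z. \<bar>fQ z\<bar> <= L" by (rule drift_bounds) blast
 have B0: "B >= 0" using e(1,2) order_trans by blast
 define F where "F n = cut (real n) e w" for n :: nat
 define F0 where "F0 n x = ind (cball 0 (real n)) x * w0 x" for n :: nat and x
 have Fsq: "square_int (F n)" for n unfolding F_def by (rule cut_square_int[OF bor(1,2) e w])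
 have F0sq: "square_int (F0 n)" for n
  unfolding square_int_def
 proof (intro conjI)
  show m: "F0 n \<in> borel_fun" unfolding F0_def[abs_def]
   by (intro borel_measurable_times borel_measurable_indicator bor(3)) simp
  show "integrable lborel (%z. (norm (F0 n z))\<^sup>2)"
  proof (rule integrable_bounded_support[where R="real n" and B="B\<^sup>2"])
   show "(%z. (norm (F0 n z))\<^sup>2) \<in> borel_fun" using m by measurable
   show "norm ((norm (F0 n z))\<^sup>2) <= B\<^sup>2" for z
    using power_mono[OF w0(2) w0(1), of z 2] by (auto simp: F0_def indicator_def)
   show "norm z > real n ==> (norm (F0 n z))\<^sup>2 = 0" for z by (simp add: F0_def)
  qed
 qed
 define Q where "Q n eps \<longleftrightarrow> (\<forall>j::nat. 0 < eps j) & (\<forall>j. eps j <= 1 / real (Suc j)) &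
   (AE z in lborel. (%j. cone_avg L (F n) (eps j) z) ----> F n z) & (AE x in lborel. (%j. ball_avg (F0 n) (eps j) x) ----> F0 n x)" for n eps
 have "\<exists>eps. Q n eps" for n unfolding Q_def
  by (rule averages_converge_AE[OF Fsq[of n] F0sq[of n] less_imp_le[OF L(1)]]) blast
 then have "\<exists>E. \<forall>n. Q n (E n)" by (intro choice allI)
 then obtain E where "\<forall>n. Q n (E n)" ..
 then have E: "!!n j. 0 < E n j" "!!n j. E n j <= 1 / real (Suc j)"
  and Ec: "!!n. AE z in lborel. (%j. cone_avg L (F n) (E n j) z) ----> F n z"
  and Eb: "!!n. AE x in lborel. (%j. ball_avg (F0 n) (E n j) x) ----> F0 n x" unfolding Q_def by blast+
 \<comment> \<open>The averages converge almost everywhere in space-time; \<open>flow_AE\<close>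
   turns this into convergence at almost every time on almost every streamline.\<close>
 have "AE y in lborel. AE t in lborel. 0 < t & t < T --> (%j. cone_avg L (F n) (E n j) (X t y, t)) ----> F n (X t y, t)" for n
  by (rule flow_AE) (rule eventually_mono[OF Ec[of n]], blast)
 then have A1: "AE y in lborel. \<forall>n. AE t in lborel. 0 < t & t < T --> (%j. cone_avg L (F n) (E n j) (X t y, t)) ----> F n (X t y, t)"
  unfolding AE_all_countable by blast
 have A2: "AE y in lborel. \<forall>n. (%j. ball_avg (F0 n) (E n j) y) ----> F0 n y"
  unfolding AE_all_countable using Eb by blast
 from A1 A2 show ?thesis
 proof eventually_elim
  fix y assume c1: "\<forall>n. AE t in lborel. 0 < t & t < T --> (%j. cone_avg L (F n) (E n j) (X t y, t)) ----> F n (X t y, t)"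
   and c2: "\<forall>n. (%j. ball_avg (F0 n) (E n j) y) ----> F0 n y"
  \<comment> \<open>Large enough for the cones of width at most 1 around this streamline up to time
    \<open>T\<close>.\<close>
  obtain n :: nat where n: "norm y + L * T + 1 <= real n" using real_arch_simple by blast
  have LT: "0 <= L * T" using L(1) T by simp
  have yn: "F0 n y = w0 y" using n LT by (simp add: F0_def)
  have Xn: "F n (total_path y t, t) = (e (total_path y t, t), w (total_path y t, t))" for t
  proof (cases "0 < t & t < T")
   case True
   have "norm (total_path y t) <= norm y + L * \<bar>t\<bar>" by (rule total_path_bound[OF L(3)]) (use True in auto)
   also have "L * \<bar>t\<bar> <= L * T" using L(1) True by (intro mult_left_mono) auto
   finally show ?thesis using n by (simp add: F_def cut_def)
  qed (use e(3) w(3) in \<open>simp add: F_def cut_def QT_iff zero_prod_def\<close>)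
  have Fz: "cone_avg L (F n) eps (x, t) = 0" if "\<not> (0 < t & t < T)" for x t eps
   using that e(3) w(3) by (simp add: cone_avg_def F_def cut_def QT_iff zero_prod_def[symmetric])
  \<comment> \<open>The weight \<open>decay\<close> is positive, so including it does not change
    where absorption and deficit vanish.\<close>
  define a where "a t = decay L t * e (total_path y t, t)" for t
  define c where "c t = decay L t * w (total_path y t, t)" for t
  have am: "a \<in> borel_fun" and cm: "c \<in> borel_fun"
   unfolding a_def[abs_def] c_def[abs_def]
   by (intro borel_measurable_times decay_borel measurable_compose[OF path_point_borel] bor)+
  have ab: "0 <= a t" "a t <= B" "\<not> (0 < t & t < T) ==> a t = 0" for t
  proof -
   show z: "\<not> (0 < t & t < T) ==> a t = 0" using e(3)[of "(total_path y t, t)"] by (simp add: a_def QT_iff)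
   show "0 <= a t" using decay_bounds(1)[of L t] e(1) by (simp add: a_def)
   show "a t <= B"
   proof (cases "0 < t & t < T")
    case True
    have "decay L t * e (total_path y t, t) <= 1 * B"
     using decay_bounds[of L t] L(1) True e(1,2) by (intro mult_mono) auto
    then show ?thesis by (simp add: a_def)
   qed (use z B0 in auto)
  qed
  have cb: "0 <= c t" "c t <= B" "\<not> (0 < t & t < T) ==> c t = 0" for t
  proof -
   show z: "\<not> (0 < t & t < T) ==> c t = 0" using w(3)[of "(total_path y t, t)"] by (simp add: c_def QT_iff)
   show "0 <= c t" using decay_bounds(1)[of L t] w(1) by (simp add: c_def)
   show "c t <= B"
   proof (cases "0 < t & t < T")
    case True
    have "decay L t * w (total_path y t, t) <= 1 * B"
     using decay_bounds[of L t] L(1) True w(1,2) by (intro mult_mono) auto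
    then show ?thesis by (simp add: c_def)
   qed (use z B0 in auto)
  qed
  have H: "0 <= (LBINT t. - th t * a t + th' t * c t) + th 0 * w0 y"
   if h: "\<eta> > 0" "!!t. (th has_real_derivative th' t) (at t)" "continuous_on UNIV th'"
    "!!t. t > T - \<eta> ==> th t = 0 & th' t = 0" "!!t. t < -1 ==> th t = 0" "!!t. th t >= 0" for th th' \<eta>
  proof -
   have thc: "continuous_on UNIV th" using h(2) DERIV_isCont by (auto simp: continuous_on_eq_continuous_at)
   have [measurable]: "th \<in> borel_fun" "th' \<in> borel_fun"
    using borel_measurable_continuous_onI[OF thc] borel_measurable_continuous_onI[OF h(3)] by auto
   define S where "S j t = ((- th t, th' t) \<bullet> cone_avg L (F n) (E n j) (total_path y t, t)) * decay L t" for j t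
   define S0 where "S0 t = ((- th t, th' t) \<bullet> F n (total_path y t, t)) * decay L t" for t
   have S0_eq: "S0 t = - th t * a t + th' t * c t" for t
    unfolding S0_def Xn a_def c_def by (simp add: inner_prod_def algebra_simps)
   have pos: "0 <= (LBINT t. S j t) + th 0 * ball_avg (F0 n) (E n j) y" for j
   proof -
    have "E n j <= 1" using order_trans[OF E(2)[of n j], of 1] by simp
    from cone_inequality[OF L bor e w ineq h(2,3,4,5,6,1) E(1) this n]
    show ?thesis unfolding S_def F_def F0_def[abs_def] .
   qed
   have Fm: "F n \<in> borel_fun" using Fsq by (simp add: square_int_def)
   have vm: "(%t. (- th t, th' t)) \<in> borel_fun" by (intro borel_measurable_Pair) measurable
   have Sm: "S j \<in> borel_measurable lborel" for j
    unfolding S_def[abs_def] by (simp, intro borel_measurable_times borel_measurable_inner vm cone_avg_along_path_borel Fm decay_borel)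
   have S0m: "S0 \<in> borel_measurable lborel"
    unfolding S0_def[abs_def] by (simp, intro borel_measurable_times borel_measurable_inner vm measurable_compose[OF path_point_borel Fm] decay_borel)
   have "continuous_on {0..T} (%t. (- th t, th' t))"
    by (intro continuous_intros continuous_on_subset[OF thc] continuous_on_subset[OF h(3)]) auto
   then have "bounded ((%t. (- th t, th' t)) ` {0..T})" by (intro compact_imp_bounded compact_continuous_image) auto
   then obtain N where "!!y. y \<in> (%t. (- th t, th' t)) ` {0..T} ==> norm y <= N" unfolding bounded_iff by blast
   then have N: "norm (- th t, th' t) <= N" if "0 < t & t < T" for t using that by force
   have lim: "(%j. LBINT t. S j t) ----> (LBINT t. S0 t)"
   proof (rule integral_dominated_convergence[where w="%t. ind {0..T} t * (N * (2 * B))"])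
    show "integrable lborel (%t. ind {0..T} t * (N * (2 * B)))"
     by (intro integrable_mult_left integrable_real_indicator) (use T in auto)
    show "AE t in lborel. (%j. S j t) ----> S0 t"
     using c1[rule_format, of n]
    proof eventually_elim
     fix t assume l: "0 < t & t < T --> (%j. cone_avg L (F n) (E n j) (X t y, t)) ----> F n (X t y, t)"
     show "(%j. S j t) ----> S0 t"
     proof (cases "0 < t & t < T")
      case True
      then have "(%j. cone_avg L (F n) (E n j) (total_path y t, t)) ----> F n (total_path y t, t)"
       using l total_path_eq(1)[of t y] by simp
      then show ?thesis unfolding S_def S0_def by (intro tendsto_intros)
     next
      case False
      then have "e (total_path y t, t) = 0" "w (total_path y t, t) = 0" by (auto intro!: e(3) w(3) simp: QT_iff)
      then show ?thesis using Fz[OF False] by (simp add: S_def S0_def Xn zero_prod_def[symmetric])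
     qed
    qed
    fix j
    have "norm (S j t) <= ind {0..T} t * (N * (2 * B))" for t
    proof (cases "0 < t & t < T")
     case True
     have "norm ((- th t, th' t) \<bullet> cone_avg L (F n) (E n j) (total_path y t, t))
       <= norm (- th t, th' t) * norm (cone_avg L (F n) (E n j) (total_path y t, t))" using Cauchy_Schwarz_ineq2 by auto
     also have "\<dots> <= N * (2 * B)"
      by (intro mult_mono N[OF True] cone_avg_bound) (use cut_bound[OF e(1,2) w(1,2)] order_trans[OF norm_ge_zero N[OF True]] in \<open>auto simp: F_def\<close>)
     finally have "norm ((- th t, th' t) \<bullet> cone_avg L (F n) (E n j) (total_path y t, t)) * decay L t <= N * (2 * B) * 1"
      using decay_bounds[of L t] L(1) True B0 order_trans[OF norm_ge_zero N[OF True]] by (intro mult_mono) auto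
     then show ?thesis using True decay_bounds(1)[of L t] by (simp add: S_def abs_mult)
    next
     case False
     have "0 <= ind {0..T} t * (N * (2 * B))"
      using order_trans[OF norm_ge_zero N[of "T / 2"]] T B0 by simp
     then show ?thesis using Fz[OF False] by (simp add: S_def)
    qed
    then show "AE t in lborel. norm (S j t) <= ind {0..T} t * (N * (2 * B))" by (intro AE_I2)
   qed (use Sm S0m in auto)
   have "(%j. (LBINT t. S j t) + th 0 * ball_avg (F0 n) (E n j) y) ----> (LBINT t. S0 t) + th 0 * F0 n y"
    by (intro tendsto_intros lim c2[rule_format])
   then have "0 <= (LBINT t. S0 t) + th 0 * F0 n y" by (rule LIMSEQ_le_const) (use pos in auto)
   then show ?thesis unfolding yn S0_eq .
  qed
  note tc = transport_comparison[OF am cm ab cb H]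
  have dz: "decay L t ~= 0" for t using decay_bounds(1)[of L t] by simp
  show "(AE s in lborel. 0 < s --> w (total_path y s, s) = 0 --> (AE t in lborel. s < t & t < T --> e (total_path y t, t) = 0)) &
   (w0 y = 0 --> (AE t in lborel. 0 < t & t < T --> e (total_path y t, t) = 0))"
  proof
   show "AE s in lborel. 0 < s --> w (total_path y s, s) = 0 --> (AE t in lborel. s < t & t < T --> e (total_path y t, t) = 0)"
    using tc(1) unfolding a_def c_def by (simp add: dz)
   show "w0 y = 0 --> (AE t in lborel. 0 < t & t < T --> e (total_path y t, t) = 0)"
    using tc(2) unfolding a_def c_def by (simp add: dz)
  qed
 qed
qed

text \<open>Where the pressure is positive, the stiff limit gives \<open>V = 1\<close>, so the
  deficit is 0; conversely vanishing absorption inside the slab forces \<open>p > 0\<close>, because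
  \<open>EQ\<close> is positive there.\<close>

lemma positivity_propagates:
 fixes v :: "nat => (real^'n) \<times> real => real"
 assumes kap: "filterlim kap at_top sequentially" "!!j. kap j > 1"
  and sol: "!!j. regular_solution (kap j) (v0 j) (v j)"
  and V: "V \<in> borel_fun" "!!z. 0 <= V z" "!!z. V z <= 1" and p: "p \<in> borel_fun"
  and V0: "V0 \<in> borel_fun" "!!x. 0 <= V0 x" "!!x. V0 x <= 1" and p0: "p0 \<in> borel_fun"
  and lim: "AE z in lborel. z \<in> QT T --> (%j. v j z) ----> V z & (%j. kap j / (kap j - 1) * v j z powr (kap j - 1)) ----> p z"
  and lim0: "AE x in lborel. (%j. v0 j x) ----> V0 x & (%j. kap j / (kap j - 1) * v0 j x powr (kap j - 1)) ----> p0 x"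
 shows "AE y in lborel.
  (AE s in lborel. 0 < s & s < T --> p (X s y, s) > 0 --> (AE t in lborel. s < t & t < T --> p (X t y, t) > 0)) &
  (p0 y > 0 --> (AE t in lborel. 0 < t & t < T --> p (X t y, t) > 0))"
proof -
 obtain B where B: "B > 0" "!!z. mQ z <= B" "!!z. \<bar>fQ z\<bar> <= B" "!!z. norm (\<beta> z) <= B" "!!z. EQ z <= B"
  and cm [measurable]: "mQ \<in> borel_fun" "fQ \<in> borel_fun" "\<beta> \<in> borel_fun" "EQ \<in> borel_fun"
  and B0: "!!x. m (x, 0) <= B" by (rule coeffs) blast
 note [measurable] = V(1) p V0(1) p0
 define e where "e z = EQ z * ind {z. p z <= 0} z" for z
 define w where "w z = mQ z * (1 - V z)" for z
 define w0 where "w0 x = m (x, 0) * (1 - V0 x)" for x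
 have m0: "(%x. m (x, 0)) \<in> borel_fun" by (rule borel_measurable_continuous_onI[OF m_initial(2)])
 have bor: "e \<in> borel_fun" "w \<in> borel_fun" "w0 \<in> borel_fun"
  unfolding e_def[abs_def] w_def[abs_def] w0_def[abs_def] using m0 by measurable
 have vp: "v j z >= 0" "v0 j x >= 0" for j z x using sol[of j] unfolding regular_solution_def by blast+
 have e: "0 <= e z" "e z <= B" "z \<notin> QT T ==> e z = 0" for z
  using EQ_nonneg[of z] B(1) B(5)[of z] off_QT(4)[of z] by (auto simp: e_def indicator_def)
 have w: "0 <= w z" "w z <= B" "z \<notin> QT T ==> w z = 0" for z
 proof -
  show "0 <= w z" "z \<notin> QT T ==> w z = 0" using mQ_nonneg[of z] V(3)[of z] off_QT(1)[of z] by (auto simp: w_def)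
  have "mQ z * (1 - V z) <= B * 1" using B(1) B(2)[of z] V(2,3)[of z] by (intro mult_mono) auto
  then show "w z <= B" by (simp add: w_def)
 qed
 have m0p: "0 <= m (x, 0)" for x using m_initial(1)[of x] \<delta> by linarith
 have w0: "0 <= w0 x" "w0 x <= B" for x
 proof -
  show "0 <= w0 x" using m0p[of x] V0(3)[of x] by (simp add: w0_def)
  have "m (x, 0) * (1 - V0 x) <= B * 1" using B(1) B0[of x] V0(2,3)[of x] by (intro mult_mono) auto
  then show "w0 x <= B" by (simp add: w0_def)
 qed
 have ineq: "0 <= (LBINT z. (- e z + fQ z * w z) * \<phi> z + ((- w z) *. \<beta> z) \<bullet> D z) + (LBINT x. w0 x * \<phi> (x, 0))"
  if h: "C1_with \<phi> D" "!!z. \<phi> z >= 0" "compact (closure {z. \<phi> z ~= 0})" "closure {z. \<phi> z ~= 0} \<subseteq> UNIV \<times> {..<T}" for \<phi> D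
  unfolding e_def w_def w0_def by (rule deficit_inequality[OF kap sol V p V0 p0 lim lim0 h])
 have full: "AE z in lborel. z \<in> QT T --> (p z > 0 --> w z = 0)"
  using lim
 proof (eventually_elim, intro impI)
  fix z assume a: "z \<in> QT T --> (%j. v j z) ----> V z & (%j. kap j / (kap j - 1) * v j z powr (kap j - 1)) ----> p z" "z \<in> QT T" "p z > 0"
  then have "V z = 1" using stiff_pressure_limit(3)[OF kap, of "%j. v j z" "V z" "p z"] vp by blast
  then show "w z = 0" by (simp add: w_def)
 qed
 have full0: "AE x in lborel. p0 x > 0 --> w0 x = 0"
  using lim0
 proof (eventually_elim, intro impI)
  fix x assume a: "(%j. v0 j x) ----> V0 x & (%j. kap j / (kap j - 1) * v0 j x powr (kap j - 1)) ----> p0 x" "p0 x > 0"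
  then have "V0 x = 1" using stiff_pressure_limit(3)[OF kap, of "%j. v0 j x" "V0 x" "p0 x"] vp by blast
  then show "w0 x = 0" by (simp add: w0_def)
 qed
 have pe: "p (X t y, t) > 0" if "0 < t" "t < T" "e (total_path y t, t) = 0" for t y
  using that EQ_pos[of "(X t y, t)"] total_path_eq(1)[of t y]
  by (auto simp: e_def QT_iff indicator_def split: if_splits)
 have streams: "AE y in lborel.
  (AE s in lborel. 0 < s --> w (total_path y s, s) = 0 --> (AE t in lborel. s < t & t < T --> e (total_path y t, t) = 0)) &
  (w0 y = 0 --> (AE t in lborel. 0 < t & t < T --> e (total_path y t, t) = 0))"
  by (rule deficit_along_streamlines[OF bor e w w0 ineq])
 from streams flow_AE[OF full] full0 show ?thesis
 proof eventually_elim
  fix y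
  assume 1: "(AE s in lborel. 0 < s --> w (total_path y s, s) = 0 --> (AE t in lborel. s < t & t < T --> e (total_path y t, t) = 0)) &
    (w0 y = 0 --> (AE t in lborel. 0 < t & t < T --> e (total_path y t, t) = 0))"
   and 2: "AE t in lborel. 0 < t & t < T --> (p (X t y, t) > 0 --> w (X t y, t) = 0)"
   and 3: "p0 y > 0 --> w0 y = 0"
  show "(AE s in lborel. 0 < s & s < T --> p (X s y, s) > 0 --> (AE t in lborel. s < t & t < T --> p (X t y, t) > 0)) &
   (p0 y > 0 --> (AE t in lborel. 0 < t & t < T --> p (X t y, t) > 0))"
  proof
   from 1 have "AE s in lborel. 0 < s --> w (total_path y s, s) = 0 --> (AE t in lborel. s < t & t < T --> e (total_path y t, t) = 0)" ..
   with 2 show "AE s in lborel. 0 < s & s < T --> p (X s y, s) > 0 --> (AE t in lborel. s < t & t < T --> p (X t y, t) > 0)"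
   proof (eventually_elim, intro impI)
    fix s assume h: "0 < s & s < T --> (p (X s y, s) > 0 --> w (X s y, s) = 0)"
     "0 < s --> w (total_path y s, s) = 0 --> (AE t in lborel. s < t & t < T --> e (total_path y t, t) = 0)"
     "0 < s & s < T" "p (X s y, s) > 0"
    then have "AE t in lborel. s < t & t < T --> e (total_path y t, t) = 0" using total_path_eq(1)[of s y] by simp
    then show "AE t in lborel. s < t & t < T --> p (X t y, t) > 0"
     by eventually_elim (use pe h(3) in auto)
   qed
   show "p0 y > 0 --> (AE t in lborel. 0 < t & t < T --> p (X t y, t) > 0)"
   proof
    assume "p0 y > 0"
    then have "AE t in lborel. 0 < t & t < T --> e (total_path y t, t) = 0" using 1 3 by blast
    then show "AE t in lborel. 0 < t & t < T --> p (X t y, t) > 0" by eventually_elim (use pe in auto)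
   qed
  qed
 qed
qed

end

subsection \<open>Borel representatives\<close>

text \<open>Taken component by component from the real-valued case. The value 0 outside
  \<open>S\<close> prepares for integration over the whole space.\<close>

lemma borel_representative:
 fixes f :: "'a::euclidean_space => 'b::euclidean_space"
 assumes f: "f \<in> borel_measurable (lebesgue_on S)" and S: "S \<in> sets borel"
 obtains g where "g \<in> borel_fun" "AE z in lborel. z \<in> S --> g z = f z" "!!z. z \<notin> S ==> g z = 0"
proof -
 have Sl: "S \<in> sets lebesgue" using S by simp
 have fm: "(%z. if z \<in> S then f z else 0) \<in> borel_measurable lebesgue" by (rule borel_measurable_if_I[OF f Sl])
 have "\<exists>h. h \<in> borel_measurable lborel & (AE z in lborel. (if z \<in> S then f z else 0) \<bullet> i = h z)" for i
 proof -
  have "(%z. (if z \<in> S then f z else 0) \<bullet> i) \<in> borel_measurable lebesgue"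
   by (rule borel_measurable_inner[OF fm borel_measurable_const])
  from completion_ex_borel_measurable_real[OF this] show ?thesis by blast
 qed
 then have "\<exists>h. \<forall>i. h i \<in> borel_measurable lborel & (AE z in lborel. (if z \<in> S then f z else 0) \<bullet> i = h i z)"
  by (intro choice allI)
 then obtain h where h: "!!i. h i \<in> borel_measurable lborel" "!!i. AE z in lborel. (if z \<in> S then f z else 0) \<bullet> i = h i z" by blast
 define g where "g z = ind S z *. (\<Sum>i\<in>Basis. h i z *. i)" for z
 show thesis
 proof (rule that[of g])
  have "!!i. h i \<in> borel_fun" using h(1) by simp
  then show "g \<in> borel_fun" unfolding g_def[abs_def]
   by (intro borel_measurable_scaleR borel_measurable_indicator S borel_measurable_sum borel_measurable_const)
  have "AE z in lborel. \<forall>i\<in>Basis. (if z \<in> S then f z else 0) \<bullet> i = h i z"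
   by (rule AE_finite_allI) (use h(2) in auto)
  then show "AE z in lborel. z \<in> S --> g z = f z"
  proof (eventually_elim, intro impI)
   fix z assume a: "\<forall>i\<in>Basis. (if z \<in> S then f z else 0) \<bullet> i = h i z" and z: "z \<in> S"
   have "(\<Sum>i\<in>Basis. h i z *. i) = (\<Sum>i\<in>Basis. (f z \<bullet> i) *. i)" using a z by (intro sum.cong) auto
   then show "g z = f z" using z by (simp add: g_def euclidean_representation)
  qed
 qed (simp add: g_def)
qed

text \<open>Measurability of \<open>f\<close> on \<open>S\<close> is a consequence: it agrees almost
  everywhere with the Borel function \<open>g\<close>, and Lebesgue measure is complete.\<close>

lemma lebesgue_on_integral:
 fixes f g :: "'a::euclidean_space => 'b::euclidean_space"
 assumes S: "S \<in> sets borel" and g: "g \<in> borel_fun"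
  and ae: "AE z in lborel. z \<in> S --> f z = g z" and z: "!!z. z \<notin> S ==> g z = 0"
 shows "(LINT z|lebesgue_on S. f z) = (LBINT z. g z)"
  and "integrable (lebesgue_on S) f \<longleftrightarrow> integrable lborel g"
proof -
 define h where "h z = ind S z *. f z" for z
 have Sl: "S \<inter> space lebesgue \<in> sets lebesgue" using S by simp
 have gl: "g \<in> borel_measurable lborel" using g by simp
 have gm: "g \<in> borel_measurable lebesgue" by (rule measurable_completion[OF gl])
 have "AE z in lborel. h z = g z" using ae by eventually_elim (auto simp: h_def z indicator_def)
 then have hg: "AE z in lebesgue. h z = g z" by (rule AE_completion)
 have hm: "h \<in> borel_measurable lebesgue"
 proof (rule measurableI)
  fix A :: "'b set" assume A: "A \<in> sets borel"
  show "h -` A \<inter> space lebesgue \<in> sets lebesgue"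
  proof (rule completion.in_sets_AE)
   show "g -` A \<inter> space lebesgue \<in> sets lebesgue" by (rule measurable_sets[OF gm A])
   show "AE x in lebesgue. x \<in> g -` A \<inter> space lebesgue \<longleftrightarrow> x \<in> h -` A \<inter> space lebesgue"
    using hg by eventually_elim auto
  qed auto
 qed auto
 have "(LINT z|lebesgue_on S. f z) = integral\<^sup>L lebesgue h" unfolding h_def by (rule integral_restrict_space[OF Sl])
 also have "\<dots> = integral\<^sup>L lebesgue g" by (rule integral_cong_AE[OF hm gm hg])
 also have "\<dots> = integral\<^sup>L lborel g" by (rule integral_completion[OF gl])
 finally show "(LINT z|lebesgue_on S. f z) = (LBINT z. g z)" .
 have "integrable (lebesgue_on S) f \<longleftrightarrow> integrable lebesgue h" unfolding h_def by (rule integrable_restrict_space[OF Sl])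
 also have "\<dots> \<longleftrightarrow> integrable lebesgue g" by (rule integrable_cong_AE[OF hm gm hg])
 also have "\<dots> \<longleftrightarrow> integrable lborel g" by (rule integrable_completion[OF gl])
 finally show "integrable (lebesgue_on S) f \<longleftrightarrow> integrable lborel g" .
qed

lemma integrable_loc_int_bound:
 fixes g :: "'a::euclidean_space => real" and F :: "'a => 'b::euclidean_space"
 assumes "loc_int g" "F \<in> borel_fun" "!!z. norm (F z) <= C * norm (g z)" "!!z. norm z > R ==> F z = 0"
 shows "integrable lborel F"
proof (rule Bochner_Integration.integrable_bound)
 show "integrable lborel (%z. C * (ind (cball 0 R) z *. g z))"
  using assms(1) unfolding loc_int_def set_integrable_def by (intro integrable_mult_right) blast
 show "F \<in> borel_measurable lborel" using assms(2) by simp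
 have "norm (F z) <= norm (C * (ind (cball 0 R) z *. g z))" for z
 proof (cases "norm z > R")
  case False
  have "C * norm (g z) <= \<bar>C\<bar> * norm (g z)" by (intro mult_right_mono) auto
  then show ?thesis using assms(3)[of z] False by (simp add: abs_mult)
 qed (use assms(4) in simp)
 then show "AE z in lborel. norm (F z) <= norm (C * (ind (cball 0 R) z *. g z))" by (intro AE_I2)
qed

subsection \<open>Uniqueness of weak gradients\<close>

text \<open>Mollifications of a bounded function with the sign of \<open>h\<close> are admissible
  and orthogonal to \<open>h\<close>. In the limit the integral of a nonnegative product is 0, so
  the product vanishes almost everywhere.\<close>

lemma orthogonal_test_functions_AE_zero:
 fixes h :: "'a::euclidean_space => real"
 assumes C: "compact C" and r: "r > 0" and h: "integrable lborel h" "h \<in> borel_fun"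
  and test: "!!\<phi>. smooth_on UNIV \<phi> ==> {z. \<phi> z ~= 0} \<subseteq> (\<Union>x\<in>C. cball x r) ==> (LBINT z. \<phi> z * h z) = 0"
 shows "AE z in lborel. z \<in> C --> h z = 0"
proof -
 \<comment> \<open>Bounded by 1 even if \<open>h\<close> is not, supported in \<open>C\<close>, and
   with \<open>g h\<close> positive wherever \<open>h\<close> is nonzero on
   \<open>C\<close>.\<close>
 define g where "g z = ind C z * (h z / (1 + \<bar>h z\<bar>))" for z
 have Cb: "C \<in> sets borel" using C by (simp add: borel_compact)
 have gb: "g \<in> borel_fun" unfolding g_def[abs_def]
  by (intro borel_measurable_times borel_measurable_indicator Cb borel_measurable_divide borel_measurable_add
    borel_measurable_abs borel_measurable_const h(2))
 have g1: "\<bar>g z\<bar> <= 1" for z by (auto simp: g_def indicator_def abs_mult)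
 obtain R where R: "!!z. z \<in> C ==> norm z <= R" using compact_imp_bounded[OF C] unfolding bounded_iff by blast
 have gR: "g z = 0" if "norm z > R" for z using R[of z] that by (auto simp: g_def indicator_def)
 have gi: "integrable lborel g" by (rule integrable_bounded_support[OF gb, where B=1 and R=R]) (use g1 gR in auto)
 have gl: "loc_int g" by (rule loc_intI_integrable[OF gb gi])
 have gs: "square_int g" unfolding square_int_def
 proof (intro conjI gb)
  show "integrable lborel (%z. (norm (g z))\<^sup>2)"
  proof (rule integrable_bounded_support[where R=R and B=1])
   show "(%z. (norm (g z))\<^sup>2) \<in> borel_fun" using gb by measurable
   show "norm ((norm (g z))\<^sup>2) <= 1" for z using g1[of z] by (simp add: abs_square_le_1)
  qed (use gR in auto)
 qed
 \<comment> \<open>Mollification with radius at most \<open>r\<close> keeps the bound 1 and the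
   support within distance \<open>r\<close> of \<open>C\<close>; the uniform bound allows domination
   by the absolute value of \<open>h\<close>.\<close>
 have "\<exists>U. square_int (%z. U z - g z) & (LBINT z. (norm (U z - g z))\<^sup>2) <= 1 / real (Suc j) &
   (LBINT z. U z * h z) = 0 & (\<forall>z. \<bar>U z\<bar> <= 1)" for j
 proof -
  have e: "1 / real (Suc j) > 0" by simp
  obtain d where d: "d > 0" "!!\<tau>. near_id d \<tau> ==> (LBINT z. (norm (g (\<tau> z) - g z))\<^sup>2) <= 1 / real (Suc j)"
   using L2_continuity[OF gs e] by blast
  define \<rho> where "\<rho> = min d r"
  have \<rho>: "\<rho> > 0" "\<rho> <= d" "\<rho> <= r" using d(1) r by (auto simp: \<rho>_def)
  obtain k :: "'a => real" where k: "smooth_on UNIV k" "!!z. 0 <= k z" "!!z. norm (z - 0) >= \<rho> ==> k z = 0"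
   "integrable lborel k" "(LBINT z. k z) = 1" using exists_smooth_kernel[OF \<rho>(1), of 0] by blast
  have kb [measurable]: "k \<in> borel_fun" by (rule C1_with_borel(1)[OF smooth_imp_C1[OF k(1)]])
  have kv: "vanishes_beyond \<rho> k" using k(3) by (auto simp: vanishes_beyond_def)
  define U where "U = conv k g"
  have U: "U z = (LBINT y. k y *. g (z - y))" for z
   unfolding U_def by (subst conv_commute[OF kb gb]) (simp add: conv_def mult.commute)
  have \<tau>: "(%(y, z). z - y) \<in> borel_measurable (borel \<Otimes>\<^sub>M (borel :: 'a measure))" by measurable
  have near: "near_id d (%z. z - y)" if "k y ~= 0" for y
  proof (rule near_id_translate)
   show "norm y <= d" using k(3)[of y] that \<rho>(2) by fastforce
  qed
  have e0: "0 <= 1 / real (Suc j)" by simp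
  note M = L2_mollification[OF k(4,2,5) kb gs e0 \<tau> near d(2)]
  have 1: "square_int (%z. U z - g z)" "(LBINT z. (norm (U z - g z))\<^sup>2) <= 1 / real (Suc j)"
   unfolding U using M by blast+
  have Us: "smooth_on UNIV U" unfolding U_def by (rule conv_smooth[OF k(1) kv gl])
  have Uc: "{z. U z ~= 0} \<subseteq> (\<Union>x\<in>C. cball x r)"
  proof
   fix z assume "z \<in> {z. U z ~= 0}"
   then have nz: "U z ~= 0" by simp
   have "\<exists>y. k y * g (z - y) ~= 0"
   proof (rule ccontr)
    assume "\<not> ?thesis"
    then have "U z = (LBINT y::'a. 0)" unfolding U by (intro Bochner_Integration.integral_cong) auto
    then show False using nz by simp
   qed
   then obtain y where y: "k y ~= 0" "g (z - y) ~= 0" by auto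
   have "z - y \<in> C" using y(2) by (auto simp: g_def indicator_def split: if_splits)
   moreover have "norm y <= r" using k(3)[of y] y(1) \<rho>(3) by fastforce
   then have "z \<in> cball (z - y) r" by (simp add: dist_norm)
   ultimately show "z \<in> (\<Union>x\<in>C. cball x r)" by blast
  qed
  have U1: "\<bar>U z\<bar> <= 1" for z
  proof -
   have "norm (U z) <= (LBINT y. norm (k y *. g (z - y)))" unfolding U by (rule integral_norm_bound)
   also have "\<dots> <= (LBINT y. k y)"
    by (rule integral_mono'[OF k(4)]) (use k(2) g1 mult_left_mono[OF g1 k(2)] in \<open>auto simp: abs_mult\<close>)
   finally show ?thesis using k(5) by simp
  qed
  show ?thesis using 1 test[OF Us Uc] U1 by blast
 qed
 then have "\<exists>U. \<forall>j. square_int (%z. U j z - g z) & (LBINT z. (norm (U j z - g z))\<^sup>2) <= 1 / real (Suc j) &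
   (LBINT z. U j z * h z) = 0 & (\<forall>z. \<bar>U j z\<bar> <= 1)" by (intro choice allI)
 then obtain U :: "nat => 'a => real" where U: "!!j. square_int (%z. U j z - g z)" "!!j. (LBINT z. (norm (U j z - g z))\<^sup>2) <= 1 / real (Suc j)"
  "!!j. (LBINT z. U j z * h z) = 0" "!!j z. \<bar>U j z\<bar> <= 1" by blast
 have Um: "U j \<in> borel_fun" for j
 proof -
  have "(%z. U j z - g z) \<in> borel_fun" using U(1) by (simp add: square_int_def)
  from borel_measurable_add[OF this gb] show ?thesis by simp
 qed
 obtain s where s: "strict_mono s" "AE z in lborel. (%j. U (s j) z - g z) ----> 0"
  using L2_subsequence_AE[of "%j z. U j z - g z", OF U(1,2)] by blast
 have lim: "(%j. LBINT z. U (s j) z * h z) ----> (LBINT z. g z * h z)"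
 proof (rule integral_dominated_convergence[where w="%z. \<bar>h z\<bar>"])
  show "integrable lborel (%z. \<bar>h z\<bar>)" using h(1) by simp
  show "AE z in lborel. (%j. U (s j) z * h z) ----> g z * h z"
   using s(2) by eventually_elim (auto simp: LIM_zero_iff intro!: tendsto_intros)
  have "norm (U (s j) z * h z) <= \<bar>h z\<bar>" for j z
   using mult_right_mono[OF U(4)[of "s j" z] abs_ge_zero[of "h z"]] by (simp add: abs_mult)
  then show "AE z in lborel. norm (U (s j) z * h z) <= \<bar>h z\<bar>" for j by (intro AE_I2)
 qed (use Um gb h(2) in auto)
 then have gh0: "(LBINT z. g z * h z) = 0" unfolding U(3) by (simp add: LIMSEQ_const_iff)
 have ghi: "integrable lborel (%z. g z * h z)"
 proof (rule Bochner_Integration.integrable_bound[OF h(1)])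
  show "(%z. g z * h z) \<in> borel_measurable lborel" using gb h(2) by measurable
  have "norm (g z * h z) <= norm (h z)" for z
   using mult_right_mono[OF g1[of z] abs_ge_zero[of "h z"]] by (simp add: abs_mult)
  then show "AE z in lborel. norm (g z * h z) <= norm (h z)" by (intro AE_I2)
 qed
 have ghp: "0 <= g z * h z" for z
 proof -
  have "g z * h z = ind C z * (h z * h z / (1 + \<bar>h z\<bar>))" by (simp add: g_def)
  then show ?thesis by simp
 qed
 have "AE z in lborel. g z * h z = 0"
  using integral_nonneg_eq_0_iff_AE[OF ghi] ghp gh0 by simp
 then show ?thesis
 proof (eventually_elim, intro impI)
  fix z assume "g z * h z = 0" "z \<in> C"
  then have "h z / (1 + \<bar>h z\<bar>) * h z = 0" by (simp add: g_def)
  moreover have "1 + \<bar>h z\<bar> ~= 0" by linarith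
  ultimately show "h z = 0" by simp
 qed
qed

text \<open>Weak gradients are only locally integrable, so the comparison is made on compact
  subsets, component by component. Its use is to identify the arbitrary choice in
  \<open>weak_grad\<close> with a square-integrable gradient.\<close>

lemma weak_grad_AE_eq:
 assumes S: "open S" and G1: "has_weak_grad S u G1" and G2: "has_weak_grad S u G2"
 shows "AE z in lborel. z \<in> S --> G1 z = (G2 z :: 'a::euclidean_space)"
proof -
 have Sb: "S \<in> sets borel" using S by simp
 have loc: "AE z in lborel. z \<in> C --> G1 z = G2 z" if C: "compact C" "C \<subseteq> S" for C
 proof -
  obtain r where r: "r > 0" "(\<Union>x\<in>C. cball x r) \<subseteq> S"
   using compact_subset_open_imp_cball_epsilon_subset[OF C(1) S C(2)] by blast
  \<comment> \<open>A compact neighbourhood of \<open>C\<close> within \<open>S\<close>: it contains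
    the supports of the test functions, and both gradients are integrable on it.\<close>
  define K where "K = (\<Union>x\<in>C. cball x r)"
  have K: "compact K" unfolding K_def by (rule compact_minkowski_sum_cball[OF C(1)])
  have KS: "K \<subseteq> S" using r(2) by (simp add: K_def)
  have Kb: "K \<in> sets borel" using K by (simp add: borel_compact)
  have Ki: "integrable (lebesgue_on K) G1" "integrable (lebesgue_on K) G2"
   using G1 G2 K KS unfolding has_weak_grad_def locally_integrable_def by blast+
  obtain H1 where H1: "H1 \<in> borel_fun" "AE z in lborel. z \<in> K --> H1 z = G1 z" "!!z. z \<notin> K ==> H1 z = 0"
   using borel_representative[OF borel_measurable_integrable[OF Ki(1)] Kb] by blast
  obtain H2 where H2: "H2 \<in> borel_fun" "AE z in lborel. z \<in> K --> H2 z = G2 z" "!!z. z \<notin> K ==> H2 z = 0"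
   using borel_representative[OF borel_measurable_integrable[OF Ki(2)] Kb] by blast
  have e1: "AE z in lborel. z \<in> K --> G1 z = H1 z" using H1(2) by eventually_elim auto
  have e2: "AE z in lborel. z \<in> K --> G2 z = H2 z" using H2(2) by eventually_elim auto
  have Hi: "integrable lborel H1" "integrable lborel H2"
   using lebesgue_on_integral(2)[OF Kb H1(1) e1 H1(3)] lebesgue_on_integral(2)[OF Kb H2(1) e2 H2(3)] Ki by auto
  have eq: "(LBINT z. \<phi> z *. H1 z) = (LBINT z. \<phi> z *. H2 z) &
    integrable lborel (%z. \<phi> z *. H1 z) & integrable lborel (%z. \<phi> z *. H2 z)"
   if \<phi>: "smooth_on UNIV \<phi>" "{z. \<phi> z ~= 0} \<subseteq> K" for \<phi>
  proof -
   have cl: "closure {z. \<phi> z ~= 0} \<subseteq> K" by (rule closure_minimal[OF \<phi>(2) compact_imp_closed[OF K]])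
   have cp: "compact (closure {z. \<phi> z ~= 0})"
    using compact_Int_closed[OF K closed_closure[of "{z. \<phi> z ~= 0}"]] cl by (simp add: Int_absorb1)
   have tf: "test_function S \<phi>" unfolding test_function_def using \<phi>(1) cl cp KS by blast
   have \<phi>C: "C1_with \<phi> (grad \<phi>)" by (rule smooth_imp_C1[OF \<phi>(1)])
   have \<phi>b: "\<phi> \<in> borel_fun" by (rule C1_with_borel(1)[OF \<phi>C])
   have b1: "(%z. \<phi> z *. H1 z) \<in> borel_fun" "(%z. \<phi> z *. H2 z) \<in> borel_fun"
    by (intro borel_measurable_scaleR \<phi>b H1(1) H2(1))+
   have a1: "AE z in lborel. z \<in> S --> \<phi> z *. G1 z = \<phi> z *. H1 z" using e1 by eventually_elim (use \<phi>(2) in auto)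
   have a2: "AE z in lborel. z \<in> S --> \<phi> z *. G2 z = \<phi> z *. H2 z" using e2 by eventually_elim (use \<phi>(2) in auto)
   have z: "\<phi> z *. H1 z = 0" "\<phi> z *. H2 z = 0" if "z \<notin> S" for z using that KS H1(3)[of z] H2(3)[of z] by auto
   have i1: "(LINT z|lebesgue_on S. \<phi> z *. G1 z) = (LBINT z. \<phi> z *. H1 z)"
    by (rule lebesgue_on_integral(1)[OF Sb b1(1) a1]) (rule z(1))
   have i2: "(LINT z|lebesgue_on S. \<phi> z *. G2 z) = (LBINT z. \<phi> z *. H2 z)"
    by (rule lebesgue_on_integral(1)[OF Sb b1(2) a2]) (rule z(2))
   have "(LINT z|lebesgue_on S. \<phi> z *. G1 z) = (LINT z|lebesgue_on S. \<phi> z *. G2 z)"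
    using G1 G2 tf unfolding has_weak_grad_def by (metis neg_equal_iff_equal)
   then have 1: "(LBINT z. \<phi> z *. H1 z) = (LBINT z. \<phi> z *. H2 z)"
    unfolding i1 i2 .
   obtain R where R: "vanishes_beyond R \<phi>" using compact_support_vanishes[OF cp] by blast
   obtain N where N: "N > 0" "!!z. norm (\<phi> z) <= N" by (rule bounded_support_bound[OF C1_with_continuous[OF \<phi>C] R]) blast
   have i: "integrable lborel (%z. \<phi> z *. H z)" if "integrable lborel H" "(%z. \<phi> z *. H z) \<in> borel_fun" for H :: "'a => 'a"
   proof (rule Bochner_Integration.integrable_bound)
    show "integrable lborel (%z. N *. H z)" using that(1) by simp
    show "(%z. \<phi> z *. H z) \<in> borel_measurable lborel" using that(2) by simp
    show "AE z in lborel. norm (\<phi> z *. H z) <= norm (N *. H z)"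
     using N by (intro AE_I2) (auto intro!: mult_right_mono)
   qed
   show ?thesis using 1 i[OF Hi(1) b1(1)] i[OF Hi(2) b1(2)] by blast
  qed
  have "AE z in lborel. z \<in> C --> (H1 z - H2 z) \<bullet> i = 0" for i
  proof (rule orthogonal_test_functions_AE_zero[OF C(1) r(1)])
   show "integrable lborel (%z. (H1 z - H2 z) \<bullet> i)" using Hi by simp
   show "(%z. (H1 z - H2 z) \<bullet> i) \<in> borel_fun" using H1(1) H2(1) by measurable
   fix \<phi> :: "'a => real" assume \<phi>: "smooth_on UNIV \<phi>" "{z. \<phi> z ~= 0} \<subseteq> (\<Union>x\<in>C. cball x r)"
   note E = eq[OF \<phi>(1) \<phi>(2)[folded K_def]]
   have "(LBINT z. \<phi> z * ((H1 z - H2 z) \<bullet> i)) = (LBINT z. (\<phi> z *. H1 z - \<phi> z *. H2 z) \<bullet> i)"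
    by (intro Bochner_Integration.integral_cong) (auto simp: inner_diff_left algebra_simps)
   also have "\<dots> = (LBINT z. \<phi> z *. H1 z - \<phi> z *. H2 z) \<bullet> i"
    by (rule integral_inner_left) (use E in simp)
   also have "(LBINT z. \<phi> z *. H1 z - \<phi> z *. H2 z) = 0" using E by simp
   finally show "(LBINT z. \<phi> z * ((H1 z - H2 z) \<bullet> i)) = 0" by simp
  qed
  then have "AE z in lborel. \<forall>i\<in>Basis. z \<in> C --> (H1 z - H2 z) \<bullet> i = 0" by (intro AE_finite_allI) auto
  with e1 e2 show ?thesis
  proof (eventually_elim, intro impI)
   fix z assume a: "z \<in> K --> G1 z = H1 z" "z \<in> K --> G2 z = H2 z" "\<forall>i\<in>Basis. z \<in> C --> (H1 z - H2 z) \<bullet> i = 0" and z: "z \<in> C"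
   have "z \<in> K" using z r(1) unfolding K_def by (intro UN_I[of z]) auto
   moreover have "H1 z - H2 z = 0" using a(3) z euclidean_all_zero_iff[of "H1 z - H2 z"] by blast
   ultimately show "G1 z = G2 z" using a by simp
  qed
 qed
 \<comment> \<open>Countably many boxes exhaust \<open>S\<close>, which turns equality on compact
   sets into equality almost everywhere on \<open>S\<close>.\<close>
 obtain D where D: "countable D" "D \<subseteq> Pow S" "!!X. X \<in> D ==> \<exists>a b. X = cbox a b" "\<Union>D = S"
  using open_countable_Union_open_cbox[OF S] by metis
 have "AE z in lborel. \<forall>X\<in>D. z \<in> X --> G1 z = G2 z"
  unfolding AE_ball_countable[OF D(1)]
 proof
  fix X assume X: "X \<in> D"
  obtain a c where "X = cbox a c" using D(3)[OF X] by blast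
  then show "AE z in lborel. z \<in> X --> G1 z = G2 z" using loc[of X] X D(2) by auto
 qed
 then show ?thesis by eventually_elim (use D(4) in blast)
qed

section \<open>From weak solutions to regular representatives\<close>

context congested_data
begin

text \<open>Only null sets change: density, gradient and initial datum are replaced by Borel
  versions, after which every term of the weak formulation becomes an integral over the whole
  space.\<close>

lemma regular_representative:
 assumes k: "k > 1" and sol: "weak_solution T m f b k \<rho>0 \<rho>" and ini: "integrable lebesgue \<rho>0" "AE x in lebesgue. \<rho>0 x >= 0"
 obtains v v0 where "regular_solution k v0 v" "AE z in lborel. z \<in> QT T --> v z = \<rho> z / m z"
  "AE x in lborel. v0 x = \<rho>0 x / m (x, 0)"
proof -
 let ?vk = "%z. (\<rho> z / m z) powr k"
 let ?W = "weak_grad (QT T) ?vk"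
 have pos: "AE z in lebesgue_on (QT T). \<rho> z >= 0" and Lp: "Lp_on 2 (QT T) \<rho>" and W1: "W1_on 2 (QT T) ?vk"
  and eq: "!!\<phi>. test_function (UNIV \<times> {..<T}) \<phi> ==>
      (LINT z|lebesgue_on (QT T). - \<rho> z * deriv_t \<phi> z) =
      (LINT x|lebesgue. \<phi> (x, 0) * \<rho>0 x) +
      (LINT z|lebesgue_on (QT T).
        - m z * (grad_x \<phi> z \<bullet> fst (?W z)) - \<rho> z * (grad_x \<phi> z \<bullet> b z) + f z * \<phi> z * \<rho> z)"
  using sol unfolding weak_solution_def Let_def by blast+
 have QTb: "QT T \<in> sets borel" by (rule QT_borel)
 have QTl: "QT T \<inter> space lebesgue \<in> sets lebesgue" using QTb by simp
 have pos': "AE z in lborel. z \<in> QT T --> \<rho> z >= 0"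
  using pos unfolding AE_restrict_space_iff[OF QTl] AE_completion_iff .
 obtain B where B: "B > 0" "!!z. mQ z <= B" "!!z. \<bar>fQ z\<bar> <= B" "!!z. norm (\<beta> z) <= B" "!!z. EQ z <= B"
  and cm [measurable]: "mQ \<in> borel_fun" "fQ \<in> borel_fun" "\<beta> \<in> borel_fun" "EQ \<in> borel_fun"
  and B0: "!!x. m (x, 0) <= B" by (rule coeffs) blast
 obtain r where r: "r \<in> borel_fun" "AE z in lborel. z \<in> QT T --> r z = \<rho> z" "!!z. z \<notin> QT T ==> r z = 0"
  using borel_representative[of \<rho> "QT T"] Lp QTb unfolding Lp_on_def by blast
 \<comment> \<open>Clamping makes \<open>v\<close> nonnegative everywhere and agrees with the
   quotient almost everywhere in the slab. Outside it numerator and denominator are 0, and division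
   by 0 yields 0.\<close>
 define v where "v z = max 0 (r z / mQ z)" for z
 define u where "u z = v z powr k" for z
 have vb: "v \<in> borel_fun" unfolding v_def[abs_def]
  by (intro borel_measurable_max borel_measurable_const borel_measurable_divide r(1) cm)
 have ub: "u \<in> borel_fun" unfolding u_def[abs_def] using vb by measurable
 have v0: "v z >= 0" for z by (simp add: v_def)
 have voff: "v z = 0" "u z = 0" if "z \<notin> QT T" for z using r(3)[OF that] by (auto simp: v_def u_def)
 have mQm: "mQ z = m z" "mQ z > 0" if "z \<in> QT T" for z using that mQ_pos[OF that] \<delta> by (auto simp: mQ_def)
 have vae: "AE z in lborel. z \<in> QT T --> v z = \<rho> z / m z & r z = \<rho> z"
  using r(2) pos'
 proof (eventually_elim, intro impI)
  fix z assume a: "z \<in> QT T --> r z = \<rho> z" "z \<in> QT T --> 0 <= \<rho> z" "z \<in> QT T"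
  have "0 <= \<rho> z / mQ z" using a mQm[of z] by simp
  then show "v z = \<rho> z / m z & r z = \<rho> z" using a mQm[of z] by (simp add: v_def)
 qed
 have sq: "square_int g" if g: "g \<in> borel_fun" "AE z in lborel. z \<in> QT T --> g z = h z" "!!z. z \<notin> QT T ==> g z = 0"
  and h: "Lp_on 2 (QT T) h" for g h :: "(real^'n) \<times> real => 'c::euclidean_space"
  unfolding square_int_def
 proof (intro conjI g(1))
  have b: "(%z. (norm (g z))\<^sup>2) \<in> borel_fun" using g(1) by measurable
  have a: "AE z in lborel. z \<in> QT T --> norm (h z) powr 2 = (norm (g z))\<^sup>2"
   using g(2) by eventually_elim (auto simp: powr_numeral)
  have o: "(norm (g z))\<^sup>2 = 0" if "z \<notin> QT T" for z using g(3)[OF that] by simp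
  show "integrable lborel (%z. (norm (g z))\<^sup>2)"
   using lebesgue_on_integral(2)[OF QTb b a o] h unfolding Lp_on_def by blast
 qed
 have rsq: "square_int r" by (rule sq[OF r Lp])
 have vsq: "square_int v"
 proof (rule square_int_bound[OF square_int_scale[OF rsq, of "1 / \<delta>"] vb])
  fix z show "norm (v z) <= norm ((1 / \<delta>) *. r z)"
  proof (cases "z \<in> QT T")
   case True
   have "\<bar>r z / mQ z\<bar> = \<bar>r z\<bar> / mQ z" using mQm[OF True] by simp
   also have "\<dots> <= \<bar>r z\<bar> / \<delta>" using mQ_pos[OF True] \<delta> by (intro divide_left_mono) auto
   finally have "r z / mQ z <= \<bar>r z\<bar> / \<delta>" using abs_ge_self[of "r z / mQ z"] by linarith
   moreover have "0 <= \<bar>r z\<bar> / \<delta>" using \<delta> by simp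
   ultimately have "v z <= \<bar>r z\<bar> / \<delta>" unfolding v_def by (intro max.boundedI)
   then show ?thesis using v0[of z] \<delta> by simp
  qed (use voff in simp)
 qed
 have uae: "AE z in lborel. z \<in> QT T --> u z = ?vk z" using vae by eventually_elim (auto simp: u_def)
 have usq: "square_int u" by (rule sq[OF ub uae voff(2)]) (use W1 in \<open>auto simp: W1_on_def\<close>)
 obtain G' where G': "has_weak_grad (QT T) ?vk G'" "Lp_on 2 (QT T) G'" using W1 unfolding W1_on_def by blast
 \<comment> \<open>The choice made by \<open>weak_grad\<close> is a weak gradient but need not be
   the square-integrable one; the two are identified almost everywhere in \<open>GW\<close>.\<close>
 have W: "has_weak_grad (QT T) ?vk ?W" unfolding weak_grad_def by (rule someI[of "has_weak_grad (QT T) ?vk", OF G'(1)])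
 obtain G where G: "G \<in> borel_fun" "AE z in lborel. z \<in> QT T --> G z = G' z" "!!z. z \<notin> QT T ==> G z = 0"
  using borel_representative[of G' "QT T"] G'(2) QTb unfolding Lp_on_def by blast
 have Gsq: "square_int G" by (rule sq[OF G G'(2)])
 have GW: "AE z in lborel. z \<in> QT T --> ?W z = G z"
  using weak_grad_AE_eq[OF open_QT W G'(1)] G(2) by eventually_elim auto
 have ini': "integrable (lebesgue_on UNIV) \<rho>0" using ini(1) by (simp add: lebesgue_on_UNIV_eq)
 obtain r0 where r0: "r0 \<in> borel_fun" "AE x in lborel. x \<in> UNIV --> r0 x = \<rho>0 x"
  using borel_representative[OF borel_measurable_integrable[OF ini'], of thesis] by simp
 define w0 where "w0 x = max 0 (r0 x / m (x, 0))" for x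
 have m0: "m (x, 0) > 0" for x using m_initial(1)[of x] \<delta> by linarith
 have m0b: "(%x. m (x, 0)) \<in> borel_fun" by (rule borel_measurable_continuous_onI[OF m_initial(2)])
 have w0b: "w0 \<in> borel_fun" unfolding w0_def[abs_def]
  by (intro borel_measurable_max borel_measurable_const borel_measurable_divide r0(1) m0b)
 have pos0: "AE x in lborel. \<rho>0 x >= 0" using ini(2) unfolding AE_completion_iff .
 have w0ae: "AE x in lborel. w0 x = \<rho>0 x / m (x, 0)"
  using r0(2) pos0
 proof eventually_elim
  fix x assume a: "x \<in> UNIV --> r0 x = \<rho>0 x" "0 <= \<rho>0 x"
  have "0 <= \<rho>0 x / m (x, 0)" using a m0[of x] by simp
  then show "w0 x = \<rho>0 x / m (x, 0)" using a by (simp add: w0_def)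
 qed
 have r0i: "integrable lborel r0"
 proof -
  have "AE x in lborel. x \<in> UNIV --> \<rho>0 x = r0 x" using r0(2) by eventually_elim auto
  from lebesgue_on_integral(2)[OF _ r0(1) this] ini' show ?thesis by simp
 qed
 have w0l: "loc_int w0"
 proof (rule loc_intI_integrable[OF w0b], rule Bochner_Integration.integrable_bound)
  show "integrable lborel (%x. r0 x / \<delta>)" using r0i by simp
  have "norm (w0 x) <= norm (r0 x / \<delta>)" for x
  proof -
   have "\<bar>r0 x / m (x, 0)\<bar> = \<bar>r0 x\<bar> / m (x, 0)" using m0[of x] by simp
   also have "\<dots> <= \<bar>r0 x\<bar> / \<delta>" using m_initial(1)[of x] m0[of x] \<delta> by (intro divide_left_mono) auto
   finally have "r0 x / m (x, 0) <= \<bar>r0 x\<bar> / \<delta>" using abs_ge_self[of "r0 x / m (x, 0)"] by linarith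
   moreover have "0 <= \<bar>r0 x\<bar> / \<delta>" using \<delta> by simp
   ultimately have "w0 x <= \<bar>r0 x\<bar> / \<delta>" unfolding w0_def by (intro max.boundedI)
   moreover have "0 <= w0 x" by (simp add: w0_def)
   ultimately show ?thesis using \<delta> by simp
  qed
  then show "AE x in lborel. norm (w0 x) <= norm (r0 x / \<delta>)" by (intro AE_I2)
 qed (use w0b in simp)
 have id1: "(LBINT z. v z powr k *. grad \<phi> z) = - (LBINT z. \<phi> z *. G z)" if t: "test_function (QT T) \<phi>" for \<phi>
 proof -
  have \<phi>C: "C1_with \<phi> (grad \<phi>)" using t smooth_imp_C1 unfolding test_function_def by blast
  note \<phi>b = C1_with_borel[OF \<phi>C]
  have 1: "(LINT z|lebesgue_on (QT T). ?vk z *. grad \<phi> z) = (LBINT z. u z *. grad \<phi> z)"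
  proof (rule lebesgue_on_integral(1)[OF QTb])
   show "(%z. u z *. grad \<phi> z) \<in> borel_fun" by (intro borel_measurable_scaleR ub \<phi>b)
   show "AE z in lborel. z \<in> QT T --> ?vk z *. grad \<phi> z = u z *. grad \<phi> z" using uae by eventually_elim auto
  qed (use voff in simp)
  have 2: "(LINT z|lebesgue_on (QT T). \<phi> z *. G' z) = (LBINT z. \<phi> z *. G z)"
  proof (rule lebesgue_on_integral(1)[OF QTb])
   show "(%z. \<phi> z *. G z) \<in> borel_fun" by (intro borel_measurable_scaleR G(1) \<phi>b)
   show "AE z in lborel. z \<in> QT T --> \<phi> z *. G' z = \<phi> z *. G z" using G(2) by eventually_elim auto
  qed (use G(3) in simp)
  have "(LINT z|lebesgue_on (QT T). ?vk z *. grad \<phi> z) = - (LINT z|lebesgue_on (QT T). \<phi> z *. G' z)"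
   using G'(1) t unfolding has_weak_grad_def by blast
  then show ?thesis unfolding 1 2 u_def .
 qed
 have id2: "(LBINT z. mQ z * v z * (grad \<phi> z \<bullet> \<beta> z) - fQ z * mQ z * v z * \<phi> z + mQ z * (fst (grad \<phi> z) \<bullet> fst (G z)))
    = (LBINT x. \<phi> (x, 0) * (m (x, 0) * w0 x))" if t: "test_function (UNIV \<times> {..<T}) \<phi>" for \<phi>
 proof -
  have \<phi>C: "C1_with \<phi> (grad \<phi>)" and cp: "compact (closure {z. \<phi> z ~= 0})"
   using t smooth_imp_C1 unfolding test_function_def by blast+
  note \<phi>b = C1_with_borel[OF \<phi>C]
  have gc: "continuous_on UNIV (grad \<phi>)" using \<phi>C by (simp add: C1_with_def)
  obtain R where R: "vanishes_beyond R \<phi>" using compact_support_vanishes[OF cp] by blast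
  have gR: "vanishes_beyond R (grad \<phi>)" by (rule C1_with_support[OF \<phi>C R])
  obtain N1 where N1: "N1 > 0" "!!z. norm (\<phi> z) <= N1" by (rule bounded_support_bound[OF C1_with_continuous[OF \<phi>C] R]) blast
  obtain N2 where N2: "N2 > 0" "!!z. norm (grad \<phi> z) <= N2" by (rule bounded_support_bound[OF gc gR]) blast
  have fst_b: "(%z. fst (h z)) \<in> borel_fun" "(%z. snd (h z)) \<in> borel_fun"
   if "h \<in> borel_fun" for h :: "(real^'n) \<times> real => (real^'n) \<times> real"
   using that by (intro measurable_compose[OF that] borel_measurable_continuous_onI continuous_intros)+
  \<comment> \<open>\<open>J1\<close> is the time part and \<open>J2\<close> the space part of the
    weak formulation; almost everywhere \<open>J1 - J2\<close> is the integrand wanted for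
    \<open>v\<close>.\<close>
  define J1 where "J1 z = - r z * snd (grad \<phi> z)" for z
  define J2 where "J2 z = - mQ z * (fst (grad \<phi> z) \<bullet> fst (G z)) - r z * (fst (grad \<phi> z) \<bullet> fst (\<beta> z)) + fQ z * \<phi> z * r z" for z
  have J1b: "J1 \<in> borel_fun" unfolding J1_def[abs_def]
   by (intro borel_measurable_times borel_measurable_uminus r(1) fst_b \<phi>b)
  have J2b: "J2 \<in> borel_fun" unfolding J2_def[abs_def]
   by (intro borel_measurable_times borel_measurable_uminus borel_measurable_diff borel_measurable_add borel_measurable_inner r(1) fst_b \<phi>b cm G(1))
  define M where "M z = norm (G z) + norm (r z)" for z
  have Ml: "loc_int M" unfolding M_def[abs_def]
   by (intro square_int_loc_int square_int_add square_int_norm Gsq rsq)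
  have M0: "norm (G z) <= norm (M z)" "norm (r z) <= norm (M z)" "\<bar>r z\<bar> <= \<bar>M z\<bar>" "norm (G z) <= \<bar>M z\<bar>" for z
   by (simp_all add: M_def)
  have J1i: "integrable lborel J1"
  proof (rule integrable_loc_int_bound[OF Ml J1b])
   fix z
   have "norm (J1 z) <= norm (r z) * norm (grad \<phi> z)"
    using norm_snd_le[of "snd (grad \<phi> z)" "fst (grad \<phi> z)"] by (auto simp: J1_def abs_mult intro!: mult_left_mono)
   also have "\<dots> <= norm (M z) * N2" using N2 by (intro mult_mono) (use M0[of z] in auto)
   finally show "norm (J1 z) <= N2 * norm (M z)" by (simp add: mult.commute)
   show "norm z > R ==> J1 z = 0" using vanishes_beyondD[OF gR] by (simp add: J1_def)
  qed
  have J2i: "integrable lborel J2"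
  proof (rule integrable_loc_int_bound[OF Ml J2b])
   fix z
   have g: "norm (fst (grad \<phi> z)) <= N2" using norm_fst_le[of "fst (grad \<phi> z)" "snd (grad \<phi> z)"] N2(2)[of z] by simp
   have a: "\<bar>fst (grad \<phi> z) \<bullet> fst h\<bar> <= N2 * norm h" for h :: "(real^'n) \<times> real"
   proof -
    have "\<bar>fst (grad \<phi> z) \<bullet> fst h\<bar> <= norm (fst (grad \<phi> z)) * norm (fst h)" by (rule Cauchy_Schwarz_ineq2)
    also have "\<dots> <= N2 * norm h" using g norm_fst_le[of "fst h" "snd h"] N2(1) by (intro mult_mono) auto
    finally show ?thesis .
   qed
   have "\<bar>mQ z * (fst (grad \<phi> z) \<bullet> fst (G z))\<bar> <= B * (N2 * norm (G z))"
    unfolding abs_mult using a[of "G z"] B(1) B(2)[of z] mQ_nonneg[of z] by (intro mult_mono) auto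
   also have "\<dots> <= B * (N2 * norm (M z))" using B(1) N2(1) by (intro mult_left_mono) (use M0[of z] in auto)
   finally have 1: "\<bar>mQ z * (fst (grad \<phi> z) \<bullet> fst (G z))\<bar> <= B * N2 * norm (M z)" by simp
   have "\<bar>r z * (fst (grad \<phi> z) \<bullet> fst (\<beta> z))\<bar> <= norm (M z) * (N2 * norm (\<beta> z))"
    unfolding abs_mult using a[of "\<beta> z"] by (intro mult_mono) (use M0[of z] in auto)
   also have "\<dots> <= norm (M z) * (N2 * B)" using B(4)[of z] N2(1) by (intro mult_left_mono) auto
   finally have 2: "\<bar>r z * (fst (grad \<phi> z) \<bullet> fst (\<beta> z))\<bar> <= B * N2 * norm (M z)" by (simp add: mult_ac)
   have 3: "\<bar>fQ z * \<phi> z * r z\<bar> <= B * N1 * norm (M z)"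
    unfolding abs_mult using B(1) B(3)[of z] N1(1) N1(2)[of z] by (intro mult_mono) (use M0[of z] in auto)
   have t: "\<bar>- x - y + w\<bar> <= \<bar>x\<bar> + \<bar>y\<bar> + \<bar>w\<bar>" for x y w :: real by linarith
   have J2e: "J2 z = - (mQ z * (fst (grad \<phi> z) \<bullet> fst (G z))) - (r z * (fst (grad \<phi> z) \<bullet> fst (\<beta> z))) + fQ z * \<phi> z * r z"
    by (simp add: J2_def)
   have "norm (J2 z) <= \<bar>mQ z * (fst (grad \<phi> z) \<bullet> fst (G z))\<bar> + \<bar>r z * (fst (grad \<phi> z) \<bullet> fst (\<beta> z))\<bar> + \<bar>fQ z * \<phi> z * r z\<bar>"
    unfolding J2e real_norm_def by (rule t)
   also have "\<dots> <= B * N2 * norm (M z) + B * N2 * norm (M z) + B * N1 * norm (M z)" by (intro add_mono 1 2 3)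
   finally show "norm (J2 z) <= (B * N2 + B * N2 + B * N1) * norm (M z)" by (simp only: distrib_right)
   show "norm z > R ==> J2 z = 0" using vanishes_beyondD[OF gR] vanishes_beyondD[OF R] by (simp add: J2_def)
  qed
  have l1: "(LINT z|lebesgue_on (QT T). - \<rho> z * deriv_t \<phi> z) = (LBINT z. J1 z)"
  proof (rule lebesgue_on_integral(1)[OF QTb J1b])
   show "AE z in lborel. z \<in> QT T --> - \<rho> z * deriv_t \<phi> z = J1 z"
    using r(2) by eventually_elim (auto simp: J1_def deriv_t_def)
  qed (use r(3) in \<open>simp add: J1_def\<close>)
  have l2: "(LINT z|lebesgue_on (QT T). - m z * (grad_x \<phi> z \<bullet> fst (?W z)) - \<rho> z * (grad_x \<phi> z \<bullet> b z) + f z * \<phi> z * \<rho> z) = (LBINT z. J2 z)"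
  proof (rule lebesgue_on_integral(1)[OF QTb J2b])
   show "AE z in lborel. z \<in> QT T --> - m z * (grad_x \<phi> z \<bullet> fst (?W z)) - \<rho> z * (grad_x \<phi> z \<bullet> b z) + f z * \<phi> z * \<rho> z = J2 z"
    using r(2) GW by eventually_elim (auto simp: J2_def grad_x_def mQ_def fQ_def \<beta>_def)
  qed (use r(3) off_QT(1) in \<open>simp add: J2_def\<close>)
  have "(LINT x|lebesgue_on UNIV. \<phi> (x, 0) * \<rho>0 x) = (LBINT x. \<phi> (x, 0) * (m (x, 0) * w0 x))"
  proof (rule lebesgue_on_integral(1))
   have "continuous_on UNIV (%x. \<phi> (x, 0))"
    by (rule continuous_on_compose2[OF C1_with_continuous[OF \<phi>C, of UNIV]]) (auto intro!: continuous_intros)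
   then show "(%x. \<phi> (x, 0) * (m (x, 0) * w0 x)) \<in> borel_fun"
    by (intro borel_measurable_times borel_measurable_continuous_onI m0b w0b)
   show "AE x in lborel. x \<in> UNIV --> \<phi> (x, 0) * \<rho>0 x = \<phi> (x, 0) * (m (x, 0) * w0 x)"
    using w0ae
   proof (eventually_elim, intro impI)
    fix x assume "w0 x = \<rho>0 x / m (x, 0)"
    then have "m (x, 0) * w0 x = \<rho>0 x" using m0[of x] by simp
    then show "\<phi> (x, 0) * \<rho>0 x = \<phi> (x, 0) * (m (x, 0) * w0 x)" by simp
   qed
  qed auto
  then have l3: "(LINT x|lebesgue. \<phi> (x, 0) * \<rho>0 x) = (LBINT x. \<phi> (x, 0) * (m (x, 0) * w0 x))"
   unfolding lebesgue_on_UNIV_eq .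
  have "(LBINT z. mQ z * v z * (grad \<phi> z \<bullet> \<beta> z) - fQ z * mQ z * v z * \<phi> z + mQ z * (fst (grad \<phi> z) \<bullet> fst (G z)))
    = (LBINT z. J1 z - J2 z)"
  proof (rule integral_cong_AE)
   have [measurable]: "v \<in> borel_fun" "\<phi> \<in> borel_fun" by (rule vb, rule \<phi>b)
   show "(%z. mQ z * v z * (grad \<phi> z \<bullet> \<beta> z) - fQ z * mQ z * v z * \<phi> z + mQ z * (fst (grad \<phi> z) \<bullet> fst (G z))) \<in> borel_measurable lborel"
    by (simp, intro borel_measurable_times borel_measurable_diff borel_measurable_add borel_measurable_inner vb fst_b \<phi>b cm G(1))
   show "(%z. J1 z - J2 z) \<in> borel_measurable lborel" using J1b J2b by simp
   show "AE z in lborel. mQ z * v z * (grad \<phi> z \<bullet> \<beta> z) - fQ z * mQ z * v z * \<phi> z + mQ z * (fst (grad \<phi> z) \<bullet> fst (G z)) = J1 z - J2 z"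
    using vae
   proof eventually_elim
    fix z assume a: "z \<in> QT T --> v z = \<rho> z / m z & r z = \<rho> z"
    show "mQ z * v z * (grad \<phi> z \<bullet> \<beta> z) - fQ z * mQ z * v z * \<phi> z + mQ z * (fst (grad \<phi> z) \<bullet> fst (G z)) = J1 z - J2 z"
    proof (cases "z \<in> QT T")
     case True
     have mv: "mQ z * v z = r z" using a True mQm[OF True] by simp
     have gb: "grad \<phi> z \<bullet> \<beta> z = fst (grad \<phi> z) \<bullet> fst (\<beta> z) - snd (grad \<phi> z)" using True by (simp add: inner_prod_def \<beta>_def)
     have "(mQ z * v z) * (grad \<phi> z \<bullet> \<beta> z) - fQ z * (mQ z * v z) * \<phi> z + mQ z * (fst (grad \<phi> z) \<bullet> fst (G z)) = J1 z - J2 z"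
      unfolding mv gb J1_def J2_def by (simp add: algebra_simps)
     then show ?thesis by (simp only: mult.assoc)
    next
     case False
     then show ?thesis using off_QT(1)[OF False] r(3)[OF False] by (simp add: J1_def J2_def)
    qed
   qed
  qed
  also have "\<dots> = (LBINT z. J1 z) - (LBINT z. J2 z)" using J1i J2i by simp
  also have "\<dots> = (LBINT x. \<phi> (x, 0) * (m (x, 0) * w0 x))" using eq[OF t] unfolding l1 l2 l3 by simp
  finally show ?thesis .
 qed
 have w00: "w0 x >= 0" for x by (simp add: w0_def)
 have "regular_solution k w0 v"
  unfolding regular_solution_def
  by (intro conjI allI exI[of _ G] vsq v0 usq[unfolded u_def] w0l w00 Gsq impI id1 id2)
 moreover have "AE z in lborel. z \<in> QT T --> v z = \<rho> z / m z" using vae by eventually_elim auto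
 ultimately show thesis using w0ae by (rule that)
qed

end

subsection \<open>Monotonicity along streamlines\<close>

text \<open>Integrability is known for large \<open>k\<close> only, whence the shift by
  \<open>N\<close> before the subsequence is extracted.\<close>

lemma L1_limit_AE_subsequence:
 fixes u :: "real => 'a::euclidean_space => real"
 assumes u: "L1_limit S u l" and kap: "filterlim kap at_top sequentially"
 obtains r :: "nat => nat" where "strict_mono r" "AE z in lebesgue_on S. (%j. u (kap (r j)) z) ----> l z"
proof -
 have li: "integrable (lebesgue_on S) l" and ev: "\<forall>\<^sub>F k in at_top. integrable (lebesgue_on S) (u k)"
  and lim: "((%k. LINT z|lebesgue_on S. \<bar>u k z - l z\<bar>) \<longlongrightarrow> 0) at_top"
  using u by (auto simp: L1_limit_def)
 have "\<forall>\<^sub>F j in sequentially. integrable (lebesgue_on S) (u (kap j))" by (rule eventually_compose_filterlim[OF ev kap])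
 then obtain N where N: "!!j. j >= N ==> integrable (lebesgue_on S) (u (kap j))" unfolding eventually_sequentially by blast
 define w where "w j z = u (kap (j + N)) z - l z" for j z
 have wi: "integrable (lebesgue_on S) (w j)" for j
  unfolding w_def[abs_def] by (intro Bochner_Integration.integrable_diff N li) simp
 have "(%j. LINT z|lebesgue_on S. \<bar>u (kap j) z - l z\<bar>) ----> 0" by (rule filterlim_compose[OF lim kap])
 from LIMSEQ_ignore_initial_segment[OF this, of N]
 have "(%j. LINT z|lebesgue_on S. norm (w j z)) ----> 0" by (simp add: w_def)
 then obtain s where s: "strict_mono s" "AE z in lebesgue_on S. (%j. w (s j) z) ----> 0"
  using tendsto_L1_AE_subseq[of "lebesgue_on S" w] wi by auto
 show thesis
 proof (rule that[of "%j. s j + N"])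
  show "strict_mono (%j. s j + N)" using s(1) by (simp add: strict_mono_def)
  show "AE z in lebesgue_on S. (%j. u (kap (s j + N)) z) ----> l z"
   using s(2) by eventually_elim (simp add: w_def LIM_zero_iff)
 qed
qed

lemma AE_lebesgue_on_iff:
 assumes "S \<in> sets (borel :: 'a::euclidean_space measure)"
 shows "(AE z in lebesgue_on S. P z) \<longleftrightarrow> (AE z in lborel. z \<in> S --> P z)"
proof -
 have S: "S \<inter> space lebesgue \<in> sets lebesgue" using assms by simp
 show ?thesis unfolding AE_restrict_space_iff[OF S] AE_completion_iff ..
qed

text \<open>Passing from an iterated statement to almost every pair needs a measurable predicate.
  \<open>P\<close> coincides almost everywhere with membership in the Borel set \<open>Q\<close>, so
  the pairs are tested on \<open>Q\<close>; the case \<open>s = t\<close> is trivial.\<close>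

lemma AE_pair_of_iterated:
 fixes P :: "real => bool"
 assumes Q: "Q \<in> sets borel" and PQ: "AE s in lborel. 0 < s & s < T --> (P s \<longleftrightarrow> s \<in> Q)"
  and it: "AE s in lborel. 0 < s & s < T --> P s --> (AE t in lborel. s < t & t < T --> P t)"
 shows "AE (s, t) in lebesgue. 0 < s & s <= t & t < T --> P s --> P t"
proof -
 obtain N where N: "{s \<in> space lborel. \<not> (0 < s & s < T --> (P s \<longleftrightarrow> s \<in> Q))} \<subseteq> N" "emeasure lborel N = 0" "N \<in> sets lborel"
  using PQ by (rule AE_E)
 have N': "(P s \<longleftrightarrow> s \<in> Q)" if "s \<notin> N" "0 < s" "s < T" for s using N(1) that by auto
 have notN: "AE s in lborel. s \<notin> N" using N(2,3) by (intro AE_not_in) auto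
 \<comment> \<open>A Borel predicate that implies the desired one: outside the null set
   \<open>N\<close> membership in \<open>Q\<close> may be exchanged for \<open>P\<close> in both
   coordinates.\<close>
 define Z where "Z z \<longleftrightarrow> fst z \<notin> N & snd z \<notin> N & (0 < fst z & fst z \<in> Q & fst z < snd z & snd z < T --> snd z \<in> Q)"
  for z :: "real \<times> real"
 have "AE s in lborel. AE t in lborel. Z (s, t)"
  using it notN
 proof eventually_elim
  fix s assume a: "0 < s & s < T --> P s --> (AE t in lborel. s < t & t < T --> P t)" and s: "s \<notin> N"
  show "AE t in lborel. Z (s, t)"
  proof (cases "0 < s & s < T & s \<in> Q")
   case True
   then have "AE t in lborel. s < t & t < T --> P t" using a N'[OF s] by blast
   with notN show ?thesis by eventually_elim (use s True N' in \<open>auto simp: Z_def\<close>)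
  next
   case False
   from notN show ?thesis by eventually_elim (use s False in \<open>auto simp: Z_def\<close>)
  qed
 qed
 moreover have "{z \<in> space (lborel \<Otimes>\<^sub>M lborel). Z z} \<in> sets (lborel \<Otimes>\<^sub>M lborel)"
 proof -
  have [measurable]: "N \<in> sets borel" "Q \<in> sets borel" using N(3) Q by auto
  have "Measurable.pred (lborel \<Otimes>\<^sub>M lborel) Z" unfolding Z_def[abs_def] by measurable
  then show ?thesis by (simp add: pred_def)
 qed
 ultimately have "AE z in lborel \<Otimes>\<^sub>M lborel. Z z" by (intro lborel_pair.AE_pair_measure)
 then have "AE z in lborel. Z z" by (simp only: lborel_prod)
 then have "AE z in lebesgue. Z z" by (rule AE_completion)
 then show ?thesis
 proof eventually_elim
  fix z :: "real \<times> real" assume z: "Z z"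
  show "case z of (s, t) => 0 < s & s <= t & t < T --> P s --> P t"
  proof (cases z)
   case (Pair s t)
   have "P t" if "0 < s" "s <= t" "t < T" "P s"
   proof (cases "s = t")
    case False
    have "s \<in> Q" using that z N'[of s] by (simp add: Pair Z_def)
    then have "t \<in> Q" "t \<notin> N" using that False z by (auto simp: Pair Z_def)
    then show ?thesis using that N'[of t] by simp
   qed (use that in simp)
   then show ?thesis by (simp add: Pair)
  qed
 qed
qed

text \<open>One sequence of exponents has to make density, pressure and initial density converge
  almost everywhere, so three subsequences are nested; the initial pressure converges at every point
  by uniformity.\<close>

lemma positivity_set_monotone:
 fixes m f p_lim \<rho>_lim :: "(real^'n) \<times> real => real" and b :: "(real^'n) \<times> real => real^'n"
  and \<rho>0 :: "real => real^'n => real" and \<rho> :: "real => (real^'n) \<times> real => real" and X :: "real => real^'n => real^'n"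
 assumes T: "T > 0" and \<delta>: "\<delta> > 0" and data: "data_assumption T \<delta> m f b" and initial: "initial_assumption m \<rho>0"
  and congestion: "congestion_condition T m f b" and sol: "\<forall>k>1. weak_solution T m f b k (\<rho>0 k) (\<rho> k)"
  and lim_\<rho>: "L1_limit (QT T) \<rho> \<rho>_lim" and lim_p: "L1_limit (QT T) (%k. pressure k m (\<rho> k)) p_lim"
  and lim_p0: "uniform_limit UNIV (%k. initial_pressure k m (\<rho>0 k)) (%x. p_lim (x, 0)) at_top"
  and flow: "streamlines T b X"
 shows "(AE x0 in lebesgue. AE (s, t) in lebesgue. 0 < s & s <= t & t < T -->
     X s x0 \<in> pos_set p_lim s --> X t x0 \<in> pos_set p_lim t) &
    (AE x0 in lebesgue. x0 \<in> pos_set p_lim 0 -->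
     (AE t in lebesgue_on {0<..<T}. X t x0 \<in> pos_set p_lim t))"
proof -
 interpret congested_flow T \<delta> m f b X
  by unfold_locales (fact T \<delta> data congestion flow)+
 have QTb: "QT T \<in> sets borel" by (rule QT_borel)
 have Ub: "UNIV \<in> sets (borel :: (real^'n) measure)" by simp
 obtain \<rho>0_lim where lim_\<rho>0: "L1_limit UNIV \<rho>0 \<rho>0_lim" using initial unfolding initial_assumption_def by blast
 have ini: "integrable lebesgue (\<rho>0 k)" "AE x in lebesgue. \<rho>0 k x >= 0" if "k > 1" for k
 proof -
  have W: "W1_on 1 UNIV (\<rho>0 k)" and "AE x in lebesgue. \<rho>0 k x >= 0" using initial that unfolding initial_assumption_def by blast+
  then show "AE x in lebesgue. \<rho>0 k x >= 0" by blast
  have "\<rho>0 k \<in> borel_measurable lebesgue" and "integrable lebesgue (%z. norm (\<rho>0 k z))"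
   using W by (simp_all add: W1_on_def Lp_on_def lebesgue_on_UNIV_eq)
  then show "integrable lebesgue (\<rho>0 k)" by (rule integrable_norm_cancel[rotated])
 qed
 \<comment> \<open>The offset 2 keeps every exponent above 1, also for the index 0.\<close>
 define kap1 where "kap1 j = real j + 2" for j :: nat
 have k1: "filterlim kap1 at_top sequentially"
  by (rule filterlim_at_top_mono[OF filterlim_real_sequentially]) (simp add: kap1_def)
 obtain r1 where r1: "strict_mono r1" "AE z in lebesgue_on (QT T). (%j. \<rho> (kap1 (r1 j)) z) ----> \<rho>_lim z"
  using L1_limit_AE_subsequence[OF lim_\<rho> k1] by blast
 define kap2 where "kap2 j = kap1 (r1 j)" for j
 have k2: "filterlim kap2 at_top sequentially" unfolding kap2_def[abs_def] by (rule filterlim_compose[OF k1 filterlim_subseq[OF r1(1)]])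
 obtain r2 where r2: "strict_mono r2" "AE z in lebesgue_on (QT T). (%j. pressure (kap2 (r2 j)) m (\<rho> (kap2 (r2 j))) z) ----> p_lim z"
  using L1_limit_AE_subsequence[OF lim_p k2] by blast
 define kap3 where "kap3 j = kap2 (r2 j)" for j
 have k3: "filterlim kap3 at_top sequentially" unfolding kap3_def[abs_def] by (rule filterlim_compose[OF k2 filterlim_subseq[OF r2(1)]])
 obtain r3 where r3: "strict_mono r3" "AE x in lebesgue_on UNIV. (%j. \<rho>0 (kap3 (r3 j)) x) ----> \<rho>0_lim x"
  using L1_limit_AE_subsequence[OF lim_\<rho>0 k3] by blast
 define kap where "kap j = kap3 (r3 j)" for j
 have k: "filterlim kap at_top sequentially" unfolding kap_def[abs_def] by (rule filterlim_compose[OF k3 filterlim_subseq[OF r3(1)]])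
 have kap_gt: "kap j > 1" for j by (simp add: kap_def kap3_def kap2_def kap1_def)
 have c1: "AE z in lborel. z \<in> QT T --> (%j. \<rho> (kap j) z) ----> \<rho>_lim z"
  using r1(2) unfolding AE_lebesgue_on_iff[OF QTb]
 proof (eventually_elim, intro impI)
  fix z assume "z \<in> QT T --> (%j. \<rho> (kap1 (r1 j)) z) ----> \<rho>_lim z" "z \<in> QT T"
  then have "(%j. \<rho> (kap2 j) z) ----> \<rho>_lim z" by (simp add: kap2_def)
  from LIMSEQ_subseq_LIMSEQ[OF LIMSEQ_subseq_LIMSEQ[OF this r2(1)] r3(1)]
  show "(%j. \<rho> (kap j) z) ----> \<rho>_lim z" by (simp add: comp_def kap_def kap3_def)
 qed
 have c2: "AE z in lborel. z \<in> QT T --> (%j. pressure (kap j) m (\<rho> (kap j)) z) ----> p_lim z"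
  using r2(2) unfolding AE_lebesgue_on_iff[OF QTb]
 proof (eventually_elim, intro impI)
  fix z assume "z \<in> QT T --> (%j. pressure (kap2 (r2 j)) m (\<rho> (kap2 (r2 j))) z) ----> p_lim z" "z \<in> QT T"
  then have "(%j. pressure (kap3 j) m (\<rho> (kap3 j)) z) ----> p_lim z" by (simp add: kap3_def)
  from LIMSEQ_subseq_LIMSEQ[OF this r3(1)]
  show "(%j. pressure (kap j) m (\<rho> (kap j)) z) ----> p_lim z" by (simp add: comp_def kap_def)
 qed
 have c3: "AE x in lborel. (%j. \<rho>0 (kap j) x) ----> \<rho>0_lim x"
  using r3(2) unfolding AE_lebesgue_on_iff[OF Ub] by (simp add: kap_def)
 have c4: "(%j. initial_pressure (kap j) m (\<rho>0 (kap j)) x) ----> p_lim (x, 0)" for x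
  by (rule filterlim_compose[OF tendsto_uniform_limitI[OF lim_p0 UNIV_I] k])
 have "\<exists>q. regular_solution (kap j) (snd q) (fst q) & (AE z in lborel. z \<in> QT T --> fst q z = \<rho> (kap j) z / m z) &
   (AE x in lborel. snd q x = \<rho>0 (kap j) x / m (x, 0))" for j
 proof -
  have ws: "weak_solution T m f b (kap j) (\<rho>0 (kap j)) (\<rho> (kap j))" using sol kap_gt[of j] by blast
  obtain v v0 where "regular_solution (kap j) v0 v" "AE z in lborel. z \<in> QT T --> v z = \<rho> (kap j) z / m z"
   "AE x in lborel. v0 x = \<rho>0 (kap j) x / m (x, 0)"
   by (rule regular_representative[OF kap_gt ws ini(1)[OF kap_gt] ini(2)[OF kap_gt]])
  then show ?thesis by (intro exI[of _ "(v, v0)"]) simp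
 qed
 then have "\<exists>q. \<forall>j. regular_solution (kap j) (snd (q j)) (fst (q j)) & (AE z in lborel. z \<in> QT T --> fst (q j) z = \<rho> (kap j) z / m z) &
   (AE x in lborel. snd (q j) x = \<rho>0 (kap j) x / m (x, 0))" by (intro choice allI)
 then obtain q where q: "!!j. regular_solution (kap j) (snd (q j)) (fst (q j))"
  "!!j. AE z in lborel. z \<in> QT T --> fst (q j) z = \<rho> (kap j) z / m z"
  "!!j. AE x in lborel. snd (q j) x = \<rho>0 (kap j) x / m (x, 0)" by blast
 define v where "v j = fst (q j)" for j
 define v0 where "v0 j = snd (q j)" for j
 have reg: "regular_solution (kap j) (v0 j) (v j)" for j using q(1) by (simp add: v_def v0_def)
 have vp: "v j z >= 0" "v0 j x >= 0" for j z x using reg[of j] unfolding regular_solution_def by blast+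
 have v0b: "v0 j \<in> borel_fun" for j using reg[of j] unfolding regular_solution_def loc_int_def by blast
 have vall: "AE z in lborel. \<forall>j. z \<in> QT T --> v j z = \<rho> (kap j) z / m z" unfolding AE_all_countable v_def using q(2) by blast
 have v0all: "AE x in lborel. \<forall>j. v0 j x = \<rho>0 (kap j) x / m (x, 0)" unfolding AE_all_countable v0_def using q(3) by blast
 have mp: "m z > 0" if "z \<in> QT T" for z using mQ_pos[OF that] \<delta> that by (simp add: mQ_def)
 have m0: "m (x, 0) > 0" for x using m_initial(1)[of x] \<delta> by linarith
 have m0b: "(%x. m (x, 0)) \<in> borel_fun" by (rule borel_measurable_continuous_onI[OF m_initial(2)])
 obtain B where "mQ \<in> borel_fun" by (rule coeffs) blast
 then have mQb: "mQ \<in> borel_fun" .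
 have integ: "integrable (lebesgue_on (QT T)) \<rho>_lim" "integrable (lebesgue_on (QT T)) p_lim" "integrable (lebesgue_on UNIV) \<rho>0_lim"
  using lim_\<rho> lim_p lim_\<rho>0 by (auto simp: L1_limit_def)
 obtain r where r: "r \<in> borel_fun" "AE z in lborel. z \<in> QT T --> r z = \<rho>_lim z"
  using borel_representative[OF borel_measurable_integrable[OF integ(1)] QTb] by blast
 obtain p where p: "p \<in> borel_fun" "AE z in lborel. z \<in> QT T --> p z = p_lim z"
  using borel_representative[OF borel_measurable_integrable[OF integ(2)] QTb] by blast
 obtain r0 where r0: "r0 \<in> borel_fun" "AE x in lborel. x \<in> UNIV --> r0 x = \<rho>0_lim x"
  using borel_representative[OF borel_measurable_integrable[OF integ(3)] Ub] by blast
 \<comment> \<open>The bounds 0 and 1 hold almost everywhere by the stiff limit; clamping makes them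
   hold everywhere, as the deficit lemmas ask.\<close>
 define V where "V z = min 1 (max 0 (r z / mQ z))" for z
 define V0 where "V0 x = min 1 (max 0 (r0 x / m (x, 0)))" for x
 \<comment> \<open>The slice \<open>t = 0\<close> is a null set of space-time, so the representative
   \<open>p\<close> carries no information about it. A Borel version of the initial pressure is
   obtained as a pointwise limit of Borel functions.\<close>
 define p0 where "p0 x = lim (%j. kap j / (kap j - 1) * v0 j x powr (kap j - 1))" for x
 have V: "V \<in> borel_fun" "0 <= V z" "V z <= 1" for z
 proof -
  show "V \<in> borel_fun" unfolding V_def[abs_def]
   by (intro borel_measurable_min borel_measurable_max borel_measurable_const borel_measurable_divide r(1) mQb)
 qed (auto simp: V_def)
 have V0: "V0 \<in> borel_fun" "0 <= V0 x" "V0 x <= 1" for x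
 proof -
  show "V0 \<in> borel_fun" unfolding V0_def[abs_def]
   by (intro borel_measurable_min borel_measurable_max borel_measurable_const borel_measurable_divide r0(1) m0b)
 qed (auto simp: V0_def)
 have p0b: "p0 \<in> borel_fun"
  unfolding p0_def[abs_def]
 proof (rule borel_measurable_lim_metric)
  fix j
  show "(%x. kap j / (kap j - 1) * v0 j x powr (kap j - 1)) \<in> borel_fun" using v0b[of j] by measurable
 qed
 have lim: "AE z in lborel. z \<in> QT T --> (%j. v j z) ----> V z & (%j. kap j / (kap j - 1) * v j z powr (kap j - 1)) ----> p z"
  using c1 c2 vall r(2) p(2)
 proof (eventually_elim, intro impI)
  fix z
  assume a: "z \<in> QT T --> (%j. \<rho> (kap j) z) ----> \<rho>_lim z"
   "z \<in> QT T --> (%j. pressure (kap j) m (\<rho> (kap j)) z) ----> p_lim z"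
   "\<forall>j. z \<in> QT T --> v j z = \<rho> (kap j) z / m z" "z \<in> QT T --> r z = \<rho>_lim z" "z \<in> QT T --> p z = p_lim z" and z: "z \<in> QT T"
  have vz: "v j z = \<rho> (kap j) z / m z" for j using a(3) z by blast
  have 1: "(%j. v j z) ----> \<rho>_lim z / m z" unfolding vz
   by (intro tendsto_divide tendsto_const) (use a(1) z mp[OF z] in auto)
  have 2: "(%j. kap j / (kap j - 1) * v j z powr (kap j - 1)) ----> p z"
   using a(2,5) z unfolding pressure_def vz by simp
  have "0 <= \<rho>_lim z / m z" by (rule LIMSEQ_le_const[OF 1]) (use vp in auto)
  moreover have "\<rho>_lim z / m z <= 1" by (rule stiff_pressure_limit(2)[OF k kap_gt vp(1) 1 2])
  moreover have "r z / mQ z = \<rho>_lim z / m z" using a(4) z by (simp add: mQ_def)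
  ultimately have "V z = \<rho>_lim z / m z" by (simp add: V_def)
  with 1 2 show "(%j. v j z) ----> V z & (%j. kap j / (kap j - 1) * v j z powr (kap j - 1)) ----> p z" by simp
 qed
 have p0_lim: "AE x in lborel. p0 x = p_lim (x, 0) & (%j. kap j / (kap j - 1) * v0 j x powr (kap j - 1)) ----> p0 x"
  using v0all
 proof eventually_elim
  fix x assume a: "\<forall>j. v0 j x = \<rho>0 (kap j) x / m (x, 0)"
  have 1: "(%j. kap j / (kap j - 1) * v0 j x powr (kap j - 1)) ----> p_lim (x, 0)"
   using c4[of x] a by (simp add: initial_pressure_def pressure_def)
  then have "p0 x = p_lim (x, 0)" unfolding p0_def by (rule limI)
  with 1 show "p0 x = p_lim (x, 0) & (%j. kap j / (kap j - 1) * v0 j x powr (kap j - 1)) ----> p0 x" by simp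
 qed
 have lim0: "AE x in lborel. (%j. v0 j x) ----> V0 x & (%j. kap j / (kap j - 1) * v0 j x powr (kap j - 1)) ----> p0 x"
  using c3 p0_lim v0all r0(2)
 proof eventually_elim
  fix x
  assume a: "(%j. \<rho>0 (kap j) x) ----> \<rho>0_lim x"
   "p0 x = p_lim (x, 0) & (%j. kap j / (kap j - 1) * v0 j x powr (kap j - 1)) ----> p0 x"
   "\<forall>j. v0 j x = \<rho>0 (kap j) x / m (x, 0)" "x \<in> UNIV --> r0 x = \<rho>0_lim x"
  have vz: "v0 j x = \<rho>0 (kap j) x / m (x, 0)" for j using a(3) by blast
  have 2: "(%j. kap j / (kap j - 1) * v0 j x powr (kap j - 1)) ----> p0 x" using a(2) by blast
  have 1: "(%j. v0 j x) ----> \<rho>0_lim x / m (x, 0)" unfolding vz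
   by (intro tendsto_divide tendsto_const a(1)) (use m0[of x] in simp)
  have "0 <= \<rho>0_lim x / m (x, 0)" by (rule LIMSEQ_le_const[OF 1]) (use vp in auto)
  moreover have "\<rho>0_lim x / m (x, 0) <= 1" by (rule stiff_pressure_limit(2)[OF k kap_gt vp(2) 1 2])
  ultimately have "V0 x = \<rho>0_lim x / m (x, 0)" using a(4) by (simp add: V0_def)
  with 1 2 show "(%j. v0 j x) ----> V0 x & (%j. kap j / (kap j - 1) * v0 j x powr (kap j - 1)) ----> p0 x" by simp
 qed
 have P: "AE y in lborel.
  (AE s in lborel. 0 < s & s < T --> p (X s y, s) > 0 --> (AE t in lborel. s < t & t < T --> p (X t y, t) > 0)) &
  (p0 y > 0 --> (AE t in lborel. 0 < t & t < T --> p (X t y, t) > 0))"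
  by (rule positivity_propagates[OF k kap_gt reg V p(1) V0 p0b lim lim0])
 \<comment> \<open>\<open>p\<close> and \<open>p_lim\<close> differ on a null set of the slab, which
   almost every streamline meets in a null set of times.\<close>
 have F: "AE y in lborel. AE t in lborel. 0 < t & t < T --> p (X t y, t) = p_lim (X t y, t)" by (rule flow_AE[OF p(2)])
 show ?thesis
 proof
  have "AE y in lborel. AE (s, t) in lebesgue. 0 < s & s <= t & t < T -->
     X s y \<in> pos_set p_lim s --> X t y \<in> pos_set p_lim t"
   using P F
  proof eventually_elim
   fix y
   assume a: "(AE s in lborel. 0 < s & s < T --> p (X s y, s) > 0 --> (AE t in lborel. s < t & t < T --> p (X t y, t) > 0)) &
    (p0 y > 0 --> (AE t in lborel. 0 < t & t < T --> p (X t y, t) > 0))"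
    and b: "AE t in lborel. 0 < t & t < T --> p (X t y, t) = p_lim (X t y, t)"
   show "AE (s, t) in lebesgue. 0 < s & s <= t & t < T --> X s y \<in> pos_set p_lim s --> X t y \<in> pos_set p_lim t"
   proof (rule AE_pair_of_iterated[where Q="{t. p (total_path y t, t) > 0}"])
    have "(%t. p (total_path y t, t)) \<in> borel_fun" by (rule measurable_compose[OF path_point_borel p(1)])
    then show "{t. p (total_path y t, t) > 0} \<in> sets borel" by measurable
    show "AE s in lborel. 0 < s & s < T --> (X s y \<in> pos_set p_lim s \<longleftrightarrow> s \<in> {t. p (total_path y t, t) > 0})"
     using b by eventually_elim (auto simp: pos_set_def total_path_eq(1))
    from a have "AE s in lborel. 0 < s & s < T --> p (X s y, s) > 0 --> (AE t in lborel. s < t & t < T --> p (X t y, t) > 0)" ..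
    then show "AE s in lborel. 0 < s & s < T --> X s y \<in> pos_set p_lim s --> (AE t in lborel. s < t & t < T --> X t y \<in> pos_set p_lim t)"
     using b
    proof (eventually_elim, intro impI)
     fix s assume h: "0 < s & s < T --> p (X s y, s) > 0 --> (AE t in lborel. s < t & t < T --> p (X t y, t) > 0)"
      "0 < s & s < T --> p (X s y, s) = p_lim (X s y, s)" "0 < s & s < T" "X s y \<in> pos_set p_lim s"
     then have "AE t in lborel. s < t & t < T --> p (X t y, t) > 0" by (simp add: pos_set_def)
     with b show "AE t in lborel. s < t & t < T --> X t y \<in> pos_set p_lim t"
      by eventually_elim (use h(3) in \<open>auto simp: pos_set_def\<close>)
    qed
   qed
  qed
  then show "AE x0 in lebesgue. AE (s, t) in lebesgue. 0 < s & s <= t & t < T -->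
     X s x0 \<in> pos_set p_lim s --> X t x0 \<in> pos_set p_lim t" by (rule AE_completion)
 next
  have "AE y in lborel. y \<in> pos_set p_lim 0 --> (AE t in lebesgue_on {0<..<T}. X t y \<in> pos_set p_lim t)"
   using P F p0_lim
  proof (eventually_elim, intro impI)
   fix y
   assume a: "(AE s in lborel. 0 < s & s < T --> p (X s y, s) > 0 --> (AE t in lborel. s < t & t < T --> p (X t y, t) > 0)) &
    (p0 y > 0 --> (AE t in lborel. 0 < t & t < T --> p (X t y, t) > 0))"
    and b: "AE t in lborel. 0 < t & t < T --> p (X t y, t) = p_lim (X t y, t)"
    and c: "p0 y = p_lim (y, 0) & (%j. kap j / (kap j - 1) * v0 j y powr (kap j - 1)) ----> p0 y" and y: "y \<in> pos_set p_lim 0"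
   have "p0 y > 0" using c y by (simp add: pos_set_def)
   then have "AE t in lborel. 0 < t & t < T --> p (X t y, t) > 0" using a by blast
   with b have "AE t in lborel. t \<in> {0<..<T} --> X t y \<in> pos_set p_lim t" by eventually_elim (auto simp: pos_set_def)
   then show "AE t in lebesgue_on {0<..<T}. X t y \<in> pos_set p_lim t" by (subst AE_lebesgue_on_iff) auto
  qed
  then show "AE x0 in lebesgue. x0 \<in> pos_set p_lim 0 --> (AE t in lebesgue_on {0<..<T}. X t x0 \<in> pos_set p_lim t)"
   by (rule AE_completion)
 qed
qed

theorem theorem7p6:
  shows "\<exists>\<epsilon> :: real \<Rightarrow> real. (\<forall>\<delta>>0. \<epsilon> \<delta> > 0) \<and>
    (\<forall>(T::real) (\<delta>::real) (m :: (real^'n) \<times> real \<Rightarrow> real) (f :: (real^'n) \<times> real \<Rightarrow> real)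
       (b :: (real^'n) \<times> real \<Rightarrow> real^'n) (\<rho>0 :: real \<Rightarrow> real^'n \<Rightarrow> real)
       (\<rho> :: real \<Rightarrow> (real^'n) \<times> real \<Rightarrow> real)
       (\<rho>_lim :: (real^'n) \<times> real \<Rightarrow> real) (p_lim :: (real^'n) \<times> real \<Rightarrow> real)
       (X :: real \<Rightarrow> real^'n \<Rightarrow> real^'n).
       T > 0 \<longrightarrow> \<delta> > 0 \<longrightarrow>
       data_assumption T \<delta> m f b \<longrightarrow>
       initial_assumption m \<rho>0 \<longrightarrow>
       constraint_restriction T (\<epsilon> \<delta>) m \<longrightarrow>
       congestion_condition T m f b \<longrightarrow>
       (\<forall>k>1. weak_solution T m f b k (\<rho>0 k) (\<rho> k)) \<longrightarrow>
       L1_limit (QT T) \<rho> \<rho>_lim \<longrightarrow>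
       L1_limit (QT T) (\<lambda>k. pressure k m (\<rho> k)) p_lim \<longrightarrow>
       uniform_limit UNIV (\<lambda>k. initial_pressure k m (\<rho>0 k)) (\<lambda>x. p_lim (x, 0)) at_top \<longrightarrow>
       open (pos_set p_lim 0) \<longrightarrow>
       streamlines T b X \<longrightarrow>
       (AE x0 in lebesgue. AE (s, t) in lebesgue.
          0 < s \<and> s \<le> t \<and> t < T \<longrightarrow>
          X s x0 \<in> pos_set p_lim s \<longrightarrow> X t x0 \<in> pos_set p_lim t) \<and>
       (AE x0 in lebesgue. x0 \<in> pos_set p_lim 0 \<longrightarrow>
          (AE t in lebesgue_on {0<..<T}. X t x0 \<in> pos_set p_lim t)))"
proof (rule exI[of _ "\<lambda>_. 1"], rule conjI)
  show "\<forall>\<delta>>0. (1::real) > 0" by simp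
qed (intro allI impI, rule positivity_set_monotone, assumption+)

end
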